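(* Let $Q'$ be a Dynkin quiver contained in a finite connected non-Dynkin quiver $Q$ without loops. Let $\Lambda$ be the completion of the preprojective algebra of $Q$ over an algebraically closed field $k$, and let $W$ be the Coxeter group associated with $Q$. Denote by $\Lambda'$ the preprojective algebra of $Q'$, by $W'$ the subgroup of $W$ generated by $\{s_i\mid i\in Q'_0\}$, and by $w_0$ the longest element in $W'$. Then $\Lambda'$ is isomorphic to $\Lambda/I_{w_0}$ and $\underline{\operatorname{mod}}\,\Lambda'=\underline{\operatorname{Sub}}\,\Lambda/I_{w_0}$.
   Context: Preprojective algebra of a quiver $Q$: let $\widetilde Q$ be obtained from $Q$ by adding an arrow $\alpha^*\colon i\to j$ for each arrow $\alpha\colon j\to i$ of $Q$; the preprojective algebra is $k\widetilde Q/I$, where $I$ is the ideal generated by $\sum_{\beta\in Q_1}[\beta,\beta^*]$. $Q_0$ and $Q_0'$ denote the vertex sets of $Q$ and $Q'$. For a vertex $i$ of $Q$, $e_i$ is the corresponding idempotent of $\Lambda$ and $I_i=\Lambda(1-e_i)\Lambda$. $W$ has generators $s_i$ ($i\in Q_0$) and relations $s_i^2=1$; $s_is_j=s_js_i$ if there is no arrow between $i$ and $j$ in $Q$; $s_is_js_i=s_js_is_j$ if there is precisely one arrow between $i$ and $j$ in $Q$. For a reduced expression $w=s_{i_1}\cdots s_{i_m}$ of $w\in W$ put $I_w=I_{i_1}\cdots I_{i_m}$ (independent of the choice of reduced expression). $\operatorname{Sub}X$ is the category of submodules of finite direct sums of copies of $X$; $\operatorname{Sub}\Lambda/I_w$ is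 a Frobenius category whose projective-injective objects form $\operatorname{add}\Lambda/I_w$, and $\underline{\operatorname{Sub}}\,\Lambda/I_w$ denotes its stable category. $\underline{\operatorname{mod}}\,\Lambda'$ is the stable category of finitely generated $\Lambda'$-modules. *)

theory Defs
  imports
    "HOL-Computational_Algebra.Polynomial"
    "Graph_Theory.Graph_Theory"
    "HOL-Algebra.Generated_Groups"
    "HOL-Algebra.QuotRing"
    "HOL-Algebra.Ideal_Product"
    "HOL-Algebra.Module"
begin

section \<open>Quivers\<close>

text \<open>
  Quivers are the directed multigraphs of \<^theory>\<open>Graph_Theory.Digraph\<close>: an arrow
  \<open>a\<close> goes from \<open>tail Q a\<close> to \<open>head Q a\<close>.
\<close>

definition num_arrows :: "('v, 'a) pre_digraph \<Rightarrow> 'v \<Rightarrow> 'v \<Rightarrow> nat" where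
  "num_arrows Q i j = card {a \<in> arcs Q. {tail Q a, head Q a} = {i, j}}"

text \<open>
  The simply laced Dynkin diagrams, as pairs of a number \<open>n\<close> and an edge set on
  \<open>{..<n}\<close>. In types D and E the vertices \<open>0, \<dots>, n - 2\<close> form a path, to which
  \<open>n - 1\<close> is attached.
\<close>

inductive dynkin_diagram :: "nat \<Rightarrow> nat set set \<Rightarrow> bool" where
  type_A: "n \<ge> 1 \<Longrightarrow> dynkin_diagram n {{i, i + 1} | i. i + 1 < n}"
| type_D: "n \<ge> 4 \<Longrightarrow> dynkin_diagram n ({{i, i + 1} | i. i + 2 < n} \<union> {{n - 3, n - 1}})"
| type_E: "n \<in> {6, 7, 8} \<Longrightarrow> dynkin_diagram n ({{i, i + 1} | i. i + 2 < n} \<union> {{2, n - 1}})"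

definition dynkin_quiver :: "('v, 'a) pre_digraph \<Rightarrow> bool" where
  "dynkin_quiver Q \<longleftrightarrow> fin_digraph Q \<and>
     (\<exists>n E f. dynkin_diagram n E \<and> bij_betw f (verts Q) {..<n} \<and>
        (\<forall>i\<in>verts Q. \<forall>j\<in>verts Q. num_arrows Q i j = (if {f i, f j} \<in> E then 1 else 0)))"

text \<open>\<open>Inr a\<close> is the arrow opposite to \<open>Inl a\<close>.\<close>

definition double_quiver :: "('v, 'a) pre_digraph \<Rightarrow> ('v, 'a + 'a) pre_digraph" where
  "double_quiver Q =
     \<lparr>verts = verts Q, arcs = arcs Q <+> arcs Q,
      tail = case_sum (tail Q) (head Q), head = case_sum (head Q) (tail Q)\<rparr>"


section \<open>Algebras\<close>

text \<open>
  A \<open>k\<close>-algebra is a ring of HOL-Algebra carrying a scalar multiplication in the sense of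
  the record \<^typ>\<open>('k, 'x) module\<close>. The same record serves for left modules over a
  ring, where \<^const>\<open>mult\<close> and \<^const>\<open>one\<close> are not used.

  The quotient by \<open>N\<close> is defined uniformly, so that it makes sense for \<open>N\<close> a two-sided ideal
  of an algebra and for \<open>N\<close> a submodule of a left module.
\<close>

definition factor :: "('k, 'x) module \<Rightarrow> 'x set \<Rightarrow> ('k, 'x set) module" where
  "factor A N =
     ring.extend (A Quot N)
       (module.fields (\<lambda>c X. \<Union>x\<in>X. N +>\<^bsub>A\<^esub> (c \<odot>\<^bsub>A\<^esub> x)))"

definition algebra_iso :: "('k, 'x) module \<Rightarrow> ('k, 'y) module \<Rightarrow> ('x \<Rightarrow> 'y) set" where
  "algebra_iso A B =
     {h \<in> ring_iso A B. \<forall>c. \<forall>x\<in>carrier A. h (c \<odot>\<^bsub>A\<^esub> x) = c \<odot>\<^bsub>B\<^esub> h x}"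

text \<open>
  A path is given by its starting vertex and its list of arrows. Paths compose from left to
  right: \<open>p q\<close> is \<open>p\<close> followed by \<open>q\<close>.
\<close>

definition quiver_paths :: "('v, 'a) pre_digraph \<Rightarrow> ('v \<times> 'a list) set" where
  "quiver_paths Q = {(u, p) | u p. \<exists>v. pre_digraph.awalk Q u p v}"

definition path_algebra :: "('v, 'a) pre_digraph \<Rightarrow> ('k::field, 'v \<times> 'a list \<Rightarrow> 'k) module" where
  "path_algebra Q =
     \<lparr>carrier = {f. finite {x. f x \<noteq> 0} \<and> {x. f x \<noteq> 0} \<subseteq> quiver_paths Q},
      mult = (\<lambda>f g (u, p). \<Sum>n\<le>length p.
                f (u, take n p) * g (pre_digraph.awlast Q u (take n p), drop n p)),
      one = (\<lambda>(u, p). if u \<in> verts Q \<and> p = [] then 1 else 0),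
      zero = (\<lambda>_. 0),
      add = (\<lambda>f g x. f x + g x),
      smult = (\<lambda>c f x. c * f x)\<rparr>"

definition path_elem :: "'v \<times> 'a list \<Rightarrow> 'v \<times> 'a list \<Rightarrow> 'k::field" where
  "path_elem x = (\<lambda>y. if y = x then 1 else 0)"

abbreviation vertex_elem :: "'v \<Rightarrow> 'v \<times> 'a list \<Rightarrow> 'k::field" where
  "vertex_elem i \<equiv> path_elem (i, [])"

abbreviation arrow_elem :: "('v, 'a) pre_digraph \<Rightarrow> 'a \<Rightarrow> 'v \<times> 'a list \<Rightarrow> 'k::field" where
  "arrow_elem Q a \<equiv> path_elem (tail Q a, [a])"

text \<open>
  The completion of an algebra \<open>A\<close> at an ideal \<open>m\<close>: the inverse limit of the \<open>A / m\<^sup>n\<close>.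
  Compatibility of a family of cosets means that each contains the next one. Powers and
  products of ideals are taken in the monoid \<^const>\<open>ideals_set\<close>, with unit \<open>carrier A\<close>.
\<close>

abbreviation trunc :: "('k, 'x) module \<Rightarrow> 'x set \<Rightarrow> nat \<Rightarrow> ('k, 'x set) module" where
  "trunc A m n \<equiv> factor A (m [^]\<^bsub>ideals_set A\<^esub> n)"

definition completion :: "('k, 'x) module \<Rightarrow> 'x set \<Rightarrow> ('k, nat \<Rightarrow> 'x set) module" where
  "completion A m =
     \<lparr>carrier = {x. \<forall>n. x n \<in> carrier (trunc A m n) \<and> x (Suc n) \<subseteq> x n},
      mult = (\<lambda>x y n. x n \<otimes>\<^bsub>trunc A m n\<^esub> y n),
      one = (\<lambda>n. \<one>\<^bsub>trunc A m n\<^esub>),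
      zero = (\<lambda>n. \<zero>\<^bsub>trunc A m n\<^esub>),
      add = (\<lambda>x y n. x n \<oplus>\<^bsub>trunc A m n\<^esub> y n),
      smult = (\<lambda>c x n. c \<odot>\<^bsub>trunc A m n\<^esub> x n)\<rparr>"

definition to_completion :: "('k, 'x) module \<Rightarrow> 'x set \<Rightarrow> 'x \<Rightarrow> nat \<Rightarrow> 'x set" where
  "to_completion A m a = (\<lambda>n. (m [^]\<^bsub>ideals_set A\<^esub> n) +>\<^bsub>A\<^esub> a)"


section \<open>Preprojective algebras\<close>

definition preproj_ideal :: "('v, 'a) pre_digraph \<Rightarrow> ('v \<times> ('a + 'a) list \<Rightarrow> 'k::field) set" where
  "preproj_ideal Q =
     (let D = double_quiver Q; P = path_algebra D
      in Idl\<^bsub>P\<^esub> {\<Oplus>\<^bsub>P\<^esub>b\<in>arcs Q.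
            (arrow_elem D (Inl b) \<otimes>\<^bsub>P\<^esub> arrow_elem D (Inr b))
            \<ominus>\<^bsub>P\<^esub> (arrow_elem D (Inr b) \<otimes>\<^bsub>P\<^esub> arrow_elem D (Inl b))})"

definition preprojective_algebra ::
  "('v, 'a) pre_digraph \<Rightarrow> ('k::field, ('v \<times> ('a + 'a) list \<Rightarrow> 'k) set) module" where
  "preprojective_algebra Q = factor (path_algebra (double_quiver Q)) (preproj_ideal Q)"

definition preproj_class ::
  "('v, 'a) pre_digraph \<Rightarrow> ('v \<times> ('a + 'a) list \<Rightarrow> 'k::field) \<Rightarrow> ('v \<times> ('a + 'a) list \<Rightarrow> 'k) set" where
  "preproj_class Q f = preproj_ideal Q +>\<^bsub>path_algebra (double_quiver Q)\<^esub> f"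

definition arrow_ideal ::
  "('v, 'a) pre_digraph \<Rightarrow> ('v \<times> ('a + 'a) list \<Rightarrow> 'k::field) set set" where
  "arrow_ideal Q =
     Idl\<^bsub>preprojective_algebra Q\<^esub>
       {preproj_class Q (arrow_elem (double_quiver Q) a) | a. a \<in> arcs (double_quiver Q)}"

definition completed_preprojective_algebra ::
  "('v, 'a) pre_digraph \<Rightarrow> ('k::field, nat \<Rightarrow> ('v \<times> ('a + 'a) list \<Rightarrow> 'k) set set) module" where
  "completed_preprojective_algebra Q = completion (preprojective_algebra Q) (arrow_ideal Q)"

definition vertex_idempotent ::
  "('v, 'a) pre_digraph \<Rightarrow> 'v \<Rightarrow> nat \<Rightarrow> ('v \<times> ('a + 'a) list \<Rightarrow> 'k::field) set set" where
  "vertex_idempotent Q i =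
     to_completion (preprojective_algebra Q) (arrow_ideal Q) (preproj_class Q (vertex_elem i))"

definition vertex_ideal ::
  "('v, 'a) pre_digraph \<Rightarrow> 'v \<Rightarrow> (nat \<Rightarrow> ('v \<times> ('a + 'a) list \<Rightarrow> 'k::field) set set) set" where
  "vertex_ideal Q i =
     (let L = completed_preprojective_algebra Q
      in Idl\<^bsub>L\<^esub> {\<one>\<^bsub>L\<^esub> \<ominus>\<^bsub>L\<^esub> vertex_idempotent Q i})"

definition word_ideal ::
  "('v, 'a) pre_digraph \<Rightarrow> 'v list \<Rightarrow> (nat \<Rightarrow> ('v \<times> ('a + 'a) list \<Rightarrow> 'k::field) set set) set" where
  "word_ideal Q is =
     (let M = ideals_set (completed_preprojective_algebra Q)
      in foldr (\<lambda>i J. vertex_ideal Q i \<otimes>\<^bsub>M\<^esub> J) is \<one>\<^bsub>M\<^esub>)"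


section \<open>The Coxeter group of a quiver\<close>

text \<open>
  The group presented by the Coxeter relations. As the generators are involutions,
  its elements are classes of words in the generators, without formal inverses.
\<close>

inductive coxeter_relation :: "('v, 'a) pre_digraph \<Rightarrow> 'v list \<Rightarrow> 'v list \<Rightarrow> bool"
  for Q :: "('v, 'a) pre_digraph" where
  involution: "i \<in> verts Q \<Longrightarrow> coxeter_relation Q [i, i] []"
| commute: "i \<in> verts Q \<Longrightarrow> j \<in> verts Q \<Longrightarrow> num_arrows Q i j = 0 \<Longrightarrow>
    coxeter_relation Q [i, j] [j, i]"
| braid: "i \<in> verts Q \<Longrightarrow> j \<in> verts Q \<Longrightarrow> num_arrows Q i j = 1 \<Longrightarrow>
    coxeter_relation Q [i, j, i] [j, i, j]"

inductive coxeter_equiv :: "('v, 'a) pre_digraph \<Rightarrow> 'v list \<Rightarrow> 'v list \<Rightarrow> bool"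
  for Q :: "('v, 'a) pre_digraph" where
  refl: "x \<in> lists (verts Q) \<Longrightarrow> coxeter_equiv Q x x"
| sym: "coxeter_equiv Q x y \<Longrightarrow> coxeter_equiv Q y x"
| trans: "coxeter_equiv Q x y \<Longrightarrow> coxeter_equiv Q y z \<Longrightarrow> coxeter_equiv Q x z"
| rel: "coxeter_relation Q x y \<Longrightarrow> u \<in> lists (verts Q) \<Longrightarrow> v \<in> lists (verts Q) \<Longrightarrow>
    coxeter_equiv Q (u @ x @ v) (u @ y @ v)"

definition coxeter_class :: "('v, 'a) pre_digraph \<Rightarrow> 'v list \<Rightarrow> 'v list set" where
  "coxeter_class Q is = {x. coxeter_equiv Q is x}"

definition coxeter_group :: "('v, 'a) pre_digraph \<Rightarrow> 'v list set monoid" where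
  "coxeter_group Q =
     \<lparr>carrier = coxeter_class Q ` lists (verts Q),
      mult = (\<lambda>X Y. \<Union>x\<in>X. \<Union>y\<in>Y. coxeter_class Q (x @ y)),
      one = coxeter_class Q []\<rparr>"

definition coxeter_subgroup :: "('v, 'a) pre_digraph \<Rightarrow> 'v set \<Rightarrow> 'v list set set" where
  "coxeter_subgroup Q J = generate (coxeter_group Q) ((\<lambda>i. coxeter_class Q [i]) ` J)"

text \<open>Length with respect to the generators \<open>s\<^sub>i\<close>, \<open>i \<in> J\<close>.\<close>

definition coxeter_length :: "('v, 'a) pre_digraph \<Rightarrow> 'v set \<Rightarrow> 'v list set \<Rightarrow> nat" where
  "coxeter_length Q J w = (LEAST n. \<exists>is\<in>lists J. length is = n \<and> coxeter_class Q is = w)"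

definition longest_element :: "('v, 'a) pre_digraph \<Rightarrow> 'v set \<Rightarrow> 'v list set \<Rightarrow> bool" where
  "longest_element Q J w \<longleftrightarrow>
     w \<in> coxeter_subgroup Q J \<and>
     (\<forall>v\<in>coxeter_subgroup Q J. coxeter_length Q J v \<le> coxeter_length Q J w)"

definition reduced_expression :: "('v, 'a) pre_digraph \<Rightarrow> 'v list \<Rightarrow> 'v list set \<Rightarrow> bool" where
  "reduced_expression Q is w \<longleftrightarrow>
     is \<in> lists (verts Q) \<and> coxeter_class Q is = w \<and>
     length is = coxeter_length Q (verts Q) w"


section \<open>Left modules\<close>

text \<open>The locale \<^locale>\<open>module\<close> of HOL-Algebra is restricted to commutative rings.\<close>

locale lmodule = R?: ring R + M?: abelian_group M
  for R :: "('r, 'z) ring_scheme" (structure) and M :: "('r, 'm) module" (structure) +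
  assumes smult_closed: "\<lbrakk>a \<in> carrier R; x \<in> carrier M\<rbrakk> \<Longrightarrow> a \<odot>\<^bsub>M\<^esub> x \<in> carrier M"
    and smult_l_distr: "\<lbrakk>a \<in> carrier R; b \<in> carrier R; x \<in> carrier M\<rbrakk> \<Longrightarrow>
      (a \<oplus>\<^bsub>R\<^esub> b) \<odot>\<^bsub>M\<^esub> x = a \<odot>\<^bsub>M\<^esub> x \<oplus>\<^bsub>M\<^esub> b \<odot>\<^bsub>M\<^esub> x"
    and smult_r_distr: "\<lbrakk>a \<in> carrier R; x \<in> carrier M; y \<in> carrier M\<rbrakk> \<Longrightarrow>
      a \<odot>\<^bsub>M\<^esub> (x \<oplus>\<^bsub>M\<^esub> y) = a \<odot>\<^bsub>M\<^esub> x \<oplus>\<^bsub>M\<^esub> a \<odot>\<^bsub>M\<^esub> y"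
    and smult_assoc: "\<lbrakk>a \<in> carrier R; b \<in> carrier R; x \<in> carrier M\<rbrakk> \<Longrightarrow>
      (a \<otimes>\<^bsub>R\<^esub> b) \<odot>\<^bsub>M\<^esub> x = a \<odot>\<^bsub>M\<^esub> (b \<odot>\<^bsub>M\<^esub> x)"
    and smult_one: "x \<in> carrier M \<Longrightarrow> \<one>\<^bsub>R\<^esub> \<odot>\<^bsub>M\<^esub> x = x"

text \<open>
  The objects of the module category over \<open>R\<close> with underlying sets in the type \<open>'m\<close>. The values
  of the operations outside the carriers (and the unused fields) are fixed, so that two modules
  with the same elements and the same operations are equal.
\<close>

definition modules :: "('r, 'z) ring_scheme \<Rightarrow> ('r, 'm) module set" where
  "modules R =
     {M. lmodule R M \<and>
         add M \<in> carrier M \<rightarrow>\<^sub>E carrier M \<rightarrow>\<^sub>E carrier M \<and>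
         smult M \<in> carrier R \<rightarrow>\<^sub>E carrier M \<rightarrow>\<^sub>E carrier M \<and>
         mult M = undefined \<and> one M = undefined}"

definition finitely_generated :: "('r, 'z) ring_scheme \<Rightarrow> ('r, 'm) module \<Rightarrow> bool" where
  "finitely_generated R M \<longleftrightarrow>
     (\<exists>S. finite S \<and> S \<subseteq> carrier M \<and>
        (\<forall>N. submodule N R M \<and> S \<subseteq> N \<longrightarrow> N = carrier M))"

definition fg_modules :: "('r, 'z) ring_scheme \<Rightarrow> ('r, 'm) module set" where
  "fg_modules R = {M \<in> modules R. finitely_generated R M}"

definition lmodule_hom ::
  "('r, 'z) ring_scheme \<Rightarrow> ('r, 'm) module \<Rightarrow> ('r, 'n) module \<Rightarrow> ('m \<Rightarrow> 'n) set" where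
  "lmodule_hom R M N =
     {f \<in> carrier M \<rightarrow>\<^sub>E carrier N.
        (\<forall>x\<in>carrier M. \<forall>y\<in>carrier M. f (x \<oplus>\<^bsub>M\<^esub> y) = f x \<oplus>\<^bsub>N\<^esub> f y) \<and>
        (\<forall>r\<in>carrier R. \<forall>x\<in>carrier M. f (r \<odot>\<^bsub>M\<^esub> x) = r \<odot>\<^bsub>N\<^esub> f x)}"

definition lmodule_isomorphic ::
  "('r, 'z) ring_scheme \<Rightarrow> ('r, 'm) module \<Rightarrow> ('r, 'n) module \<Rightarrow> bool" where
  "lmodule_isomorphic R M N \<longleftrightarrow> (\<exists>f\<in>lmodule_hom R M N. bij_betw f (carrier M) (carrier N))"

definition regular_module :: "('r, 'z) ring_scheme \<Rightarrow> ('r, 'r) module" where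
  "regular_module R = ring.extend (ring.truncate R) (module.fields (mult R))"

definition power_module :: "nat \<Rightarrow> ('r, 'm) module \<Rightarrow> ('r, nat \<Rightarrow> 'm) module" where
  "power_module n X =
     \<lparr>carrier = {..<n} \<rightarrow>\<^sub>E carrier X, mult = undefined, one = undefined,
      zero = (\<lambda>i\<in>{..<n}. \<zero>\<^bsub>X\<^esub>),
      add = (\<lambda>x y. \<lambda>i\<in>{..<n}. x i \<oplus>\<^bsub>X\<^esub> y i),
      smult = (\<lambda>r x. \<lambda>i\<in>{..<n}. r \<odot>\<^bsub>X\<^esub> x i)\<rparr>"

text \<open>As usual, \<open>Sub X\<close> and \<open>add X\<close> are closed under isomorphism.\<close>

definition Sub_modules :: "('r, 'z) ring_scheme \<Rightarrow> ('r, 'x) module \<Rightarrow> ('r, 'm) module set" where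
  "Sub_modules R X =
     {M \<in> modules R. \<exists>n N. submodule N R (power_module n X) \<and>
        lmodule_isomorphic R M ((power_module n X)\<lparr>carrier := N\<rparr>)}"

definition add_modules :: "('r, 'z) ring_scheme \<Rightarrow> ('r, 'x) module \<Rightarrow> ('r, 'm) module set" where
  "add_modules R X =
     {M \<in> modules R. \<exists>n N N'.
        submodule N R (power_module n X) \<and> submodule N' R (power_module n X) \<and>
        N \<inter> N' = {\<zero>\<^bsub>power_module n X\<^esub>} \<and>
        N <+>\<^bsub>power_module n X\<^esub> N' = carrier (power_module n X) \<and>
        lmodule_isomorphic R M ((power_module n X)\<lparr>carrier := N\<rparr>)}"

definition fg_projective_modules :: "('r, 'z) ring_scheme \<Rightarrow> ('r, 'm) module set" where
  "fg_projective_modules R =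
     {P \<in> fg_modules R.
        \<forall>X\<in>(fg_modules R :: ('r, 'm) module set). \<forall>Y\<in>(fg_modules R :: ('r, 'm) module set).
        \<forall>g\<in>lmodule_hom R X Y. \<forall>f\<in>lmodule_hom R P Y.
          g ` carrier X = carrier Y \<longrightarrow> (\<exists>h\<in>lmodule_hom R P X. compose (carrier P) g h = f)}"

definition restrict_scalars ::
  "('r, 'z) ring_scheme \<Rightarrow> ('r \<Rightarrow> 's) \<Rightarrow> ('s, 'm) module \<Rightarrow> ('r, 'm) module" where
  "restrict_scalars R \<psi> M =
     \<lparr>carrier = carrier M, mult = mult M, one = one M, zero = zero M, add = add M,
      smult = (\<lambda>r\<in>carrier R. \<lambda>x\<in>carrier M. \<psi> r \<odot>\<^bsub>M\<^esub> x)\<rparr>"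


section \<open>Linear categories and stable categories\<close>

text \<open>
  In \<open>Comp C X Y Z g f\<close> the morphism \<open>f\<close> goes from \<open>X\<close> to \<open>Y\<close> and \<open>g\<close> from \<open>Y\<close> to \<open>Z\<close>.
\<close>

record ('o, 'h, 'k) lin_cat =
  Obj :: "'o set"
  Hom :: "'o \<Rightarrow> 'o \<Rightarrow> ('k, 'h) module"
  Ident :: "'o \<Rightarrow> 'h"
  Comp :: "'o \<Rightarrow> 'o \<Rightarrow> 'o \<Rightarrow> 'h \<Rightarrow> 'h \<Rightarrow> 'h"

definition lin_functor ::
  "('o, 'h, 'k) lin_cat \<Rightarrow> ('p, 'i, 'k) lin_cat \<Rightarrow> ('o \<Rightarrow> 'p) \<Rightarrow> ('o \<Rightarrow> 'o \<Rightarrow> 'h \<Rightarrow> 'i) \<Rightarrow> bool" where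
  "lin_functor C D F \<Phi> \<longleftrightarrow>
     (\<forall>X\<in>Obj C. F X \<in> Obj D \<and> \<Phi> X X (Ident C X) = Ident D (F X)) \<and>
     (\<forall>X\<in>Obj C. \<forall>Y\<in>Obj C. \<forall>f\<in>carrier (Hom C X Y).
        \<Phi> X Y f \<in> carrier (Hom D (F X) (F Y)) \<and>
        (\<forall>c. \<Phi> X Y (c \<odot>\<^bsub>Hom C X Y\<^esub> f) = c \<odot>\<^bsub>Hom D (F X) (F Y)\<^esub> \<Phi> X Y f) \<and>
        (\<forall>g\<in>carrier (Hom C X Y).
           \<Phi> X Y (f \<oplus>\<^bsub>Hom C X Y\<^esub> g) = \<Phi> X Y f \<oplus>\<^bsub>Hom D (F X) (F Y)\<^esub> \<Phi> X Y g)) \<and>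
     (\<forall>X\<in>Obj C. \<forall>Y\<in>Obj C. \<forall>Z\<in>Obj C.
        \<forall>f\<in>carrier (Hom C X Y). \<forall>g\<in>carrier (Hom C Y Z).
          \<Phi> X Z (Comp C X Y Z g f) = Comp D (F X) (F Y) (F Z) (\<Phi> Y Z g) (\<Phi> X Y f))"

definition lin_cat_isomorphism ::
  "('o, 'h, 'k) lin_cat \<Rightarrow> ('p, 'i, 'k) lin_cat \<Rightarrow> ('o \<Rightarrow> 'p) \<Rightarrow> ('o \<Rightarrow> 'o \<Rightarrow> 'h \<Rightarrow> 'i) \<Rightarrow> bool" where
  "lin_cat_isomorphism C D F \<Phi> \<longleftrightarrow>
     lin_functor C D F \<Phi> \<and> bij_betw F (Obj C) (Obj D) \<and>
     (\<forall>X\<in>Obj C. \<forall>Y\<in>Obj C.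
        bij_betw (\<Phi> X Y) (carrier (Hom C X Y)) (carrier (Hom D (F X) (F Y))))"

text \<open>
  For a \<open>k\<close>-algebra \<open>A\<close>, the scalar \<open>c\<close> acts on homomorphisms through \<open>c \<cdot> 1 \<in> A\<close>.
\<close>

definition hom_space ::
  "('k, 'r) module \<Rightarrow> ('r, 'm) module \<Rightarrow> ('r, 'm) module \<Rightarrow> ('k, 'm \<Rightarrow> 'm) module" where
  "hom_space A X Y =
     \<lparr>carrier = lmodule_hom A X Y, mult = undefined, one = undefined,
      zero = (\<lambda>x\<in>carrier X. \<zero>\<^bsub>Y\<^esub>),
      add = (\<lambda>f g. \<lambda>x\<in>carrier X. f x \<oplus>\<^bsub>Y\<^esub> g x),
      smult = (\<lambda>c f. \<lambda>x\<in>carrier X. (c \<odot>\<^bsub>A\<^esub> \<one>\<^bsub>A\<^esub>) \<odot>\<^bsub>Y\<^esub> f x)\<rparr>"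

definition factoring_homs ::
  "('k, 'r) module \<Rightarrow> ('r, 'm) module set \<Rightarrow> ('r, 'm) module \<Rightarrow> ('r, 'm) module \<Rightarrow> ('m \<Rightarrow> 'm) set" where
  "factoring_homs A P X Y =
     {compose (carrier X) g f | f g Z.
        Z \<in> P \<and> f \<in> lmodule_hom A X Z \<and> g \<in> lmodule_hom A Z Y}"

text \<open>
  The category of the modules in \<open>C\<close>, modulo the homomorphisms that factor through a module
  in \<open>P\<close>; morphisms are cosets of homomorphisms.
\<close>

definition stable_category ::
  "('k, 'r) module \<Rightarrow> ('r, 'm) module set \<Rightarrow> ('r, 'm) module set \<Rightarrow>
     (('r, 'm) module, ('m \<Rightarrow> 'm) set, 'k) lin_cat" where
  "stable_category A C P =
     \<lparr>Obj = C,
      Hom = (\<lambda>X Y. factor (hom_space A X Y) (factoring_homs A P X Y)),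
      Ident = (\<lambda>X. factoring_homs A P X X +>\<^bsub>hom_space A X X\<^esub> (\<lambda>x\<in>carrier X. x)),
      Comp = (\<lambda>X Y Z G F. \<Union>g\<in>G. \<Union>f\<in>F.
                factoring_homs A P X Z +>\<^bsub>hom_space A X Z\<^esub> compose (carrier X) g f)\<rparr>"

definition stable_mod ::
  "('k, 'r) module \<Rightarrow> (('r, 'm) module, ('m \<Rightarrow> 'm) set, 'k) lin_cat" where
  "stable_mod A = stable_category A (fg_modules A) (fg_projective_modules A)"

text \<open>
  The stable category of \<open>Sub A/I\<close>, for a two-sided ideal \<open>I\<close> for which this is a Frobenius
  category with projective-injective objects \<open>add A/I\<close>.
\<close>

definition stable_Sub ::
  "('k, 'r) module \<Rightarrow> 'r set \<Rightarrow> (('r, 'm) module, ('m \<Rightarrow> 'm) set, 'k) lin_cat" where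
  "stable_Sub A I =
     (let X = factor (regular_module A) I
      in stable_category A (Sub_modules A X) (add_modules A X))"

end

(* An ideal of the preprojective algebra of the Dynkin quiver Q' that is fixed by multiplication with
every vertex ideal lies in all powers of the arrow ideal, so it vanishes. Products of vertex ideals
satisfy the relations of the 0-Hecke monoid, and the word of the longest element absorbs every
generator of this monoid; hence the product of the vertex ideals of the Dynkin algebra along the word
is zero. So its arrow ideal is nilpotent, and the product along the same word in the completed algebra of Q
is the ideal generated by the idempotents at the vertices outside Q'. Its quotient is the algebra of Q'.

For a nilpotent arrow ideal, the linear dual of the preprojective algebra is projective: an equivariant
section of a free cover exists since the obstruction, paired with any functional that kills the
coboundaries, is a trace that vanishes by cyclicity and the preprojective relations. Hence every finitely
generated module embeds into a free one. So restriction of scalars identifies the finitely generated modules over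
the Dynkin algebra with the submodules of powers of the quotient, and the projective ones with the summands. *)

theory Submission
  imports Defs "HOL-Library.Function_Algebras"
begin

text \<open>The longest element enters through lengths: its existence bounds the length on W', so an
  affine orbit is finite, and this forces the vertices of Q' to span a forest in Q. Since a Dynkin
  diagram on n vertices already has n - 1 edges, Q' is then a full subquiver, which
  \<open>subgraph\<close> alone does not say. The relations are homogeneous in the path length. This
  gives the graded arguments, and it lets elements of the completion be represented by formal series
  of paths. The dual of the algebra is a space of functions on paths, on which an arrow acts by
  appending it; spanning families and linear projections take the place of bases. The modules of one
  category live on one type 'm, so projectivity is tested only against modules on 'm, and a free
  cover has to be copied into 'm before it can split. A nonzero module contains a copy of k, which
  is infinite because k is algebraically closed, and a finitely generated free module injects into k
  as a set. Restriction of scalars is then bijective on objects and the identity on morphisms,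
  because the records involved are equal and not merely isomorphic.\<close>

type_synonym ('v, 'a) dpath = "'v \<times> ('a + 'a) list"
type_synonym ('v, 'a, 'k) pfun = "'v \<times> ('a + 'a) list \<Rightarrow> 'k"

section \<open>The Coxeter group and its parabolic subgroups in terms of words\<close>

lemma coxeter_equiv_words:
 "coxeter_equiv Q x y ==> set x <= verts Q & set y <= verts Q"
 by (induction rule: coxeter_equiv.induct) (auto elim!: coxeter_relation.cases)

lemma coxeter_equiv_context:
 "coxeter_equiv Q x y ==> set u <= verts Q ==> set v <= verts Q ==>
  coxeter_equiv Q (u @ x @ v) (u @ y @ v)"
proof (induction rule: coxeter_equiv.induct)
 case (rel x y u' v')
 then show ?case using coxeter_equiv.rel[of Q x y "u @ u'" "v' @ v"] by (simp add: in_lists_conv_set ball_Un subset_iff)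
next
 case (refl x)
 then show ?case by (intro coxeter_equiv.refl) (auto simp: in_lists_conv_set)
next
 case (sym x y)
 then show ?case by (simp add: coxeter_equiv.sym)
next
 case (trans x y z)
 then show ?case by (meson coxeter_equiv.trans)
qed

lemma coxeter_equiv_append:
 assumes "coxeter_equiv Q x y" "coxeter_equiv Q x' y'"
 shows "coxeter_equiv Q (x @ x') (y @ y')"
proof -
 have "coxeter_equiv Q ([] @ x @ x') ([] @ y @ x')"
  using assms coxeter_equiv_words[of Q x' y'] by (intro coxeter_equiv_context) auto
 moreover have "coxeter_equiv Q (y @ x' @ []) (y @ y' @ [])"
  using assms coxeter_equiv_words[of Q x y] by (intro coxeter_equiv_context) auto
 ultimately show ?thesis using coxeter_equiv.trans by auto
qed

lemma coxeter_equiv_rev: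
 "set x <= verts Q ==> coxeter_equiv Q (x @ rev x) []"
proof (induction x)
 case Nil
 then show ?case by (simp add: coxeter_equiv.refl)
next
 case (Cons i x)
 then have "coxeter_equiv Q ([i] @ (x @ rev x) @ [i]) ([i] @ [] @ [i])" by (intro coxeter_equiv_context) auto
 moreover have "coxeter_equiv Q ([] @ [i, i] @ []) ([] @ [] @ [])"
  using Cons by (intro coxeter_equiv.rel coxeter_relation.involution) auto
 ultimately show ?case using coxeter_equiv.trans by auto
qed

lemma coxeter_class_self: "set x <= verts Q ==> x : coxeter_class Q x"
 by (simp add: coxeter_class_def coxeter_equiv.refl in_lists_conv_set subset_iff)

lemma coxeter_class_eq_iff:
 assumes "set y <= verts Q"
 shows "coxeter_class Q x = coxeter_class Q y \<longleftrightarrow> coxeter_equiv Q x y"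
proof
 assume "coxeter_class Q x = coxeter_class Q y"
 then have "y : coxeter_class Q x" using assms coxeter_class_self by blast
 then show "coxeter_equiv Q x y" by (simp add: coxeter_class_def)
next
 assume *: "coxeter_equiv Q x y"
 have "coxeter_equiv Q x z \<longleftrightarrow> coxeter_equiv Q y z" for z
  using coxeter_equiv.trans[OF *] coxeter_equiv.trans[OF coxeter_equiv.sym[OF *]] by blast
 then show "coxeter_class Q x = coxeter_class Q y" by (simp add: coxeter_class_def)
qed

lemma coxeter_mult:
 assumes "set x <= verts Q" "set y <= verts Q"
 shows "coxeter_class Q x \<otimes>\<^bsub>coxeter_group Q\<^esub> coxeter_class Q y = coxeter_class Q (x @ y)"
proof -
 have "coxeter_class Q (x' @ y') = coxeter_class Q (x @ y)"
  if "x' : coxeter_class Q x" "y' : coxeter_class Q y" for x' y'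
 proof -
  have "coxeter_equiv Q (x @ y) (x' @ y')" using that by (intro coxeter_equiv_append) (auto simp: coxeter_class_def)
  then show ?thesis using coxeter_class_eq_iff[of "x' @ y'" Q "x @ y"] coxeter_equiv_words by fastforce
 qed
 moreover have "x : coxeter_class Q x" "y : coxeter_class Q y" using assms by (simp_all add: coxeter_class_self)
 ultimately have "(\<Union>x'\<in>coxeter_class Q x. \<Union>y'\<in>coxeter_class Q y. coxeter_class Q (x' @ y')) =
   coxeter_class Q (x @ y)" by blast
 then show ?thesis by (simp add: coxeter_group_def)
qed

lemma coxeter_group_carrier:
 "carrier (coxeter_group Q) = coxeter_class Q ` {x. set x <= verts Q}"
 and coxeter_group_one: "\<one>\<^bsub>coxeter_group Q\<^esub> = coxeter_class Q []"
 by (auto simp: coxeter_group_def lists_eq_set)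

lemma coxeter_class_rev:
 assumes "set x <= verts Q"
 shows "coxeter_class Q (x @ rev x) = coxeter_class Q []"
  "coxeter_class Q (rev x @ x) = coxeter_class Q []"
 using assms coxeter_equiv_rev[of x Q] coxeter_equiv_rev[of "rev x" Q] by (simp_all add: coxeter_class_eq_iff)

lemma group_coxeter_group: "group (coxeter_group Q)"
proof (rule groupI)
 fix x assume "x : carrier (coxeter_group Q)"
 then obtain a where a: "set a <= verts Q" "x = coxeter_class Q a" unfolding coxeter_group_carrier by auto
 then have "coxeter_class Q (rev a) \<otimes>\<^bsub>coxeter_group Q\<^esub> x = \<one>\<^bsub>coxeter_group Q\<^esub>"
  by (simp add: coxeter_mult coxeter_class_rev coxeter_group_one)
 moreover have "coxeter_class Q (rev a) : carrier (coxeter_group Q)" using a unfolding coxeter_group_carrier by auto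
 ultimately show "EX y:carrier (coxeter_group Q). y \<otimes>\<^bsub>coxeter_group Q\<^esub> x = \<one>\<^bsub>coxeter_group Q\<^esub>"
  by blast
next
 fix x y assume "x : carrier (coxeter_group Q)" "y : carrier (coxeter_group Q)"
 then show "x \<otimes>\<^bsub>coxeter_group Q\<^esub> y : carrier (coxeter_group Q)"
  unfolding coxeter_group_carrier by (auto simp: coxeter_mult intro!: imageI)
next
 fix x y z
 assume "x : carrier (coxeter_group Q)" "y : carrier (coxeter_group Q)" "z : carrier (coxeter_group Q)"
 then obtain a b c where "set a <= verts Q" "x = coxeter_class Q a" "set b <= verts Q"
   "y = coxeter_class Q b" "set c <= verts Q" "z = coxeter_class Q c" unfolding coxeter_group_carrier by blast
 then show "x \<otimes>\<^bsub>coxeter_group Q\<^esub> y \<otimes>\<^bsub>coxeter_group Q\<^esub> z =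
   x \<otimes>\<^bsub>coxeter_group Q\<^esub> (y \<otimes>\<^bsub>coxeter_group Q\<^esub> z)"
  by (simp add: coxeter_mult)
next
 show "\<one>\<^bsub>coxeter_group Q\<^esub> : carrier (coxeter_group Q)"
  unfolding coxeter_group_carrier coxeter_group_one by (rule imageI) simp
next
 fix x assume "x : carrier (coxeter_group Q)"
 then obtain a where a: "set a <= verts Q" "x = coxeter_class Q a" unfolding coxeter_group_carrier by auto
 then show "\<one>\<^bsub>coxeter_group Q\<^esub> \<otimes>\<^bsub>coxeter_group Q\<^esub> x = x"
  by (simp add: coxeter_mult coxeter_group_one)
qed

text \<open>The generators are involutions, so the inverses allowed by \<open>generate\<close>
  produce nothing beyond words in J.\<close>

lemma coxeter_subgroup_eq:
 assumes "J <= verts Q"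
 shows "coxeter_subgroup Q J = coxeter_class Q ` {x. set x \<subseteq> J}"
proof -
 interpret group "coxeter_group Q" by (rule group_coxeter_group)
 have inv_s: "inv\<^bsub>coxeter_group Q\<^esub> coxeter_class Q [i] = coxeter_class Q [i]" if "i : J" for i
  using that assms coxeter_class_rev[of "[i]" Q]
  by (intro inv_equality) (auto simp: coxeter_mult coxeter_group_one coxeter_group_carrier)
 show ?thesis
 proof
  show "coxeter_subgroup Q J \<subseteq> coxeter_class Q ` {x. set x \<subseteq> J}"
  proof
   fix w assume "w : coxeter_subgroup Q J"
   then show "w : coxeter_class Q ` {x. set x \<subseteq> J}" unfolding coxeter_subgroup_def
   proof (induction rule: generate.induct)
    case one
    show ?case by (rule image_eqI[of _ _ "[]"]) (simp_all add: coxeter_group_one)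
   next
    case (incl h)
    then show ?case by auto
   next
    case (inv h)
    then obtain i where "i : J" "h = coxeter_class Q [i]" by blast
    then show ?case using inv_s[of i] by (intro image_eqI[of _ _ "[i]"]) simp_all
   next
    case (eng h1 h2)
    then obtain a b where ab: "set a \<subseteq> J" "set b \<subseteq> J"
      "h1 = coxeter_class Q a" "h2 = coxeter_class Q b" by blast
    then show ?case using assms by (intro image_eqI[of _ _ "a @ b"]) (auto simp: coxeter_mult)
   qed
  qed
  have "coxeter_class Q x : coxeter_subgroup Q J" if "set x \<subseteq> J" for x using that
  proof (induction x)
   case Nil
   then show ?case by (metis coxeter_group_one coxeter_subgroup_def generate.one)
  next
   case (Cons i x)
   then have "coxeter_class Q (i # x) = coxeter_class Q [i] \<otimes>\<^bsub>coxeter_group Q\<^esub> coxeter_class Q x"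
    using assms by (subst coxeter_mult) auto
   moreover have "coxeter_class Q [i] : coxeter_subgroup Q J"
    using Cons unfolding coxeter_subgroup_def by (intro generate.incl) auto
   ultimately show ?case using Cons unfolding coxeter_subgroup_def by (auto intro: generate.eng)
  qed
  then show "coxeter_class Q ` {x. set x \<subseteq> J} \<subseteq> coxeter_subgroup Q J" by auto
 qed
qed

text \<open>An assignment of maps to letters that respects the Coxeter relations on S is an action
  of W on S. It is used for inversion sets and for the affine action.\<close>

lemma coxeter_equiv_foldr:
 assumes closed: "!!i a. i : verts Q ==> a : S ==> f i a : S"
  and rel: "!!x y a. coxeter_relation Q x y ==> a : S ==> foldr f x a = foldr f y a"
  and "coxeter_equiv Q x y" "a : S"
 shows "foldr f x a = foldr f y a" using assms(3,4)
proof (induction arbitrary: a rule: coxeter_equiv.induct)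
 case (rel x y u v)
 have "foldr f v a : S" using rel(3,4) closed by (induction v) (auto simp: in_lists_conv_set)
 then show ?case using rel assms(2) by simp
qed auto

text \<open>The set of reflections that separate the element represented by the word from the identity.\<close>

definition inversion_step :: "('v, 'a) pre_digraph => 'v => 'v list set set => 'v list set set" where
 "inversion_step Q i A =
   {t : carrier (coxeter_group Q). (t = coxeter_class Q [i]) ~=
    (coxeter_class Q [i] \<otimes>\<^bsub>coxeter_group Q\<^esub> t \<otimes>\<^bsub>coxeter_group Q\<^esub> coxeter_class Q [i] : A)}"

definition inversions :: "('v, 'a) pre_digraph => 'v list => 'v list set set" where
 "inversions Q x = foldr (inversion_step Q) x {}"

lemma inversions_Nil [simp]: "inversions Q [] = {}"
 and inversions_Cons: "inversions Q (i # x) = inversion_step Q i (inversions Q x)" by (simp_all add: inversions_def)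

section \<open>Inversion sets, the exchange condition and the length\<close>

locale coxeter_generators =
 fixes Q :: "('v, 'a) pre_digraph"
begin

sublocale G: group "coxeter_group Q" by (rule group_coxeter_group)

abbreviation G where "G \<equiv> coxeter_group Q"
abbreviation s where "s i \<equiv> coxeter_class Q [i]"

lemma s_closed: "i : verts Q ==> s i : carrier G" by (auto simp: coxeter_group_carrier)

lemma s_s: "i : verts Q ==> s i \<otimes>\<^bsub>G\<^esub> s i = \<one>\<^bsub>G\<^esub>"
 using coxeter_class_rev[of "[i]" Q] by (simp add: coxeter_mult coxeter_group_one)

lemma s_s_left: "i : verts Q ==> g : carrier G ==> s i \<otimes>\<^bsub>G\<^esub> (s i \<otimes>\<^bsub>G\<^esub> g) = g"
 by (metis G.l_one G.m_assoc s_closed s_s)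

lemma s_s_right: "i : verts Q ==> g : carrier G ==> g \<otimes>\<^bsub>G\<^esub> s i \<otimes>\<^bsub>G\<^esub> s i = g"
 by (metis G.r_one G.m_assoc s_closed s_s)

lemma class_Cons: "i : verts Q ==> set x <= verts Q ==> 
 coxeter_class Q (i # x) = s i \<otimes>\<^bsub>G\<^esub> coxeter_class Q x" by (simp add: coxeter_mult)

definition c :: "'v => 'v list set => 'v list set" where
 "c i t = s i \<otimes>\<^bsub>G\<^esub> t \<otimes>\<^bsub>G\<^esub> s i"

lemma conj_eq_iff:
 assumes "i : verts Q" "t : carrier G" "u : carrier G"
 shows "c i t = u \<longleftrightarrow> t = c i u"
proof -
 have "c i (c i t) = t" if "t : carrier G" for t using that assms(1) s_s_left[of i] s_s_right[of i] s_closed[of i]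
  by (simp add: c_def G.m_assoc s_s)
 then show ?thesis using assms by metis
qed

end

context coxeter_generators
begin

lemma c_closed: "i : verts Q ==> t : carrier G ==> c i t : carrier G" unfolding c_def using s_closed by (intro G.m_closed)

lemma c_c: "i : verts Q ==> t : carrier G ==> c i (c i t) = t" using conj_eq_iff[of i "c i t" t] c_closed by blast

lemma c_self: "i : verts Q ==> c i (s i) = s i" by (simp add: c_def s_s s_closed)

lemma mem_inversion_step:
 "t : carrier G ==> t : inversion_step Q i A \<longleftrightarrow> (t = s i) ~= (c i t : A)"
 by (simp add: inversion_step_def c_def)

lemma inversion_step_closed: "inversion_step Q i A <= carrier G" by (auto simp: inversion_step_def)

lemma inversions_closed: "inversions Q x <= carrier G" by (cases x) (auto simp: inversions_Cons inversion_step_def)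

lemma inversion_step_involution:
 assumes "i : verts Q" "A <= carrier G"
 shows "inversion_step Q i (inversion_step Q i A) = A"
proof -
 have "t : inversion_step Q i (inversion_step Q i A) \<longleftrightarrow> t : A" if t: "t : carrier G" for t
  using assms t conj_eq_iff[of i t "s i"]
  by (cases "t = s i") (simp_all add: mem_inversion_step c_closed c_c c_self s_closed)
 then show ?thesis using assms(2) inversion_step_closed by blast
qed

lemma relation_mult:
 "coxeter_relation Q x y ==> coxeter_class Q x = coxeter_class Q y"
 using coxeter_equiv.rel[of Q x y "[]" "[]"] coxeter_equiv_words[of Q x y] by (simp add: coxeter_class_eq_iff)

text \<open>One step is conjugation by the generator followed by the symmetric difference with that
  generator. For a commuting pair both sides toggle s_i and s_j; for a braid both sides toggle the
  three reflections s_i, s_j and s_i s_j s_i. Hence the inversion set depends only on the group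
  element.\<close>

lemma inversion_step_relation:
 assumes "coxeter_relation Q x y" "A <= carrier G"
 shows "foldr (inversion_step Q) x A = foldr (inversion_step Q) y A" using assms(1)
proof cases
 case (involution i)
 then show ?thesis using assms(2) by (simp add: inversion_step_involution)
next
 case (commute i j)
 have eq: "s i \<otimes>\<^bsub>G\<^esub> s j = s j \<otimes>\<^bsub>G\<^esub> s i"
  using relation_mult[OF assms(1)] commute by (simp add: coxeter_mult)
 note sc = s_closed[OF commute(3)] s_closed[OF commute(4)]
 have 1: "c i (c j t) = c j (c i t)" if "t : carrier G" for t
 proof -
  have "c i (c j t) = (s i \<otimes>\<^bsub>G\<^esub> s j) \<otimes>\<^bsub>G\<^esub> t \<otimes>\<^bsub>G\<^esub> (s j \<otimes>\<^bsub>G\<^esub> s i)"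
   using that sc by (simp add: c_def G.m_assoc)
  also have "\<dots> = (s j \<otimes>\<^bsub>G\<^esub> s i) \<otimes>\<^bsub>G\<^esub> t \<otimes>\<^bsub>G\<^esub> (s i \<otimes>\<^bsub>G\<^esub> s j)"
   using eq by simp
  finally show ?thesis using that sc by (simp add: c_def G.m_assoc)
 qed
 have 2: "c i (s j) = s j" "c j (s i) = s i"
  using eq s_s_right[of i "s j"] s_s_right[of j "s i"] commute(3,4) sc by (simp_all add: c_def)
 have "t : inversion_step Q i (inversion_step Q j A) \<longleftrightarrow> t : inversion_step Q j (inversion_step Q i A)"
  if t: "t : carrier G" for t
  using t 1[OF t] conj_eq_iff[OF commute(3) t sc(2)] conj_eq_iff[OF commute(4) t sc(1)] 2 commute(3,4)
  by (cases "t = s i"; cases "t = s j") (simp_all add: mem_inversion_step c_closed)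
 then have "inversion_step Q i (inversion_step Q j A) = inversion_step Q j (inversion_step Q i A)"
  using inversion_step_closed by blast
 then show ?thesis by (simp add: commute(1,2))
next
 case (braid i j)
 have eq: "s i \<otimes>\<^bsub>G\<^esub> s j \<otimes>\<^bsub>G\<^esub> s i = s j \<otimes>\<^bsub>G\<^esub> s i \<otimes>\<^bsub>G\<^esub> s j"
  using relation_mult[OF assms(1)] braid by (simp add: coxeter_mult)
 note sc = s_closed[OF braid(3)] s_closed[OF braid(4)]
 have 1: "c i (c j (c i t)) = c j (c i (c j t))" if "t : carrier G" for t
 proof -
  have "c i (c j (c i t)) =
    (s i \<otimes>\<^bsub>G\<^esub> s j \<otimes>\<^bsub>G\<^esub> s i) \<otimes>\<^bsub>G\<^esub> t \<otimes>\<^bsub>G\<^esub> (s i \<otimes>\<^bsub>G\<^esub> s j \<otimes>\<^bsub>G\<^esub> s i)"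
   using that sc by (simp add: c_def G.m_assoc)
  also have "\<dots> = (s j \<otimes>\<^bsub>G\<^esub> s i \<otimes>\<^bsub>G\<^esub> s j) \<otimes>\<^bsub>G\<^esub> t \<otimes>\<^bsub>G\<^esub> (s j \<otimes>\<^bsub>G\<^esub> s i \<otimes>\<^bsub>G\<^esub> s j)"
   using eq by simp
  finally show ?thesis using that sc by (simp add: c_def G.m_assoc)
 qed
 have 2: "c i (c j (s i)) = s j" "c j (c i (s j)) = s i"
  using eq c_c[OF braid(3) sc(2)] c_c[OF braid(4) sc(1)] by (simp_all add: c_def)
 have "t : inversion_step Q i (inversion_step Q j (inversion_step Q i A)) \<longleftrightarrow>
   t : inversion_step Q j (inversion_step Q i (inversion_step Q j A))"
  if t: "t : carrier G" for t
 proof -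
  have "c j (c i t) = s i \<longleftrightarrow> t = s j" using conj_eq_iff[OF braid(4) c_closed[OF braid(3) t] sc(1)]
    conj_eq_iff[OF braid(3) t c_closed[OF braid(4) sc(1)]] 2 by simp
  moreover have "c i (c j t) = s j \<longleftrightarrow> t = s i"
   using conj_eq_iff[OF braid(3) c_closed[OF braid(4) t] sc(2)]
    conj_eq_iff[OF braid(4) t c_closed[OF braid(3) sc(2)]] 2 by simp
  moreover have "c i t = s j \<longleftrightarrow> c j t = s i"
   using conj_eq_iff[OF braid(3) t sc(2)] conj_eq_iff[OF braid(4) t sc(1)] eq by (simp add: c_def)
  moreover have "t : inversion_step Q i (inversion_step Q j (inversion_step Q i A)) \<longleftrightarrow>
    (t = s i) ~= ((c i t = s j) ~= ((c j (c i t) = s i) ~= (c i (c j (c i t)) : A)))"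
   by (simp only: mem_inversion_step c_closed braid(3,4) t)
  moreover have "t : inversion_step Q j (inversion_step Q i (inversion_step Q j A)) \<longleftrightarrow>
    (t = s j) ~= ((c j t = s i) ~= ((c i (c j t) = s j) ~= (c j (c i (c j t)) : A)))"
   by (simp only: mem_inversion_step c_closed braid(3,4) t)
  ultimately show ?thesis using 1[OF t] by argo
 qed
 then have "inversion_step Q i (inversion_step Q j (inversion_step Q i A)) =
   inversion_step Q j (inversion_step Q i (inversion_step Q j A))" using inversion_step_closed by blast
 then show ?thesis by (simp add: braid(1,2))
qed

lemma inversions_cong:
 assumes "coxeter_equiv Q x y"
 shows "inversions Q x = inversions Q y" unfolding inversions_def
 by (rule coxeter_equiv_foldr[where S = "Pow (carrier G)"])
  (use assms inversion_step_relation inversion_step_closed in auto)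

text \<open>Conjugation by s_i fixes s_i, so toggling it either removes it before conjugating or
  adds it afterwards. In this form the cardinality visibly changes by exactly one.\<close>

lemma inversion_step_eq:
 assumes "i : verts Q" "A <= carrier G"
 shows "inversion_step Q i A = (if s i : A then c i ` (A - {s i}) else insert (s i) (c i ` A))"
  (is "_ = ?R")
proof -
 have sub: "?R <= carrier G" using assms c_closed s_closed by auto
 have mem: "t : c i ` A' \<longleftrightarrow> c i t : A'" if "t : carrier G" "A' <= carrier G" for t A'
  using that c_c[OF assms(1)] by (force simp: image_iff subset_iff)
 have "t : inversion_step Q i A \<longleftrightarrow> t : ?R" if t: "t : carrier G" for t
  using t assms conj_eq_iff[of i t "s i"] c_self[of i] s_closed[of i] mem[OF t, of A] mem[OF t, of "A - {s i}"]
  by (auto simp: mem_inversion_step)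
 then show ?thesis using sub inversion_step_closed by blast
qed

lemma inj_c: "i : verts Q ==> inj_on (c i) (carrier G)" by (metis c_c inj_onI)

lemma finite_inversions: "set x <= verts Q ==> finite (inversions Q x)"
 by (induction x) (auto simp: inversions_Cons inversion_step_eq inversions_closed)

lemma card_inversions_Cons:
 assumes "i : verts Q" "set x <= verts Q"
 shows "s i : inversions Q x ==> Suc (card (inversions Q (i # x))) = card (inversions Q x)"
  and "s i ~: inversions Q x ==> card (inversions Q (i # x)) = Suc (card (inversions Q x))"
proof -
 note fin = finite_inversions[OF assms(2)]
 have inj: "inj_on (c i) A" if "A \<subseteq> inversions Q x" for A
  using inj_c[OF assms(1)] inversions_closed that by (meson inj_on_subset order_trans)
 show "Suc (card (inversions Q (i # x))) = card (inversions Q x)" if "s i : inversions Q x"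
  using that assms inj[of "inversions Q x - {s i}"] fin
  by (simp add: inversions_Cons inversion_step_eq inversions_closed card_image card_Suc_Diff1 del: card_Diff_insert)
 assume *: "s i ~: inversions Q x"
 have "s i ~: c i ` inversions Q x"
 proof
  assume "s i : c i ` inversions Q x"
  then obtain t where t: "t : inversions Q x" "c i t = s i" by auto
  then have "t = c i (s i)" using conj_eq_iff[of i t "s i"] assms(1) inversions_closed s_closed by blast
  then show False using * t(1) c_self[OF assms(1)] by simp
 qed
 then show "card (inversions Q (i # x)) = Suc (card (inversions Q x))" using * assms inj[of "inversions Q x"] fin
  by (simp add: inversions_Cons inversion_step_eq inversions_closed card_image)
qed

lemma card_inversions_le: "set x <= verts Q ==> card (inversions Q x) <= length x"
proof (induction x)
 case (Cons i x)
 then show ?case using card_inversions_Cons[of i x] by (cases "s i : inversions Q x") auto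
qed simp

lemma class_closed: "set x <= verts Q ==> coxeter_class Q x : carrier G" by (auto simp: coxeter_group_carrier)

lemma mult_inversion:
 assumes "set y <= verts Q" "t : inversions Q y"
 shows "EX u j v. y = u @ j # v & t \<otimes>\<^bsub>G\<^esub> coxeter_class Q y = coxeter_class Q (u @ v)" using assms
proof (induction y arbitrary: t)
 case (Cons k y)
 then have k: "k : verts Q" and y: "set y <= verts Q" by auto
 have t: "t : carrier G" using Cons.prems inversions_closed by blast
 show ?case
 proof (cases "t = s k")
  case True
  then have "t \<otimes>\<^bsub>G\<^esub> coxeter_class Q (k # y) = coxeter_class Q y"
   using k y class_Cons[of k y] by (simp add: s_s_left class_closed)
  then show ?thesis by (intro exI[of _ "[]"] exI[of _ k] exI[of _ y]) simp
 next
  case False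
  then have "c k t : inversions Q y" using Cons.prems(2) t by (simp add: inversions_Cons mem_inversion_step)
  then obtain u j v where uv: "y = u @ j # v"
    "c k t \<otimes>\<^bsub>G\<^esub> coxeter_class Q y = coxeter_class Q (u @ v)" using Cons.IH[OF y] by blast
  have "s k \<otimes>\<^bsub>G\<^esub> (t \<otimes>\<^bsub>G\<^esub> coxeter_class Q (k # y)) = coxeter_class Q (u @ v)"
   using uv(2) k y t s_closed[OF k] class_closed[OF y] class_Cons[of k y] by (simp add: c_def G.m_assoc)
  moreover have "t \<otimes>\<^bsub>G\<^esub> coxeter_class Q (k # y) : carrier G"
   using t class_closed[of "k # y"] k y by (intro G.m_closed) auto
  moreover have "coxeter_class Q (k # u @ v) = s k \<otimes>\<^bsub>G\<^esub> coxeter_class Q (u @ v)"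
   using uv(1) k y by (intro class_Cons) auto
  ultimately have "t \<otimes>\<^bsub>G\<^esub> coxeter_class Q (k # y) = coxeter_class Q (k # u @ v)"
   using s_s_left[OF k] by metis
  then show ?thesis using uv(1) by (intro exI[of _ "k # u"] exI[of _ j] exI[of _ v]) simp
 qed
qed simp

lemma exchange:
 assumes "set y <= verts Q" "i : verts Q" "s i : inversions Q y"
 obtains u j v where "y = u @ j # v" "coxeter_equiv Q (i # y) (u @ v)"
proof -
 obtain u j v where uv: "y = u @ j # v" "s i \<otimes>\<^bsub>G\<^esub> coxeter_class Q y = coxeter_class Q (u @ v)"
  using mult_inversion[OF assms(1,3)] by blast
 then have "coxeter_class Q (i # y) = coxeter_class Q (u @ v)" using assms class_Cons[of i y] by simp
 then have "coxeter_equiv Q (i # y) (u @ v)" using uv(1) assms by (subst (asm) coxeter_class_eq_iff) auto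
 then show ?thesis using uv(1) that by blast
qed

text \<open>Counting inversions stands in for minimality of the length;
  \<open>coxeter_length_eq\<close> shows that the two agree.\<close>

definition reduced :: "'v list => bool" where
 "reduced x \<longleftrightarrow> set x <= verts Q & card (inversions Q x) = length x"

lemma coxeter_equiv_refl: "set x <= verts Q ==> coxeter_equiv Q x x" by (intro coxeter_equiv.refl) auto

lemma coxeter_equiv_Cons:
 assumes "coxeter_equiv Q x y" "i : verts Q"
 shows "coxeter_equiv Q (i # x) (i # y)" using coxeter_equiv_context[OF assms(1), of "[i]" "[]"] assms(2) by simp

lemma coxeter_equiv_Cons_Cons:
 assumes "set x <= verts Q" "i : verts Q"
 shows "coxeter_equiv Q (i # i # x) x"
 using coxeter_equiv_context[OF coxeter_equiv_rev[of "[i]" Q], of "[]" x] assms by simp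

lemma coxeter_equiv_Cons_swap:
 assumes "coxeter_equiv Q (i # x) y" "i : verts Q"
 shows "coxeter_equiv Q x (i # y)"
proof -
 have "set x <= verts Q" using coxeter_equiv_words[OF assms(1)] by simp
 then have "coxeter_equiv Q x (i # i # x)" using assms(2) by (intro coxeter_equiv.sym[OF coxeter_equiv_Cons_Cons])
 then show ?thesis using coxeter_equiv_Cons[OF assms] coxeter_equiv.trans by blast
qed

text \<open>If the new letter is already an inversion of the reduced tail, the exchange condition
  deletes a letter instead of adding one. No new letters appear, which is what makes the result
  usable inside a parabolic subgroup.\<close>

lemma exists_reduced:
 "set x <= verts Q ==> EX y. set y \<subseteq> set x & coxeter_equiv Q x y & reduced y"
proof (induction x)
 case Nil
 then show ?case by (intro exI[of _ "[]"]) (simp add: reduced_def coxeter_equiv_refl)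
next
 case (Cons i x)
 then obtain y where y: "set y \<subseteq> set x" "coxeter_equiv Q x y" "reduced y" by auto
 have i: "i : verts Q" using Cons by simp
 have y': "set y <= verts Q" using y by (simp add: reduced_def)
 have eq: "coxeter_equiv Q (i # x) (i # y)" using y i coxeter_equiv_Cons by blast
 show ?case
 proof (cases "s i : inversions Q y")
  case True
  obtain u j v where uv: "y = u @ j # v" "coxeter_equiv Q (i # y) (u @ v)" using exchange[OF y' i True] .
  have "card (inversions Q (u @ v)) = length (u @ v)"
   using card_inversions_Cons(1)[OF i y' True] inversions_cong[OF uv(2)] y(3) uv(1) by (simp add: reduced_def)
  then have "reduced (u @ v)" "set (u @ v) \<subseteq> set (i # x)" using y y' uv(1) by (auto simp: reduced_def)
  then show ?thesis using coxeter_equiv.trans[OF eq uv(2)] by blast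
 next
  case False
  then have "reduced (i # y)" using card_inversions_Cons(2)[OF i y'] y i by (simp add: reduced_def)
  moreover have "set (i # y) \<subseteq> set (i # x)" using y by auto
  ultimately show ?thesis using eq by blast
 qed
qed

text \<open>The right-hand side does not mention J: the length in the parabolic subgroup is the
  length in W.\<close>

lemma coxeter_length_eq:
 assumes "set x \<subseteq> J" "J <= verts Q"
 shows "coxeter_length Q J (coxeter_class Q x) = card (inversions Q x)" unfolding coxeter_length_def
proof (rule Least_equality)
 have x: "set x <= verts Q" using assms by auto
 obtain y where y: "set y \<subseteq> set x" "coxeter_equiv Q x y" "reduced y" using exists_reduced[OF x] by blast
 then have "coxeter_class Q y = coxeter_class Q x" using x coxeter_equiv.sym by (subst coxeter_class_eq_iff) auto
 moreover have "length y = card (inversions Q x)" using y inversions_cong[OF y(2)] by (simp add: reduced_def)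
 moreover have "y : lists J" using y assms by auto
 ultimately show "EX is:lists J. length is = card (inversions Q x) & coxeter_class Q is = coxeter_class Q x" by blast
next
 fix n assume "EX is:lists J. length is = n & coxeter_class Q is = coxeter_class Q x"
 then obtain y where y: "set y \<subseteq> J" "length y = n" "coxeter_class Q y = coxeter_class Q x"
  by (auto simp: in_lists_conv_set)
 then have "inversions Q y = inversions Q x"
  using assms by (intro inversions_cong, subst coxeter_class_eq_iff[symmetric]) auto
 then show "card (inversions Q x) <= n" using card_inversions_le[of y] y assms by auto
qed

lemma reduced_Cons:
 assumes "reduced (i # x)"
 shows "reduced x" "s i : inversions Q (i # x)"
proof -
 have i: "i : verts Q" and x: "set x <= verts Q" using assms by (auto simp: reduced_def)
 have *: "s i ~: inversions Q x"
  using card_inversions_Cons(1)[OF i x] card_inversions_le[OF x] assms by (auto simp: reduced_def)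
 then show "reduced x" using card_inversions_Cons(2)[OF i x] assms by (simp add: reduced_def)
 show "s i : inversions Q (i # x)" using * i by (simp add: inversions_Cons mem_inversion_step s_closed c_self)
qed

lemma reduced_cong:
 assumes "reduced x" "coxeter_equiv Q x y" "length y = length x"
 shows "reduced y" using assms inversions_cong[OF assms(2)] coxeter_equiv_words[OF assms(2)] by (simp add: reduced_def)

lemma length_reduced_le:
 assumes "reduced x" "coxeter_equiv Q x y"
 shows "length x <= length y"
 using assms inversions_cong[OF assms(2)] card_inversions_le[of y] coxeter_equiv_words[OF assms(2)]
 by (simp add: reduced_def)

end

section \<open>The affine action, reduced words in parabolic subgroups, and longest elements\<close>

locale coxeter_quiver = coxeter_generators Q + fin_digraph Q + loopfree_digraph Q
 for Q :: "('v, 'a) pre_digraph"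
begin

lemma num_arrows_self [simp]: "num_arrows Q i i = 0"
proof -
 have "{a : arcs Q. {tail Q a, head Q a} = {i, i}} = {}" using no_loops by fastforce
 then show ?thesis unfolding num_arrows_def by (simp only: card.empty)
qed

lemma num_arrows_commute: "num_arrows Q i j = num_arrows Q j i" by (simp add: num_arrows_def insert_commute)

text \<open>The affine action obtained from the geometric representation of the quiver with one extra
 vertex joined to all others: coordinates of the orbit of the new simple root.\<close>

definition affine_reflection :: "'v => ('v => int) => 'v => int" where
 "affine_reflection i u = u(i := (SUM j:verts Q. int (num_arrows Q i j) * u j) + 1 - u i)"

lemma sum_num_arrows_upd:
 assumes "j : verts Q"
 shows "(SUM k:verts Q. int (num_arrows Q i k) * (u(j := x)) k) =
  (SUM k:verts Q. int (num_arrows Q i k) * u k) + int (num_arrows Q i j) * (x - u j)"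
proof -
 have "(SUM k:verts Q. int (num_arrows Q i k) * (u(j := x)) k) =
   int (num_arrows Q i j) * x + (SUM k:verts Q - {j}. int (num_arrows Q i k) * u k)"
  using assms by (subst sum.remove[of _ j]) (auto intro!: sum.cong)
 moreover have "(SUM k:verts Q. int (num_arrows Q i k) * u k) =
   int (num_arrows Q i j) * u j + (SUM k:verts Q - {j}. int (num_arrows Q i k) * u k)"
  using assms by (subst sum.remove[of _ j]) auto
 ultimately show ?thesis by (simp add: algebra_simps)
qed

lemma affine_reflection_apply:
 "affine_reflection i u k =
  (if k = i then (SUM j:verts Q. int (num_arrows Q i j) * u j) + 1 - u i else u k)" by (simp add: affine_reflection_def)

lemma sum_affine_reflection:
 assumes "j : verts Q"
 shows "(SUM k:verts Q. int (num_arrows Q i k) * affine_reflection j u k) =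
  (SUM k:verts Q. int (num_arrows Q i k) * u k) + int (num_arrows Q i j) * (affine_reflection j u j - u j)"
 unfolding affine_reflection_def sum_num_arrows_upd[OF assms] by simp

lemma affine_reflection_relation:
 assumes "coxeter_relation Q x y"
 shows "foldr affine_reflection x u = foldr affine_reflection y u"
proof
 fix k
 show "foldr affine_reflection x u k = foldr affine_reflection y u k" using assms
 proof cases
  case (involution i)
  then show ?thesis by (simp add: sum_affine_reflection affine_reflection_apply[where k = k]
     affine_reflection_apply[where k = i])
 next
  case (commute i j)
  then show ?thesis using num_arrows_commute[of i j]
   by (cases "i = j") (auto simp: sum_affine_reflection affine_reflection_apply[where k = k]
     affine_reflection_apply[where k = i] affine_reflection_apply[where k = j])
 next
  case (braid i j)
  then have "i ~= j" by auto
  then show ?thesis using braid num_arrows_commute[of i j]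
   by (auto simp: sum_affine_reflection affine_reflection_apply[where k = k]
     affine_reflection_apply[where k = i] affine_reflection_apply[where k = j] algebra_simps)
 qed
qed

lemma affine_reflection_cong:
 "coxeter_equiv Q x y ==> foldr affine_reflection x u = foldr affine_reflection y u"
 by (rule coxeter_equiv_foldr[where S = UNIV]) (auto intro: affine_reflection_relation)

lemma affine_reflection_support:
 "set x \<subseteq> J ==> k ~: J ==> foldr affine_reflection x (%_. 0) k = 0"
 by (induction x) (auto simp: affine_reflection_def)

text \<open>The affine action separates generators: words in J move the origin only in the
  coordinates of J, whereas s_i moves its coordinate i to 1.\<close>

lemma coxeter_equiv_generator:
 assumes "coxeter_equiv Q [i] x" "set x \<subseteq> J"
 shows "i : J"
proof (rule ccontr)
 assume "i ~: J"
 then have "foldr affine_reflection [i] (%_. 0) i = 0"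
  using affine_reflection_cong[OF assms(1)] affine_reflection_support[OF assms(2)] by metis
 then show False by (simp add: affine_reflection_def)
qed

lemma s_inj: "i : verts Q ==> j : verts Q ==> s i = s j ==> i = j"
 using coxeter_equiv_generator[of i "[j]" "{j}"] by (simp add: coxeter_class_eq_iff)

text \<open>Each inversion arises from a letter by conjugating with earlier letters, all of them in
  J.\<close>

lemma inversions_words:
 "set u \<subseteq> J ==> J <= verts Q ==> t : inversions Q u ==> EX z. set z \<subseteq> J & t = coxeter_class Q z"
proof (induction u arbitrary: t)
 case (Cons i u)
 then have i: "i : verts Q" "i : J" by auto
 have t: "t : carrier G" using Cons.prems inversions_closed by blast
 show ?case
 proof (cases "t = s i")
  case True
  then show ?thesis using i by (intro exI[of _ "[i]"]) auto
 next
  case False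
  then have "c i t : inversions Q u" using Cons.prems t by (simp add: inversions_Cons mem_inversion_step)
  then obtain z where z: "set z \<subseteq> J" "c i t = coxeter_class Q z" using Cons.IH[of "c i t"] Cons.prems by auto
  have zQ: "set z <= verts Q" using z Cons.prems by auto
  have "t = c i (coxeter_class Q z)" using z(2) c_c[OF i(1) t] by simp
  also have "\<dots> = coxeter_class Q (i # z @ [i])" using zQ i by (simp add: c_def coxeter_mult)
  finally show ?thesis using z i by (intro exI[of _ "i # z @ [i]"]) auto
 qed
qed simp

text \<open>The first letter of a reduced word is an inversion of its class, hence of the word in J,
  hence lies in the parabolic subgroup; the affine action then puts the letter itself into J.
  Cancelling it on both sides starts the induction again.\<close>

lemma reduced_word_in_parabolic:
 assumes "reduced x" "coxeter_equiv Q x u" "set u \<subseteq> J" "J <= verts Q"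
 shows "set x \<subseteq> J" using assms
proof (induction x arbitrary: u)
 case (Cons i x)
 have i: "i : verts Q" using Cons.prems by (simp add: reduced_def)
 have "s i : inversions Q u" using reduced_Cons[OF Cons.prems(1)] inversions_cong[OF Cons.prems(2)] by simp
 then obtain z where z: "set z \<subseteq> J" "s i = coxeter_class Q z"
  using inversions_words[OF Cons.prems(3,4)] by metis
 then have "coxeter_equiv Q [i] z" using Cons.prems(4) coxeter_class_eq_iff[of z Q "[i]"] by auto
 then have iJ: "i : J" using z(1) by (rule coxeter_equiv_generator)
 have "coxeter_equiv Q x (i # u)" using coxeter_equiv_Cons_swap[OF Cons.prems(2) i] .
 then have "set x \<subseteq> J" using Cons.IH[of "i # u"] Cons.prems iJ reduced_Cons(1) by auto
 then show ?case using iJ by simp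
qed simp

text \<open>Matsumoto's theorem for a simply laced parabolic subgroup.\<close>

lemma foldr_reduced_cong:
 assumes J: "J <= verts Q" "!!i j. i : J ==> j : J ==> num_arrows Q i j <= 1"
  and closed: "!!i a. i : J ==> a : S ==> f i a : S"
  and commute: "!!i j a. i : J ==> j : J ==> a : S ==> num_arrows Q i j = 0 ==> f i (f j a) = f j (f i a)"
  and braid: "!!i j a. i : J ==> j : J ==> a : S ==> num_arrows Q i j = 1 ==>
   f i (f j (f i a)) = f j (f i (f j a))"
  and a: "a : S"
 shows "reduced x ==> coxeter_equiv Q x y ==> length y = length x ==> set x \<subseteq> J ==> set y \<subseteq> J ==>
  foldr f x a = foldr f y a"
proof (induction "length x" arbitrary: x y rule: less_induct)
 case less
 have fclosed: "foldr f w a : S" if "set w \<subseteq> J" for w using that a closed by (induction w) auto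
 have IH: "foldr f x' a = foldr f y' a"
  if "reduced x'" "coxeter_equiv Q x' y'" "length y' = length x'" "set x' \<subseteq> J" "set y' \<subseteq> J"
   "length x' < length x" for x' y' using less.hyps[of x' y'] that by blast
 show ?case
 proof (cases x)
  case Nil
  then show ?thesis using less.prems by simp
 next
  case x: (Cons i x')
  then obtain j y' where y: "y = j # y'" using less.prems(3) by (cases y) auto
  have ij: "i : J" "j : J" "i : verts Q" "j : verts Q" "set x' \<subseteq> J" "set y' \<subseteq> J"
   using less.prems x y J(1) by auto
  have red_y: "reduced y" using reduced_cong[OF less.prems(1,2,3)] .
  have red_x': "reduced x'" and red_y': "reduced y'" using reduced_Cons(1) less.prems(1) red_y x y by blast+
  have len: "length x = Suc (length x')" "length y' = length x'" using x y less.prems by auto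
  have xQ: "set x <= verts Q" using less.prems J by auto
  show ?thesis
  proof (cases "i = j")
   case True
   have "coxeter_equiv Q x' (i # y)" using coxeter_equiv_Cons_swap[of i x' y] less.prems(2) x ij by simp
   moreover have "coxeter_equiv Q (i # y) y'" using y True ij J by (auto intro!: coxeter_equiv_Cons_Cons)
   ultimately have "coxeter_equiv Q x' y'" by (rule coxeter_equiv.trans)
   then have "foldr f x' a = foldr f y' a" using IH[of x' y'] red_x' ij len by simp
   then show ?thesis using x y True by simp
  next
   case False
   have jx: "coxeter_equiv Q (j # x) y'"
   proof -
    have "coxeter_equiv Q (j # x) (j # y)" using less.prems(2) ij by (intro coxeter_equiv_Cons)
    moreover have "coxeter_equiv Q (j # y) y'" using y ij J by (auto intro!: coxeter_equiv_Cons_Cons)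
    ultimately show ?thesis by (rule coxeter_equiv.trans)
   qed
   \<comment> \<open>Exchange of j in x. The deleted letter is not the initial i, since that would
     give s_j = s_i; hence x is equivalent to j i w with w shorter by two.\<close>
   have "s j : inversions Q x" using reduced_Cons(2)[of j y'] red_y y inversions_cong[OF less.prems(2)] by simp
   then obtain u k v where uv: "x = u @ k # v" "coxeter_equiv Q (j # x) (u @ v)" using exchange[OF xQ ij(4)] by blast
   have y'uv: "coxeter_equiv Q y' (u @ v)" using coxeter_equiv.trans[OF coxeter_equiv.sym[OF jx] uv(2)] .
   have "u ~= []"
   proof
    assume "u = []"
    then have "coxeter_equiv Q y' x'" using uv(1) y'uv x by simp
    then have "coxeter_equiv Q (j # x) x'" using coxeter_equiv.trans[OF jx] by blast
    then have "s j \<otimes>\<^bsub>G\<^esub> coxeter_class Q x = coxeter_class Q x'"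
     using class_Cons[of j x] ij xQ x coxeter_class_eq_iff[of x' Q "j # x"] by simp
    then have "s j \<otimes>\<^bsub>G\<^esub> s i \<otimes>\<^bsub>G\<^esub> coxeter_class Q x' = coxeter_class Q x'"
     using class_Cons[of i x'] x xQ ij s_closed class_closed[of x'] by (simp add: G.m_assoc)
    then have "s j \<otimes>\<^bsub>G\<^esub> s i = \<one>\<^bsub>G\<^esub>"
     using x xQ s_closed class_closed[of x'] ij by (intro G.r_cancel_one[THEN iffD1]) auto
    then have "s j \<otimes>\<^bsub>G\<^esub> s i = s i \<otimes>\<^bsub>G\<^esub> s i" using s_s ij by simp
    then have "s j = s i" using G.right_cancel[of "s i" "s j" "s i"] s_closed ij by simp
    then show False using s_inj False ij by blast
   qed
   then obtain u' where u: "u = i # u'" using uv(1) x by (cases u) auto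
   define w where "w = u' @ v"
   have w: "set w \<subseteq> J" "length w = length x - 2" "length x \<ge> 2"
    using uv(1) u less.prems(4) x by (auto simp: w_def)
   have wQ: "set w <= verts Q" using w J by auto
   have y'w: "coxeter_equiv Q y' (i # w)" using y'uv u by (simp add: w_def)
   have red_iw: "reduced (i # w)" using reduced_cong[OF red_y' y'w] len w by simp
   have fy: "foldr f y a = f j (f i (foldr f w a))" using IH[of y' "i # w"] red_y' y'w w len ij y by simp
   have xjiw: "coxeter_equiv Q x (j # i # w)"
    using coxeter_equiv_Cons_swap[of j x "i # w"] coxeter_equiv.trans[OF jx y'w] ij by blast
   consider "num_arrows Q i j = 0" | "num_arrows Q i j = 1" using J(2)[of i j] ij by linarith
   then show ?thesis
   proof cases
    case 1
    have "coxeter_equiv Q ([] @ [j, i] @ w) ([] @ [i, j] @ w)" using 1 ij wQ num_arrows_commute[of i j]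
     by (intro coxeter_equiv_context[of Q "[j, i]" "[i, j]" "[]" w]
       coxeter_equiv.rel[of Q "[j, i]" "[i, j]" "[]" "[]", simplified] coxeter_relation.commute) auto
    then have "coxeter_equiv Q x (i # j # w)" using coxeter_equiv.trans[OF xjiw] by simp
    then have "coxeter_equiv Q (i # x') (i # j # w)" using x by simp
    then have "coxeter_equiv Q x' (i # i # j # w)" using coxeter_equiv_Cons_swap ij by blast
    moreover have "coxeter_equiv Q (i # i # j # w) (j # w)" using ij wQ by (intro coxeter_equiv_Cons_Cons) auto
    ultimately have "coxeter_equiv Q x' (j # w)" by (rule coxeter_equiv.trans)
    then have "foldr f x' a = foldr f (j # w) a" using IH[of x' "j # w"] red_x' w len ij by simp
    then show ?thesis using fy x commute[of i j "foldr f w a"] ij fclosed[OF w(1)] 1 by simp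
   next
    case 2
    let ?z = "j # i # w"
    have zQ: "set ?z <= verts Q" using ij wQ by simp
    have red_z: "reduced ?z" using reduced_cong[OF less.prems(1) xjiw] w by simp
    \<comment> \<open>A second exchange, of i in j i w. Deleting j would contradict that j i w is
      reduced, and deleting i would give s_i = s_j; so the deleted letter lies in w, and both words
      can be compared with the two sides of a braid relation.\<close>
    have "s i : inversions Q ?z" using reduced_Cons(2)[of i x'] less.prems(1) x inversions_cong[OF xjiw] by simp
    then obtain u2 k2 v2 where uv2: "?z = u2 @ k2 # v2" "coxeter_equiv Q (i # ?z) (u2 @ v2)"
     using exchange[OF zQ ij(3)] by blast
    have braid_rel: "coxeter_equiv Q (i # j # i # r) (j # i # j # r)" if "set r <= verts Q" for r using 2 ij that
     coxeter_equiv_context[of Q "[i, j, i]" "[j, i, j]" "[]" r]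
       coxeter_equiv.rel[of Q "[i, j, i]" "[j, i, j]" "[]" "[]", simplified] coxeter_relation.braid[of i Q j]
     by auto
    have "u2 ~= []"
    proof
     assume "u2 = []"
     then have "coxeter_equiv Q (i # ?z) (i # w)" using uv2 by simp
     then have "coxeter_equiv Q ?z (i # i # w)" using coxeter_equiv_Cons_swap ij by blast
     moreover have "coxeter_equiv Q (i # i # w) w" using ij wQ by (intro coxeter_equiv_Cons_Cons)
     ultimately have "coxeter_equiv Q ?z w" by (rule coxeter_equiv.trans)
     then show False using length_reduced_le[OF red_z] by fastforce
    qed
    then obtain u3 where u3: "u2 = j # u3" using uv2(1) by (cases u2) auto
    have "u3 ~= []"
    proof
     assume "u3 = []"
     then have "coxeter_equiv Q (i # ?z) (j # w)" using uv2 u3 by simp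
     then have "coxeter_equiv Q (j # i # j # w) (j # w)"
      using coxeter_equiv.trans[OF coxeter_equiv.sym[OF braid_rel[OF wQ]]] by blast
     then have "coxeter_equiv Q (i # j # w) (j # j # w)" using coxeter_equiv_Cons_swap ij by blast
     moreover have "coxeter_equiv Q (j # j # w) w" using ij wQ by (intro coxeter_equiv_Cons_Cons)
     ultimately have "coxeter_equiv Q (i # j # w) w" by (rule coxeter_equiv.trans)
     then have "s i \<otimes>\<^bsub>G\<^esub> coxeter_class Q (j # w) = coxeter_class Q w"
      using class_Cons[of i "j # w"] ij wQ coxeter_class_eq_iff[of w Q "i # j # w"] by simp
     then have "s i \<otimes>\<^bsub>G\<^esub> s j \<otimes>\<^bsub>G\<^esub> coxeter_class Q w = coxeter_class Q w"
      using class_Cons[of j w] wQ ij s_closed class_closed[of w] by (simp add: G.m_assoc)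
     then have "s i \<otimes>\<^bsub>G\<^esub> s j = \<one>\<^bsub>G\<^esub>"
      using wQ s_closed class_closed[of w] ij by (intro G.r_cancel_one[THEN iffD1]) auto
     then have "s i \<otimes>\<^bsub>G\<^esub> s j = s j \<otimes>\<^bsub>G\<^esub> s j" using s_s ij by simp
     then have "s i = s j" using G.right_cancel[of "s j" "s i" "s j"] s_closed ij by simp
     then show False using s_inj False ij by blast
    qed
    then obtain u4 where u4: "u3 = i # u4" using uv2(1) u3 by (cases u3) auto
    define w' where "w' = u4 @ v2"
    have w': "set w' \<subseteq> J" "length w = Suc (length w')" using uv2(1) u3 u4 w(1) by (auto simp: w'_def)
    have w'Q: "set w' <= verts Q" using w' J by auto
    have iz: "coxeter_equiv Q (i # ?z) (j # i # w')" using uv2(2) u3 u4 by (simp add: w'_def)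
    have "coxeter_equiv Q x' (i # ?z)" using coxeter_equiv_Cons_swap[of i x' ?z] xjiw x ij by simp
    then have x'w': "coxeter_equiv Q x' (j # i # w')" using coxeter_equiv.trans[OF _ iz] by blast
    then have "coxeter_equiv Q x (i # j # i # w')" using coxeter_equiv_Cons ij x by blast
    then have "coxeter_equiv Q x (j # i # j # w')" using coxeter_equiv.trans[OF _ braid_rel[OF w'Q]] by blast
    then have "coxeter_equiv Q (j # i # j # w') y"
     using coxeter_equiv.trans[OF coxeter_equiv.sym less.prems(2)] by blast
    then have "coxeter_equiv Q (i # j # w') (j # j # y')" using coxeter_equiv_Cons_swap y ij by blast
    moreover have "coxeter_equiv Q (j # j # y') y'" using ij J by (intro coxeter_equiv_Cons_Cons) auto
    ultimately have "coxeter_equiv Q (i # j # w') y'" by (rule coxeter_equiv.trans)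
    then have y'w': "coxeter_equiv Q y' (i # j # w')" by (rule coxeter_equiv.sym)
    have "foldr f x' a = foldr f (j # i # w') a" using IH[of x' "j # i # w'"] red_x' x'w' w w' len ij by simp
    moreover have "foldr f y' a = foldr f (i # j # w') a" using IH[of y' "i # j # w'"] red_y' y'w' w w' len ij by simp
    ultimately show ?thesis using x y braid[of i j "foldr f w' a"] ij fclosed[OF w'(1)] 2 by simp
   qed
  qed
 qed
qed

text \<open>Every generator s_i with i in J is an inversion of x, because otherwise the word i # x
  would represent a longer element of the subgroup.\<close>

lemma longest_elementD:
 assumes "longest_element Q J w" "reduced_expression Q x w" "J <= verts Q"
 shows "reduced x" "set x \<subseteq> J" "i : J ==> s i : inversions Q x"
  and "set u \<subseteq> J ==> card (inversions Q u) <= length x"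
proof -
 have xQ: "set x <= verts Q" and w: "w = coxeter_class Q x"
  and len: "length x = coxeter_length Q (verts Q) w"
  using assms(2) by (auto simp: reduced_expression_def in_lists_conv_set)
 then show red: "reduced x" using coxeter_length_eq[OF xQ] by (simp add: reduced_def)
 obtain u0 where u0: "set u0 \<subseteq> J" "w = coxeter_class Q u0"
  using assms(1) coxeter_subgroup_eq[OF assms(3)] by (auto simp: longest_element_def)
 have "coxeter_equiv Q x u0" using u0 w assms(3) coxeter_class_eq_iff[of u0 Q x] by auto
 then show xJ: "set x \<subseteq> J" using reduced_word_in_parabolic[OF red _ u0(1) assms(3)] by blast
 show *: "card (inversions Q u) <= length x" if u: "set u \<subseteq> J" for u
 proof -
  have "coxeter_class Q u : coxeter_subgroup Q J" using u coxeter_subgroup_eq[OF assms(3)] by blast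
  then have "coxeter_length Q J (coxeter_class Q u) <= coxeter_length Q J (coxeter_class Q x)"
   using assms(1) w by (auto simp: longest_element_def)
  then show ?thesis using coxeter_length_eq[OF u assms(3)] coxeter_length_eq[OF xJ assms(3)] red
   by (simp add: reduced_def)
 qed
 show "s i : inversions Q x" if i: "i : J" using *[of "i # x"] card_inversions_Cons(2)[of i x] i xJ red xQ assms(3)
  by (fastforce simp: reduced_def)
qed

text \<open>As s_i is an inversion of x, the exchange condition yields an equivalent word of the
  same length that begins with i. Matsumoto's theorem evaluates the product along that word, and
  idempotency absorbs one more factor i.\<close>

lemma foldr_longest_absorb:
 assumes "longest_element Q J w" "reduced_expression Q x w"
  and J: "J <= verts Q" "!!i j. i : J ==> j : J ==> num_arrows Q i j <= 1"
  and closed: "!!i a. i : J ==> a : S ==> f i a : S"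
  and idem: "!!i a. i : J ==> a : S ==> f i (f i a) = f i a"
  and commute: "!!i j a. i : J ==> j : J ==> a : S ==> num_arrows Q i j = 0 ==> f i (f j a) = f j (f i a)"
  and braid: "!!i j a. i : J ==> j : J ==> a : S ==> num_arrows Q i j = 1 ==>
   f i (f j (f i a)) = f j (f i (f j a))"
  and a: "a : S" and i: "i : J"
 shows "f i (foldr f x a) = foldr f x a"
proof -
 note x = longest_elementD[OF assms(1,2) J(1)]
 have xQ: "set x <= verts Q" using x(2) J by auto
 obtain u k v where uv: "x = u @ k # v" "coxeter_equiv Q (i # x) (u @ v)"
  using exchange[OF xQ _ x(3)[OF i]] i J(1) by blast
 have "coxeter_equiv Q x (i # u @ v)" using coxeter_equiv_Cons_swap[OF uv(2)] i J(1) by auto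
 then have eq: "foldr f x a = foldr f (i # u @ v) a" using x(1,2) i uv(1)
  by (intro foldr_reduced_cong[where J = J and S = S] J closed commute braid a) auto
 have foldr_closed: "foldr f y a : S" if "set y \<subseteq> J" for y using that a closed by (induction y) auto
 have "set (u @ v) \<subseteq> J" using x(2) uv(1) by auto
 then have "foldr f (u @ v) a : S" using foldr_closed[of "u @ v"] by blast
 then show ?thesis using eq idem[OF i, of "foldr f (u @ v) a"] by simp
qed

end

subsection \<open>Paths\<close>

context pre_digraph
begin

lemma awlast_eq: "awlast u p = (if p = [] then u else head G (last p))" by (simp add: awalk_verts_conv)

lemma awlast_append: "awlast u (p @ q) = awlast (awlast u p) q" by (simp add: awlast_eq)

end

context wf_digraph
begin

lemma quiver_paths_iff: "(u, p) : quiver_paths G \<longleftrightarrow> awalk u p (awlast u p)"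
 by (auto simp: quiver_paths_def)

lemma quiver_paths_append:
 "(u, p @ q) : quiver_paths G \<longleftrightarrow> (u, p) : quiver_paths G & (awlast u p, q) : quiver_paths G"
 by (simp only: quiver_paths_iff awalk_append_iff awlast_append)

lemma quiver_paths_Nil [simp]: "(u, []) : quiver_paths G \<longleftrightarrow> u : verts G"
 by (simp add: quiver_paths_iff awalk_Nil_iff)

lemma quiver_paths_Cons:
 "(u, a # p) : quiver_paths G \<longleftrightarrow> a : arcs G & tail G a = u & (head G a, p) : quiver_paths G"
 by (auto simp: quiver_paths_def awalk_Cons_iff)

lemma quiver_paths_snoc:
 "(u, p @ [a]) : quiver_paths G \<longleftrightarrow> (u, p) : quiver_paths G & a : arcs G & tail G a = awlast u p"
 by (auto simp: quiver_paths_append quiver_paths_Cons)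

lemma quiver_paths_end: "(u, p) : quiver_paths G ==> awlast u p : verts G"
 unfolding quiver_paths_iff by (rule awlast_in_verts) auto

lemma quiver_paths_start: "(u, p) : quiver_paths G ==> u : verts G" unfolding quiver_paths_iff by (auto simp: awalk_def)

lemma quiver_paths_arcs: "(u, p) : quiver_paths G ==> set p <= arcs G"
 unfolding quiver_paths_iff by (auto simp: awalk_def)

end

lemma (in fin_digraph) finite_quiver_paths: "finite {x : quiver_paths G. length (snd x) < N}"
proof (rule finite_subset)
 show "{x : quiver_paths G. length (snd x) < N} <= verts G \<times> {p. set p <= arcs G & length p <= N}"
  by (auto dest: quiver_paths_start quiver_paths_arcs)
 show "finite (verts G \<times> {p. set p <= arcs G & length p <= N})"
  by (intro finite_cartesian_product finite_lists_length_le finite_verts finite_arcs)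
qed

lemma double_quiver_simps [simp]:
 "verts (double_quiver Q) = verts Q"
 "Inl b : arcs (double_quiver Q) \<longleftrightarrow> b : arcs Q"
 "Inr b : arcs (double_quiver Q) \<longleftrightarrow> b : arcs Q"
 "tail (double_quiver Q) (Inl b) = tail Q b"
 "head (double_quiver Q) (Inl b) = head Q b"
 "tail (double_quiver Q) (Inr b) = head Q b"
 "head (double_quiver Q) (Inr b) = tail Q b" by (auto simp: double_quiver_def)

lemma arcs_double_quiver: "arcs (double_quiver Q) = arcs Q <+> arcs Q" by (simp add: double_quiver_def)

lemma (in fin_digraph) fin_digraph_double_quiver: "fin_digraph (double_quiver G)"
 by unfold_locales (auto simp: arcs_double_quiver)

fun opposite :: "'a + 'a => 'a + 'a" where
 "opposite (Inl b) = Inr b"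
| "opposite (Inr b) = Inl b"

text \<open>With these signs the sum of the commutators over the arrows of Q is a single sum, over
  all arrows c of the doubled quiver, of the sign of c times c followed by its opposite.\<close>

fun arrow_sign :: "'a + 'a => 'k::field" where
 "arrow_sign (Inl b) = 1"
| "arrow_sign (Inr b) = - 1"

lemma opposite_opposite [simp]: "opposite (opposite a) = a" by (cases a) auto

lemma arrow_sign_opposite: "arrow_sign (opposite a) = - arrow_sign a" by (cases a) auto

lemma arrow_sign_square [simp]: "arrow_sign a * arrow_sign a = 1" by (cases a) auto

lemma opposite_arc [simp]:
 "opposite a : arcs (double_quiver Q) \<longleftrightarrow> a : arcs (double_quiver Q)"
 "tail (double_quiver Q) (opposite a) = head (double_quiver Q) a"
 "head (double_quiver Q) (opposite a) = tail (double_quiver Q) a" by (cases a; simp)+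

lemma sum_opposite: "(SUM a:arcs (double_quiver Q). f (opposite a)) = (SUM a:arcs (double_quiver Q). f a)"
 by (rule sum.reindex_bij_witness[of _ opposite opposite]) auto

lemma sum_double_quiver:
 assumes "finite (arcs Q)"
 shows "(SUM a:arcs (double_quiver Q). f a) = (SUM b:arcs Q. f (Inl b) + f (Inr b))"
 using assms by (simp add: arcs_double_quiver sum.Plus sum.distrib)

subsection \<open>Linear maps between function spaces\<close>

definition fscale :: "'k::field => ('x => 'k) => 'x => 'k" where
 "fscale c f = (%x. c * f x)"

lemma fscale_apply [simp]: "fscale c f x = c * f x" by (simp add: fscale_def)

lemma vector_space_fscale: "vector_space fscale" by unfold_locales (auto simp: fun_eq_iff algebra_simps)

lemma sum_fun_apply: "(SUM i:A. f i) x = (SUM i:A. f i x)" for f :: "'i => 'x => 'k::field"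
 by (induction A rule: infinite_finite_induct) auto

definition fun_linear :: "(('x => 'k::field) => 'y => 'k) => bool" where
 "fun_linear f \<longleftrightarrow> (ALL u v. f (u + v) = f u + f v) & (ALL c u. f (fscale c u) = fscale c (f u))"

lemma fun_linearI:
 assumes "!!u v. f (u + v) = f u + f v" "!!c u. f (fscale c u) = fscale c (f u)"
 shows "fun_linear f" using assms by (simp add: fun_linear_def)

context
 fixes f :: "('x => 'k::field) => 'y => 'k"
 assumes f: "fun_linear f"
begin

lemma fun_linear_add: "f (u + v) = f u + f v"
 and fun_linear_scale: "f (fscale c u) = fscale c (f u)" using f by (auto simp: fun_linear_def)

lemma fun_linear_0: "f 0 = 0" using fun_linear_add[of 0 0] by simp

lemma fun_linear_diff: "f (u - v) = f u - f v" using fun_linear_add[of "u - v" v] by (simp add: eq_diff_eq)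

lemma fun_linear_minus: "f (- u) = - f u" using fun_linear_diff[of 0 u] fun_linear_0 by simp

lemma fun_linear_sum: "f (SUM i:A. g i) = (SUM i:A. f (g i))"
 by (induction A rule: infinite_finite_induct) (simp_all only: sum.infinite sum.empty sum.insert fun_linear_0 fun_linear_add not_False_eq_True)

end

definition fun_subspace :: "('x => 'k::field) set => bool" where
 "fun_subspace U \<longleftrightarrow> 0 : U & (ALL f:U. ALL g:U. f + g : U) & (ALL c. ALL f:U. fscale c f : U)"

lemma fun_subspaceI:
 assumes "0 : U" "!!f g. f : U ==> g : U ==> f + g : U" "!!c f. f : U ==> fscale c f : U"
 shows "fun_subspace U" using assms by (simp add: fun_subspace_def)

lemma fun_subspace_add: "fun_subspace U ==> f : U ==> g : U ==> f + g : U"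
 and fun_subspace_scale: "fun_subspace U ==> f : U ==> fscale c f : U"
 and fun_subspace_0: "fun_subspace U ==> 0 : U" by (auto simp: fun_subspace_def)

lemma fun_subspace_sum:
 assumes "fun_subspace U" "!!i. i : A ==> f i : U"
 shows "(SUM i:A. f i) : U" using assms(2)
 by (induction A rule: infinite_finite_induct) (auto simp: assms(1) fun_subspace_0 fun_subspace_add)

lemma fun_subspace_diff:
 assumes "fun_subspace U" "f : U" "g : U"
 shows "f - g : U"
proof -
 have "f + fscale (- 1) g : U" using assms by (intro fun_subspace_add fun_subspace_scale)
 moreover have "f + fscale (- 1) g = f - g" by (auto simp: fun_eq_iff)
 ultimately show ?thesis by simp
qed

text \<open>Source of all linear choices below: sections, normal forms, and functionals that vanish
  on a given subspace.\<close>

lemma exists_projection: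
 fixes U :: "('x => 'k::field) set"
 assumes "fun_subspace U"
 obtains g where "fun_linear g" "!!f. g f : U" "!!f. f : U ==> g f = f"
proof -
 interpret V: vector_space "fscale :: 'k => ('x => 'k) => 'x => 'k" by (rule vector_space_fscale)
 interpret VV: vector_space_pair "fscale :: 'k => ('x => 'k) => 'x => 'k" "fscale :: 'k => ('x => 'k) => 'x => 'k"
  by unfold_locales
 have "V.subspace U" using assms by (auto simp: V.subspace_def fun_subspace_def)
 then obtain g where "range g \<subseteq> U" "Vector_Spaces.linear fscale fscale g" "ALL v:U. g v = v"
  using VV.linear_exists_left_inverse_on[OF V.linear_id, of U] by (auto simp: id_def)
 then show ?thesis using that[of g] by (auto simp: fun_linear_def Vector_Spaces.linear_iff)
qed

lemma sum_delta_expansion: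
 fixes f :: "'x => 'k::field"
 assumes "finite B" "!!x. x ~: B ==> f x = 0"
 shows "f = (SUM b:B. fscale (f b) (%x. if x = b then 1 else 0))"
proof
 fix x
 have "(SUM b:B. f b * (if x = b then 1 else 0)) = (if x : B then f x else 0)"
  using assms(1) by (simp add: if_distrib cong: if_cong)
 then show "f x = (SUM b:B. fscale (f b) (%x. if x = b then 1 else 0)) x"
  using assms(2)[of x] by (simp add: sum_fun_apply)
qed

subsection \<open>Functionals on the preprojective algebra\<close>

text \<open>The left module of linear functionals on a preprojective algebra; a functional is given by its
 values on paths, and an arrow \<open>a\<close> sends \<open>xi\<close> to the functional \<open>p \<mapsto> xi (p a)\<close>.\<close>

definition dual_module :: "('v, 'a) pre_digraph => (('v, 'a) dpath => 'k::field) set" where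
 "dual_module Q = {xi. (ALL x. xi x ~= 0 --> x : quiver_paths (double_quiver Q)) \<and>
   (ALL u p q. (SUM c:arcs (double_quiver Q). arrow_sign c * xi (u, p @ [c, opposite c] @ q)) = 0)}"

definition dual_arrow :: "'b => ('v \<times> 'b list => 'k) => 'v \<times> 'b list => 'k" where
 "dual_arrow a xi = (%(u, p). xi (u, p @ [a]))"

definition dual_vertex ::
 "('v, 'b) pre_digraph => 'v => ('v \<times> 'b list => 'k::field) => 'v \<times> 'b list => 'k" where
 "dual_vertex D i xi = (%(u, p). if pre_digraph.awlast D u p = i then xi (u, p) else 0)"

lemma fun_linear_dual_arrow: "fun_linear (dual_arrow a)" by (auto simp: fun_linear_def dual_arrow_def)

lemma fun_linear_dual_vertex: "fun_linear (dual_vertex D i)" by (auto simp: fun_linear_def dual_vertex_def fun_eq_iff)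

locale double_digraph = fin_digraph Q for Q :: "('v, 'a) pre_digraph"
begin

abbreviation D where "D \<equiv> double_quiver Q"

sublocale D: fin_digraph D by (rule fin_digraph_double_quiver)

lemma dual_module_path: "xi : dual_module Q ==> x ~: quiver_paths D ==> xi x = 0" unfolding dual_module_def by blast

lemma dual_moduleI:
 assumes "!!u p. xi (u, p) ~= 0 ==> (u, p) : quiver_paths D"
  and "!!u p q. (SUM c:arcs D. arrow_sign c * xi (u, p @ [c, opposite c] @ q)) = 0"
 shows "xi : dual_module Q" unfolding dual_module_def using assms by force

lemma dual_module_relation:
 "xi : dual_module Q ==>
  (SUM c:arcs D. arrow_sign c * xi (u, p @ [c, opposite c] @ q)) = 0" unfolding dual_module_def by blast

lemma fun_subspace_dual_module: "fun_subspace (dual_module Q :: (('v, 'a) dpath => 'k::field) set)"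
proof (rule fun_subspaceI)
 fix f g :: "('v, 'a) dpath => 'k" assume f: "f : dual_module Q" and g: "g : dual_module Q"
 show "f + g : dual_module Q"
 proof (rule dual_moduleI)
  fix u p assume "(f + g) (u, p) ~= 0"
  then show "(u, p) : quiver_paths D" using dual_module_path[OF f] dual_module_path[OF g] by fastforce
 next
  fix u p q
  show "(SUM c:arcs D. arrow_sign c * (f + g) (u, p @ [c, opposite c] @ q)) = 0"
   using dual_module_relation[OF f, of u p q] dual_module_relation[OF g, of u p q]
   by (simp add: distrib_left sum.distrib)
 qed
next
 fix a and f :: "('v, 'a) dpath => 'k" assume f: "f : dual_module Q"
 show "fscale a f : dual_module Q"
 proof (rule dual_moduleI)
  fix u p assume "fscale a f (u, p) ~= 0"
  then show "(u, p) : quiver_paths D" using dual_module_path[OF f] by fastforce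
 next
  fix u p q
  have "(SUM c:arcs D. arrow_sign c * fscale a f (u, p @ [c, opposite c] @ q)) =
    a * (SUM c:arcs D. arrow_sign c * f (u, p @ [c, opposite c] @ q))"
   by (simp add: sum_distrib_left mult.left_commute)
  then show "(SUM c:arcs D. arrow_sign c * fscale a f (u, p @ [c, opposite c] @ q)) = 0"
   using dual_module_relation[OF f, of u p q] by simp
 qed
qed (rule dual_moduleI; simp)

lemma dual_arrow_closed:
 assumes xi: "xi : dual_module Q"
 shows "dual_arrow a xi : dual_module Q"
proof (rule dual_moduleI)
 fix u p assume "dual_arrow a xi (u, p) ~= 0"
 then show "(u, p) : quiver_paths D"
  using dual_module_path[OF xi, of "(u, p @ [a])"] by (auto simp: dual_arrow_def D.quiver_paths_snoc)
next
 fix u p q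
 show "(SUM c:arcs D. arrow_sign c * dual_arrow a xi (u, p @ [c, opposite c] @ q)) = 0"
  using dual_module_relation[OF xi, of u p "q @ [a]"] by (simp add: dual_arrow_def)
qed

lemma dual_vertex_closed:
 assumes xi: "xi : dual_module Q"
 shows "dual_vertex D i xi : dual_module Q"
proof -
 have "(SUM c:arcs D. arrow_sign c * dual_vertex D i xi (u, p @ [c, opposite c] @ q)) = 0" for u p q
 proof -
  \<comment> \<open>All paths in the relation end at the same vertex \<open>e\<close>, so cutting by
    a vertex keeps either all terms or none.\<close>
  define e where "e = D.awlast (D.awlast u p) q"
  have "dual_vertex D i xi (u, p @ [c, opposite c] @ q) =
    (if e = i then xi (u, p @ [c, opposite c] @ q) else 0)" for c
  proof (cases "(u, p @ [c, opposite c] @ q) : quiver_paths D")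
   case True
   then have "tail D c = D.awlast u p" by (simp add: D.quiver_paths_append D.quiver_paths_Cons)
   then have "D.awlast u (p @ [c, opposite c] @ q) = e" by (simp add: D.awlast_eq e_def)
   then show ?thesis by (simp add: dual_vertex_def)
  next
   case False
   then show ?thesis using dual_module_path[OF xi] by (simp add: dual_vertex_def)
  qed
  then show ?thesis using dual_module_relation[OF xi, of u p q] by (cases "e = i") simp_all
 qed
 moreover have "(u, p) : quiver_paths D" if "dual_vertex D i xi (u, p) ~= 0" for u p
  using that dual_module_path[OF xi, of "(u, p)"] by (auto simp: dual_vertex_def split: if_splits)
 ultimately show ?thesis by (intro dual_moduleI)
qed

lemma dual_vertex_arrow:
 assumes xi: "xi : dual_module Q"
 shows "dual_vertex D (tail D a) (dual_arrow a xi) = dual_arrow a xi"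
proof (rule ext, clarify)
 fix u p
 show "dual_vertex D (tail D a) (dual_arrow a xi) (u, p) = dual_arrow a xi (u, p)"
  using dual_module_path[OF xi, of "(u, p @ [a])"] by (auto simp: dual_vertex_def dual_arrow_def D.quiver_paths_snoc)
qed

lemma dual_arrow_vertex: "dual_arrow a (dual_vertex D (head D a) xi) = dual_arrow a xi"
 by (auto simp: dual_vertex_def dual_arrow_def D.awlast_eq)

lemma dual_vertex_vertex:
 "dual_vertex D i (dual_vertex D j xi) = (if i = j then dual_vertex D i xi else 0)"
 by (auto simp: dual_vertex_def fun_eq_iff)

lemma sum_dual_vertex:
 assumes xi: "xi : dual_module Q"
 shows "(SUM i:verts Q. dual_vertex D i xi) = xi"
proof (rule ext, clarify)
 fix u p
 have "(SUM i:verts Q. dual_vertex D i xi (u, p)) =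
   (if D.awlast u p : verts Q then xi (u, p) else 0)" by (simp add: dual_vertex_def)
 then show "(SUM i:verts Q. dual_vertex D i xi) (u, p) = xi (u, p)"
  using dual_module_path[OF xi, of "(u, p)"] D.quiver_paths_end[of u p] by (auto simp: sum_fun_apply)
qed

lemma dual_arrow_relation:
 assumes xi: "xi : dual_module Q"
 shows "(SUM c:arcs D. fscale (arrow_sign c) (dual_arrow c (dual_arrow (opposite c) xi))) = 0"
proof (rule ext, clarify)
 fix u p
 show "(SUM c:arcs D. fscale (arrow_sign c) (dual_arrow c (dual_arrow (opposite c) xi))) (u, p) = 0 (u, p)"
  using dual_module_relation[OF xi, of u p "[]"] by (simp add: sum_fun_apply dual_arrow_def)
qed

end

subsection \<open>Finite parabolic subgroups and trees\<close>

context coxeter_quiver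
begin

definition inner_arcs :: "'v set => 'a set" where
 "inner_arcs S = {a : arcs Q. tail Q a : S & head Q a : S}"

lemma finite_inner_arcs: "finite (inner_arcs S)" by (simp add: inner_arcs_def)

lemma card_inner_arcs_remove:
 assumes "finite S" "v : S"
 shows "card (inner_arcs S) = card (inner_arcs (S - {v})) + (SUM j:S. num_arrows Q v j)"
proof -
 let ?B = "%j. {a : arcs Q. {tail Q a, head Q a} = {v, j}}"
 have "card (\<Union>j\<in>S. ?B j) = (SUM j:S. num_arrows Q v j)" unfolding num_arrows_def using assms(1)
  by (intro card_UN_disjoint) (auto simp: doubleton_eq_iff)
 moreover have "inner_arcs S = inner_arcs (S - {v}) \<union> (\<Union>j\<in>S. ?B j)"
  using assms(2) by (auto simp: inner_arcs_def doubleton_eq_iff)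
 moreover have "inner_arcs (S - {v}) \<inter> (\<Union>j\<in>S. ?B j) = {}"
  by (auto simp: inner_arcs_def doubleton_eq_iff)
 moreover have "finite (\<Union>j\<in>S. ?B j)" using assms(1) by auto
 ultimately show ?thesis using card_Un_disjoint[OF finite_inner_arcs[of "S - {v}"], of "\<Union>j\<in>S. ?B j"] by simp
qed

text \<open>Take C minimal among the nonempty subsets with at least as many arrows as vertices; a
  vertex of valency at most one could still be removed from C.\<close>

lemma exists_core:
 assumes "finite S" "S ~= {}" "card S <= card (inner_arcs S)"
 obtains C where "C \<subseteq> S" "C ~= {}" "!!v. v : C ==> 2 <= (SUM j:C. num_arrows Q v j)"
proof -
 define P where "P n \<longleftrightarrow> (EX C. C \<subseteq> S & C ~= {} & card C <= card (inner_arcs C) & card C = n)" for n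
 have "P (card S)" using assms by (auto simp: P_def)
 then have "P (LEAST n. P n)" by (rule LeastI)
 then have "EX C. C \<subseteq> S & C ~= {} & card C <= card (inner_arcs C) & card C = (LEAST n. P n)"
  by (simp only: P_def[of "LEAST n. P n"])
 then obtain C where C: "C \<subseteq> S" "C ~= {}" "card C <= card (inner_arcs C)" "card C = (LEAST n. P n)" by blast
 have fin: "finite C" using C(1) assms(1) finite_subset by blast
 have "2 <= (SUM j:C. num_arrows Q v j)" if v: "v : C" for v
 proof (rule ccontr)
  assume "\<not> 2 <= (SUM j:C. num_arrows Q v j)"
  then have *: "card C - 1 <= card (inner_arcs (C - {v}))" using card_inner_arcs_remove[OF fin v] C(3) by linarith
  have pos: "card C > 0" using fin v card_gt_0_iff by blast
  have card: "card (C - {v}) = card C - 1" using v by simp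
  show False
  proof (cases "C = {v}")
   case True
   have "inner_arcs {v} = {}" using no_loops by (fastforce simp: inner_arcs_def)
   then show False using C(3) True by simp
  next
   case False
   then have "P (card C - 1)" unfolding P_def using C(1) v * card by (intro exI[of _ "C - {v}"]) auto
   then have "card C <= card C - 1" unfolding C(4) by (rule Least_le)
   then show False using pos by simp
  qed
 qed
 then show ?thesis using that C by blast
qed

text \<open>The bound on lengths makes the affine orbit of the origin finite. If S were not a
  forest, it would contain a core C of valencies at least two; a nonnegative orbit point with
  maximal coordinate sum then satisfies inequalities on C that cannot all hold.\<close>

lemma card_inner_arcs_less:
 assumes "longest_element Q J w" "reduced_expression Q x w" "J <= verts Q"
  and S: "S \<subseteq> J" "S ~= {}"
 shows "card (inner_arcs S) < card S"
proof (rule ccontr)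
 assume "\<not> card (inner_arcs S) < card S"
 moreover have "finite S" using S(1) assms(3) finite_verts by (meson finite_subset)
 ultimately obtain C where C: "C \<subseteq> S" "C ~= {}" "!!v. v : C ==> 2 <= (SUM j:C. num_arrows Q v j)"
  using exists_core[OF _ S(2)] by (metis not_less)
 have finC: "finite C" and finJ: "finite J" and CJ: "C \<subseteq> J"
  using C(1) S(1) assms(3) finite_verts by (meson finite_subset order_trans)+
 define orbit where "orbit = (%y. foldr affine_reflection y (%_. 0)) ` {y. set y \<subseteq> J}"
 \<comment> \<open>Every orbit point is reached by a reduced word, which is no longer than the word
   of the longest element.\<close>
 have "orbit \<subseteq> (%y. foldr affine_reflection y (%_. 0)) ` {y. set y \<subseteq> J & length y <= length x}"
 proof
  fix u assume "u : orbit"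
  then obtain y where y: "set y \<subseteq> J" "u = foldr affine_reflection y (%_. 0)" by (auto simp: orbit_def)
  then obtain z where z: "set z \<subseteq> set y" "coxeter_equiv Q y z" "reduced z"
   using exists_reduced[of y] assms(3) by auto
  have "length z <= length x" using longest_elementD(4)[OF assms(1-3) y(1)] z(3) inversions_cong[OF z(2)]
   by (simp add: reduced_def)
  moreover have "u = foldr affine_reflection z (%_. 0)" using y(2) affine_reflection_cong[OF z(2)] by simp
  ultimately show "u : (%y. foldr affine_reflection y (%_. 0)) ` {y. set y \<subseteq> J & length y <= length x}"
   using y z by blast
 qed
 then have "finite orbit" using finite_lists_length_le[OF finJ, of "length x"] by (meson finite_imageI finite_subset)
 then have fin: "finite {u : orbit. ALL i. u i \<ge> 0}" by simp
 have "(%_. 0) : {u : orbit. ALL i. u i \<ge> 0}" unfolding orbit_def by (auto intro!: image_eqI[of _ _ "[]"])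
 then obtain u where "u : {u : orbit. ALL i. u i \<ge> 0}"
  and Max: "Max ((%u. sum u J) ` {u : orbit. ALL i. u i \<ge> 0}) = sum u J"
  using obtains_MAX[OF fin, of "%u. sum u J"] by blast
 then have u: "u : orbit" "ALL i. u i \<ge> 0" by auto
 have max: "sum u' J <= sum u J" if "u' : orbit" "ALL i. u' i \<ge> 0" for u'
  unfolding Max[symmetric] using that fin by (intro Max_ge) auto
 obtain y where y: "set y \<subseteq> J" "u = foldr affine_reflection y (%_. 0)" using u(1) by (auto simp: orbit_def)
 \<comment> \<open>Otherwise reflecting at i would raise the coordinate i, leave the others alone
   and give a larger nonnegative orbit point. Neighbours outside C only help, since the coordinates
   are nonnegative.\<close>
 have ineq: "(SUM j:C. int (num_arrows Q i j) * u j) + 1 <= 2 * u i" if i: "i : C" for i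
 proof (rule ccontr)
  assume *: "\<not> ?thesis"
  define u' where "u' = affine_reflection i u"
  have "(SUM j:C. int (num_arrows Q i j) * u j) <= (SUM j:verts Q. int (num_arrows Q i j) * u j)"
   using u(2) CJ assms(3) by (intro sum_mono2) auto
  then have gt: "u' i > u i" using * by (simp add: u'_def affine_reflection_def)
  have other: "u' k = u k" if "k ~= i" for k using that by (simp add: u'_def affine_reflection_def)
  have "u' = foldr affine_reflection (i # y) (%_. 0)" using y(2) by (simp add: u'_def)
  then have "u' : orbit" unfolding orbit_def using y(1) i CJ by (intro image_eqI[of _ _ "i # y"]) auto
  moreover have "ALL k. u' k \<ge> 0" using u(2) gt other by (metis less_le_not_le order_trans linorder_le_cases)
  ultimately have "sum u' J <= sum u J" by (rule max)
  moreover have "sum u J < sum u' J"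
  proof (rule sum_strict_mono_ex1[OF finJ])
   show "ALL k:J. u k <= u' k" using gt other by (metis order.refl less_imp_le)
   show "EX k:J. u k < u' k" using gt i CJ by blast
  qed
  ultimately show False by simp
 qed
 have "(SUM i:C. (SUM j:C. int (num_arrows Q i j) * u j) + 1) <= (SUM i:C. 2 * u i)" by (intro sum_mono ineq)
 \<comment> \<open>Valency at least two in C bounds the doubled coordinate sum by the double sum
   over adjacent vertices. Adding up the inequalities for all i in C then leaves
   \<open>card C <= 0\<close>.\<close>
 moreover have "(SUM i:C. 2 * u i) <= (SUM i:C. SUM j:C. int (num_arrows Q i j) * u j)"
 proof -
  have "(SUM j:C. 2 * u j) <= (SUM j:C. (SUM i:C. int (num_arrows Q j i)) * u j)"
  proof (intro sum_mono mult_right_mono)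
   fix j assume "j : C"
   then have "int 2 <= int (SUM i:C. num_arrows Q j i)" using C(3) by (simp only: of_nat_le_iff)
   then show "2 <= (SUM i:C. int (num_arrows Q j i))" by simp
  qed (use u in auto)
  also have "\<dots> = (SUM i:C. SUM j:C. int (num_arrows Q i j) * u j)"
   unfolding sum_distrib_right by (subst sum.swap) (simp add: num_arrows_commute)
  finally show ?thesis .
 qed
 moreover have "card C > 0" using finC C(2) by (simp add: card_gt_0_iff)
 ultimately show False by (simp add: sum.distrib)
qed

end

text \<open>All three types are trees; their edge count is what \<open>dynkin_subgraph_full\<close>
  compares with the forest bound.\<close>

lemma dynkin_diagram_card:
 assumes "dynkin_diagram n E"
 shows "finite E & n <= Suc (card E) & n > 0 & (ALL e:E. \<exists>p<n. \<exists>q<n. e = {p, q})"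
proof -
 have path: "finite {{i, i + 1} | i :: nat. i + k < n} & card {{i, i + 1} | i :: nat. i + k < n} = n - k" for k
 proof -
  have "{{i, i + 1} | i :: nat. i + k < n} = (%i. {i, i + 1}) ` {..<n - k}" by (auto simp: image_iff less_diff_conv)
  moreover have "inj_on (%i. {i, i + 1}) {..<n - k}" by (auto simp: inj_on_def doubleton_eq_iff)
  ultimately show ?thesis by (simp add: card_image)
 qed
 show ?thesis using assms
 proof cases
  case type_A
  then have "\<exists>p<n. \<exists>q<n. e = {p, q}" if e: "e : E" for e
  proof -
   obtain i where "e = {i, i + 1}" "i + 1 < n" using e type_A by blast
   then have "i < n & i + 1 < n & e = {i, i + 1}" by simp
   then show ?thesis by blast
  qed
  then show ?thesis using path[of 1] type_A by simp
 next
  case type_D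
  have "{n - 3, n - 1} ~: {{i, i + 1} | i. i + 2 < n}" using type_D by (auto simp: doubleton_eq_iff)
  then have "card E = Suc (n - 2)" using path[of 2] type_D by simp
  moreover have "\<exists>p<n. \<exists>q<n. e = {p, q}" if e: "e : E" for e
  proof -
   consider i where "e = {i, i + 1}" "i + 2 < n" | "e = {n - 3, n - 1}" using e type_D by blast
   then show ?thesis
   proof cases
    case 1
    then have "i < n & i + 1 < n & e = {i, i + 1}" by simp
    then show ?thesis by blast
   next
    case 2
    then have "n - 3 < n & n - 1 < n & e = {n - 3, n - 1}" using type_D by simp
    then show ?thesis by blast
   qed
  qed
  ultimately show ?thesis using path[of 2] type_D by simp
 next
  case type_E
  have n: "6 <= n" using type_E by auto
  have "{2, n - 1} ~: {{i, i + 1} | i. i + 2 < n}" using n by (auto simp: doubleton_eq_iff)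
  then have "card E = Suc (n - 2)" using path[of 2] type_E(1) by simp
  moreover have "\<exists>p<n. \<exists>q<n. e = {p, q}" if e: "e : E" for e
  proof -
   consider i where "e = {i, i + 1}" "i + 2 < n" | "e = {2, n - 1}" using e type_E by blast
   then show ?thesis
   proof cases
    case 1
    then have "i < n & i + 1 < n & e = {i, i + 1}" by simp
    then show ?thesis by blast
   next
    case 2
    then have "2 < n & n - 1 < n & e = {2, n - 1}" using n by simp
    then show ?thesis by blast
   qed
  qed
  ultimately show ?thesis using path[of 2] type_E(1) n by simp
 qed
qed

lemma dynkin_quiver_card:
 assumes "dynkin_quiver Q"
 shows "card (verts Q) <= Suc (card (arcs Q))" "verts Q ~= {}"
  and "i : verts Q ==> j : verts Q ==> num_arrows Q i j <= 1"
proof -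
 obtain n E f where fin: "fin_digraph Q" and E: "dynkin_diagram n E"
  and f: "bij_betw f (verts Q) {..<n}"
  and num: "!!i j. i : verts Q ==> j : verts Q ==>
   num_arrows Q i j = (if {f i, f j} : E then 1 else 0)" using assms unfolding dynkin_quiver_def by blast
 interpret fin_digraph Q by (rule fin)
 note E' = dynkin_diagram_card[OF E]
 have n: "card (verts Q) = n" using bij_betw_same_card[OF f] by simp
 have "E \<subseteq> (%a. {f (tail Q a), f (head Q a)}) ` arcs Q"
 proof
  fix e assume e: "e : E"
  then obtain p q where pq: "p < n" "q < n" "e = {p, q}" using E' by blast
  then have "p : f ` verts Q" "q : f ` verts Q" using f by (auto simp: bij_betw_def)
  then obtain i j where ij: "i : verts Q" "j : verts Q" "p = f i" "q = f j" by blast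
  then have "num_arrows Q i j = 1" using num e pq by simp
  then have "{a : arcs Q. {tail Q a, head Q a} = {i, j}} ~= {}"
   unfolding num_arrows_def by (metis card.empty zero_neq_one)
  then obtain a where "a : arcs Q" "{tail Q a, head Q a} = {i, j}" by blast
  then show "e : (%a. {f (tail Q a), f (head Q a)}) ` arcs Q"
   using pq ij by (intro image_eqI[of _ _ a]) (auto simp: doubleton_eq_iff)
 qed
 then have "card E <= card (arcs Q)" by (rule surj_card_le[OF finite_arcs])
 then show "card (verts Q) <= Suc (card (arcs Q))" using n E' by linarith
 show "verts Q ~= {}" using n E' by auto
 show "num_arrows Q i j <= 1" if "i : verts Q" "j : verts Q" using num[OF that] by simp
qed

text \<open>Q' has at least one arrow less than vertices, while the full subquiver of Q on these
  vertices is a forest and has at most that many. So both have the same arrows, and the Coxeter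
  relations of W between letters of Q' are those read off from Q'.\<close>

lemma (in coxeter_quiver) dynkin_subgraph_full:
 assumes "longest_element Q (verts Q') w" "reduced_expression Q x w"
  and "subgraph Q' Q" "dynkin_quiver Q'"
 shows "arcs Q' = inner_arcs (verts Q')"
  and "i : verts Q' ==> j : verts Q' ==> num_arrows Q i j = num_arrows Q' i j"
  and "i : verts Q' ==> j : verts Q' ==> num_arrows Q i j <= 1"
proof -
 have sub: "verts Q' <= verts Q" "arcs Q' <= arcs Q" "tail Q' = tail Q" "head Q' = head Q" "wf_digraph Q'"
  using assms(3) by (auto simp: subgraph_def compatible_def)
 have le: "arcs Q' \<subseteq> inner_arcs (verts Q')"
  using sub wf_digraph.tail_in_verts[OF sub(5)] wf_digraph.head_in_verts[OF sub(5)] by (auto simp: inner_arcs_def)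
 have "card (inner_arcs (verts Q')) < card (verts Q')"
  using dynkin_quiver_card(2)[OF assms(4)] by (intro card_inner_arcs_less[OF assms(1,2) sub(1)]) auto
 then have "card (inner_arcs (verts Q')) <= card (arcs Q')" using dynkin_quiver_card(1)[OF assms(4)] by linarith
 then show eq: "arcs Q' = inner_arcs (verts Q')" using le finite_inner_arcs card_seteq by blast
 show "num_arrows Q i j = num_arrows Q' i j" if "i : verts Q'" "j : verts Q'" for i j
 proof -
  have "{a : arcs Q. {tail Q a, head Q a} = {i, j}} = {a : arcs Q'. {tail Q' a, head Q' a} = {i, j}}"
   using that eq sub by (auto simp: inner_arcs_def doubleton_eq_iff)
  then show ?thesis by (simp only: num_arrows_def)
 qed
 then show "num_arrows Q i j <= 1" if "i : verts Q'" "j : verts Q'"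
  using that dynkin_quiver_card(3)[OF assms(4) that] by simp
qed

text \<open>Nilpotency of the arrow ideal enters as the vanishing of functionals on paths of length at
 least \<open>N\<close>.\<close>

locale nilpotent_double_digraph = double_digraph Q for Q :: "('v, 'a) pre_digraph" +
 fixes N :: nat and X :: "(('v, 'a) dpath => 'k::field) set"
 assumes X: "X = dual_module Q"
  and nilpotent: "xi : X ==> length p \<ge> N ==> xi (u, p) = 0"
begin

definition B :: "(('v, 'a) dpath) set" where
 "B = {x : quiver_paths D. length (snd x) < N}"

lemma finite_B: "finite B" unfolding B_def by (rule D.finite_quiver_paths)

lemma X_iff: "xi : X \<longleftrightarrow> xi : dual_module Q" by (simp add: X)

lemma X_outside_B: "xi : X ==> x ~: B ==> xi x = 0" using nilpotent[of xi "snd x" "fst x"] dual_module_path[of xi x] X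
 by (cases x) (auto simp: B_def not_less)

lemma fun_subspace_X: "fun_subspace X" unfolding X by (rule fun_subspace_dual_module)

definition proj :: "('v, 'a, 'k) pfun => ('v, 'a, 'k) pfun" where
 "proj = (SOME g. fun_linear g & (ALL f. g f : X) & (ALL f:X. g f = f))"

lemma lin_proj: "fun_linear proj" and proj_closed: "proj f : X" and proj_id: "f : X ==> proj f = f"
proof -
 have "EX g. fun_linear g & (ALL f. g f : X) & (ALL f:X. g f = f)" using exists_projection[OF fun_subspace_X] by metis
 then have "fun_linear proj & (ALL f. proj f : X) & (ALL f:X. proj f = f)" unfolding proj_def by (rule someI_ex)
 then show "fun_linear proj" "proj f : X" "f : X ==> proj f = f" by auto
qed

text \<open>A spanning family of X, not necessarily a basis. Together with the evaluations at the
  paths b it behaves like a pair of dual bases, so for an endomorphism f of X the sum over b of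
  \<open>f (\<chi> b) b\<close> is the trace of f.\<close>

definition \<chi> :: "('v, 'a) dpath => ('v, 'a, 'k) pfun" where
 "\<chi> b = proj (%x. if x = b then 1 else 0)"

lemma \<chi>_closed: "\<chi> b : X" by (simp add: \<chi>_def proj_closed)

lemma \<chi>_expansion:
 assumes "xi : X"
 shows "xi = (SUM b:B. fscale (xi b) (\<chi> b))"
proof -
 have "xi = proj xi" using assms by (simp add: proj_id)
 also have "\<dots> = proj (SUM b:B. fscale (xi b) (%x. if x = b then 1 else 0))"
  using sum_delta_expansion[OF finite_B, of xi] X_outside_B[OF assms] by simp
 also have "\<dots> = (SUM b:B. fscale (xi b) (\<chi> b))"
  by (simp add: fun_linear_sum[OF lin_proj] fun_linear_scale[OF lin_proj] \<chi>_def)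
 finally show ?thesis .
qed

end

text \<open>A representation of the preprojective relations on a space of functions, not necessarily
 unital, with an equivariant surjection onto the dual module.\<close>

locale dual_module_cover = nilpotent_double_digraph Q N X
 for Q :: "('v, 'a) pre_digraph" and N :: nat
  and X :: "(('v, 'a) dpath => 'k::field) set" +
 fixes A :: "'a + 'a => ('i => 'k) => 'i => 'k"
  and E :: "'v => ('i => 'k) => 'i => 'k"
  and \<pi> :: "('i => 'k) => ('v, 'a, 'k) pfun"
 assumes lin_A: "fun_linear (A a)" and lin_E: "fun_linear (E i)" and lin_\<pi>: "fun_linear \<pi>"
  and A_outside: "a ~: arcs D ==> A a y = 0"
  and A_E: "a : arcs D ==> A a (E (head D a) y) = A a y"
  and E_A: "a : arcs D ==> E (tail D a) (A a y) = A a y"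
  and E_E: "i : verts Q ==> j : verts Q ==> E i (E j y) = (if i = j then E i y else 0)"
  and relation: "(SUM c:arcs D. fscale (arrow_sign c) (A c (A (opposite c) y))) = 0"
  and \<pi>_closed: "\<pi> y : X"
  and \<pi>_surj: "xi : X ==> EX y. \<pi> y = xi"
  and \<pi>_A: "a : arcs D ==> \<pi> (A a y) = dual_arrow a (\<pi> y)"
  and \<pi>_E: "i : verts Q ==> \<pi> (E i y) = dual_vertex D i (\<pi> y)"
begin

lemmas A_add = fun_linear_add[OF lin_A] and A_scale = fun_linear_scale[OF lin_A]
 and A_0 = fun_linear_0[OF lin_A] and A_diff = fun_linear_diff[OF lin_A]
 and A_sum = fun_linear_sum[OF lin_A]
lemmas E_add = fun_linear_add[OF lin_E] and E_scale = fun_linear_scale[OF lin_E]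
 and E_0 = fun_linear_0[OF lin_E] and E_diff = fun_linear_diff[OF lin_E]
 and E_sum = fun_linear_sum[OF lin_E]
lemmas \<pi>_add = fun_linear_add[OF lin_\<pi>] and \<pi>_scale = fun_linear_scale[OF lin_\<pi>]
 and \<pi>_0 = fun_linear_0[OF lin_\<pi>] and \<pi>_diff = fun_linear_diff[OF lin_\<pi>]
 and \<pi>_sum = fun_linear_sum[OF lin_\<pi>]
lemmas rho_add = fun_linear_add[OF fun_linear_dual_arrow]
 and rho_scale = fun_linear_scale[OF fun_linear_dual_arrow]
 and rho_sum = fun_linear_sum[OF fun_linear_dual_arrow]
lemmas eps_add = fun_linear_add[OF fun_linear_dual_vertex]
 and eps_scale = fun_linear_scale[OF fun_linear_dual_vertex]
 and eps_sum = fun_linear_sum[OF fun_linear_dual_vertex]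

abbreviation rho where "rho \<equiv> dual_arrow"
abbreviation eps where "eps \<equiv> dual_vertex D"
abbreviation sg :: "'a + 'a => 'k" where "sg \<equiv> arrow_sign"

lemma rho_closed: "xi : X ==> rho a xi : X" and eps_closed: "xi : X ==> eps i xi : X"
 unfolding X by (auto intro: dual_arrow_closed dual_vertex_closed)

lemma A_E': "a : arcs D ==> i : verts Q ==> A a (E i y) = (if i = head D a then A a y else 0)"
 using A_E[of a "E i y"] A_E[of a y] E_E[of "head D a" i y] D.head_in_verts[of a] A_0[of a] by auto

text \<open>Both sides are traces on X. Expanding the inner value along \<chi> turns each into a
  double sum, and the two double sums differ by exchanging the indices.\<close>

lemma trace_commute:
 assumes "fun_linear f" "!!xi. xi : X ==> f xi : X" "fun_linear g" "!!xi. xi : X ==> g xi : X"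
 shows "(SUM b:B. f (g (\<chi> b)) b) = (SUM b:B. g (f (\<chi> b)) b)"
proof -
 have *: "(SUM b:B. f (g (\<chi> b)) b) = (SUM b:B. SUM c:B. g (\<chi> b) c * f (\<chi> c) b)"
  if "fun_linear f" "!!xi. xi : X ==> g xi : X" for f g
 proof (rule sum.cong[OF HOL.refl])
  fix b
  have "f (g (\<chi> b)) = f (SUM c:B. fscale (g (\<chi> b) c) (\<chi> c))"
   using \<chi>_expansion[OF that(2)[OF \<chi>_closed]] by simp
  then show "f (g (\<chi> b)) b = (SUM c:B. g (\<chi> b) c * f (\<chi> c) b)"
   by (simp add: fun_linear_sum[OF that(1)] fun_linear_scale[OF that(1)] sum_fun_apply)
 qed
 have "(SUM b:B. f (g (\<chi> b)) b) = (SUM b:B. SUM c:B. g (\<chi> b) c * f (\<chi> c) b)" by (rule *[OF assms(1,4)])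
 also have "\<dots> = (SUM b:B. SUM c:B. f (\<chi> b) c * g (\<chi> c) b)" by (subst sum.swap) (simp add: mult.commute)
 also have "\<dots> = (SUM b:B. g (f (\<chi> b)) b)" by (rule *[OF assms(3,2), symmetric])
 finally show ?thesis .
qed

subsubsection \<open>A linear section and its defect\<close>

definition lift :: "('v, 'a) dpath => 'i => 'k" where
 "lift b = (SOME y. \<pi> y = \<chi> b)"

lemma \<pi>_lift: "\<pi> (lift b) = \<chi> b" unfolding lift_def by (rule someI_ex[OF \<pi>_surj[OF \<chi>_closed]])

definition lin_section :: "('v, 'a, 'k) pfun => 'i => 'k" where
 "lin_section xi = (SUM b:B. fscale (xi b) (lift b))"

lemma lin_lin_section: "fun_linear lin_section" by (rule fun_linearI)
  (auto simp: lin_section_def fun_eq_iff sum_fun_apply sum.distrib algebra_simps sum_distrib_left)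

lemma \<pi>_lin_section: "xi : X ==> \<pi> (lin_section xi) = xi"
 using \<chi>_expansion[of xi] by (simp add: lin_section_def \<pi>_sum \<pi>_scale \<pi>_lift)

text \<open>Cutting with the vertex idempotents on both sides makes the linear section commute with
  the vertices. Only the arrows are left as an obstruction.\<close>

definition sec :: "('v, 'a, 'k) pfun => 'i => 'k" where
 "sec xi = (SUM i:verts Q. E i (lin_section (eps i xi)))"

lemma lin_sec: "fun_linear sec" by (rule fun_linearI)
  (auto simp: sec_def eps_add eps_scale fun_linear_add[OF lin_lin_section] fun_linear_scale[OF lin_lin_section]
   E_add E_scale sum.distrib fun_eq_iff sum_fun_apply sum_distrib_left)

lemma \<pi>_sec: "xi : X ==> \<pi> (sec xi) = xi" using sum_dual_vertex[of xi, folded X]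
 by (simp add: sec_def \<pi>_sum \<pi>_E \<pi>_lin_section eps_closed dual_vertex_vertex)

lemma sec_eps:
 assumes "i : verts Q"
 shows "sec (eps i xi) = E i (sec xi)"
proof -
 have "sec (eps i xi) = (SUM j:verts Q. if j = i then E i (lin_section (eps i xi)) else 0)" unfolding sec_def
  by (rule sum.cong) (auto simp: dual_vertex_vertex fun_linear_0[OF lin_lin_section] E_0)
 moreover have "E i (sec xi) = (SUM j:verts Q. if j = i then E i (lin_section (eps i xi)) else 0)"
  unfolding sec_def E_sum using assms by (intro sum.cong) (auto simp: E_E)
 ultimately show ?thesis by simp
qed

text \<open>The failure of \<open>sec\<close> to commute with the arrow a. Its values lie in the
  kernel of \<pi>, so it is a 1-cochain on X with values in that kernel.\<close>

definition defect :: "'a + 'a => ('v, 'a, 'k) pfun => 'i => 'k" where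
 "defect a xi = A a (sec xi) - sec (rho a xi)"

lemma lin_defect: "fun_linear (defect a)" by (rule fun_linearI)
  (auto simp: defect_def rho_add rho_scale fun_linear_add[OF lin_sec] fun_linear_scale[OF lin_sec]
   A_add A_scale algebra_simps fun_eq_iff)

lemma \<pi>_defect: "a : arcs D ==> xi : X ==> \<pi> (defect a xi) = 0"
 by (simp add: defect_def \<pi>_diff \<pi>_A \<pi>_sec rho_closed)

lemma E_defect:
 assumes "a : arcs D" "xi : X"
 shows "E (tail D a) (defect a xi) = defect a xi"
proof -
 have "E (tail D a) (sec (rho a xi)) = sec (eps (tail D a) (rho a xi))"
  using sec_eps[of "tail D a" "rho a xi"] D.tail_in_verts[OF assms(1)] by simp
 also have "\<dots> = sec (rho a xi)" using dual_vertex_arrow[of xi a] assms(2) X by simp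
 finally show ?thesis by (simp add: defect_def E_diff E_A[OF assms(1)])
qed

lemma defect_eps:
 assumes "a : arcs D"
 shows "defect a (eps (head D a) xi) = defect a xi"
 using sec_eps[of "head D a" xi] D.head_in_verts[OF assms] A_E[OF assms] dual_arrow_vertex[of a xi]
 by (simp add: defect_def)

subsubsection \<open>Coboundaries\<close>

text \<open>A function on triples of an arrow, a path and an index encodes, for each arrow \<open>a\<close>, the
 linear map \<open>xi \<mapsto> cochain c a xi\<close>.\<close>

definition cochain ::
 "(('a + 'a) \<times> (('v, 'a) dpath) \<times> 'i => 'k) => 'a + 'a => ('v, 'a, 'k) pfun => 'i => 'k" where
 "cochain c a xi = (%x. SUM b:B. xi b * c (a, b, x))"

text \<open>The rank one map that sends xi to xi(b) y, placed at the arrow a. The elements of X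
  vanish off \<open>B\<close>, so the value 0 there does not change the map.\<close>

definition elementary ::
 "'a + 'a => ('v, 'a) dpath => ('i => 'k) => ('a + 'a) \<times> (('v, 'a) dpath) \<times> 'i => 'k" where
 "elementary a b y = (%(a', b', x). if a' = a & b' = b & b : B then y x else 0)"

text \<open>Membership constrains only the maps induced on X. A cochain that induces the zero map
  for every arrow, such as a preprojective relation, is therefore a coboundary too.\<close>

definition coboundaries :: "(('a + 'a) \<times> (('v, 'a) dpath) \<times> 'i => 'k) set" where
 "coboundaries = {c. EX u. fun_linear u & (ALL xi:X. \<pi> (u xi) = 0) \<and>
   (ALL i:verts Q. ALL xi:X. u (eps i xi) = E i (u xi)) \<and>
   (ALL a:arcs D. ALL xi:X. cochain c a xi = A a (u xi) - u (rho a xi))}"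

lemma coboundariesI:
 assumes "fun_linear u" "!!xi. xi : X ==> \<pi> (u xi) = 0"
  "!!i xi. i : verts Q ==> xi : X ==> u (eps i xi) = E i (u xi)"
  "!!a xi. a : arcs D ==> xi : X ==> cochain c a xi = A a (u xi) - u (rho a xi)"
 shows "c : coboundaries" unfolding coboundaries_def using assms by blast

lemma cochain_add: "cochain (c + d) a xi = cochain c a xi + cochain d a xi"
 and cochain_scale: "cochain (fscale r c) a xi = fscale r (cochain c a xi)"
 and cochain_0: "cochain 0 a xi = 0" by (auto simp: cochain_def fun_eq_iff sum.distrib algebra_simps sum_distrib_left)

lemma cochain_sum: "cochain (SUM i:I. c i) a xi = (SUM i:I. cochain (c i) a xi)"
 by (induction I rule: infinite_finite_induct) (simp_all only: sum.infinite sum.empty sum.insert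
   cochain_0 cochain_add not_False_eq_True)

lemma cochain_elementary:
 assumes "xi : X"
 shows "cochain (elementary a b y) a' xi = (if a' = a then fscale (xi b) y else 0)"
proof
 fix x
 have "cochain (elementary a b y) a' xi x = (SUM b':B. if b' = b then if a' = a then xi b * y x else 0 else 0)"
  unfolding cochain_def by (rule sum.cong) (auto simp: elementary_def)
 also have "\<dots> = (if b : B then if a' = a then xi b * y x else 0 else 0)" using finite_B by simp
 finally show "cochain (elementary a b y) a' xi x = (if a' = a then fscale (xi b) y else 0) x"
  using X_outside_B[OF assms, of b] by auto
qed

lemma fun_subspace_coboundaries: "fun_subspace coboundaries"
proof (rule fun_subspaceI)
 show "0 : coboundaries"
  by (rule coboundariesI[of "%_. 0"]) (auto simp: fun_linear_def \<pi>_0 E_0 A_0 cochain_0 fun_eq_iff)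
next
 fix c d assume c: "c : coboundaries" and d: "d : coboundaries"
 obtain u where
  u: "fun_linear u" "!!xi. xi : X ==> \<pi> (u xi) = 0"
   "!!i xi. i : verts Q ==> xi : X ==> u (eps i xi) = E i (u xi)"
   "!!a xi. a : arcs D ==> xi : X ==> cochain c a xi = A a (u xi) - u (rho a xi)"
  using c unfolding coboundaries_def by blast
 obtain v where
  v: "fun_linear v" "!!xi. xi : X ==> \<pi> (v xi) = 0"
   "!!i xi. i : verts Q ==> xi : X ==> v (eps i xi) = E i (v xi)"
   "!!a xi. a : arcs D ==> xi : X ==> cochain d a xi = A a (v xi) - v (rho a xi)"
  using d unfolding coboundaries_def by blast
 show "c + d : coboundaries"
 proof (rule coboundariesI[of "%xi. u xi + v xi"])
  show "fun_linear (%xi. u xi + v xi)" using u(1) v(1) by (auto simp: fun_linear_def algebra_simps fun_eq_iff)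
 qed (simp_all add: u v \<pi>_add E_add A_add cochain_add)
next
 fix r c assume c: "c : coboundaries"
 obtain u where
  u: "fun_linear u" "!!xi. xi : X ==> \<pi> (u xi) = 0"
   "!!i xi. i : verts Q ==> xi : X ==> u (eps i xi) = E i (u xi)"
   "!!a xi. a : arcs D ==> xi : X ==> cochain c a xi = A a (u xi) - u (rho a xi)"
  using c unfolding coboundaries_def by blast
 show "fscale r c : coboundaries"
 proof (rule coboundariesI[of "%xi. fscale r (u xi)"])
  show "fun_linear (%xi. fscale r (u xi))" using u(1) by (auto simp: fun_linear_def algebra_simps fun_eq_iff)
  show "\<pi> (fscale r (u xi)) = 0" if "xi : X" for xi using u(2)[OF that] by (simp add: \<pi>_scale fun_eq_iff)
  show "fscale r (u (eps i xi)) = E i (fscale r (u xi))" if "i : verts Q" "xi : X" for i xi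
   using u(3)[OF that] by (simp add: E_scale)
  show "cochain (fscale r c) a xi = A a (fscale r (u xi)) - fscale r (u (rho a xi))"
   if "a : arcs D" "xi : X" for a xi
   by (simp only: cochain_scale u(4)[OF that] A_scale) (simp add: fun_eq_iff algebra_simps)
 qed
qed

text \<open>Elements of X satisfy the relation, so the induced maps vanish and u = 0 is a witness. A
  functional that kills coboundaries thus takes values that obey the preprojective relations, which
  is how \<open>h\<close> lands in X.\<close>

lemma relation_coboundary:
 "(SUM c:arcs D. fscale (sg c) (elementary a (u, p @ [c, opposite c] @ q) y)) : coboundaries"
proof (rule coboundariesI[of "%_. 0"])
 fix a' xi assume "xi : X"
 then have "cochain (SUM c:arcs D. fscale (sg c) (elementary a (u, p @ [c, opposite c] @ q) y)) a' xi =
   (if a' = a then (SUM c:arcs D. fscale (sg c * xi (u, p @ [c, opposite c] @ q)) y) else 0)"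
  by (simp add: cochain_sum cochain_scale cochain_elementary fun_eq_iff sum_fun_apply mult.assoc)
 also have "(SUM c:arcs D. fscale (sg c * xi (u, p @ [c, opposite c] @ q)) y) =
   fscale (SUM c:arcs D. sg c * xi (u, p @ [c, opposite c] @ q)) y"
  by (simp add: fun_eq_iff sum_fun_apply sum_distrib_right)
 also have "\<dots> = 0" using dual_module_relation[of xi u p q] \<open>xi : X\<close> X by (simp add: fun_eq_iff)
 finally show "cochain (SUM c:arcs D. fscale (sg c) (elementary a (u, p @ [c, opposite c] @ q) y)) a' xi =
   A a' 0 - 0" by (simp only: A_0 if_cancel diff_self)
qed (auto simp: fun_linear_def \<pi>_0 E_0 fun_eq_iff)

text \<open>The coboundary of the rank one map from xi to xi(u, p) y. The hypotheses on y make this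
  map commute with the vertices and take values in the kernel of \<pi>.\<close>

lemma differential_coboundary:
 assumes y: "\<pi> y = 0" and p: "(u, p) : B" "E (D.awlast u p) y = y"
 shows "(SUM a:arcs D. elementary a (u, p) (A a y) - elementary a (u, p @ [a]) y) : coboundaries"
proof (rule coboundariesI[of "%xi. fscale (xi (u, p)) y"])
 let ?i = "D.awlast u p"
 have i: "?i : verts Q" using p(1) D.quiver_paths_end[of u p] by (simp add: B_def)
 show "fun_linear (%xi. fscale (xi (u, p)) y)" by (auto simp: fun_linear_def fun_eq_iff algebra_simps)
 show "\<pi> (fscale (xi (u, p)) y) = 0" for xi using y by (simp add: \<pi>_scale fun_eq_iff)
 show "fscale (eps j xi (u, p)) y = E j (fscale (xi (u, p)) y)" if "j : verts Q" for j xi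
 proof (cases "j = ?i")
  case True
  then show ?thesis using p(2) by (simp add: E_scale dual_vertex_def)
 next
  case False
  then have "E j y = 0" using E_E[OF that i, of y] p(2) by simp
  then show ?thesis using False by (simp add: E_scale dual_vertex_def fun_eq_iff)
 qed
 fix a xi assume a: "a : arcs D" and xi: "xi : X"
 have "elementary a' (u, p) (A a' y) - elementary a' (u, p @ [a']) y =
   elementary a' (u, p) (A a' y) + fscale (- 1) (elementary a' (u, p @ [a']) y)" for a' by (auto simp: fun_eq_iff)
 then have "cochain (elementary a' (u, p) (A a' y) - elementary a' (u, p @ [a']) y) a xi =
   (if a' = a then fscale (xi (u, p)) (A a y) + fscale (- 1) (fscale (xi (u, p @ [a])) y) else 0)" for a'
  by (simp only: cochain_add cochain_scale cochain_elementary[OF xi] split: if_split) (auto simp: fun_eq_iff)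
 then have "cochain (SUM a:arcs D. elementary a (u, p) (A a y) - elementary a (u, p @ [a]) y) a xi =
   (SUM a':arcs D. if a' = a then fscale (xi (u, p)) (A a y) + fscale (- 1) (fscale (xi (u, p @ [a])) y) else 0)"
  by (simp only: cochain_sum)
 also have "\<dots> = fscale (xi (u, p)) (A a y) + fscale (- 1) (fscale (xi (u, p @ [a])) y)" using a by simp
 also have "\<dots> = A a (fscale (xi (u, p)) y) - fscale (rho a xi (u, p)) y"
  by (auto simp: A_scale fun_eq_iff dual_arrow_def)
 finally show "cochain (SUM a:arcs D. elementary a (u, p) (A a y) - elementary a (u, p @ [a]) y) a xi =
   A a (fscale (xi (u, p)) y) - fscale (rho a xi (u, p)) y" .
qed

text \<open>\<open>defect a\<close> sees only the component of xi at the head of a, so the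
  restriction to paths ending there loses nothing; it also matches the support built into
  \<open>h\<close> below.\<close>

definition defect_cochain :: "('a + 'a) \<times> (('v, 'a) dpath) \<times> 'i => 'k" where
 "defect_cochain =
   (SUM a:arcs D. SUM b:{b : B. D.awlast (fst b) (snd b) = head D a}. elementary a b (defect a (\<chi> b)))"

lemma cochain_defect_cochain:
 assumes a: "a : arcs D" and xi: "xi : X"
 shows "cochain defect_cochain a xi = defect a xi"
proof -
 have "cochain defect_cochain a xi =
   (SUM a':arcs D. if a' = a then SUM b:{b : B. D.awlast (fst b) (snd b) = head D a}.
     fscale (xi b) (defect a (\<chi> b)) else 0)" unfolding defect_cochain_def cochain_sum
  by (intro sum.cong) (auto simp: cochain_elementary[OF xi])
 also have "\<dots> = (SUM b:{b : B. D.awlast (fst b) (snd b) = head D a}. fscale (xi b) (defect a (\<chi> b)))"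
  using a by simp
 also have "\<dots> = (SUM b:B. fscale (eps (head D a) xi b) (defect a (\<chi> b)))"
  unfolding sum.inter_filter[OF finite_B] by (rule sum.cong) (auto simp: dual_vertex_def fun_eq_iff split: prod.splits)
 also have "\<dots> = defect a (SUM b:B. fscale (eps (head D a) xi b) (\<chi> b))"
  by (simp add: fun_linear_sum[OF lin_defect] fun_linear_scale[OF lin_defect])
 also have "\<dots> = defect a (eps (head D a) xi)" using \<chi>_expansion[OF eps_closed[OF xi]] by simp
 also have "\<dots> = defect a xi" by (rule defect_eps[OF a])
 finally show ?thesis .
qed

text \<open>A functional on cochains that vanishes on the coboundaries but not on the defect gives maps \<open>h a\<close>
 in the opposite direction; being a cocycle, they come from the map \<open>ka\<close> below, and cyclicity of
 the trace yields a contradiction.\<close>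

context
 assumes not_coboundary: "defect_cochain ~: coboundaries"
begin

definition th :: "(('a + 'a) \<times> (('v, 'a) dpath) \<times> 'i => 'k) => 'k" where
 "th = (SOME th. (ALL c d. th (c + d) = th c + th d) & (ALL r c. th (fscale r c) = r * th c) \<and>
   (ALL c:coboundaries. th c = 0) & th defect_cochain ~= 0)"

lemma th_add: "th (c + d) = th c + th d" and th_scale: "th (fscale r c) = r * th c"
 and th_coboundary: "c : coboundaries ==> th c = 0" and th_defect: "th defect_cochain ~= 0"
proof -
 obtain g :: "(('a + 'a) \<times> (('v, 'a) dpath) \<times> 'i => 'k) => ('a + 'a) \<times> (('v, 'a) dpath) \<times> 'i => 'k"
  where g: "fun_linear g" "!!f. g f : coboundaries" "!!f. f : coboundaries ==> g f = f"
  using exists_projection[OF fun_subspace_coboundaries] by blast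
 have "g defect_cochain ~= defect_cochain" using g(2)[of defect_cochain] not_coboundary by auto
 then obtain x where x: "g defect_cochain x ~= defect_cochain x" by (meson ext)
 \<comment> \<open>The x-coordinate of the difference between c and its projection to the
   coboundaries: it vanishes on coboundaries, and x is chosen where the defect differs from its
   projection.\<close>
 let ?th = "%c. c x - g c x"
 have "(ALL c d. ?th (c + d) = ?th c + ?th d) & (ALL r c. ?th (fscale r c) = r * ?th c) \<and>
   (ALL c:coboundaries. ?th c = 0) & ?th defect_cochain ~= 0"
  using g x by (auto simp: fun_linear_add[OF g(1)] fun_linear_scale[OF g(1)] algebra_simps)
 then have "EX th. (ALL c d. th (c + d) = th c + th d) & (ALL r c. th (fscale r c) = r * th c) \<and>
   (ALL c:coboundaries. th c = 0) & th defect_cochain ~= 0" by (intro exI[of _ ?th])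
 then have "(ALL c d. th (c + d) = th c + th d) & (ALL r c. th (fscale r c) = r * th c) \<and>
   (ALL c:coboundaries. th c = 0) & th defect_cochain ~= 0" unfolding th_def by (rule someI_ex)
 then show "th (c + d) = th c + th d" "th (fscale r c) = r * th c"
  "c : coboundaries ==> th c = 0" "th defect_cochain ~= 0" by blast+
qed

lemma th_0: "th 0 = 0"
proof -
 have "th (fscale 0 0) = 0" by (simp add: th_scale)
 moreover have "fscale 0 0 = (0 :: ('a + 'a) \<times> (('v, 'a) dpath) \<times> 'i => 'k)" by (simp add: fun_eq_iff)
 ultimately show ?thesis by simp
qed

lemma th_diff: "th (c - d) = th c - th d" using th_add[of "c - d" d] by (simp add: eq_diff_eq)

lemma th_sum: "th (SUM i:I. c i) = (SUM i:I. th (c i))"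
 by (induction I rule: infinite_finite_induct) (simp_all only: sum.infinite sum.empty sum.insert
   th_0 th_add not_False_eq_True)

lemma elementary_add: "elementary a b (y + z) = elementary a b y + elementary a b z"
 and elementary_scale: "elementary a b (fscale r y) = fscale r (elementary a b y)"
 and elementary_0: "elementary a b 0 = 0"
 and elementary_outside: "b ~: B ==> elementary a b y = 0" by (auto simp: elementary_def fun_eq_iff)

text \<open>The transpose of \<open>th\<close> at the arrow a: for fixed y it is a function of the
  path b. The two vertex conditions make it compatible with the idempotents.\<close>

definition h :: "'a + 'a => ('i => 'k) => ('v, 'a, 'k) pfun" where
 "h a y = (%b. if a : arcs D & D.awlast (fst b) (snd b) = head D a
   then th (elementary a b (E (tail D a) y)) else 0)"

lemma lin_h: "fun_linear (h a)"
 by (rule fun_linearI) (auto simp: h_def fun_eq_iff E_add E_scale elementary_add elementary_scale th_add th_scale)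

lemma h_outside_B: "b ~: B ==> h a y b = 0" by (simp add: h_def elementary_outside th_0)

lemma h_path: "h a y (u, p) ~= 0 ==> (u, p) : quiver_paths D & D.awlast u p = head D a & a : arcs D"
 using h_outside_B[of "(u, p)" a y] by (auto simp: h_def B_def split: if_splits)

lemma h_E: "i : verts Q ==> a : arcs D ==> h a (E i y) = (if i = tail D a then h a y else 0)"
proof -
 assume i: "i : verts Q" and a: "a : arcs D"
 have "E (tail D a) (E i y) = (if i = tail D a then E (tail D a) y else 0)"
  using E_E[of "tail D a" i y] D.tail_in_verts[OF a] i by auto
 then show ?thesis by (cases "i = tail D a") (auto simp: h_def elementary_0 th_0)
qed

lemma h_closed: "h a y : X" unfolding X_iff
proof (rule dual_moduleI)
 show "(u, p) : quiver_paths D" if "h a y (u, p) ~= 0" for u p using h_path[OF that] by simp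
next
 fix u p q
 let ?y = "E (tail D a) y"
 show "(SUM c:arcs D. arrow_sign c * h a y (u, p @ [c, opposite c] @ q)) = 0"
 proof (cases "a : arcs D & D.awlast (D.awlast u p) q = head D a")
  case True
  have "arrow_sign c * h a y (u, p @ [c, opposite c] @ q) =
    th (fscale (sg c) (elementary a (u, p @ [c, opposite c] @ q) ?y))" for c
  proof (cases "(u, p @ [c, opposite c] @ q) : B")
   case True
   then have "tail D c = D.awlast u p" by (simp add: B_def D.quiver_paths_append D.quiver_paths_Cons)
   then have "D.awlast u (p @ [c, opposite c] @ q) = D.awlast (D.awlast u p) q" by (simp add: D.awlast_eq)
   then show ?thesis
    using \<open>a : arcs D & D.awlast (D.awlast u p) q = head D a\<close> by (simp add: h_def th_scale)
  next
   case False
   then show ?thesis by (simp only: h_outside_B elementary_outside th_scale th_0 not_False_eq_True)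
  qed
  then have "(SUM c:arcs D. arrow_sign c * h a y (u, p @ [c, opposite c] @ q)) =
    th (SUM c:arcs D. fscale (sg c) (elementary a (u, p @ [c, opposite c] @ q) ?y))" by (simp only: th_sum)
  then show ?thesis using th_coboundary[OF relation_coboundary] by simp
 next
  case False
  have "h a y (u, p @ [c, opposite c] @ q) = 0" for c
  proof (rule ccontr)
   assume "h a y (u, p @ [c, opposite c] @ q) ~= 0"
   from h_path[OF this] have "tail D c = D.awlast u p" "a : arcs D"
     "D.awlast u (p @ [c, opposite c] @ q) = head D a" by (auto simp: D.quiver_paths_append D.quiver_paths_Cons)
   then show False using False by (simp add: D.awlast_eq split: if_splits)
  qed
  then show ?thesis by simp
 qed
qed

text \<open>\<open>th\<close> vanishes on the coboundaries of the rank one maps. Evaluating it there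
  at the path (u, p), with y cut down to the vertex where p ends, gives the identity at (u,
  p).\<close>

lemma h_cocycle:
 assumes y: "\<pi> y = 0"
 shows "(SUM a:arcs D. h a (A a y) - rho a (h a y)) = 0"
proof (rule ext, clarify)
 fix u p
 let ?i = "D.awlast u p"
 have "(SUM a:arcs D. h a (A a y) (u, p) - h a y (u, p @ [a])) = 0"
 proof (cases "(u, p) : B")
  case True
  then have i: "?i : verts Q" and path: "(u, p) : quiver_paths D" using D.quiver_paths_end[of u p] by (auto simp: B_def)
  have 1: "h a (A a y) (u, p) = th (elementary a (u, p) (A a (E ?i y)))" if a: "a : arcs D" for a
   using A_E'[OF a i, of y] a E_A[OF a, of y] by (auto simp: h_def th_0 elementary_0)
  have 2: "h a y (u, p @ [a]) = th (elementary a (u, p @ [a]) (E ?i y))" if a: "a : arcs D" for a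
  proof (cases "tail D a = ?i")
   case True
   then show ?thesis using a by (simp add: h_def D.awlast_eq)
  next
   case False
   then have "(u, p @ [a]) ~: B" by (auto simp: B_def D.quiver_paths_snoc)
   then show ?thesis using h_outside_B[of "(u, p @ [a])" a y] elementary_outside[of "(u, p @ [a])" a "E ?i y"] th_0
    by metis
  qed
  have "\<pi> (E ?i y) = 0" using y by (simp add: \<pi>_E[OF i] fun_linear_0[OF fun_linear_dual_vertex])
  moreover have "E ?i (E ?i y) = E ?i y" using E_E[OF i i] by simp
  ultimately have "th (SUM a:arcs D. elementary a (u, p) (A a (E ?i y)) - elementary a (u, p @ [a]) (E ?i y)) = 0"
   using True by (intro th_coboundary differential_coboundary)
  moreover have "(SUM a:arcs D. h a (A a y) (u, p) - h a y (u, p @ [a])) =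
    (SUM a:arcs D. th (elementary a (u, p) (A a (E ?i y)) - elementary a (u, p @ [a]) (E ?i y)))"
   using 1 2 by (intro sum.cong) (simp_all add: th_diff)
  ultimately show ?thesis by (simp add: th_sum)
 next
  case False
  have "(u, p @ [a]) ~: B" for a using False by (auto simp: B_def D.quiver_paths_snoc)
  then show ?thesis using False by (simp add: h_outside_B)
 qed
 then show "(SUM a:arcs D. h a (A a y) - rho a (h a y)) (u, p) = 0 (u, p)" by (simp add: sum_fun_apply dual_arrow_def)
qed

text \<open>Passing to the opposite arrow with a sign turns \<open>h_cocycle\<close> into the
  statement that K, extended to paths by the Leibniz rule, vanishes on the preprojective
  relation.\<close>

definition K :: "'a + 'a => ('i => 'k) => ('v, 'a, 'k) pfun" where
 "K a y = fscale (sg a) (h (opposite a) y)"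

lemma lin_K: "fun_linear (K a)" by (rule fun_linearI)
  (auto simp: K_def fun_linear_add[OF lin_h] fun_linear_scale[OF lin_h] fun_eq_iff algebra_simps)

lemma K_closed: "K a y : X" unfolding K_def by (rule fun_subspace_scale[OF fun_subspace_X h_closed])

lemma K_path: "K a y (u, p) ~= 0 ==> (u, p) : quiver_paths D & D.awlast u p = tail D a & a : arcs D"
 using h_path[of "opposite a" y u p] by (auto simp: K_def)

lemma K_E: "i : verts Q ==> a : arcs D ==> K a (E i y) = (if i = head D a then K a y else 0)"
 using h_E[of i "opposite a" y] by (auto simp: K_def fun_eq_iff)

lemma K_cocycle:
 assumes "\<pi> y = 0"
 shows "(SUM c:arcs D. fscale (sg c) (K c (A (opposite c) y) + rho c (K (opposite c) y))) = 0"
proof -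
 have eq: "fscale (sg c) (K c (A (opposite c) y) + rho c (K (opposite c) y)) =
   h (opposite c) (A (opposite c) y) - rho c (h c y)" for c by (cases c) (auto simp: K_def rho_scale fun_eq_iff)
 have "(SUM c:arcs D. fscale (sg c) (K c (A (opposite c) y) + rho c (K (opposite c) y))) =
   (SUM c:arcs D. h (opposite c) (A (opposite c) y)) - (SUM c:arcs D. rho c (h c y))"
  unfolding eq by (rule sum_subtractf)
 also have "\<dots> = (SUM c:arcs D. h c (A c y) - rho c (h c y))"
  unfolding sum_opposite[of "%c. h c (A c y)" Q] by (rule sum_subtractf[symmetric])
 finally show ?thesis using h_cocycle[OF assms] by simp
qed

text \<open>The potential of K: the rule that appending a to the argument of \<open>ka y\<close>
  gives \<open>ka (A a y) + K a y\<close>, with value 0 on trivial paths, determines it. The list is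
  reversed because the last arrow is peeled off first.\<close>

fun ka' :: "'v => ('a + 'a) list => ('i => 'k) => 'k" where
 "ka' u [] y = 0"
| "ka' u (a # r) y = ka' u r (A a y) + K a y (u, rev r)"

definition ka :: "('i => 'k) => ('v, 'a, 'k) pfun" where
 "ka y = (%(u, p). ka' u (rev p) y)"

lemma ka_Nil: "ka y (u, []) = 0" and ka_snoc: "ka y (u, p @ [a]) = ka (A a y) (u, p) + K a y (u, p)"
 by (simp_all add: ka_def)

lemma lin_ka: "fun_linear ka"
proof (rule fun_linearI)
 have "ka (y + z) (u, p) = (ka y + ka z) (u, p)" for y z u p by (induction p arbitrary: y z rule: rev_induct)
   (auto simp: ka_Nil ka_snoc A_add fun_linear_add[OF lin_K])
 then show "ka (y + z) = ka y + ka z" for y z by (rule_tac ext, clarify)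
 have "ka (fscale r y) (u, p) = fscale r (ka y) (u, p)" for r y u p by (induction p arbitrary: y rule: rev_induct)
   (auto simp: ka_Nil ka_snoc A_scale fun_linear_scale[OF lin_K] algebra_simps)
 then show "ka (fscale r y) = fscale r (ka y)" for r y by (rule_tac ext, clarify)
qed

lemma ka_E: "i : verts Q ==> D.awlast u p ~= i ==> ka (E i y) (u, p) = 0"
proof (cases p rule: rev_cases)
 case (snoc q a)
 assume i: "i : verts Q" "D.awlast u p ~= i"
 show ?thesis
 proof (cases "a : arcs D")
  case True
  then have "A a (E i y) = 0" "K a (E i y) = 0" using A_E'[of a i y] K_E[of i a y] i snoc by (auto simp: D.awlast_eq)
  then show ?thesis using snoc by (simp add: ka_snoc fun_linear_0[OF lin_ka])
 next
  case False
  then have "K a (E i y) (u, q) = 0" using K_path by blast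
  then show ?thesis using snoc A_outside[OF False] by (simp add: ka_snoc fun_linear_0[OF lin_ka])
 qed
qed (simp add: ka_Nil)

lemma ka_path: "ka y (u, p) ~= 0 ==> (u, p) : quiver_paths D"
proof (induction p arbitrary: y rule: rev_induct)
 case (snoc a p)
 then consider "ka (A a y) (u, p) ~= 0" | "K a y (u, p) ~= 0" unfolding ka_snoc by (metis add_0)
 then show ?case
 proof cases
  case 1
  then have a: "a : arcs D" using A_outside[of a y] fun_linear_0[OF lin_ka] zero_fun_apply by metis
  then have "D.awlast u p = tail D a"
   using ka_E[of "tail D a" u p "A a y"] E_A[OF a, of y] D.tail_in_verts[OF a] 1 by auto
  then show ?thesis using snoc.IH[OF 1] a by (simp add: D.quiver_paths_snoc)
 next
  case 2
  then show ?thesis using K_path[OF 2] by (simp add: D.quiver_paths_snoc)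
 qed
qed (simp add: ka_Nil)

lemma ka_arrow: "rho a (ka y) = ka (A a y) + K a y" by (auto simp: dual_arrow_def ka_snoc fun_eq_iff)

text \<open>For a relation at the very end of the path, the two summands of the recursion give the
  relation of the cover and \<open>K_cocycle\<close>, the latter needing \<pi> y = 0. Further arrows
  behind it are removed by induction, because K already takes values in X.\<close>

lemma ka_closed:
 assumes "\<pi> y = 0"
 shows "ka y : X" unfolding X_iff
proof (rule dual_moduleI)
 show "(u, p) : quiver_paths D" if "ka y (u, p) ~= 0" for u p using ka_path[OF that] .
next
 fix u p q
 show "(SUM c:arcs D. arrow_sign c * ka y (u, p @ [c, opposite c] @ q)) = 0" using assms
 proof (induction q arbitrary: y rule: rev_induct)
  case Nil
  have "(SUM c:arcs D. arrow_sign c * ka y (u, p @ [c, opposite c] @ [])) =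
    (SUM c:arcs D. fscale (sg c) (ka (A c (A (opposite c) y))) +
     fscale (sg c) (K c (A (opposite c) y) + rho c (K (opposite c) y))) (u, p)"
   using ka_snoc[of y u "p @ [c]" "opposite c" for c] by (simp add: sum_fun_apply ka_snoc dual_arrow_def algebra_simps)
  also have "\<dots> = (ka (SUM c:arcs D. fscale (sg c) (A c (A (opposite c) y))) +
    (SUM c:arcs D. fscale (sg c) (K c (A (opposite c) y) + rho c (K (opposite c) y)))) (u, p)"
   by (simp add: sum.distrib fun_linear_sum[OF lin_ka] fun_linear_scale[OF lin_ka] del: plus_fun_apply)
  also have "\<dots> = 0" by (simp add: relation K_cocycle[OF Nil] fun_linear_0[OF lin_ka])
  finally show ?case .
 next
  case (snoc a q)
  have "\<pi> (A a y) = 0"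
   using snoc.prems \<pi>_A[of a y] A_outside[of a y] \<pi>_0 fun_linear_0[OF fun_linear_dual_arrow, of a] by metis
  then have "(SUM c:arcs D. arrow_sign c * ka (A a y) (u, p @ [c, opposite c] @ q)) = 0" by (rule snoc.IH)
  moreover have "(SUM c:arcs D. arrow_sign c * K a y (u, p @ [c, opposite c] @ q)) = 0"
   using dual_module_relation[of "K a y"] K_closed X by blast
  ultimately show ?case using ka_snoc[of y u "p @ [c, opposite c] @ q" a for c] by (simp add: distrib_left sum.distrib)
 qed
qed

text \<open>The value of \<open>th\<close> at the defect is the sum over a of the traces of h a
  after defect a. Writing h a through \<open>ka\<close>, moving the arrow around the trace and
  collecting terms leaves \<open>ka\<close> applied to a signed sum of defects composed with
  opposite arrows, on either side; this sum is zero because both the cover and X satisfy the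
  preprojective relations.\<close>

lemma defect_coboundary_False: False
proof -
 define g where "g a = defect a" for a
 have g_\<pi>: "\<pi> (defect a (\<chi> b)) = 0" if "a : arcs D" for a b by (rule \<pi>_defect[OF that \<chi>_closed])
 have h_eq: "h a y = fscale (sg (opposite a)) (rho (opposite a) (ka y) - ka (A (opposite a) y))" for a y
 proof -
  have "K (opposite a) y = rho (opposite a) (ka y) - ka (A (opposite a) y)" using ka_arrow[of "opposite a" y] by simp
  moreover have "h a y = fscale (sg (opposite a)) (K (opposite a) y)"
   by (simp add: K_def fun_eq_iff mult.assoc[symmetric] del: arrow_sign.simps)
  ultimately show ?thesis by simp
 qed
 have "th defect_cochain = (SUM a:arcs D. SUM b:{b : B. D.awlast (fst b) (snd b) = head D a}.
   th (elementary a b (defect a (\<chi> b))))" unfolding defect_cochain_def by (simp only: th_sum)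
 also have "\<dots> = (SUM a:arcs D. SUM b:B. h a (defect a (\<chi> b)) b)"
 proof (rule sum.cong[OF HOL.refl])
  fix a assume a: "a : arcs D"
  show "(SUM b:{b : B. D.awlast (fst b) (snd b) = head D a}. th (elementary a b (defect a (\<chi> b)))) =
    (SUM b:B. h a (defect a (\<chi> b)) b)" unfolding sum.inter_filter[OF finite_B]
   by (rule sum.cong) (auto simp: h_def a E_defect[OF a \<chi>_closed])
 qed
 also have "\<dots> = (SUM a:arcs D. SUM b:B. sg (opposite a) *
   (rho (opposite a) (ka (defect a (\<chi> b))) b - ka (A (opposite a) (defect a (\<chi> b))) b))" by (subst h_eq) simp
 also have "\<dots> = (SUM a:arcs D. sg (opposite a) * ((SUM b:B. rho (opposite a) (ka (defect a (\<chi> b))) b) -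
   (SUM b:B. ka (A (opposite a) (defect a (\<chi> b))) b)))"
  by (simp add: sum_distrib_left sum_subtractf right_diff_distrib)
 also have "\<dots> = (SUM a:arcs D. sg (opposite a) * ((SUM b:B. ka (defect a (rho (opposite a) (\<chi> b))) b) -
   (SUM b:B. ka (A (opposite a) (defect a (\<chi> b))) b)))"
 proof (rule sum.cong[OF HOL.refl])
  fix a assume a: "a : arcs D"
  \<comment> \<open>Cyclicity needs an endomorphism of X: the defect lands in the kernel of \<pi>,
    and there \<open>ka\<close> takes values in X.\<close>
  have "fun_linear (%xi. ka (defect a xi))"
   by (rule fun_linearI) (simp_all add: fun_linear_add[OF lin_ka] fun_linear_scale[OF lin_ka]
     fun_linear_add[OF lin_defect] fun_linear_scale[OF lin_defect])
  then have "(SUM b:B. rho (opposite a) (ka (defect a (\<chi> b))) b) =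
    (SUM b:B. ka (defect a (rho (opposite a) (\<chi> b))) b)" using ka_closed[OF \<pi>_defect[OF a]]
   by (intro trace_commute[of "rho (opposite a)" "%xi. ka (defect a xi)"] fun_linear_dual_arrow rho_closed) auto
  then show "sg (opposite a) * ((SUM b:B. rho (opposite a) (ka (defect a (\<chi> b))) b) -
     (SUM b:B. ka (A (opposite a) (defect a (\<chi> b))) b)) =
    sg (opposite a) * ((SUM b:B. ka (defect a (rho (opposite a) (\<chi> b))) b) -
     (SUM b:B. ka (A (opposite a) (defect a (\<chi> b))) b))" by (simp only:)
 qed
 also have "\<dots> = (SUM b:B. ka (SUM a:arcs D. fscale (sg (opposite a))
   (defect a (rho (opposite a) (\<chi> b)) - A (opposite a) (defect a (\<chi> b)))) b)"
  unfolding fun_linear_sum[OF lin_ka] fun_linear_scale[OF lin_ka] fun_linear_diff[OF lin_ka] sum_fun_apply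
  by (subst sum.swap) (simp add: sum_distrib_left sum_subtractf right_diff_distrib)
 also have "\<dots> = 0"
 proof (rule sum.neutral, rule ballI)
  fix b :: "('v, 'a) dpath"
  let ?b = b
  let ?S = "sec (\<chi> ?b)"
  have "(SUM a:arcs D. fscale (sg (opposite a))
    (defect a (rho (opposite a) (\<chi> ?b)) - A (opposite a) (defect a (\<chi> ?b)))) =
   (SUM a:arcs D. fscale (sg (opposite a)) (A a (sec (rho (opposite a) (\<chi> ?b)))))
   + (SUM a:arcs D. fscale (sg (opposite a)) (A (opposite a) (sec (rho a (\<chi> ?b)))))
   - (SUM a:arcs D. fscale (sg (opposite a)) (sec (rho a (rho (opposite a) (\<chi> ?b)))))
   - (SUM a:arcs D. fscale (sg (opposite a)) (A (opposite a) (A a ?S)))"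
   by (simp add: defect_def A_diff fun_eq_iff sum_fun_apply sum_subtractf[symmetric] sum.distrib[symmetric]
     algebra_simps)
  \<comment> \<open>Reindexing by opposite arrows makes this mixed term the negative of the other
    one, because the sign changes; the two unmixed sums are preprojective relations.\<close>
  also have "(SUM a:arcs D. fscale (sg (opposite a)) (A (opposite a) (sec (rho a (\<chi> ?b))))) =
    (SUM a:arcs D. fscale (sg a) (A a (sec (rho (opposite a) (\<chi> ?b)))))"
   using sum_opposite[of "%a. fscale (sg a) (A a (sec (rho (opposite a) (\<chi> ?b))))" Q] by simp
  also have "(SUM a:arcs D. fscale (sg (opposite a)) (A a (sec (rho (opposite a) (\<chi> ?b))))) =
    - (SUM a:arcs D. fscale (sg a) (A a (sec (rho (opposite a) (\<chi> ?b)))))"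
   by (simp add: arrow_sign_opposite fun_eq_iff sum_fun_apply sum_negf)
  also have "(SUM a:arcs D. fscale (sg (opposite a)) (A (opposite a) (A a ?S))) = 0"
   using sum_opposite[of "%a. fscale (sg a) (A a (A (opposite a) ?S))" Q] relation[of ?S] by simp
  also have "(SUM a:arcs D. fscale (sg (opposite a)) (sec (rho a (rho (opposite a) (\<chi> ?b))))) =
    sec (- (SUM a:arcs D. fscale (sg a) (rho a (rho (opposite a) (\<chi> ?b)))))"
   by (simp add: fun_linear_minus[OF lin_sec] fun_linear_sum[OF lin_sec] fun_linear_scale[OF lin_sec]
     arrow_sign_opposite fun_eq_iff sum_fun_apply sum_negf)
  also have "\<dots> = 0"
   by (simp only: dual_arrow_relation[OF \<chi>_closed[unfolded X_iff]] minus_zero fun_linear_0[OF lin_sec])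
  finally have "(SUM a:arcs D. fscale (sg (opposite a))
    (defect a (rho (opposite a) (\<chi> ?b)) - A (opposite a) (defect a (\<chi> ?b)))) = 0"
   by (simp only: add.left_inverse diff_self diff_zero)
  then show "ka (SUM a:arcs D. fscale (sg (opposite a))
    (defect a (rho (opposite a) (\<chi> ?b)) - A (opposite a) (defect a (\<chi> ?b)))) ?b = 0"
   by (simp add: fun_linear_0[OF lin_ka])
 qed
 finally show False using th_defect by simp
qed

end

text \<open>The dual module is projective.\<close>

lemma exists_equivariant_section:
 obtains v where "fun_linear v" "!!xi. xi : X ==> \<pi> (v xi) = xi"
  "!!i xi. i : verts Q ==> xi : X ==> v (eps i xi) = E i (v xi)"
  "!!a xi. a : arcs D ==> xi : X ==> v (rho a xi) = A a (v xi)"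
proof -
 have "defect_cochain : coboundaries" using defect_coboundary_False by blast
 then obtain u where u: "fun_linear u" "!!xi. xi : X ==> \<pi> (u xi) = 0"
   "!!i xi. i : verts Q ==> xi : X ==> u (eps i xi) = E i (u xi)"
   "!!a xi. a : arcs D ==> xi : X ==> cochain defect_cochain a xi = A a (u xi) - u (rho a xi)"
  unfolding coboundaries_def by blast
 show ?thesis
 \<comment> \<open>The defect of \<open>sec\<close> is the coboundary of u, so subtracting u makes
   the section commute with the arrows. As u maps into the kernel of \<pi>, it remains a
   section.\<close>
 proof (rule that[of "%xi. sec xi - u xi"])
  show "fun_linear (%xi. sec xi - u xi)"
   by (rule fun_linearI) (auto simp: fun_linear_add[OF lin_sec] fun_linear_scale[OF lin_sec]
     fun_linear_add[OF u(1)] fun_linear_scale[OF u(1)] fun_eq_iff algebra_simps)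
  show "\<pi> (sec xi - u xi) = xi" if "xi : X" for xi using that u(2) by (simp add: \<pi>_diff \<pi>_sec)
  show "sec (eps i xi) - u (eps i xi) = E i (sec xi - u xi)" if "i : verts Q" "xi : X" for i xi
   using that u(3) by (simp add: E_diff sec_eps)
  show "sec (rho a xi) - u (rho a xi) = A a (sec xi - u xi)" if "a : arcs D" "xi : X" for a xi
  proof -
   have "A a (sec xi) - sec (rho a xi) = A a (u xi) - u (rho a xi)"
    using u(4)[OF that] cochain_defect_cochain[OF that] by (simp add: defect_def)
   then show ?thesis by (simp add: A_diff algebra_simps)
  qed
 qed
qed

end

subsection \<open>Algebras and their quotients\<close>

text \<open>B is not assumed to be a ring: the axioms are carried over along the surjection. This is
  applied to quotients and, by way of formal series, to the completion.\<close>

lemma ring_homomorphic_image: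
 assumes "ring A" and surj: "h ` carrier A = carrier B"
  and mult: "!!x y. x : carrier A ==> y : carrier A ==> h (x \<otimes>\<^bsub>A\<^esub> y) = h x \<otimes>\<^bsub>B\<^esub> h y"
  and add: "!!x y. x : carrier A ==> y : carrier A ==> h (x \<oplus>\<^bsub>A\<^esub> y) = h x \<oplus>\<^bsub>B\<^esub> h y"
  and one: "h \<one>\<^bsub>A\<^esub> = \<one>\<^bsub>B\<^esub>" and zero: "h \<zero>\<^bsub>A\<^esub> = \<zero>\<^bsub>B\<^esub>"
 shows "ring B" "h : ring_hom A B"
proof -
 interpret A: ring A by fact
 have im: "h x : carrier B" if "x : carrier A" for x using that surj by blast
 have pre: "EX x':carrier A. x = h x'" if "x : carrier B" for x using that surj by blast
 show "ring B"
 proof (intro ringI abelian_groupI monoidI)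
  fix x y assume "x : carrier B" "y : carrier B"
  then obtain x' y' where [simp]: "x' : carrier A" "y' : carrier A" "x = h x'" "y = h y'" using pre by metis
  show "x \<oplus>\<^bsub>B\<^esub> y : carrier B" "x \<otimes>\<^bsub>B\<^esub> y : carrier B"
   by (simp_all add: im flip: add mult)
  show "x \<oplus>\<^bsub>B\<^esub> y = y \<oplus>\<^bsub>B\<^esub> x" by (simp add: A.a_comm flip: add)
 next
  show "\<zero>\<^bsub>B\<^esub> : carrier B" "\<one>\<^bsub>B\<^esub> : carrier B" by (simp_all add: im flip: one zero)
 next
  fix x y z assume "x : carrier B" "y : carrier B" "z : carrier B"
  then obtain x' y' z' where [simp]: "x' : carrier A" "y' : carrier A" "z' : carrier A"
    "x = h x'" "y = h y'" "z = h z'" using pre by metis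
  show "x \<oplus>\<^bsub>B\<^esub> y \<oplus>\<^bsub>B\<^esub> z = x \<oplus>\<^bsub>B\<^esub> (y \<oplus>\<^bsub>B\<^esub> z)"
   by (simp add: A.a_assoc flip: add)
  show "x \<otimes>\<^bsub>B\<^esub> y \<otimes>\<^bsub>B\<^esub> z = x \<otimes>\<^bsub>B\<^esub> (y \<otimes>\<^bsub>B\<^esub> z)"
   by (simp add: A.m_assoc flip: mult)
  show "(x \<oplus>\<^bsub>B\<^esub> y) \<otimes>\<^bsub>B\<^esub> z = x \<otimes>\<^bsub>B\<^esub> z \<oplus>\<^bsub>B\<^esub> y \<otimes>\<^bsub>B\<^esub> z"
   by (simp add: A.l_distr flip: add mult)
  show "z \<otimes>\<^bsub>B\<^esub> (x \<oplus>\<^bsub>B\<^esub> y) = z \<otimes>\<^bsub>B\<^esub> x \<oplus>\<^bsub>B\<^esub> z \<otimes>\<^bsub>B\<^esub> y"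
   by (simp add: A.r_distr flip: add mult)
 next
  fix x assume "x : carrier B"
  then obtain x' where [simp]: "x' : carrier A" "x = h x'" using pre by metis
  show "\<zero>\<^bsub>B\<^esub> \<oplus>\<^bsub>B\<^esub> x = x" by (simp flip: add zero)
  show "\<one>\<^bsub>B\<^esub> \<otimes>\<^bsub>B\<^esub> x = x" "x \<otimes>\<^bsub>B\<^esub> \<one>\<^bsub>B\<^esub> = x"
   by (simp_all flip: mult one)
  have "h (\<ominus>\<^bsub>A\<^esub> x') \<oplus>\<^bsub>B\<^esub> x = \<zero>\<^bsub>B\<^esub>"
   by (simp add: A.l_neg flip: add zero)
  then show "EX y:carrier B. y \<oplus>\<^bsub>B\<^esub> x = \<zero>\<^bsub>B\<^esub>"
   using im[of "\<ominus>\<^bsub>A\<^esub> x'"] by auto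
 qed
 show "h : ring_hom A B" by (rule ring_hom_memI) (auto simp: im mult add one)
qed

text \<open>Gives an induction rule for the elements of a generated ideal.\<close>

inductive_set two_sided_sums :: "('x, 'z) ring_scheme => 'x set => 'x set" for A S where
 zero: "\<zero>\<^bsub>A\<^esub> : two_sided_sums A S"
| step: "a : carrier A ==> s : S ==> b : carrier A ==> y : two_sided_sums A S ==>
  (a \<otimes>\<^bsub>A\<^esub> s \<otimes>\<^bsub>A\<^esub> b) \<oplus>\<^bsub>A\<^esub> y : two_sided_sums A S"

lemma (in ring) genideal_eq_two_sided_sums:
 assumes S: "S <= carrier R"
 shows "Idl S = two_sided_sums R S"
proof
 have carr: "x : carrier R" if "x : two_sided_sums R S" for x using that S by induction auto
 have add: "x \<oplus> y : two_sided_sums R S" if "x : two_sided_sums R S" "y : two_sided_sums R S" for x y using that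
 proof (induction x)
  case zero
  then show ?case using carr by simp
 next
  case (step a s b x)
  then have "(a \<otimes> s \<otimes> b \<oplus> x) \<oplus> y = a \<otimes> s \<otimes> b \<oplus> (x \<oplus> y)"
   using S carr by (intro a_assoc) auto
  then show ?case using step by (simp add: two_sided_sums.step)
 qed
 have neg: "\<ominus> x : two_sided_sums R S" if "x : two_sided_sums R S" for x using that
 proof (induction x)
  case (step a s b x)
  then have "\<ominus> (a \<otimes> s \<otimes> b \<oplus> x) = (\<ominus> a) \<otimes> s \<otimes> b \<oplus> \<ominus> x"
   using S carr by (auto simp: minus_add l_minus subset_iff)
  then show ?case using step by (simp add: two_sided_sums.step)
 qed (simp add: two_sided_sums.zero)
 have left: "z \<otimes> x : two_sided_sums R S" if "x : two_sided_sums R S" "z : carrier R" for x z using that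
 proof (induction x)
  case (step a s b x)
  then have "z \<otimes> (a \<otimes> s \<otimes> b \<oplus> x) = (z \<otimes> a) \<otimes> s \<otimes> b \<oplus> z \<otimes> x"
   using S carr by (auto simp: r_distr m_assoc subset_iff)
  then show ?case using step by (simp add: two_sided_sums.step)
 qed (simp add: two_sided_sums.zero)
 have right: "x \<otimes> z : two_sided_sums R S" if "x : two_sided_sums R S" "z : carrier R" for x z using that
 proof (induction x)
  case (step a s b x)
  then have "(a \<otimes> s \<otimes> b \<oplus> x) \<otimes> z = a \<otimes> s \<otimes> (b \<otimes> z) \<oplus> x \<otimes> z"
   using S carr by (auto simp: l_distr m_assoc subset_iff)
  then show ?case using step by (simp add: two_sided_sums.step)
 qed (simp add: two_sided_sums.zero)
 have "ideal (two_sided_sums R S) R"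
 proof (rule idealI)
  show "subgroup (two_sided_sums R S) (add_monoid R)"
   using carr add neg by (intro add.subgroupI) (auto intro: two_sided_sums.zero simp flip: a_inv_def)
 qed (auto simp: ring_axioms left right)
 moreover have "S \<subseteq> two_sided_sums R S"
 proof
  fix s assume "s : S"
  then have "\<one> \<otimes> s \<otimes> \<one> \<oplus> \<zero> : two_sided_sums R S"
   by (intro two_sided_sums.intros) auto
  then show "s : two_sided_sums R S" using \<open>s : S\<close> S by auto
 qed
 ultimately show "Idl S \<subseteq> two_sided_sums R S" by (rule genideal_minimal)
 interpret I: ideal "Idl S" R by (rule genideal_ideal[OF S])
 show "two_sided_sums R S \<subseteq> Idl S"
 proof
  fix x assume "x : two_sided_sums R S"
  then show "x : Idl S"
  proof induction
   case (step a s b y)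
   have "s : Idl S" using genideal_self[OF S] step by blast
   then show ?case using step by (intro I.a_closed I.I_r_closed I.I_l_closed)
  qed simp
 qed
qed

locale algebra_over = ring A for A :: "('k::field, 'x) module" (structure) +
 assumes scale_closed [simp]: "x : carrier A ==> c \<odot>\<^bsub>A\<^esub> x : carrier A"
  and scale_add: "x : carrier A ==> y : carrier A ==> c \<odot>\<^bsub>A\<^esub> (x \<oplus> y) = c \<odot>\<^bsub>A\<^esub> x \<oplus> c \<odot>\<^bsub>A\<^esub> y"
  and add_scale: "x : carrier A ==> (c + d) \<odot>\<^bsub>A\<^esub> x = c \<odot>\<^bsub>A\<^esub> x \<oplus> d \<odot>\<^bsub>A\<^esub> x"
  and scale_scale: "x : carrier A ==> (c * d) \<odot>\<^bsub>A\<^esub> x = c \<odot>\<^bsub>A\<^esub> (d \<odot>\<^bsub>A\<^esub> x)"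
  and scale_one: "x : carrier A ==> 1 \<odot>\<^bsub>A\<^esub> x = x"
  and scale_mult_left: "x : carrier A ==> y : carrier A ==> (c \<odot>\<^bsub>A\<^esub> x) \<otimes> y = c \<odot>\<^bsub>A\<^esub> (x \<otimes> y)"
  and scale_mult_right: "x : carrier A ==> y : carrier A ==> x \<otimes> (c \<odot>\<^bsub>A\<^esub> y) = c \<odot>\<^bsub>A\<^esub> (x \<otimes> y)"
begin

lemma ideal_scale: "ideal I A ==> x : I ==> c \<odot>\<^bsub>A\<^esub> x : I"
 using ideal.I_l_closed[of I A x "c \<odot>\<^bsub>A\<^esub> \<one>"] ideal.Icarr[of I A x] scale_mult_left[of \<one> x c] by simp

end

lemma factor_simps:
 "carrier (factor A N) = a_rcosets\<^bsub>A\<^esub> N"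
 "X \<otimes>\<^bsub>factor A N\<^esub> Y = rcoset_mult A N X Y"
 "\<one>\<^bsub>factor A N\<^esub> = N +>\<^bsub>A\<^esub> \<one>\<^bsub>A\<^esub>"
 "\<zero>\<^bsub>factor A N\<^esub> = N"
 "X \<oplus>\<^bsub>factor A N\<^esub> Y = X <+>\<^bsub>A\<^esub> Y"
 "c \<odot>\<^bsub>factor A N\<^esub> X = (\<Union>x\<in>X. N +>\<^bsub>A\<^esub> (c \<odot>\<^bsub>A\<^esub> x))"
 by (simp_all add: factor_def ring.defs module.defs FactRing_def)

locale algebra_ideal = algebra_over A + I: ideal I A for A :: "('k::field, 'x) module" (structure) and I
begin

abbreviation coset where "coset x \<equiv> I +> x"

lemma coset_eq_iff: "x : carrier A ==> y : carrier A ==> coset x = coset y \<longleftrightarrow> x \<ominus> y : I"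
 using quotient_eq_iff_same_a_r_cos[OF I.ideal_axioms] by blast

lemma coset_carrier: "carrier (factor A I) = coset ` carrier A" by (auto simp: factor_simps A_RCOSETS_def')

lemma coset_mult: "x : carrier A ==> y : carrier A ==> coset (x \<otimes> y) = coset x \<otimes>\<^bsub>factor A I\<^esub> coset y"
 by (simp add: factor_simps I.rcoset_mult_add)

lemma coset_add: "x : carrier A ==> y : carrier A ==> coset (x \<oplus> y) = coset x \<oplus>\<^bsub>factor A I\<^esub> coset y"
 by (simp add: factor_simps I.a_rcos_sum)

lemma coset_one: "coset \<one> = \<one>\<^bsub>factor A I\<^esub>" by (simp add: factor_simps)

lemma coset_zero: "coset \<zero> = \<zero>\<^bsub>factor A I\<^esub>"
 using I.Icarr by (auto simp: factor_simps a_r_coset_def')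

lemma coset_self: "x : carrier A ==> x : coset x" using a_r_coset_def'[of A I x] I.zero_closed by force

lemma coset_mem: "y : coset x ==> x : carrier A ==> y : carrier A & coset y = coset x"
proof -
 assume y: "y : coset x" and x: "x : carrier A"
 then obtain i where i: "i : I" "y = i \<oplus> x" by (auto simp: a_r_coset_def')
 then have "y : carrier A" "y \<ominus> x = i" using x I.Icarr by (auto simp: minus_eq a_assoc r_neg)
 then show ?thesis using coset_eq_iff[of y x] i x by simp
qed

lemma coset_scale:
 assumes x: "x : carrier A"
 shows "coset (c \<odot>\<^bsub>A\<^esub> x) = c \<odot>\<^bsub>factor A I\<^esub> coset x"
proof -
 have "coset (c \<odot>\<^bsub>A\<^esub> y) = coset (c \<odot>\<^bsub>A\<^esub> x)" if y: "y : coset x" for y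
 proof -
  obtain i where i: "i : I" "y = i \<oplus> x" using y unfolding a_r_coset_def' by blast
  have "c \<odot>\<^bsub>A\<^esub> y \<ominus> c \<odot>\<^bsub>A\<^esub> x = c \<odot>\<^bsub>A\<^esub> i"
   using i x I.Icarr[OF i(1)] by (simp add: scale_add minus_eq a_assoc r_neg)
  then have "c \<odot>\<^bsub>A\<^esub> y \<ominus> c \<odot>\<^bsub>A\<^esub> x : I"
   using ideal_scale[OF I.ideal_axioms i(1)] by simp
  then show ?thesis
   using coset_eq_iff[of "c \<odot>\<^bsub>A\<^esub> y" "c \<odot>\<^bsub>A\<^esub> x"] coset_mem[OF y x] x by simp
 qed
 then have "(\<Union>y\<in>coset x. coset (c \<odot>\<^bsub>A\<^esub> y)) = coset (c \<odot>\<^bsub>A\<^esub> x)"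
  using coset_self[OF x] by blast
 then show ?thesis by (simp only: factor_simps)
qed

lemma ring_factor: "ring (factor A I)" and coset_hom: "coset : ring_hom A (factor A I)"
 using ring_homomorphic_image[OF ring_axioms, of coset "factor A I"]
 by (auto simp: coset_carrier coset_mult coset_add coset_one coset_zero)

lemma coset_minus: "x : carrier A ==> y : carrier A ==> coset (x \<ominus> y) = coset x \<ominus>\<^bsub>factor A I\<^esub> coset y"
proof -
 assume x: "x : carrier A" and y: "y : carrier A"
 interpret F: ring "factor A I" by (rule ring_factor)
 have cl: "coset z : carrier (factor A I)" if "z : carrier A" for z using that by (simp add: coset_carrier)
 have "coset (x \<ominus> y) \<oplus>\<^bsub>factor A I\<^esub> coset y = coset x"
  using x y by (simp add: coset_add[symmetric] minus_eq a_assoc l_neg)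
 moreover have "coset (x \<ominus> y) = (coset (x \<ominus> y) \<oplus>\<^bsub>factor A I\<^esub> coset y) \<ominus>\<^bsub>factor A I\<^esub> coset y"
  using cl x y by (simp add: F.minus_eq F.a_assoc F.r_neg)
 ultimately show ?thesis by simp
qed

lemma algebra_over_factor: "algebra_over (factor A I)"
proof -
 interpret F: ring "factor A I" by (rule ring_factor)
 show ?thesis
 proof
  fix X Y c d assume "X : carrier (factor A I)" "Y : carrier (factor A I)"
  then obtain x y where [simp]: "x : carrier A" "y : carrier A" "X = coset x" "Y = coset y"
   by (auto simp: coset_carrier)
  show "c \<odot>\<^bsub>factor A I\<^esub> X : carrier (factor A I)"
   by (auto simp: coset_carrier simp flip: coset_scale)
  show "c \<odot>\<^bsub>factor A I\<^esub> (X \<oplus>\<^bsub>factor A I\<^esub> Y) = c \<odot>\<^bsub>factor A I\<^esub> X \<oplus>\<^bsub>factor A I\<^esub> c \<odot>\<^bsub>factor A I\<^esub> Y"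
   by (simp add: scale_add flip: coset_scale coset_add)
  show "(c + d) \<odot>\<^bsub>factor A I\<^esub> X = c \<odot>\<^bsub>factor A I\<^esub> X \<oplus>\<^bsub>factor A I\<^esub> d \<odot>\<^bsub>factor A I\<^esub> X"
   by (simp add: add_scale flip: coset_scale coset_add)
  show "(c * d) \<odot>\<^bsub>factor A I\<^esub> X = c \<odot>\<^bsub>factor A I\<^esub> (d \<odot>\<^bsub>factor A I\<^esub> X)"
   by (simp add: scale_scale flip: coset_scale)
  show "1 \<odot>\<^bsub>factor A I\<^esub> X = X" by (simp add: scale_one flip: coset_scale)
  show "(c \<odot>\<^bsub>factor A I\<^esub> X) \<otimes>\<^bsub>factor A I\<^esub> Y = c \<odot>\<^bsub>factor A I\<^esub> (X \<otimes>\<^bsub>factor A I\<^esub> Y)"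
   by (simp add: scale_mult_left flip: coset_scale coset_mult)
  show "X \<otimes>\<^bsub>factor A I\<^esub> (c \<odot>\<^bsub>factor A I\<^esub> Y) = c \<odot>\<^bsub>factor A I\<^esub> (X \<otimes>\<^bsub>factor A I\<^esub> Y)"
   by (simp add: scale_mult_right flip: coset_scale coset_mult)
 qed
qed

lemma coset_in: "x : carrier A ==> coset x : carrier (factor A I)" by (simp add: coset_carrier)

end

subsection \<open>Path algebras\<close>

definition path_mult ::
 "('v, 'b) pre_digraph => ('v \<times> 'b list => 'k::field) => ('v \<times> 'b list => 'k) => 'v \<times> 'b list => 'k" where
 "path_mult G f g = (%(u, p). \<Sum>n\<le>length p.
   f (u, take n p) * g (pre_digraph.awlast G u (take n p), drop n p))"

definition pfunctions :: "('v, 'b) pre_digraph => ('v \<times> 'b list => 'k::field) set" where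
 "pfunctions G = {f. ALL x. f x ~= 0 --> x : quiver_paths G}"

text \<open>Formal series of paths under the same convolution, in which every coefficient is a
  finite sum. The map \<open>Theta\<close> below presents the completed preprojective algebra as an
  image of it.\<close>

definition complete_path_algebra ::
 "('v, 'b) pre_digraph => ('k::field, 'v \<times> 'b list => 'k) module" where
 "complete_path_algebra G = path_algebra G\<lparr>carrier := pfunctions G\<rparr>"

lemma path_algebra_simps:
 "mult (path_algebra G) = path_mult G"
 "add (path_algebra G) = (+)"
 "zero (path_algebra G) = 0"
 "smult (path_algebra G) = fscale"
 "carrier (path_algebra G) = {f : pfunctions G. finite {x. f x ~= 0}}"
 by (auto simp: path_algebra_def path_mult_def fun_eq_iff pfunctions_def)

lemma complete_path_algebra_simps:
 "mult (complete_path_algebra G) = path_mult G"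
 "add (complete_path_algebra G) = (+)"
 "zero (complete_path_algebra G) = 0"
 "smult (complete_path_algebra G) = fscale"
 "carrier (complete_path_algebra G) = pfunctions G"
 "one (complete_path_algebra G) = one (path_algebra G)" by (simp_all add: complete_path_algebra_def path_algebra_simps)

lemma pfunctionsI: "(!!u p. f (u, p) ~= 0 ==> (u, p) : quiver_paths G) ==> f : pfunctions G"
 by (auto simp: pfunctions_def)

lemma pfunctionsD: "f : pfunctions G ==> x ~: quiver_paths G ==> f x = 0" unfolding pfunctions_def by blast

lemma fun_subspace_pfunctions:
 fixes G :: "('v, 'b) pre_digraph"
 shows "fun_subspace (pfunctions G :: ('v \<times> 'b list => 'k::field) set)"
proof (rule fun_subspaceI)
 fix f g :: "'v \<times> 'b list => 'k" assume f: "f : pfunctions G" and g: "g : pfunctions G"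
 show "f + g : pfunctions G" by (rule pfunctionsI) (use pfunctionsD[OF f] pfunctionsD[OF g] in fastforce)
next
 fix c and f :: "'v \<times> 'b list => 'k" assume f: "f : pfunctions G"
 show "fscale c f : pfunctions G" by (rule pfunctionsI) (use pfunctionsD[OF f] in fastforce)
qed (simp add: pfunctions_def)

lemma fun_subspace_path_algebra:
 fixes G :: "('v, 'b) pre_digraph"
 shows "fun_subspace (carrier (path_algebra G) :: ('v \<times> 'b list => 'k::field) set)"
proof (rule fun_subspaceI)
 fix f g :: "'v \<times> 'b list => 'k"
 assume "f : carrier (path_algebra G)" "g : carrier (path_algebra G)"
 moreover have "{x. (f + g) x ~= 0} <= {x. f x ~= 0} \<union> {x. g x ~= 0}" by auto
 ultimately show "f + g : carrier (path_algebra G)" using fun_subspace_add[OF fun_subspace_pfunctions]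
  unfolding path_algebra_simps mem_Collect_eq by (meson finite_UnI finite_subset)
next
 fix c and f :: "'v \<times> 'b list => 'k" assume "f : carrier (path_algebra G)"
 moreover have "{x. fscale c f x ~= 0} <= {x. f x ~= 0}" by auto
 ultimately show "fscale c f : carrier (path_algebra G)" using fun_subspace_scale[OF fun_subspace_pfunctions]
  unfolding path_algebra_simps mem_Collect_eq by (meson finite_subset)
qed (simp add: path_algebra_simps pfunctions_def)

lemma path_mult_add_left: "path_mult G (f + g) h = path_mult G f h + path_mult G g h"
 and path_mult_add_right: "path_mult G h (f + g) = path_mult G h f + path_mult G h g"
 and path_mult_scale_left: "path_mult G (fscale c f) h = fscale c (path_mult G f h)"
 and path_mult_scale_right: "path_mult G h (fscale c f) = fscale c (path_mult G h f)"
 by (auto simp: path_mult_def fun_eq_iff algebra_simps sum.distrib sum_distrib_left)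

lemma fun_linear_path_mult_left: "fun_linear (%f. path_mult G f h)"
 and fun_linear_path_mult_right: "fun_linear (path_mult G h)"
 by (auto intro!: fun_linearI simp: path_mult_add_left path_mult_add_right path_mult_scale_left path_mult_scale_right)

lemmas path_mult_0_left = fun_linear_0[OF fun_linear_path_mult_left]
 and path_mult_0_right = fun_linear_0[OF fun_linear_path_mult_right]
 and path_mult_sum_left = fun_linear_sum[OF fun_linear_path_mult_left]
 and path_mult_sum_right = fun_linear_sum[OF fun_linear_path_mult_right]
 and path_mult_diff_left = fun_linear_diff[OF fun_linear_path_mult_left]
 and path_mult_diff_right = fun_linear_diff[OF fun_linear_path_mult_right]

context wf_digraph
begin

lemma path_mult_assoc: "path_mult G (path_mult G f g) h = path_mult G f (path_mult G g h)"
proof (rule ext, clarify)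
 fix u p
 define F where "F m n = f (u, take m p) * g (awlast u (take m p), drop m (take n p)) *
   h (awlast u (take n p), drop n p)" for m n
 have "path_mult G (path_mult G f g) h (u, p) = (\<Sum>n\<le>length p. \<Sum>m\<le>n. F m n)"
  by (simp add: path_mult_def F_def sum_distrib_right min_absorb1 cong: sum.cong_simp)
 also have "\<dots> = (\<Sum>(n, m)\<in>Sigma {..length p} (%n. {..n}). F m n)" by (rule sum.Sigma) auto
 \<comment> \<open>A pair of cuts m <= n of the path is recorded as the first cut and the distance
   to the second.\<close>
 also have "\<dots> = (\<Sum>(m, k)\<in>Sigma {..length p} (%m. {..length p - m}). F m (k + m))"
  by (rule sum.reindex_bij_witness[of _ "%(m, k). (k + m, m)" "%(n, m). (m, n - m)"]) auto
 also have "\<dots> = (\<Sum>m\<le>length p. \<Sum>k\<le>length p - m. F m (k + m))" by (rule sum.Sigma[symmetric]) auto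
 also have "\<dots> = path_mult G f (path_mult G g h) (u, p)"
 proof -
  have "awlast (awlast u (take m p)) (take k (drop m p)) = awlast u (take (k + m) p)" for k m
   by (metis awlast_append append_take_drop_id add.commute take_add)
  then show ?thesis by (simp add: path_mult_def F_def sum_distrib_left take_drop mult.assoc add.commute)
 qed
 finally show "path_mult G (path_mult G f g) h (u, p) = path_mult G f (path_mult G g h) (u, p)" .
qed

lemma path_one_mult:
 assumes "f : pfunctions G"
 shows "path_mult G \<one>\<^bsub>path_algebra G\<^esub> f = f"
proof (rule ext, clarify)
 fix u p
 have "path_mult G \<one>\<^bsub>path_algebra G\<^esub> f (u, p) = (\<Sum>n\<le>length p. if n = 0 then (if u : verts G then f (u, p) else 0) else 0)"
  unfolding path_mult_def prod.case by (rule sum.cong) (auto simp: path_algebra_def)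
 also have "\<dots> = f (u, p)" using pfunctionsD[OF assms, of "(u, p)"] quiver_paths_start[of u p] by auto
 finally show "path_mult G \<one>\<^bsub>path_algebra G\<^esub> f (u, p) = f (u, p)" .
qed

lemma path_mult_one:
 assumes "f : pfunctions G"
 shows "path_mult G f \<one>\<^bsub>path_algebra G\<^esub> = f"
proof (rule ext, clarify)
 fix u p
 have "path_mult G f \<one>\<^bsub>path_algebra G\<^esub> (u, p) =
   (\<Sum>n\<le>length p. if n = length p then (if awlast u p : verts G then f (u, p) else 0) else 0)"
  unfolding path_mult_def prod.case by (rule sum.cong) (auto simp: path_algebra_def)
 also have "\<dots> = f (u, p)" using pfunctionsD[OF assms, of "(u, p)"] quiver_paths_end[of u p] by auto
 finally show "path_mult G f \<one>\<^bsub>path_algebra G\<^esub> (u, p) = f (u, p)" .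
qed

lemma path_mult_nonzero:
 assumes "path_mult G f g (u, p) ~= 0"
 obtains q r where "p = q @ r" "f (u, q) ~= 0" "g (awlast u q, r) ~= 0"
proof -
 obtain n where "f (u, take n p) * g (awlast u (take n p), drop n p) ~= 0"
  using assms unfolding path_mult_def prod.case by (meson sum.neutral)
 then show ?thesis using that[of "take n p" "drop n p"] by simp
qed

lemma path_mult_closed:
 assumes "f : pfunctions G" "g : pfunctions G"
 shows "path_mult G f g : pfunctions G"
proof (rule pfunctionsI)
 fix u p assume "path_mult G f g (u, p) ~= 0"
 then obtain q r where "p = q @ r" "f (u, q) ~= 0" "g (awlast u q, r) ~= 0" by (rule path_mult_nonzero)
 then show "(u, p) : quiver_paths G"
  using pfunctionsD[OF assms(1)] pfunctionsD[OF assms(2)] by (auto simp: quiver_paths_append)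
qed

lemma path_mult_finite:
 assumes "finite {x. f x ~= 0}" "finite {x. g x ~= 0}"
 shows "finite {x. path_mult G f g x ~= 0}"
proof (rule finite_subset)
 show "{x. path_mult G f g x ~= 0} \<subseteq> (%(x, y). (fst x, snd x @ snd y)) ` ({x. f x ~= 0} \<times> {x. g x ~= 0})"
  by (force elim!: path_mult_nonzero)
qed (use assms in auto)

lemma path_one_functions: "\<one>\<^bsub>path_algebra G\<^esub> : pfunctions G"
 by (auto intro!: pfunctionsI simp: path_algebra_def split: if_splits)

end

lemma fun_subspace_uminus: "fun_subspace U ==> f : U ==> - f : U"
 using fun_subspace_diff[of U 0 f] fun_subspace_0[of U] by simp

lemma algebra_overI_functions:
 fixes A :: "('k::field, 'x => 'k) module"
 assumes add: "add A = (+)" and zero: "zero A = 0" and smult: "smult A = fscale"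
  and sub: "fun_subspace (carrier A)"
  and one: "\<one>\<^bsub>A\<^esub> : carrier A"
  and closed: "!!f g. f : carrier A ==> g : carrier A ==> f \<otimes>\<^bsub>A\<^esub> g : carrier A"
  and assoc: "!!f g h. f : carrier A ==> g : carrier A ==> h : carrier A ==>
   f \<otimes>\<^bsub>A\<^esub> g \<otimes>\<^bsub>A\<^esub> h = f \<otimes>\<^bsub>A\<^esub> (g \<otimes>\<^bsub>A\<^esub> h)"
  and unit: "!!f. f : carrier A ==> \<one>\<^bsub>A\<^esub> \<otimes>\<^bsub>A\<^esub> f = f" "!!f. f : carrier A ==> f \<otimes>\<^bsub>A\<^esub> \<one>\<^bsub>A\<^esub> = f"
  and linear: "!!f. fun_linear (%g. f \<otimes>\<^bsub>A\<^esub> g)" "!!f. fun_linear (%g. g \<otimes>\<^bsub>A\<^esub> f)"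
 shows "algebra_over A"
proof -
 have "ring A"
 proof (intro ringI abelian_groupI monoidI)
  fix f assume "f : carrier A"
  then have "- f : carrier A" "- f + f = 0" using fun_subspace_uminus[OF sub] by auto
  then show "EX g:carrier A. g \<oplus>\<^bsub>A\<^esub> f = \<zero>\<^bsub>A\<^esub>" using add zero by metis
 qed (auto simp: add zero fun_subspace_add[OF sub] fun_subspace_0[OF sub] one closed assoc unit add.assoc
   add.commute fun_linear_add[OF linear(1)] fun_linear_add[OF linear(2)])
 then interpret ring A .
 show ?thesis by unfold_locales
   (simp_all add: add smult fun_subspace_scale[OF sub] fun_eq_iff algebra_simps
    fun_linear_scale[OF linear(1)] fun_linear_scale[OF linear(2)])
qed

context wf_digraph
begin

lemma finite_support_one:
 assumes "finite (verts G)"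
 shows "finite {x. \<one>\<^bsub>path_algebra G\<^esub> x ~= (0::'k::field)}"
proof (rule finite_subset)
 show "{x. \<one>\<^bsub>path_algebra G\<^esub> x ~= (0::'k)} <= verts G \<times> {[]}"
  by (auto simp: path_algebra_def split: if_splits)
qed (use assms in simp)

lemma algebra_over_complete_path_algebra: "algebra_over (complete_path_algebra G :: ('k::field, 'a \<times> 'b list => 'k) module)"
 by (rule algebra_overI_functions)
  (simp_all add: complete_path_algebra_simps fun_subspace_pfunctions path_mult_closed path_mult_assoc
   path_one_functions path_one_mult path_mult_one fun_linear_path_mult_left fun_linear_path_mult_right)

end

lemma (in fin_digraph) algebra_over_path_algebra:
 "algebra_over (path_algebra G :: ('k::field, 'a \<times> 'b list => 'k) module)"
proof (rule algebra_overI_functions)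
 show "fun_subspace (carrier (path_algebra G :: ('k, 'a \<times> 'b list => 'k) module))"
  by (rule fun_subspace_path_algebra)
qed (simp_all add: path_algebra_simps path_mult_closed path_mult_assoc path_mult_finite
   path_one_functions path_one_mult path_mult_one fun_linear_path_mult_left fun_linear_path_mult_right
   finite_support_one)

lemma path_elem_apply: "path_elem x y = (if y = x then 1 else 0)" by (simp add: path_elem_def)

lemma path_elem_carrier: "x : quiver_paths G ==> path_elem x : carrier (path_algebra G)"
 by (auto simp: path_algebra_simps pfunctions_def path_elem_apply)

lemma path_elem_functions: "x : quiver_paths G ==> path_elem x : pfunctions G"
 by (auto simp: pfunctions_def path_elem_apply)

lemma path_algebra_induct [consumes 1, case_names zero step]:
 assumes "f : carrier (path_algebra G)" and zero: "S 0"
  and step: "!!c x f. x : quiver_paths G ==> f : carrier (path_algebra G) ==> S f ==> S (fscale c (path_elem x) + f)"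
 shows "S f"
proof -
 have "finite A ==> (ALL f:carrier (path_algebra G). {x. f x ~= 0} = A --> S f)" for A
 proof (induction A rule: finite_induct)
  case empty
  have "f = 0" if "{x. f x ~= 0} = {}" for f :: "'a \<times> 'b list => 'c" using that by (auto simp: fun_eq_iff)
  then show ?case using zero by auto
 next
  case (insert x A)
  show ?case
  proof (intro ballI impI)
   fix f :: "'a \<times> 'b list => 'c"
   assume f: "f : carrier (path_algebra G)" "{x. f x ~= 0} = insert x A"
   define g where "g = f(x := 0)"
   have supp: "{x. g x ~= 0} = A" using f(2) insert.hyps(2) by (auto simp: g_def)
   have "f x ~= 0" using f(2) by blast
   then have x: "x : quiver_paths G" using f(1) pfunctionsD[of f G x] by (auto simp: path_algebra_simps)
   have "g : carrier (path_algebra G)"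
    using f insert.hyps(1) supp by (auto simp: path_algebra_simps pfunctions_def g_def fun_upd_def)
   moreover from this have "S g" using insert.IH supp by blast
   moreover have "f = fscale (f x) (path_elem x) + g" by (auto simp: fun_eq_iff g_def path_elem_apply)
   ultimately show "S f" using step[OF x] by metis
  qed
 qed
 then show ?thesis using assms(1) by (auto simp: path_algebra_simps)
qed

context wf_digraph
begin

lemma path_elem_mult:
 "path_mult G (path_elem (w, q)) f (u, p) =
  (if u = w & (EX r. p = q @ r) then f (awlast w q, drop (length q) p) else 0)"
proof -
 have "path_mult G (path_elem (w, q)) f (u, p) =
   (\<Sum>n\<le>length p. if n = length q then (if u = w & take n p = q then f (awlast w q, drop (length q) p) else 0) else 0)"
  unfolding path_mult_def prod.case by (rule sum.cong) (auto simp: path_elem_apply)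
 also have "\<dots> = (if length q <= length p & u = w & take (length q) p = q then f (awlast w q, drop (length q) p) else 0)"
  by simp
 also have "length q <= length p & u = w & take (length q) p = q \<longleftrightarrow> u = w & (EX r. p = q @ r)"
  by (metis append_take_drop_id append_eq_conv_conj length_append le_add1)
 finally show ?thesis by simp
qed

lemma path_elem_mult_path_elem:
 "path_mult G (path_elem (u, p)) (path_elem (w, q)) = (if w = awlast u p then path_elem (u, p @ q) else 0)"
 by (auto simp: fun_eq_iff path_elem_mult path_elem_apply)

end

lemma (in ring) minus_unique: "x : carrier R ==> y : carrier R ==> z : carrier R ==> z \<oplus> y = x ==> x \<ominus> y = z"
 by (auto simp: minus_eq a_assoc r_neg)

context fin_digraph
begin

lemma path_algebra_minus:
 assumes "f : carrier (path_algebra G)" "g : carrier (path_algebra G)"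
 shows "f \<ominus>\<^bsub>path_algebra G\<^esub> g = f - g"
proof -
 interpret algebra_over "path_algebra G" by (rule algebra_over_path_algebra)
 show ?thesis using assms fun_subspace_diff[OF fun_subspace_path_algebra assms]
  by (intro minus_unique) (auto simp: path_algebra_simps(2))
qed

lemma path_algebra_finsum:
 assumes "finite A" "!!i. i : A ==> f i : carrier (path_algebra G)"
 shows "(\<Oplus>\<^bsub>path_algebra G\<^esub>i\<in>A. f i) = (SUM i:A. f i)"
proof -
 interpret algebra_over "path_algebra G" by (rule algebra_over_path_algebra)
 show ?thesis using assms
 proof (induction A rule: finite_induct)
  case (insert x A)
  then have "(\<Oplus>\<^bsub>path_algebra G\<^esub>i\<in>insert x A. f i) = f x \<oplus>\<^bsub>path_algebra G\<^esub> (\<Oplus>\<^bsub>path_algebra G\<^esub>i\<in>A. f i)"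
   by (intro finsum_insert) auto
  then show ?case using insert by (simp add: path_algebra_simps(2))
 qed (simp add: path_algebra_simps(3))
qed

end

subsection \<open>The preprojective relations\<close>

context double_digraph
begin

abbreviation P :: "('k::field, ('v, 'a) dpath => 'k) module" where "P \<equiv> path_algebra D"

abbreviation \<R> :: "(('v, 'a) dpath => 'k::field) set" where "\<R> \<equiv> preproj_ideal Q"

text \<open>The product of p, the total relation and q. The arrows starting at the end of p are
  those that survive the multiplication.\<close>

definition relation_elem :: "'v => ('a + 'a) list => ('a + 'a) list => ('v, 'a) dpath => 'k::field" where
 "relation_elem u p q = (SUM c:{c : arcs D. tail D c = D.awlast u p}.
   fscale (arrow_sign c) (path_elem (u, p @ [c, opposite c] @ q)))"

definition total_relation :: "('v, 'a) dpath => 'k::field" where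
 "total_relation = (SUM c:arcs D. fscale (arrow_sign c) (path_elem (tail D c, [c, opposite c])))"

lemma double_path: "c : arcs D ==> (tail D c, [c, opposite c]) : quiver_paths D"
 using D.tail_in_verts[of c] by (simp add: D.quiver_paths_Cons)

lemma total_relation_carrier: "total_relation : carrier P" unfolding total_relation_def
 by (intro fun_subspace_sum[OF fun_subspace_path_algebra] fun_subspace_scale[OF fun_subspace_path_algebra]
   path_elem_carrier double_path)

lemma preproj_ideal_eq: "(\<R> :: (('v, 'a) dpath => 'k::field) set) = Idl\<^bsub>P\<^esub> {total_relation}"
proof -
 let ?P = "P :: ('k, ('v, 'a) dpath => 'k) module"
 let ?f = "%b. path_elem (tail D (Inl b), [Inl b, Inr b]) - path_elem (tail D (Inr b), [Inr b, Inl b]) ::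
  ('v, 'a) dpath => 'k"
 have car: "path_elem (tail D (Inl b), [Inl b, Inr b]) : carrier ?P"
  "path_elem (tail D (Inr b), [Inr b, Inl b]) : carrier ?P" if "b : arcs Q" for b
  using that double_path[of "Inl b"] double_path[of "Inr b"] path_elem_carrier by force+
 have "(\<Oplus>\<^bsub>?P\<^esub>b\<in>arcs Q. (arrow_elem D (Inl b) \<otimes>\<^bsub>?P\<^esub> arrow_elem D (Inr b))
      \<ominus>\<^bsub>?P\<^esub> (arrow_elem D (Inr b) \<otimes>\<^bsub>?P\<^esub> arrow_elem D (Inl b))) =
   (\<Oplus>\<^bsub>?P\<^esub>b\<in>arcs Q. ?f b)"
 proof (rule abelian_monoid.finsum_cong'[OF _ HOL.refl])
  interpret algebra_over ?P by (rule D.algebra_over_path_algebra)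
  show "abelian_monoid ?P" by (rule abelian_monoid_axioms)
  show "?f : arcs Q \<rightarrow> carrier ?P" using car fun_subspace_diff[OF fun_subspace_path_algebra] by blast
  fix b assume "b : arcs Q"
  then show "(arrow_elem D (Inl b) \<otimes>\<^bsub>?P\<^esub> arrow_elem D (Inr b))
      \<ominus>\<^bsub>?P\<^esub> (arrow_elem D (Inr b) \<otimes>\<^bsub>?P\<^esub> arrow_elem D (Inl b)) = ?f b"
   using car by (simp add: path_algebra_simps(1) D.path_elem_mult_path_elem D.awlast_eq D.path_algebra_minus)
 qed
 also have "\<dots> = (SUM b:arcs Q. ?f b)"
  by (intro D.path_algebra_finsum finite_arcs fun_subspace_diff[OF fun_subspace_path_algebra] car)
 also have "\<dots> = total_relation" unfolding total_relation_def sum_double_quiver[OF finite_arcs]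
  by (rule sum.cong) (auto simp: fun_eq_iff)
 finally show ?thesis by (simp add: preproj_ideal_def Let_def)
qed

sublocale R: algebra_ideal "P :: ('k::field, ('v, 'a) dpath => 'k) module" "\<R>"
proof -
 interpret algebra_over "P :: ('k, ('v, 'a) dpath => 'k) module" by (rule D.algebra_over_path_algebra)
 show "algebra_ideal (P :: ('k, ('v, 'a) dpath => 'k) module) \<R>" unfolding preproj_ideal_eq algebra_ideal_def
  using total_relation_carrier algebra_over_axioms by (auto intro: genideal_ideal)
qed

end

lemma algebra_homomorphic_image:
 assumes "algebra_over A" and surj: "h ` carrier A = carrier B"
  and mult: "!!x y. x : carrier A ==> y : carrier A ==> h (x \<otimes>\<^bsub>A\<^esub> y) = h x \<otimes>\<^bsub>B\<^esub> h y"
  and add: "!!x y. x : carrier A ==> y : carrier A ==> h (x \<oplus>\<^bsub>A\<^esub> y) = h x \<oplus>\<^bsub>B\<^esub> h y"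
  and one: "h \<one>\<^bsub>A\<^esub> = \<one>\<^bsub>B\<^esub>" and zero: "h \<zero>\<^bsub>A\<^esub> = \<zero>\<^bsub>B\<^esub>"
  and scale: "!!c x. x : carrier A ==> h (c \<odot>\<^bsub>A\<^esub> x) = c \<odot>\<^bsub>B\<^esub> h x"
 shows "algebra_over B"
proof -
 interpret A: algebra_over A by fact
 interpret B: ring B using ring_homomorphic_image(1)[OF A.ring_axioms surj mult add one zero] .
 have im: "h x : carrier B" if "x : carrier A" for x using that surj by blast
 show ?thesis
 proof
  fix X Y c d assume "X : carrier B" "Y : carrier B"
  then obtain x y where [simp]: "x : carrier A" "y : carrier A" "X = h x" "Y = h y" using surj by blast
  show "c \<odot>\<^bsub>B\<^esub> X : carrier B" by (simp add: im flip: scale)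
  show "c \<odot>\<^bsub>B\<^esub> (X \<oplus>\<^bsub>B\<^esub> Y) = c \<odot>\<^bsub>B\<^esub> X \<oplus>\<^bsub>B\<^esub> c \<odot>\<^bsub>B\<^esub> Y"
   by (simp add: A.scale_add flip: scale add)
  show "(c + d) \<odot>\<^bsub>B\<^esub> X = c \<odot>\<^bsub>B\<^esub> X \<oplus>\<^bsub>B\<^esub> d \<odot>\<^bsub>B\<^esub> X"
   by (simp add: A.add_scale flip: scale add)
  show "(c * d) \<odot>\<^bsub>B\<^esub> X = c \<odot>\<^bsub>B\<^esub> (d \<odot>\<^bsub>B\<^esub> X)"
   by (simp add: A.scale_scale flip: scale)
  show "1 \<odot>\<^bsub>B\<^esub> X = X" by (simp add: A.scale_one flip: scale)
  show "(c \<odot>\<^bsub>B\<^esub> X) \<otimes>\<^bsub>B\<^esub> Y = c \<odot>\<^bsub>B\<^esub> (X \<otimes>\<^bsub>B\<^esub> Y)"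
   by (simp add: A.scale_mult_left flip: scale mult)
  show "X \<otimes>\<^bsub>B\<^esub> (c \<odot>\<^bsub>B\<^esub> Y) = c \<odot>\<^bsub>B\<^esub> (X \<otimes>\<^bsub>B\<^esub> Y)"
   by (simp add: A.scale_mult_right flip: scale mult)
 qed
qed

section \<open>Truncation by path length, the pairing with functionals, and the ideal of
  relations\<close>

definition below :: "nat => ('v \<times> 'b list => 'k::field) => 'v \<times> 'b list => 'k" where
 "below n f = (%x. if length (snd x) < n then f x else 0)"

lemma below_apply: "below n f x = (if length (snd x) < n then f x else 0)" by (simp add: below_def)

lemma fun_linear_below: "fun_linear (below n)" by (auto intro!: fun_linearI simp: below_def fun_eq_iff)

lemmas below_add = fun_linear_add[OF fun_linear_below] and below_diff = fun_linear_diff[OF fun_linear_below]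
 and below_scale = fun_linear_scale[OF fun_linear_below] and below_0 = fun_linear_0[OF fun_linear_below]

lemma below_functions: "f : pfunctions G ==> below n f : pfunctions G"
 by (auto intro!: pfunctionsI dest: pfunctionsD simp: below_apply split: if_splits)

lemma (in fin_digraph) below_carrier: "f : pfunctions G ==> below n f : carrier (path_algebra G)"
proof -
 assume f: "f : pfunctions G"
 have "{x. below n f x ~= 0} <= {x : quiver_paths G. length (snd x) < n}"
  using pfunctionsD[OF f] by (auto simp: below_apply split: if_splits)
 then show ?thesis using below_functions[OF f] finite_subset[OF _ finite_quiver_paths] by (simp add: path_algebra_simps)
qed

lemma path_algebra_functions: "f : carrier (path_algebra G) ==> f : pfunctions G" by (simp add: path_algebra_simps)

lemma below_path_mult: "below n (path_mult G f g) = below n (path_mult G (below n f) (below n g))"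
proof (rule ext, clarify)
 fix u p
 show "below n (path_mult G f g) (u, p) = below n (path_mult G (below n f) (below n g)) (u, p)"
  by (cases "length p < n") (auto simp: below_apply path_mult_def intro!: sum.cong)
qed

text \<open>A function on paths, viewed as a linear functional and evaluated at an element of finite
  support.\<close>

definition pairing :: "('x => 'k::field) => ('x => 'k) => 'k" where
 "pairing xi f = (SUM x:{x. f x ~= 0}. f x * xi x)"

lemma pairing_eq:
 assumes "finite A" "{x. f x ~= 0} \<subseteq> A"
 shows "pairing xi f = (SUM x:A. f x * xi x)" unfolding pairing_def
proof (rule sum.mono_neutral_left[OF assms], rule ballI)
 fix i assume "i : A - {x. f x ~= 0}"
 then have "f i = 0" by blast
 then show "f i * xi i = 0" by (simp only: mult_zero_left)
qed

lemma pairing_add: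
 assumes "finite {x. f x ~= 0}" "finite {x. g x ~= 0}"
 shows "pairing xi (f + g) = pairing xi f + pairing xi g"
proof -
 let ?A = "{x. f x ~= 0} \<union> {x. g x ~= 0}"
 have "pairing xi (f + g) = (SUM x:?A. (f + g) x * xi x)" by (rule pairing_eq) (use assms in auto)
 also have "\<dots> = (SUM x:?A. f x * xi x) + (SUM x:?A. g x * xi x)" by (simp add: distrib_right sum.distrib)
 also have "(SUM x:?A. f x * xi x) = pairing xi f" by (rule pairing_eq[symmetric]) (use assms in auto)
 also have "(SUM x:?A. g x * xi x) = pairing xi g" by (rule pairing_eq[symmetric]) (use assms in auto)
 finally show ?thesis .
qed

lemma pairing_scale:
 assumes "finite {x. f x ~= 0}"
 shows "pairing xi (fscale c f) = c * pairing xi f"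
proof -
 have "pairing xi (fscale c f) = (SUM x:{x. f x ~= 0}. fscale c f x * xi x)" by (rule pairing_eq) (use assms in auto)
 then show ?thesis by (simp add: pairing_def sum_distrib_left mult.assoc)
qed

lemma pairing_0: "pairing xi 0 = 0" by (simp add: pairing_def)

lemma pairing_path_elem: "pairing xi (path_elem x) = xi x"
 using pairing_eq[of "{x}" "path_elem x" xi] by (auto simp: path_elem_apply)

text \<open>The parameter \<open>field\<close> fixes the scalar type, which the quiver does not
  determine.\<close>

locale preprojective = double_digraph Q for Q :: "('v, 'a) pre_digraph" +
 fixes field :: "'k::field itself"
begin

abbreviation PP :: "('k, ('v, 'a) dpath => 'k) module" where "PP \<equiv> path_algebra D"
abbreviation RR :: "('v, 'a, 'k) pfun set" where "RR \<equiv> preproj_ideal Q"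
abbreviation rel :: "'v => ('a + 'a) list => ('a + 'a) list => ('v, 'a, 'k) pfun" where
 "rel \<equiv> relation_elem"
abbreviation total :: "('v, 'a) dpath => 'k" where "total \<equiv> total_relation"
abbreviation pe :: "('v, 'a) dpath => ('v, 'a, 'k) pfun" where "pe \<equiv> path_elem"
abbreviation mul :: "('v, 'a, 'k) pfun => ('v, 'a, 'k) pfun => ('v, 'a, 'k) pfun" where
 "mul \<equiv> path_mult D"

lemma algebra_over_P: "algebra_over PP" by (rule D.algebra_over_path_algebra)

lemma relation_elem_eq:
 assumes "(u, p) : quiver_paths D" "(v, q) : quiver_paths D"
 shows "mul (mul (pe (u, p)) total) (pe (v, q)) =
  (if D.awlast u p = v then rel u p q else 0)"
proof -
 have "mul (mul (pe (u, p)) (pe (tail D c, [c, opposite c]))) (pe (v, q)) =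
   (if tail D c = D.awlast u p then if D.awlast u p = v then pe (u, p @ [c, opposite c] @ q) else 0 else 0)"
  for c by (auto simp: D.path_elem_mult_path_elem D.awlast_eq path_mult_0_left)
 then have "mul (mul (pe (u, p)) total) (pe (v, q)) =
   (SUM c:arcs D. fscale (arrow_sign c) (if tail D c = D.awlast u p then
     if D.awlast u p = v then pe (u, p @ [c, opposite c] @ q) else 0 else 0))"
  unfolding total_relation_def path_mult_sum_left path_mult_sum_right path_mult_scale_left path_mult_scale_right
  by (simp only:)
 also have "\<dots> = (if D.awlast u p = v then rel u p q else 0)"
 proof -
  have "fscale (arrow_sign c) (if tail D c = D.awlast u p then
     if D.awlast u p = v then pe (u, p @ [c, opposite c] @ q) else 0 else 0) =
    (if D.awlast u p = v then if tail D c = D.awlast u p then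
     fscale (arrow_sign c) (pe (u, p @ [c, opposite c] @ q)) else 0 else 0)" for c by (rule ext) simp
  then show ?thesis unfolding relation_elem_def sum.inter_filter[OF D.finite_arcs]
   by (cases "D.awlast u p = v") (simp_all only: if_True if_False simp_thms sum.neutral_const)
 qed
 finally show ?thesis .
qed

lemma R_subspace: "fun_subspace RR"
proof (rule fun_subspaceI)
 show "0 : RR" using R.I.zero_closed by (simp add: path_algebra_simps)
 fix f g :: "('v, 'a) dpath => 'k" assume "f : RR" "g : RR"
 then show "f + g : RR" using R.I.a_closed[of f g] by (simp add: path_algebra_simps)
next
 fix c and f :: "('v, 'a) dpath => 'k" assume "f : RR"
 then show "fscale c f : RR" using R.ideal_scale[OF R.I.ideal_axioms, of f c] by (simp add: path_algebra_simps)
qed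

lemmas R_add = fun_subspace_add[OF R_subspace] and R_diff = fun_subspace_diff[OF R_subspace]
 and R_scale = fun_subspace_scale[OF R_subspace] and R_0 = fun_subspace_0[OF R_subspace]
 and R_sum = fun_subspace_sum[OF R_subspace]

lemma R_carrier: "f : RR ==> f : carrier PP" by (rule R.I.Icarr)

lemma R_mult_left: "f : RR ==> g : carrier PP ==> mul g f : RR"
 and R_mult_right: "f : RR ==> g : carrier PP ==> mul f g : RR"
 using R.I.I_l_closed[of f g] R.I.I_r_closed[of f g] by (simp_all add: path_algebra_simps(1))

lemma total_relation_in_R: "total : RR" unfolding preproj_ideal_eq
 using ring.genideal_self'[OF algebra_over.axioms(1)[OF algebra_over_P]] total_relation_carrier by blast

lemma relation_elem_in_R:
 assumes "(u, p) : quiver_paths D" "(D.awlast u p, q) : quiver_paths D"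
 shows "rel u p q : RR"
proof -
 have "mul (mul (pe (u, p)) total) (pe (D.awlast u p, q)) : RR"
  by (intro R_mult_left R_mult_right total_relation_in_R path_elem_carrier assms)
 then show ?thesis unfolding relation_elem_eq[OF assms] by (simp split: if_splits)
qed

inductive_set relation_span :: "('v, 'a, 'k) pfun set" where
 zero: "0 : relation_span"
| step: "(u, p) : quiver_paths D ==> (D.awlast u p, q) : quiver_paths D ==> f : relation_span ==>
  fscale c (rel u p q) + f : relation_span"

lemma relation_span_add: "f : relation_span ==> g : relation_span ==> f + g : relation_span"
proof (induction rule: relation_span.induct)
 case (step u p q f c)
 then show ?case unfolding add.assoc by (intro relation_span.step)
qed simp

lemma relation_span_scale: "f : relation_span ==> fscale d f : relation_span"
proof (induction rule: relation_span.induct)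
 case zero
 have "fscale d (0 :: ('v, 'a) dpath => 'k) = 0" by (simp add: fun_eq_iff)
 then show ?case using relation_span.zero by metis
next
 case (step u p q f c)
 have "fscale d (fscale c (rel u p q) + f) = fscale (d * c) (rel u p q) + fscale d f"
  by (simp add: fun_eq_iff algebra_simps)
 then show ?case using relation_span.step[OF step(1,2,4), of "d * c"] by (simp only:)
qed

lemma relation_span_relation_elem:
 assumes "(u, p) : quiver_paths D" "(D.awlast u p, q) : quiver_paths D"
 shows "rel u p q : relation_span"
proof -
 have "fscale 1 (rel u p q) + 0 = (rel u p q :: ('v, 'a) dpath => 'k)" by (simp add: fun_eq_iff)
 then show ?thesis using relation_span.step[OF assms relation_span.zero, of 1] by metis
qed

text \<open>Expanding the outer factors of a two-sided sum into paths shows that the relations p r q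
  span the ideal. Homogeneity and the vanishing of pairings can then be checked on these
  elements.\<close>

lemma R_relation_span:
 assumes "f : RR"
 shows "f : relation_span"
proof -
 have *: "mul (mul f total) g : relation_span"
  if "f : carrier PP" "g : carrier PP" for f g using that
 proof (induction f rule: path_algebra_induct)
  case zero
  then show ?case by (simp only: path_mult_0_left relation_span.zero)
 next
  case (step c x f)
  obtain u p where x: "x = (u, p)" by (cases x)
  have "mul (mul (pe x) total) g : relation_span" using \<open>g : carrier PP\<close>
  proof (induction g rule: path_algebra_induct)
   case zero
   then show ?case by (simp only: path_mult_0_right relation_span.zero)
  next
   case (step d y g)
   obtain v q where y: "y = (v, q)" by (cases y)
   have "mul (mul (pe x) total) (pe y) : relation_span"
    using relation_elem_eq[of u p v q] \<open>x : quiver_paths D\<close> step(1) x y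
     relation_span_relation_elem[of u p q] relation_span.zero by (cases "D.awlast u p = v") simp_all
   then show ?case
    using step(3) by (simp only: path_mult_add_right path_mult_scale_right relation_span_add relation_span_scale)
  qed
  then show ?case
   using step by (simp only: path_mult_add_left path_mult_scale_left relation_span_add relation_span_scale)
 qed
 have "f : two_sided_sums PP {total}"
  using assms ring.genideal_eq_two_sided_sums[OF algebra_over.axioms(1)[OF algebra_over_P], of "{total}"]
   total_relation_carrier unfolding preproj_ideal_eq by blast
 then show ?thesis
 proof induction
  case zero
  then show ?case by (simp only: path_algebra_simps relation_span.zero)
 next
  case (step a s b y)
  then have "mul (mul a s) b : relation_span" using *[of a b] by blast
  then show ?case unfolding path_algebra_simps(1,2) by (rule relation_span_add) (rule step)
 qed
qed

lemma below_relation_elem: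
 "below n (rel u p q) = (if length p + length q + 2 < n then rel u p q else 0)"
 by (auto simp: fun_eq_iff relation_elem_def below_apply sum_fun_apply path_elem_apply intro!: sum.neutral sum.cong)

text \<open>The ideal of relations is homogeneous.\<close>

lemma below_R: "f : RR ==> below n f : RR"
proof -
 assume "f : RR"
 then have "f : relation_span" by (rule R_relation_span)
 then show ?thesis
 proof (induction rule: relation_span.induct)
  case zero
  then show ?case by (simp only: below_0 R_0)
 next
  case (step u p q f c)
  have "below n (rel u p q) : RR" unfolding below_relation_elem using relation_elem_in_R[OF step(1,2)] R_0 by presburger
  then show ?case using step(4) by (simp only: below_add below_scale R_add R_scale)
 qed
qed

lemma P_finite: "f : carrier PP ==> finite {x. f x ~= 0}" by (simp add: path_algebra_simps)

text \<open>On a spanning relation the pairing is the equation defining \<open>dual_module\<close>;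
  the arrows that do not start at the end of p contribute words that are not paths, where xi
  vanishes.\<close>

lemma pairing_R:
 assumes xi: "xi : dual_module Q" and "f : RR"
 shows "pairing xi f = 0"
proof -
 have pairing_rel: "pairing xi (rel u p q) = 0"
  if "(u, p) : quiver_paths D" "(D.awlast u p, q) : quiver_paths D" for u p q
 proof -
  have fin: "finite {x. (SUM c:C. fscale (arrow_sign c) (pe (u, p @ [c, opposite c] @ q))) x ~= (0::'k)}"
   if "finite C" for C
  proof (rule finite_subset)
   show "{x. (SUM c:C. fscale (arrow_sign c) (pe (u, p @ [c, opposite c] @ q))) x ~= (0::'k)}
     \<subseteq> (%c. (u, p @ [c, opposite c] @ q)) ` C"
    by (auto simp: sum_fun_apply path_elem_apply split: if_splits elim!: sum.not_neutral_contains_not_neutral)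
  qed (use that in simp)
  have "pairing xi (SUM c:C. fscale (arrow_sign c) (pe (u, p @ [c, opposite c] @ q))) =
    (SUM c:C. arrow_sign c * xi (u, p @ [c, opposite c] @ q))" if "finite C" for C using that
  proof (induction C rule: finite_induct)
   case empty
   show ?case by (simp only: sum.empty pairing_0)
  next
   case (insert c C)
   have "finite {x. (pe y :: _ => 'k) x ~= 0}" for y :: "('v, 'a) dpath"
    by (rule finite_subset[of _ "{y}"]) (auto simp: path_elem_apply)
   moreover from this have "finite {x. fscale (arrow_sign c) (pe y :: _ => 'k) x ~= 0}" for y :: "('v, 'a) dpath"
    by (rule rev_finite_subset) auto
   ultimately show ?case
    using insert fin[of C] by (simp only: sum.insert pairing_add pairing_scale pairing_path_elem not_False_eq_True)
  qed
  then have "pairing xi (rel u p q) =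
    (SUM c:{c : arcs D. tail D c = D.awlast u p}. arrow_sign c * xi (u, p @ [c, opposite c] @ q))"
   unfolding relation_elem_def by simp
  also have "\<dots> = (SUM c:arcs D. arrow_sign c * xi (u, p @ [c, opposite c] @ q))"
  proof (rule sum.mono_neutral_left[OF D.finite_arcs], blast, rule ballI)
   fix c assume "c : arcs D - {c : arcs D. tail D c = D.awlast u p}"
   then have "(u, p @ [c, opposite c] @ q) ~: quiver_paths D" by (auto simp: D.quiver_paths_append D.quiver_paths_Cons)
   then show "arrow_sign c * xi (u, p @ [c, opposite c] @ q) = 0" using dual_module_path[OF xi] by simp
  qed
  finally show ?thesis using dual_module_relation[OF xi] by simp
 qed
 have "f : relation_span" using assms(2) by (rule R_relation_span)
 then have "f : RR & pairing xi f = 0"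
 proof (induction rule: relation_span.induct)
  case zero
  then show ?case by (simp only: pairing_0 R_0)
 next
  case (step u p q f c)
  have r: "rel u p q : RR" by (rule relation_elem_in_R[OF step(1,2)])
  have "pairing xi (fscale c (rel u p q) + f) = c * pairing xi (rel u p q) + pairing xi f"
   using step(4) P_finite[OF R_carrier[OF r]] P_finite[OF R_carrier[OF R_scale[OF r]]] P_finite[OF R_carrier, of f]
   by (simp only: pairing_add pairing_scale)
  then show ?case using step(4) pairing_rel[OF step(1,2)] R_add[OF R_scale[OF r]] by (metis add_0 mult_zero_right)
 qed
 then show ?thesis by simp
qed

definition high :: "nat => ('v, 'a, 'k) pfun set" where
 "high n = {f : carrier PP. below n f = 0}"

lemma high_iff: "f : high n \<longleftrightarrow> f : carrier PP & (ALL u p. length p < n --> f (u, p) = 0)"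
proof -
 have "below n f = 0 \<longleftrightarrow> (ALL u p. below n f (u, p) = 0)" by (auto simp: fun_eq_iff)
 then show ?thesis by (simp add: high_def below_apply)
qed

lemma highI: "f : carrier PP ==> (!!u p. f (u, p) ~= 0 ==> n <= length p) ==> f : high n"
 unfolding high_iff by (meson not_le)

lemma highD: "f : high n ==> f (u, p) ~= 0 ==> n <= length p" unfolding high_iff by (meson not_le)

lemma high_carrier: "f : high n ==> f : carrier PP" by (simp add: high_def)

lemma high_subspace: "fun_subspace (high n)" unfolding high_def using fun_subspace_path_algebra[of D]
 by (auto simp: fun_subspace_def below_add below_scale below_0 fun_eq_iff)

lemma P_mult_closed: "f : carrier PP ==> g : carrier PP ==> mul f g : carrier PP"
 by (simp add: path_algebra_simps D.path_mult_closed D.path_mult_finite)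

lemma high_mult:
 assumes f: "f : high m" and g: "g : high n"
 shows "mul f g : high (m + n)"
proof (rule highI)
 show "mul f g : carrier PP" using f g by (intro P_mult_closed high_carrier)
 fix u p assume "mul f g (u, p) ~= 0"
 then obtain q r where "p = q @ r" "f (u, q) ~= 0" "g (D.awlast u q, r) ~= 0" by (rule D.path_mult_nonzero)
 then show "m + n <= length p" using highD[OF f] highD[OF g] by (simp add: add_mono)
qed

lemma high_0: "high 0 = carrier PP" by (auto simp: high_iff)

lemma high_mono: "m <= n ==> high n \<subseteq> high m" by (auto simp: high_iff)

lemma path_elem_high: "x : quiver_paths D ==> n <= length (snd x) ==> pe x : high n"
 by (intro highI path_elem_carrier) (auto simp: path_elem_apply split: if_splits)

lemma high_induct [consumes 1, case_names zero step]:
 assumes f: "f : high n" and zero: "S 0"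
  and step: "!!c x f. x : quiver_paths D ==> n <= length (snd x) ==> f : high n ==> S f ==>
   S (fscale c (pe x) + f)"
 shows "S f"
proof -
 \<comment> \<open>The induction runs over the whole path algebra, applied to f minus its
   truncation: a short path does not change this difference, a long one is added to it.\<close>
 have "(f - below n f) : high n & S (f - below n f)" using high_carrier[OF f]
 proof (induction f rule: path_algebra_induct)
  case zero
  then show ?case unfolding below_0 diff_zero using assms(2) fun_subspace_0[OF high_subspace] by blast
 next
  case (step c x f)
  show ?case
  proof (cases "length (snd x) < n")
   case True
   then have "fscale c (pe x) + f - below n (fscale c (pe x) + f) = f - below n f"
    by (auto simp: fun_eq_iff below_apply path_elem_apply)
   then show ?thesis using step(3) by (simp only:)
  next
   case False
   then have "fscale c (pe x) + f - below n (fscale c (pe x) + f) =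
     fscale c (pe x) + (f - below n f)" by (auto simp: fun_eq_iff below_apply path_elem_apply)
   moreover have "fscale c (pe x) + (f - below n f) : high n" using False step(3) path_elem_high[OF step(1), of n]
    by (intro fun_subspace_add[OF high_subspace] fun_subspace_scale[OF high_subspace]) (simp_all only: not_less)
   moreover have "S (fscale c (pe x) + (f - below n f))"
    using False step(3) assms(3)[OF step(1), of "f - below n f" c] by (simp only: not_less)
   ultimately show ?thesis by (simp only: simp_thms)
  qed
 qed
 moreover have "f - below n f = f" using f by (simp add: high_def)
 ultimately show ?thesis by simp
qed

end

section \<open>The preprojective algebra, its arrow filtration and its completion\<close>

context preprojective
begin

abbreviation Pi :: "('k, ('v, 'a, 'k) pfun set) module" where
 "Pi \<equiv> preprojective_algebra Q"

abbreviation cls :: "('v, 'a, 'k) pfun => ('v, 'a, 'k) pfun set" where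
 "cls \<equiv> preproj_class Q"

lemma algebra_ideal_R: "algebra_ideal PP RR" by (rule R.algebra_ideal_axioms)

lemma algebra_over_Pi: "algebra_over Pi"
 unfolding preprojective_algebra_def by (rule algebra_ideal.algebra_over_factor[OF algebra_ideal_R])

sublocale Pi: algebra_over Pi by (rule algebra_over_Pi)

lemma cls_mult: "f : carrier PP ==> g : carrier PP ==> cls (mul f g) = cls f \<otimes>\<^bsub>Pi\<^esub> cls g"
 and cls_add: "f : carrier PP ==> g : carrier PP ==> cls (f + g) = cls f \<oplus>\<^bsub>Pi\<^esub> cls g"
 and cls_diff: "f : carrier PP ==> g : carrier PP ==> cls (f - g) = cls f \<ominus>\<^bsub>Pi\<^esub> cls g"
 and cls_scale: "f : carrier PP ==> cls (fscale c f) = c \<odot>\<^bsub>Pi\<^esub> cls f"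
 and cls_zero: "cls 0 = \<zero>\<^bsub>Pi\<^esub>"
 and cls_one: "cls \<one>\<^bsub>PP\<^esub> = \<one>\<^bsub>Pi\<^esub>"
 and cls_carrier: "carrier Pi = cls ` carrier PP" unfolding preproj_class_def preprojective_algebra_def
 using algebra_ideal.coset_mult[OF algebra_ideal_R, of f g] algebra_ideal.coset_add[OF algebra_ideal_R, of f g]
  algebra_ideal.coset_minus[OF algebra_ideal_R, of f g] algebra_ideal.coset_scale[OF algebra_ideal_R, of f c]
  algebra_ideal.coset_zero[OF algebra_ideal_R] algebra_ideal.coset_one[OF algebra_ideal_R]
  algebra_ideal.coset_carrier[OF algebra_ideal_R] D.path_algebra_minus[of f g]
 by (simp_all only: path_algebra_simps(1-4))

lemma cls_in: "f : carrier PP ==> cls f : carrier Pi" by (simp add: cls_carrier)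

lemma cls_eq_iff: "f : carrier PP ==> g : carrier PP ==> cls f = cls g \<longleftrightarrow> f - g : RR"
 unfolding preproj_class_def
 using algebra_ideal.coset_eq_iff[OF algebra_ideal_R, of f g] D.path_algebra_minus[of f g] by simp

lemma cls_eq_zero_iff: "f : carrier PP ==> cls f = \<zero>\<^bsub>Pi\<^esub> \<longleftrightarrow> f : RR"
proof -
 assume f: "f : carrier PP"
 have "0 : carrier PP" by (rule fun_subspace_0[OF fun_subspace_path_algebra])
 then show ?thesis using cls_eq_iff[OF f, of 0] by (simp only: cls_zero diff_zero)
qed

lemma P_diff: "f : carrier PP ==> g : carrier PP ==> f - g : carrier PP"
 by (rule fun_subspace_diff[OF fun_subspace_path_algebra])

lemma P_add: "f : carrier PP ==> g : carrier PP ==> f + g : carrier PP"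
 by (rule fun_subspace_add[OF fun_subspace_path_algebra])

lemma P_scale: "f : carrier PP ==> fscale c f : carrier PP" by (rule fun_subspace_scale[OF fun_subspace_path_algebra])

text \<open>Concrete form of the n-th power of the arrow ideal, as shown in
  \<open>arrow_ideal_pow\<close>.\<close>

definition M :: "nat => ('v, 'a, 'k) pfun set set" where
 "M n = cls ` high n"

lemma M_I: "f : high n ==> cls f : M n" by (simp add: M_def)

lemma M_E:
 assumes "x : M n"
 obtains f where "f : high n" "f : carrier PP" "x = cls f" using assms high_carrier unfolding M_def by blast

lemma ideal_M: "ideal (M n) Pi"
proof (rule idealI)
 show "ring Pi" by (rule Pi.ring_axioms)
 show "subgroup (M n) (add_monoid Pi)"
 proof (rule Pi.add.subgroupI)
  show "M n <= carrier Pi" by (auto elim!: M_E simp: cls_in)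
  show "M n ~= {}" unfolding M_def using fun_subspace_0[OF high_subspace] by blast
  fix x assume "x : M n"
  then obtain f where f: "f : high n" "f : carrier PP" "x = cls f" by (rule M_E)
  have f': "- f : high n" by (rule fun_subspace_uminus[OF high_subspace f(1)])
  have "cls (- f) \<oplus>\<^bsub>Pi\<^esub> x = cls (- f + f)" using f high_carrier[OF f'] by (simp only: cls_add)
  then have "cls (- f) \<oplus>\<^bsub>Pi\<^esub> x = \<zero>\<^bsub>Pi\<^esub>"
   by (simp only: cls_zero add.left_inverse)
  then have "\<ominus>\<^bsub>Pi\<^esub> x = cls (- f)"
   using f high_carrier[OF f'] cls_in by (intro Pi.minus_equality) auto
  then show "\<ominus>\<^bsub>Pi\<^esub> x : M n" using M_I[OF f'] by simp
 next
  fix x y assume "x : M n" "y : M n"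
  then obtain f g where "f : high n" "f : carrier PP" "x = cls f" "g : high n" "g : carrier PP" "y = cls g"
   by (elim M_E)
  then have "x \<oplus>\<^bsub>Pi\<^esub> y = cls (f + g)" "f + g : high n"
   using fun_subspace_add[OF high_subspace] by (simp_all only: cls_add)
  then show "x \<oplus>\<^bsub>Pi\<^esub> y : M n" by (simp only: M_I)
 qed
next
 fix x y assume "x : M n" "y : carrier Pi"
 then obtain f g where "f : high n" "f : carrier PP" "x = cls f" "g : high 0" "g : carrier PP" "y = cls g"
  using high_0 by (auto elim!: M_E simp: cls_carrier)
 then have "y \<otimes>\<^bsub>Pi\<^esub> x = cls (mul g f)" "x \<otimes>\<^bsub>Pi\<^esub> y = cls (mul f g)"
   "mul g f : high n" "mul f g : high n" using high_mult[of g 0 f n] high_mult[of f n g 0] by (simp_all add: cls_mult)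
 then show "y \<otimes>\<^bsub>Pi\<^esub> x : M n" "x \<otimes>\<^bsub>Pi\<^esub> y : M n" by (simp_all only: M_I)
qed

lemma ideal_cls_high:
 assumes I: "ideal I Pi" and paths: "!!x. x : quiver_paths D ==> n <= length (snd x) ==> cls (pe x) : I"
 shows "M n \<subseteq> I"
proof
 interpret I: ideal I Pi by (rule I)
 fix x assume "x : M n"
 then obtain f where f: "f : high n" "x = cls f" by (auto elim: M_E)
 from f(1) have "cls f : I"
 proof (induction rule: high_induct)
  case zero
  then show ?case using I.zero_closed by (simp only: cls_zero)
 next
  case (step c x f)
  have px: "pe x : carrier PP" by (rule path_elem_carrier[OF step(1)])
  have "cls (fscale c (pe x) + f) = c \<odot>\<^bsub>Pi\<^esub> cls (pe x) \<oplus>\<^bsub>Pi\<^esub> cls f"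
   using px high_carrier[OF step(3)] P_scale[OF px] by (simp only: cls_add cls_scale)
  then show ?case using Pi.ideal_scale[OF I paths[OF step(1,2)]] step(4) I.a_closed by (simp only:)
 qed
 then show "x : I" using f by simp
qed

lemma arrow_ideal_eq: "arrow_ideal Q = M 1"
proof
 let ?S = "{cls (arrow_elem D a) | a. a : arcs D}"
 have arrow: "(tail D a, [a]) : quiver_paths D" if "a : arcs D" for a
  using that D.head_in_verts[OF that] by (simp add: D.quiver_paths_Cons)
 have sub: "?S \<subseteq> M 1" using arrow by (auto intro!: M_I path_elem_high)
 then show "arrow_ideal Q \<subseteq> M 1" unfolding arrow_ideal_def by (intro Pi.genideal_minimal ideal_M)
 have S: "?S <= carrier Pi" using arrow by (auto intro!: cls_in path_elem_carrier)
 show "M 1 \<subseteq> arrow_ideal Q" unfolding arrow_ideal_def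
 proof (rule ideal_cls_high[OF Pi.genideal_ideal[OF S]])
  interpret I: ideal "Idl\<^bsub>Pi\<^esub> ?S" Pi by (rule Pi.genideal_ideal[OF S])
  fix x assume x: "x : quiver_paths D" "1 <= length (snd x)"
  then obtain u a p where up: "x = (u, a # p)"
   by (metis One_nat_def length_0_conv not_one_le_zero prod.exhaust_sel list.exhaust list.size(3))
  then have a: "a : arcs D" "u = tail D a" "(head D a, p) : quiver_paths D" using x by (auto simp: D.quiver_paths_Cons)
  have "pe x = mul (pe (tail D a, [a])) (pe (head D a, p))"
   using up a by (simp add: D.path_elem_mult_path_elem D.awlast_eq)
  then have "cls (pe x) = cls (arrow_elem D a) \<otimes>\<^bsub>Pi\<^esub> cls (pe (head D a, p))"
   using arrow[OF a(1)] a(3) by (simp only: cls_mult path_elem_carrier)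
  moreover have "cls (arrow_elem D a) : Idl\<^bsub>Pi\<^esub> ?S" using Pi.genideal_self[OF S] a(1) by blast
  ultimately show "cls (pe x) : Idl\<^bsub>Pi\<^esub> ?S"
   using I.I_r_closed cls_in[OF path_elem_carrier[OF a(3)]] by (simp only:)
 qed
qed

lemma ideal_prod_M: "ideal_prod Pi (M m) (M n) = M (m + n)"
proof
 show "ideal_prod Pi (M m) (M n) \<subseteq> M (m + n)"
 proof
  interpret I: ideal "M (m + n)" Pi by (rule ideal_M)
  fix x assume "x : ideal_prod Pi (M m) (M n)"
  then show "x : M (m + n)"
  proof induction
   case (prod i j)
   then obtain f g where fg: "f : high m" "f : carrier PP" "i = cls f" "g : high n" "g : carrier PP" "j = cls g"
    by (elim M_E)
   then have "i \<otimes>\<^bsub>Pi\<^esub> j = cls (mul f g)" by (simp only: cls_mult)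
   then show ?case using M_I[OF high_mult[OF fg(1,4)]] by (simp only:)
  qed (rule I.a_closed)
 qed
 show "M (m + n) \<subseteq> ideal_prod Pi (M m) (M n)"
 proof (rule ideal_cls_high[OF Pi.ideal_prod_is_ideal[OF ideal_M ideal_M]])
  fix x assume x: "x : quiver_paths D" "m + n <= length (snd x)"
  obtain u p where up: "x = (u, p)" by (cases x)
  \<comment> \<open>A path with at least m + n arrows is cut after the first m.\<close>
  let ?v = "D.awlast u (take m p)"
  have paths: "(u, take m p) : quiver_paths D" "(?v, drop m p) : quiver_paths D"
   using x(1) D.quiver_paths_append[of u "take m p" "drop m p"] up by auto
  have "pe x = mul (pe (u, take m p)) (pe (?v, drop m p))" using up by (simp add: D.path_elem_mult_path_elem)
  then have "cls (pe x) = cls (pe (u, take m p)) \<otimes>\<^bsub>Pi\<^esub> cls (pe (?v, drop m p))"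
   using paths by (simp only: cls_mult path_elem_carrier)
  moreover have "cls (pe (u, take m p)) : M m" "cls (pe (?v, drop m p)) : M n"
   using paths x(2) up by (auto intro!: M_I path_elem_high)
  ultimately show "cls (pe x) : ideal_prod Pi (M m) (M n)" by (simp add: ideal_prod.prod)
 qed
qed

lemma arrow_ideal_pow: "arrow_ideal Q [^]\<^bsub>ideals_set Pi\<^esub> n = M n"
proof (induction n)
 case 0
 have "M 0 = carrier Pi" by (simp add: M_def high_0 cls_carrier)
 then show ?case by (simp add: nat_pow_def ideals_set_def)
next
 case (Suc n)
 have "arrow_ideal Q [^]\<^bsub>ideals_set Pi\<^esub> Suc n =
   ideal_prod Pi (arrow_ideal Q [^]\<^bsub>ideals_set Pi\<^esub> n) (arrow_ideal Q)"
  by (simp add: nat_pow_def ideals_set_def)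
 also have "\<dots> = ideal_prod Pi (M n) (M 1)" unfolding Suc.IH by (simp only: arrow_ideal_eq)
 also have "\<dots> = M (Suc n)" by (simp add: ideal_prod_M)
 finally show ?case .
qed

lemma algebra_ideal_M: "algebra_ideal Pi (M n)" by (intro algebra_ideal.intro algebra_over_Pi ideal_M)

definition tau :: "nat => ('v, 'a, 'k) pfun => ('v, 'a, 'k) pfun set set" where
 "tau n f = M n +>\<^bsub>Pi\<^esub> cls f"

lemma below_below: "below n (below n f) = below n f" by (auto simp: below_apply fun_eq_iff)

text \<open>Homogeneity of the relations turns congruence modulo relations and long paths into a
  condition on the truncation alone.\<close>

lemma tau_eq_iff:
 assumes f: "f : carrier PP" and g: "g : carrier PP"
 shows "tau n f = tau n g \<longleftrightarrow> below n (f - g) : RR"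
proof -
 note fg = P_diff[OF f g]
 have "tau n f = tau n g \<longleftrightarrow> cls f \<ominus>\<^bsub>Pi\<^esub> cls g : M n"
  unfolding tau_def using f g by (intro algebra_ideal.coset_eq_iff[OF algebra_ideal_M] cls_in)
 also have "\<dots> \<longleftrightarrow> cls (f - g) : M n" using f g by (simp only: cls_diff)
 also have "\<dots> \<longleftrightarrow> below n (f - g) : RR"
 proof
  assume "cls (f - g) : M n"
  then obtain h where h: "h : high n" "h : carrier PP" "cls (f - g) = cls h" by (rule M_E)
  then have "f - g - h : RR" using cls_eq_iff[OF fg h(2)] by simp
  then have "below n (f - g - h) : RR" by (rule below_R)
  moreover have "below n (f - g - h) = below n (f - g) - below n h" by (rule below_diff)
  moreover have "below n h = 0" using h(1) by (simp add: high_def)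
  ultimately show "below n (f - g) : RR" by (metis diff_zero)
 next
  assume R: "below n (f - g) : RR"
  let ?h = "(f - g) - below n (f - g)"
  have bc: "below n (f - g) : carrier PP" by (rule D.below_carrier[OF path_algebra_functions[OF fg]])
  have "?h : carrier PP" by (rule P_diff[OF fg bc])
  moreover have "below n ?h = 0" by (simp only: below_diff below_below diff_self)
  ultimately have "?h : high n" by (simp add: high_def)
  moreover have "cls (f - g) = cls ?h" using cls_eq_iff[OF fg \<open>?h : carrier PP\<close>] R by simp
  ultimately show "cls (f - g) : M n" using M_I by metis
 qed
 finally show ?thesis .
qed

text \<open>The truncations of a series have finite support because the quiver is finite, so each
  represents an element of the corresponding quotient.\<close>

definition Theta :: "('v, 'a, 'k) pfun => nat => ('v, 'a, 'k) pfun set set" where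
 "Theta f = (%n. tau n (below n f))"

abbreviation Lam :: "('k, nat => ('v, 'a, 'k) pfun set set) module" where
 "Lam \<equiv> completed_preprojective_algebra Q"

abbreviation PF :: "('v, 'a, 'k) pfun set" where
 "PF \<equiv> pfunctions D"

lemma Lam_simps:
 "carrier Lam = {x. ALL n. x n : carrier (factor Pi (M n)) & x (Suc n) \<subseteq> x n}"
 "x \<otimes>\<^bsub>Lam\<^esub> y = (%n. x n \<otimes>\<^bsub>factor Pi (M n)\<^esub> y n)"
 "\<one>\<^bsub>Lam\<^esub> = (%n. \<one>\<^bsub>factor Pi (M n)\<^esub>)"
 "\<zero>\<^bsub>Lam\<^esub> = (%n. \<zero>\<^bsub>factor Pi (M n)\<^esub>)"
 "x \<oplus>\<^bsub>Lam\<^esub> y = (%n. x n \<oplus>\<^bsub>factor Pi (M n)\<^esub> y n)"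
 "c \<odot>\<^bsub>Lam\<^esub> x = (%n. c \<odot>\<^bsub>factor Pi (M n)\<^esub> x n)"
 by (simp_all add: completed_preprojective_algebra_def completion_def arrow_ideal_pow)

lemma tau_mult: "f : carrier PP ==> g : carrier PP ==> tau n (mul f g) = tau n f \<otimes>\<^bsub>factor Pi (M n)\<^esub> tau n g"
 and tau_add: "f : carrier PP ==> g : carrier PP ==> tau n (f + g) = tau n f \<oplus>\<^bsub>factor Pi (M n)\<^esub> tau n g"
 and tau_scale: "f : carrier PP ==> tau n (fscale c f) = c \<odot>\<^bsub>factor Pi (M n)\<^esub> tau n f"
 and tau_zero: "tau n 0 = \<zero>\<^bsub>factor Pi (M n)\<^esub>"
 and tau_one: "tau n \<one>\<^bsub>PP\<^esub> = \<one>\<^bsub>factor Pi (M n)\<^esub>"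
 and tau_carrier: "carrier (factor Pi (M n)) = tau n ` carrier PP" unfolding tau_def
 using algebra_ideal.coset_mult[OF algebra_ideal_M cls_in cls_in, of f g n]
  algebra_ideal.coset_add[OF algebra_ideal_M cls_in cls_in, of f g n]
  algebra_ideal.coset_scale[OF algebra_ideal_M cls_in, of f n c]
  algebra_ideal.coset_zero[OF algebra_ideal_M, of n] algebra_ideal.coset_one[OF algebra_ideal_M, of n]
  algebra_ideal.coset_carrier[OF algebra_ideal_M, of n]
 by (simp_all only: cls_mult cls_add cls_scale cls_zero cls_one cls_carrier cls_in image_image)

lemma below_PP: "f : PF ==> below n f : carrier PP" by (rule D.below_carrier)

lemma tau_Suc_subset:
 assumes "f : carrier PP"
 shows "tau (Suc n) f \<subseteq> tau n f"
proof -
 have "M (Suc n) \<subseteq> M n" unfolding M_def using high_mono[of n "Suc n"] by auto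
 then show ?thesis unfolding tau_def a_r_coset_def' by blast
qed

text \<open>Surjectivity: representatives of a compatible family agree only modulo relations. A
  series glued from the homogeneous parts of chosen representatives still represents the family,
  since the truncated differences are relations.\<close>

lemma Theta_carrier: "carrier Lam = Theta ` PF"
proof
 show "Theta ` PF <= carrier Lam"
 proof (rule image_subsetI)
  fix f assume f: "f : PF"
  have "Theta f (Suc n) \<subseteq> Theta f n" for n
  proof -
   have "below n (below (Suc n) f - below n f) = 0" by (auto simp: fun_eq_iff below_apply)
   then have "tau n (below (Suc n) f) = tau n (below n f)"
    using tau_eq_iff[OF below_PP[OF f] below_PP[OF f], of n "Suc n" n] R_0 by metis
   then show ?thesis using tau_Suc_subset[OF below_PP[OF f], of n "Suc n"] by (simp add: Theta_def)
  qed
  moreover have "Theta f n : carrier (factor Pi (M n))" for n using below_PP[OF f] by (simp add: Theta_def tau_carrier)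
  ultimately show "Theta f : carrier Lam" by (simp add: Lam_simps)
 qed
 show "carrier Lam \<subseteq> Theta ` PF"
 proof
  fix x assume x: "x : carrier Lam"
  then have "x n : tau n ` carrier PP" for n by (simp add: Lam_simps tau_carrier)
  then have "ALL n. EX f. f : carrier PP & x n = tau n f" by blast
  then obtain r where r: "!!n. r n : carrier PP" "!!n. x n = tau n (r n)" by metis
  have step: "below n (r (Suc n) - r n) : RR" for n
  proof -
   have "cls (r (Suc n)) : x (Suc n)"
    unfolding r(2) tau_def by (rule algebra_ideal.coset_self[OF algebra_ideal_M cls_in[OF r(1)]])
   then have "cls (r (Suc n)) : M n +>\<^bsub>Pi\<^esub> cls (r n)"
    using x r(2)[of n] by (auto simp: Lam_simps tau_def)
   then have "tau n (r (Suc n)) = tau n (r n)"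
    unfolding tau_def using algebra_ideal.coset_mem[OF algebra_ideal_M _ cls_in[OF r(1)]] by blast
   then show ?thesis using tau_eq_iff[OF r(1) r(1)] by blast
  qed
  \<comment> \<open>A path of length l is read off from the representative of index l + 1, the first
    one whose truncation contains it.\<close>
  define f where "f = (%y. r (Suc (length (snd y))) y)"
  have f: "f : PF"
   by (rule pfunctionsI) (use pfunctionsD[OF path_algebra_functions[OF r(1)]] in \<open>force simp: f_def\<close>)
  have "below n f - below n (r n) : RR" for n
  proof (induction n)
   case 0
   have "below 0 f - below 0 (r 0) = 0" by (auto simp: fun_eq_iff below_apply)
   then show ?case using R_0 by metis
  next
   case (Suc n)
   have "below (Suc n) f - below (Suc n) (r (Suc n)) = (below n f - below n (r n)) - below n (r (Suc n) - r n)"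
   proof
    fix y :: "('v, 'a) dpath"
    show "(below (Suc n) f - below (Suc n) (r (Suc n))) y =
     ((below n f - below n (r n)) - below n (r (Suc n) - r n)) y"
     by (cases "length (snd y) = n") (auto simp: below_apply f_def)
   qed
   then show ?case using R_diff[OF Suc step] by metis
  qed
  then have "below n (below n f - r n) : RR" for n by (simp only: below_diff below_below)
  then have "Theta f = x" unfolding Theta_def fun_eq_iff using tau_eq_iff[OF below_PP[OF f] r(1)] r(2) by blast
  then show "x : Theta ` PF" using f by blast
 qed
qed

lemma Theta_in: "f : PF ==> Theta f : carrier Lam" by (simp add: Theta_carrier)

lemma Theta_eq_iff:
 assumes "f : PF" "g : PF"
 shows "Theta f = Theta g \<longleftrightarrow> (ALL n. below n (f - g) : RR)"
proof -
 have "below n (below n f - below n g) = below n (f - g)" for n by (simp only: below_diff below_below)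
 moreover have "Theta f = Theta g \<longleftrightarrow> (ALL n. tau n (below n f) = tau n (below n g))"
  by (simp only: Theta_def fun_eq_iff)
 ultimately show ?thesis by (simp only: tau_eq_iff[OF below_PP[OF assms(1)] below_PP[OF assms(2)]])
qed

lemma tau_cong:
 assumes "f : carrier PP" "g : carrier PP" "below n f = below n g"
 shows "tau n f = tau n g" using tau_eq_iff[OF assms(1,2), of n] R_0 assms(3) by (simp only: below_diff diff_self)

lemma Theta_mult: "f : PF ==> g : PF ==> Theta (mul f g) = Theta f \<otimes>\<^bsub>Lam\<^esub> Theta g"
proof
 fix n assume f: "f : PF" and g: "g : PF"
 have "tau n (below n (mul f g)) = tau n (mul (below n f) (below n g))" using f g below_path_mult[of n D f g]
  by (intro tau_cong below_PP P_mult_closed D.path_mult_closed) (simp_all only: below_below)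
 then show "Theta (mul f g) n = (Theta f \<otimes>\<^bsub>Lam\<^esub> Theta g) n"
  using tau_mult[OF below_PP[OF f] below_PP[OF g]] by (simp add: Theta_def Lam_simps)
qed

lemma Theta_add: "f : PF ==> g : PF ==> Theta (f + g) = Theta f \<oplus>\<^bsub>Lam\<^esub> Theta g"
 using tau_add[OF below_PP below_PP, of f g] by (auto simp: Theta_def Lam_simps below_add fun_eq_iff)

lemma Theta_scale: "f : PF ==> Theta (fscale c f) = c \<odot>\<^bsub>Lam\<^esub> Theta f"
 using tau_scale[OF below_PP, of f] by (auto simp: Theta_def Lam_simps below_scale fun_eq_iff)

lemma Theta_zero: "Theta 0 = \<zero>\<^bsub>Lam\<^esub>" unfolding Theta_def Lam_simps by (simp only: below_0 tau_zero)

lemma Theta_finite: "f : carrier PP ==> Theta f = (%n. tau n f)" unfolding Theta_def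
 by (rule ext, intro tau_cong below_PP path_algebra_functions) (simp_all only: below_below)

lemma Theta_one: "Theta \<one>\<^bsub>PP\<^esub> = \<one>\<^bsub>Lam\<^esub>"
proof -
 have "\<one>\<^bsub>PP\<^esub> : carrier PP" using algebra_over_P by (simp add: algebra_over_def ring.ring_simprules)
 then show ?thesis by (simp add: Theta_finite tau_one Lam_simps)
qed

lemma algebra_over_Lam: "algebra_over Lam"
 and ring_hom_Theta: "Theta : ring_hom (complete_path_algebra D) Lam"
 using algebra_homomorphic_image[OF D.algebra_over_complete_path_algebra, of Theta Lam]
  ring_homomorphic_image(2)[of "complete_path_algebra D" Theta Lam]
  D.algebra_over_complete_path_algebra[where 'k = 'k]
 by (simp_all add: complete_path_algebra_simps Theta_carrier Theta_mult Theta_add Theta_one Theta_zero Theta_scale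
   algebra_over_def)

lemma vertex_idempotent_eq: "i : verts Q ==> vertex_idempotent Q i = Theta (pe (i, []))"
 by (simp add: Theta_finite path_elem_carrier vertex_idempotent_def to_completion_def arrow_ideal_pow tau_def)

end

subsection \<open>Vertex ideals of a preprojective algebra\<close>

context preprojective
begin

text \<open>Elements that can be represented by combinations of paths in Z. Products of ideals are
  bounded from above in this form, with \<open>cat\<close> describing the paths that occur.\<close>

definition L :: "(('v, 'a) dpath) set => ('v, 'a, 'k) pfun set set" where
 "L Z = {cls f | f. f : carrier PP & (ALL x. f x ~= 0 --> x : Z)}"

definition cat :: "(('v, 'a) dpath) set => (('v, 'a) dpath) set => (('v, 'a) dpath) set" where
 "cat Z Z' = {(u, p @ q) | u p q. (u, p) : Z & (D.awlast u p, q) : Z'}"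

text \<open>The paths that visit some vertex other than i, possibly their starting vertex. They
  bound the ideal of 1 - e_i from above.\<close>

definition leaves :: "'v => (('v, 'a) dpath) set" where
 "leaves i = {(u, p). EX q r. p = q @ r & D.awlast u q ~= i}"

definition VI :: "'v => ('v, 'a, 'k) pfun set set" where
 "VI i = Idl\<^bsub>Pi\<^esub> {\<one>\<^bsub>Pi\<^esub> \<ominus>\<^bsub>Pi\<^esub> cls (pe (i, []))}"

lemma L_I: "f : carrier PP ==> (!!u p. f (u, p) ~= 0 ==> (u, p) : Z) ==> cls f : L Z"
 unfolding L_def by (auto intro!: exI[of _ f])

lemma L_E:
 assumes "x : L Z"
 obtains f where "f : carrier PP" "x = cls f" "!!u p. f (u, p) ~= 0 ==> (u, p) : Z" using assms unfolding L_def by blast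

lemma L_add:
 assumes "x : L Z" "y : L Z"
 shows "x \<oplus>\<^bsub>Pi\<^esub> y : L Z"
proof -
 obtain f where f: "f : carrier PP" "x = cls f" "!!u p. f (u, p) ~= 0 ==> (u, p) : Z" using L_E[OF assms(1)] by blast
 obtain g where g: "g : carrier PP" "y = cls g" "!!u p. g (u, p) ~= 0 ==> (u, p) : Z" using L_E[OF assms(2)] by blast
 have "cls (f + g) : L Z"
 proof (rule L_I[OF P_add[OF f(1) g(1)]])
  fix u p assume "(f + g) (u, p) ~= 0"
  then have "f (u, p) ~= 0 | g (u, p) ~= 0" by auto
  then show "(u, p) : Z" using f(3) g(3) by blast
 qed
 then show ?thesis using f g by (simp only: cls_add)
qed

lemma L_mult:
 assumes "x : L Z" "y : L Z'"
 shows "x \<otimes>\<^bsub>Pi\<^esub> y : L (cat Z Z')"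
proof -
 obtain f where f: "f : carrier PP" "x = cls f" "!!u p. f (u, p) ~= 0 ==> (u, p) : Z" using L_E[OF assms(1)] by blast
 obtain g where g: "g : carrier PP" "y = cls g" "!!u p. g (u, p) ~= 0 ==> (u, p) : Z'" using L_E[OF assms(2)] by blast
 have "cls (mul f g) : L (cat Z Z')"
 proof (rule L_I[OF P_mult_closed[OF f(1) g(1)]])
  fix u p assume "mul f g (u, p) ~= 0"
  then obtain q r where "p = q @ r" "f (u, q) ~= 0" "g (D.awlast u q, r) ~= 0" by (rule D.path_mult_nonzero)
  then show "(u, p) : cat Z Z'" using f(3) g(3) unfolding cat_def by blast
 qed
 then show ?thesis using f g by (simp only: cls_mult)
qed

lemma L_mono: "Z \<subseteq> Z' ==> L Z \<subseteq> L Z'" unfolding L_def by blast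

lemma L_UNIV: "L UNIV = carrier Pi" by (auto simp: L_def cls_carrier)

lemma ideal_prod_L: "A \<subseteq> L Z ==> B \<subseteq> L Z' ==> ideal_prod Pi A B \<subseteq> L (cat Z Z')"
proof
 fix x assume "A \<subseteq> L Z" "B \<subseteq> L Z'" "x : ideal_prod Pi A B"
 then show "x : L (cat Z Z')" by (induction rule: ideal_prod.induct[OF \<open>x : ideal_prod Pi A B\<close>])
   (use L_mult L_add in blast)+
qed

lemma ideal_L:
 assumes left: "cat UNIV Z \<subseteq> Z" and right: "cat Z UNIV \<subseteq> Z"
 shows "ideal (L Z) Pi"
proof (rule idealI)
 show "ring Pi" by (rule Pi.ring_axioms)
 have sub: "L Z <= carrier Pi" using L_mono[of Z UNIV] L_UNIV by simp
 show "subgroup (L Z) (add_monoid Pi)"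
 proof (rule Pi.add.subgroupI)
  show "L Z <= carrier Pi" by (rule sub)
  have "0 : carrier PP" by (rule fun_subspace_0[OF fun_subspace_path_algebra])
  then have "cls 0 : L Z" by (rule L_I) simp
  then show "L Z ~= {}" by blast
  fix x assume x: "x : L Z"
  obtain f where f: "f : carrier PP" "x = cls f" "!!u p. f (u, p) ~= 0 ==> (u, p) : Z" using L_E[OF x] by blast
  have f': "- f : carrier PP" by (rule fun_subspace_uminus[OF fun_subspace_path_algebra f(1)])
  have "cls (- f) \<oplus>\<^bsub>Pi\<^esub> x = cls (- f + f)" using f f' by (simp only: cls_add)
  then have "cls (- f) \<oplus>\<^bsub>Pi\<^esub> x = \<zero>\<^bsub>Pi\<^esub>"
   by (simp only: cls_zero add.left_inverse)
  then have "\<ominus>\<^bsub>Pi\<^esub> x = cls (- f)" using f f' cls_in by (intro Pi.minus_equality) auto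
  moreover have "cls (- f) : L Z" using f(3) by (intro L_I[OF f']) simp
  ultimately show "\<ominus>\<^bsub>Pi\<^esub> x : L Z" by simp
 qed (rule L_add)
 fix x y assume x: "x : L Z" and y: "y : carrier Pi"
 show "y \<otimes>\<^bsub>Pi\<^esub> x : L Z" using L_mult[of y UNIV x Z] x y L_UNIV L_mono[OF left] by blast
 show "x \<otimes>\<^bsub>Pi\<^esub> y : L Z" using L_mult[of x Z y UNIV] x y L_UNIV L_mono[OF right] by blast
qed

lemma L_subset_ideal:
 assumes I: "ideal I Pi" and paths: "!!x. x : quiver_paths D ==> x : Z ==> cls (pe x) : I"
 shows "L Z \<subseteq> I"
proof
 interpret I: ideal I Pi by (rule I)
 fix y assume y: "y : L Z"
 obtain f where f: "f : carrier PP" "y = cls f" "!!u p. f (u, p) ~= 0 ==> (u, p) : Z" using L_E[OF y] by blast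
 \<comment> \<open>Restricting to Z lets the induction run over the whole path algebra; f itself is
   unchanged by it.\<close>
 define rs where "rs g = (%x. if x : Z then g x else 0)" for g :: "('v, 'a) dpath => 'k"
 have "rs f : carrier PP & cls (rs f) : I" using f(1)
 proof (induction f rule: path_algebra_induct)
  case zero
  have "rs 0 = 0" by (simp add: rs_def fun_eq_iff)
  then show ?case using I.zero_closed fun_subspace_0[OF fun_subspace_path_algebra] cls_zero by metis
 next
  case (step c x f)
  have px: "pe x : carrier PP" by (rule path_elem_carrier[OF step(1)])
  show ?case
  proof (cases "x : Z")
   case True
   have "rs (fscale c (pe x) + f) = fscale c (pe x) + rs f"
    using True by (auto simp: rs_def fun_eq_iff path_elem_apply)
   moreover have "cls (fscale c (pe x) + rs f) = c \<odot>\<^bsub>Pi\<^esub> cls (pe x) \<oplus>\<^bsub>Pi\<^esub> cls (rs f)"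
    using px step(3) P_scale[OF px] by (simp only: cls_add cls_scale)
   ultimately show ?thesis
    using Pi.ideal_scale[OF I paths[OF step(1) True]] step(3) I.a_closed P_add[OF P_scale[OF px]] by (simp only:)
  next
   case False
   have "rs (fscale c (pe x) + f) = rs f" using False by (auto simp: rs_def fun_eq_iff path_elem_apply)
   then show ?thesis using step(3) by (simp only:)
  qed
 qed
 moreover have "rs f = f" using f(3) by (auto simp: rs_def fun_eq_iff)
 ultimately show "y : I" using f(2) by simp
qed

lemma M_eq_L: "M n = L {x. n <= length (snd x)}"
proof
 show "M n \<subseteq> L {x. n <= length (snd x)}" by (auto elim!: M_E intro!: L_I dest: highD)
 show "L {x. n <= length (snd x)} \<subseteq> M n" by (rule L_subset_ideal[OF ideal_M]) (auto intro!: M_I path_elem_high)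
qed

lemma one_minus_vertex:
 assumes "i : verts Q"
 shows "\<one>\<^bsub>PP\<^esub> - pe (i, []) : carrier PP"
  and "\<one>\<^bsub>Pi\<^esub> \<ominus>\<^bsub>Pi\<^esub> cls (pe (i, [])) = cls (\<one>\<^bsub>PP\<^esub> - pe (i, []))"
proof -
 have "\<one>\<^bsub>PP\<^esub> : carrier PP" using algebra_over_P by (simp add: algebra_over_def ring.ring_simprules)
 moreover have "pe (i, []) : carrier PP" using assms by (intro path_elem_carrier) simp
 ultimately show "\<one>\<^bsub>PP\<^esub> - pe (i, []) : carrier PP"
  "\<one>\<^bsub>Pi\<^esub> \<ominus>\<^bsub>Pi\<^esub> cls (pe (i, [])) = cls (\<one>\<^bsub>PP\<^esub> - pe (i, []))"
  by (rule P_diff) (simp only: cls_diff cls_one \<open>\<one>\<^bsub>PP\<^esub> : carrier PP\<close> \<open>pe (i, []) : carrier PP\<close>)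
qed

lemma one_apply: "\<one>\<^bsub>PP\<^esub> (u, p) = (if u : verts Q & p = [] then 1 else 0)"
 by (simp add: path_algebra_def)

lemma VI_carrier: "i : verts Q ==> {\<one>\<^bsub>Pi\<^esub> \<ominus>\<^bsub>Pi\<^esub> cls (pe (i, []))} <= carrier Pi"
 using one_minus_vertex[of i] by (simp add: cls_in)

lemma ideal_VI: "i : verts Q ==> ideal (VI i) Pi" unfolding VI_def by (intro Pi.genideal_ideal VI_carrier)

lemma leaves_ext: "cat UNIV (leaves i) \<subseteq> leaves i" "cat (leaves i) UNIV \<subseteq> leaves i"
proof -
 have "(u, p @ q) : leaves i" if leaves: "(D.awlast u p, q) : leaves i" for u p q
 proof -
  obtain q' r' where "q = q' @ r'" "D.awlast (D.awlast u p) q' ~= i" using leaves by (auto simp: leaves_def)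
  then show ?thesis
   unfolding leaves_def using D.awlast_append[of u p q'] by (metis (mono_tags, lifting) append.assoc case_prodI mem_Collect_eq)
 qed
 then show "cat UNIV (leaves i) \<subseteq> leaves i" by (auto simp: cat_def)
 show "cat (leaves i) UNIV \<subseteq> leaves i" by (fastforce simp: cat_def leaves_def)
qed

lemma VI_subset_L:
 assumes "i : verts Q"
 shows "VI i \<subseteq> L (leaves i)" unfolding VI_def
proof (rule Pi.genideal_minimal[OF ideal_L[OF leaves_ext]], clarify)
 have "(u, p) : leaves i" if "(\<one>\<^bsub>PP\<^esub> - pe (i, [])) (u, p) ~= 0" for u p
  using that assms by (auto simp: one_apply path_elem_apply leaves_def D.awlast_eq split: if_splits)
 then show "\<one>\<^bsub>Pi\<^esub> \<ominus>\<^bsub>Pi\<^esub> cls (pe (i, [])) : L (leaves i)"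
  unfolding one_minus_vertex(2)[OF assms] by (rule L_I[OF one_minus_vertex(1)[OF assms]])
qed

lemma vertex_in_VI:
 assumes "i : verts Q" "v : verts Q" "v ~= i"
 shows "cls (pe (v, [])) : VI i"
proof -
 interpret I: ideal "VI i" Pi by (rule ideal_VI[OF assms(1)])
 have v: "pe (v, []) : carrier PP" using assms by (intro path_elem_carrier) simp
 have "mul (pe (v, [])) (\<one>\<^bsub>PP\<^esub> - pe (i, [])) = pe (v, []) - 0"
  using assms D.path_mult_one[OF path_algebra_functions[OF v]]
  by (simp only: path_mult_diff_right D.path_elem_mult_path_elem D.awlast_eq) simp
 then have "cls (pe (v, [])) = cls (pe (v, [])) \<otimes>\<^bsub>Pi\<^esub> cls (\<one>\<^bsub>PP\<^esub> - pe (i, []))"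
  using cls_mult[OF v one_minus_vertex(1)[OF assms(1)]] by simp
 moreover have "cls (\<one>\<^bsub>PP\<^esub> - pe (i, [])) : VI i" using Pi.genideal_self[OF VI_carrier[OF assms(1)]]
  unfolding VI_def one_minus_vertex(2)[OF assms(1)] by blast
 ultimately show ?thesis using I.I_l_closed cls_in[OF v] by metis
qed

lemma path_in_ideal:
 assumes I: "ideal I Pi" and "(u, p @ q) : quiver_paths D" "cls (pe (D.awlast u p, [])) : I"
 shows "cls (pe (u, p @ q)) : I"
proof -
 interpret I: ideal I Pi by (rule I)
 let ?v = "D.awlast u p"
 have paths: "(u, p) : quiver_paths D" "(?v, q) : quiver_paths D" "(?v, []) : quiver_paths D"
  using assms(2) D.quiver_paths_end[of u p] by (auto simp: D.quiver_paths_append)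
 have "pe (u, p @ q) = mul (mul (pe (u, p)) (pe (?v, []))) (pe (?v, q))" by (simp add: D.path_elem_mult_path_elem)
 moreover have car: "pe (u, p) : carrier PP" "pe (?v, q) : carrier PP" "pe (?v, []) : carrier PP"
  using paths by (auto intro: path_elem_carrier)
 ultimately have "cls (pe (u, p @ q)) = cls (pe (u, p)) \<otimes>\<^bsub>Pi\<^esub> cls (pe (?v, [])) \<otimes>\<^bsub>Pi\<^esub> cls (pe (?v, q))"
  by (simp only: cls_mult P_mult_closed)
 then show ?thesis using assms(3) cls_in car by (simp only: I.I_l_closed I.I_r_closed)
qed

text \<open>The common value of the products of \<open>VI i\<close> and \<open>VI j\<close> on the
  two sides of a commutation or braid relation. It is symmetric in i and j, and this symmetry gives
  the relations.\<close>

definition KI :: "'v => 'v => ('v, 'a, 'k) pfun set set" where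
 "KI i j = Idl\<^bsub>Pi\<^esub> {cls (pe (v, [])) | v. v : verts Q & v ~= i & v ~= j}"

lemma KI_carrier: "{cls (pe (v, [])) | v. v : verts Q & v ~= i & v ~= j} <= carrier Pi"
 by (auto intro!: cls_in path_elem_carrier)

lemma ideal_KI: "ideal (KI i j) Pi" unfolding KI_def by (rule Pi.genideal_ideal[OF KI_carrier])

lemma vertex_in_KI: "v : verts Q ==> v ~= i ==> v ~= j ==> cls (pe (v, [])) : KI i j"
 unfolding KI_def using Pi.genideal_self[OF KI_carrier] by blast

lemma vertex_idem: "v : verts Q ==> cls (pe (v, [])) \<otimes>\<^bsub>Pi\<^esub> cls (pe (v, [])) = cls (pe (v, []))"
proof -
 assume "v : verts Q"
 then have v: "pe (v, []) : carrier PP" by (intro path_elem_carrier) simp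
 show ?thesis using cls_mult[OF v v] by (simp add: D.path_elem_mult_path_elem D.awlast_eq)
qed

lemma KI_minimal:
 assumes "ideal I Pi" "!!v. v : verts Q ==> v ~= i ==> v ~= j ==> cls (pe (v, [])) : I"
 shows "KI i j \<subseteq> I" unfolding KI_def using assms(2) by (intro Pi.genideal_minimal[OF assms(1)]) auto

lemma vertex_in_prod:
 "cls (pe (v, [])) : A ==> cls (pe (v, [])) : B ==> v : verts Q ==> cls (pe (v, [])) : ideal_prod Pi A B"
 using ideal_prod.prod[of "cls (pe (v, []))" A "cls (pe (v, []))" B Pi] vertex_idem by simp

lemma path_in_KI:
 assumes "(u, p @ q) : quiver_paths D" "D.awlast u p ~: {i, j}"
 shows "cls (pe (u, p @ q)) : KI i j" using assms D.quiver_paths_end[of u p]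
 by (intro path_in_ideal[OF ideal_KI] vertex_in_KI) (auto simp: D.quiver_paths_append)

text \<open>The generator 1 - e_i is idempotent, hence itself a product of two elements of the
  ideal.\<close>

lemma VI_idem:
 assumes i: "i : verts Q"
 shows "ideal_prod Pi (VI i) (VI i) = VI i"
proof
 show "ideal_prod Pi (VI i) (VI i) \<subseteq> VI i" using Pi.ideal_prod_inter[OF ideal_VI[OF i] ideal_VI[OF i]] by blast
 let ?e = "\<one>\<^bsub>PP\<^esub> - pe (i, [])"
 have "mul ?e ?e = ?e"
 proof (rule ext, clarify)
  have pi: "pe (i, []) : pfunctions D" using i by (intro path_elem_functions) simp
  have "mul ?e ?e = mul \<one>\<^bsub>PP\<^esub> \<one>\<^bsub>PP\<^esub> - mul \<one>\<^bsub>PP\<^esub> (pe (i, [])) - (mul (pe (i, [])) \<one>\<^bsub>PP\<^esub> - mul (pe (i, [])) (pe (i, [])))"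
   by (simp only: path_mult_diff_left path_mult_diff_right) simp
  also have "\<dots> = \<one>\<^bsub>PP\<^esub> - pe (i, []) - (pe (i, []) - pe (i, []))"
   using D.path_one_mult[OF pi] D.path_mult_one[OF pi] D.path_one_mult[OF D.path_one_functions]
   by (simp add: D.path_elem_mult_path_elem D.awlast_eq)
  finally show "mul ?e ?e (u, p) = ?e (u, p)" for u p by simp
 qed
 then have "cls ?e = cls ?e \<otimes>\<^bsub>Pi\<^esub> cls ?e"
  using cls_mult[OF one_minus_vertex(1)[OF i] one_minus_vertex(1)[OF i]] by simp
 moreover have "cls ?e : VI i" using Pi.genideal_self[OF VI_carrier[OF i]]
  unfolding VI_def one_minus_vertex(2)[OF i] by blast
 ultimately have "cls ?e : ideal_prod Pi (VI i) (VI i)"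
  using ideal_prod.prod[of "cls ?e" "VI i" "cls ?e" "VI i" Pi] by simp
 then have "Idl\<^bsub>Pi\<^esub> {\<one>\<^bsub>Pi\<^esub> \<ominus>\<^bsub>Pi\<^esub> cls (pe (i, []))} \<subseteq> ideal_prod Pi (VI i) (VI i)"
  unfolding one_minus_vertex(2)[OF i] by (intro Pi.genideal_minimal Pi.ideal_prod_is_ideal ideal_VI i) auto
 then show "VI i \<subseteq> ideal_prod Pi (VI i) (VI i)" by (simp only: VI_def)
qed

lemma num_arrows_eq_0: "num_arrows Q i j = 0 ==> b : arcs Q ==> {tail Q b, head Q b} ~= {i, j}"
 unfolding num_arrows_def by (auto simp: card_eq_0_iff)

lemma arc_between:
 assumes "a : arcs D" "{tail D a, head D a} = {i, j}"
 obtains b where "b : arcs Q" "{tail Q b, head Q b} = {i, j}" "a = Inl b | a = Inr b"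
 using assms by (cases a) (auto simp: insert_commute)

end

section \<open>The 0-Hecke relations between vertex ideals, and graded vanishing\<close>

locale loopfree_preprojective = preprojective Q field + loopfree_digraph Q
 for Q :: "('v, 'a) pre_digraph" and field :: "'k::field itself"
begin

lemma double_no_loops: "a : arcs D ==> tail D a ~= head D a" by (cases a) (use no_loops in force)+

text \<open>For vertices not joined by an arrow, a path that leaves \<open>i\<close> and then \<open>j\<close> meets a third vertex.\<close>

lemma doubleton_eqI: "x : {i, j} ==> y : {i, j} ==> x ~= y ==> {x, y} = {i, j}" by blast

lemma VI_commute_aux:
 assumes ij: "i : verts Q" "j : verts Q" "i ~= j" "num_arrows Q i j = 0"
 shows "ideal_prod Pi (VI i) (VI j) = KI i j"
proof
 show "KI i j \<subseteq> ideal_prod Pi (VI i) (VI j)"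
  using ij by (intro KI_minimal Pi.ideal_prod_is_ideal ideal_VI vertex_in_prod vertex_in_VI)
 have "ideal_prod Pi (VI i) (VI j) \<subseteq> L (cat (leaves i) (leaves j))"
  using ij by (intro ideal_prod_L VI_subset_L)
 also have "\<dots> \<subseteq> KI i j"
 proof (rule L_subset_ideal[OF ideal_KI], clarify)
  fix u p assume path: "(u, p) : quiver_paths D" "(u, p) : cat (leaves i) (leaves j)"
  then obtain q r where qr: "p = q @ r" "(u, q) : leaves i" "(D.awlast u q, r) : leaves j" by (auto simp: cat_def)
  show "cls (pe (u, p)) : KI i j"
  proof (cases "EX q r. p = q @ r & D.awlast u q ~: {i, j}")
   case True
   then show ?thesis using path_in_KI path(1) by blast
  next
   case False
   then have in_ij: "D.awlast u q : {i, j}" if "p = q @ r" for q r using that by blast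
   \<comment> \<open>Without loops and without arrows between i and j, a path that stays in {i, j}
     is trivial. A trivial path would have to start off both i and j, which is the contradiction
     below.\<close>
   have "p = []"
   proof (cases p)
    case (Cons a p')
    then have a: "a : arcs D" "tail D a = u" using path(1) by (auto simp: D.quiver_paths_Cons)
    have "u : {i, j}" "head D a : {i, j}"
     using in_ij[of "[]" p] in_ij[of "[a]" p'] Cons by (simp_all add: D.awlast_eq)
    moreover have "tail D a ~= head D a" using double_no_loops[OF a(1)] .
    ultimately have ends: "{tail D a, head D a} = {i, j}" unfolding a(2) by (intro doubleton_eqI) simp_all
    obtain b where "b : arcs Q" "{tail Q b, head Q b} = {i, j}" by (rule arc_between[OF a(1) ends])
    then have False using num_arrows_eq_0[OF ij(4)] by metis
    then show ?thesis ..
   qed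
   then have "u ~= i" "u ~= j" using qr by (auto simp: leaves_def D.awlast_eq)
   then show ?thesis using in_ij[of "[]" p] by (simp add: D.awlast_eq)
  qed
 qed
 finally show "ideal_prod Pi (VI i) (VI j) \<subseteq> KI i j" .
qed

lemma KI_commute: "KI i j = KI j i" unfolding KI_def by (rule arg_cong[where f = "genideal Pi"]) auto

text \<open>For vertices joined by one arrow \<open>a\<close>, the relation at \<open>i\<close> puts \<open>a a\<^sup>*\<close> into \<open>KI i j\<close>.\<close>

lemma arc_unique:
 assumes "num_arrows Q i j = 1" "a : arcs D" "{tail D a, head D a} = {i, j}"
  "c : arcs D" "{tail D c, head D c} = {i, j}" "tail D c = tail D a"
 shows "c = a"
proof -
 obtain b where b: "{b : arcs Q. {tail Q b, head Q b} = {i, j}} = {b}"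
  using assms(1) unfolding num_arrows_def by (auto simp: card_1_singleton_iff)
 obtain b' where b': "b' : arcs Q" "{tail Q b', head Q b'} = {i, j}" "c = Inl b' | c = Inr b'"
  by (rule arc_between[OF assms(4,5)])
 obtain b'' where b'': "b'' : arcs Q" "{tail Q b'', head Q b''} = {i, j}" "a = Inl b'' | a = Inr b''"
  by (rule arc_between[OF assms(2,3)])
 have eq: "b' = b" "b'' = b" using b b' b'' by blast+
 have "tail Q b ~= head Q b" using no_loops b'(1) eq by simp
 then show ?thesis using b'(3) b''(3) eq assms(6) by auto
qed

lemma double_arrow_in_KI:
 assumes ij: "i ~= j" "num_arrows Q i j = 1" and a: "a : arcs D" "{tail D a, head D a} = {i, j}"
 shows "cls (pe (tail D a, [a, opposite a])) : KI i j"
proof -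
 interpret I: ideal "KI i j" Pi by (rule ideal_KI)
 let ?x = "tail D a"
 have x: "?x : verts Q" "(?x, []) : quiver_paths D" using D.tail_in_verts[OF a(1)] by auto
 have car: "pe (tail D c, [c, opposite c]) : carrier PP" if "c : arcs D" for c
  using that by (intro path_elem_carrier double_path)
 \<comment> \<open>The relation at the tail of a expresses a followed by its opposite through the
   other arrows c starting there. These lead to third vertices, because a is the only arrow from its
   tail to the other vertex of the pair.\<close>
 define C where "C = {c : arcs D. tail D c = ?x} - {a}"
 have rel_eq: "rel ?x [] [] = fscale (arrow_sign a) (pe (?x, [a, opposite a])) +
   (SUM c:C. fscale (arrow_sign c) (pe (tail D c, [c, opposite c])))"
 proof -
  have "rel ?x [] [] = (SUM c:{c : arcs D. tail D c = ?x}. fscale (arrow_sign c) (pe (tail D c, [c, opposite c])))"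
   unfolding relation_elem_def by (rule sum.cong) (auto simp: D.awlast_eq)
  then show ?thesis unfolding C_def using a(1) D.finite_arcs by (simp add: sum.remove[of _ a])
 qed
 define G where "G c = fscale (arrow_sign c) (pe (tail D c, [c, opposite c]))" for c
 have G: "G c : carrier PP" if "c : arcs D" for c unfolding G_def by (rule P_scale[OF car[OF that]])
 have G_KI: "cls (G c) : KI i j" if "cls (pe (tail D c, [c, opposite c])) : KI i j" "c : arcs D" for c
  unfolding G_def cls_scale[OF car[OF that(2)]] by (rule Pi.ideal_scale[OF ideal_KI that(1)])
 have Cin: "sum G C' : carrier PP & cls (sum G C') : KI i j" if "finite C'" "C' \<subseteq> C" for C' using that
 proof (induction C' rule: finite_induct)
  case empty
  have "(0 :: ('v, 'a) dpath => 'k) : carrier PP" by (rule fun_subspace_0[OF fun_subspace_path_algebra])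
  moreover have "cls 0 : KI i j" unfolding cls_zero by (rule I.zero_closed)
  ultimately show ?case unfolding sum.empty by (rule conjI)
 next
  case (insert c C')
  then have c: "c : arcs D" "tail D c = ?x" "c ~= a" by (auto simp: C_def)
  have "cls (pe (tail D c, [c, opposite c])) : KI i j"
  proof (cases "head D c : {i, j}")
   case True
   have "tail D c : {i, j}" unfolding c(2) a(2)[symmetric] by simp
   then have "{tail D c, head D c} = {i, j}" by (rule doubleton_eqI[OF _ True double_no_loops[OF c(1)]])
   then have "c = a" by (rule arc_unique[OF ij(2) a c(1) _ c(2)])
   then show ?thesis using c(3) by (rule notE[rotated])
  next
   case False
   then show ?thesis using path_in_KI[of "tail D c" "[c]" "[opposite c]" i j] double_path[OF c(1)]
    by (simp add: D.awlast_eq)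
  qed
  then have Gc: "cls (G c) : KI i j" by (rule G_KI[OF _ c(1)])
  have IH: "sum G C' : carrier PP" "cls (sum G C') : KI i j" using insert.IH insert.prems by simp_all
  show ?case unfolding sum.insert[OF insert.hyps] cls_add[OF G[OF c(1)] IH(1)]
   using P_add[OF G[OF c(1)] IH(1)] I.a_closed[OF Gc IH(2)] by (rule conjI)
 qed
 have S: "sum G C : carrier PP" "cls (sum G C) : KI i j" using Cin[of C] D.finite_arcs by (simp_all add: C_def)
 have R: "rel ?x [] [] : RR" using x by (intro relation_elem_in_R) (simp_all add: D.awlast_eq)
 have "G a = rel ?x [] [] - sum G C" unfolding rel_eq G_def by (rule add_diff_cancel_right'[symmetric])
 then have "cls (G a) = cls (rel ?x [] [] - sum G C)" by (rule arg_cong)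
 also have "\<dots> = cls (rel ?x [] []) \<ominus>\<^bsub>Pi\<^esub> cls (sum G C)"
  by (rule cls_diff[OF R_carrier[OF R] S(1)])
 finally have "cls (G a) = cls (rel ?x [] []) \<ominus>\<^bsub>Pi\<^esub> cls (sum G C)" .
 moreover have "cls (rel ?x [] []) : KI i j" using R cls_eq_zero_iff[OF R_carrier[OF R]] I.zero_closed by metis
 ultimately have "cls (G a) : KI i j" using I.a_closed[OF _ I.a_inv_closed[OF S(2)]] by (simp only: Pi.minus_eq)
 then have "arrow_sign a \<odot>\<^bsub>Pi\<^esub> cls (G a) : KI i j" by (rule Pi.ideal_scale[OF ideal_KI])
 then have "cls (fscale (arrow_sign a) (G a)) : KI i j" unfolding cls_scale[OF G[OF a(1)]] .
 moreover have "fscale (arrow_sign a) (G a) = pe (?x, [a, opposite a])" unfolding G_def by (rule ext) (cases a, simp_all)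
 ultimately show ?thesis by (simp only:)
qed

lemma leaves_iff: "(u, p) : leaves i \<longleftrightarrow> (\<exists>n\<le>length p. D.awlast u (take n p) ~= i)"
proof
 assume "(u, p) : leaves i"
 then obtain q r where "p = q @ r" "D.awlast u q ~= i" by (auto simp: leaves_def)
 then show "\<exists>n\<le>length p. D.awlast u (take n p) ~= i" by (intro exI[of _ "length q"]) simp
next
 assume "\<exists>n\<le>length p. D.awlast u (take n p) ~= i"
 then obtain n where "D.awlast u (take n p) ~= i" by blast
 then show "(u, p) : leaves i"
  unfolding leaves_def using append_take_drop_id[of n p] by (metis (mono_tags, lifting) case_prodI mem_Collect_eq)
qed

text \<open>A path in the threefold product that avoids third vertices visits j, i and j in this
  order. So it has at least two arrows and begins with an arrow followed by its opposite, which lies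
  in \<open>KI i j\<close> by the relation.\<close>

lemma VI_braid_aux:
 assumes ij: "i : verts Q" "j : verts Q" "i ~= j" "num_arrows Q i j = 1"
 shows "ideal_prod Pi (VI i) (ideal_prod Pi (VI j) (VI i)) = KI i j"
proof
 show "KI i j \<subseteq> ideal_prod Pi (VI i) (ideal_prod Pi (VI j) (VI i))"
  using ij by (intro KI_minimal Pi.ideal_prod_is_ideal ideal_VI vertex_in_prod vertex_in_VI)
 have "ideal_prod Pi (VI i) (ideal_prod Pi (VI j) (VI i)) \<subseteq> L (cat (leaves i) (cat (leaves j) (leaves i)))"
  using ij by (intro ideal_prod_L VI_subset_L)
 also have "\<dots> \<subseteq> KI i j"
 proof (rule L_subset_ideal[OF ideal_KI], clarify)
  fix u p assume path: "(u, p) : quiver_paths D" "(u, p) : cat (leaves i) (cat (leaves j) (leaves i))"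
  obtain q t where qt: "p = q @ t" "(u, q) : leaves i" "(D.awlast u q, t) : cat (leaves j) (leaves i)"
   using path(2) unfolding cat_def[of "leaves i"] by blast
  obtain r s where rs: "t = r @ s" "(D.awlast u q, r) : leaves j" "(D.awlast (D.awlast u q) r, s) : leaves i"
   using qt(3) unfolding cat_def by blast
  show "cls (pe (u, p)) : KI i j"
  proof (cases "EX q r. p = q @ r & D.awlast u q ~: {i, j}")
   case True
   then show ?thesis using path_in_KI path(1) by blast
  next
   case False
   then have in_ij: "D.awlast u q : {i, j}" if "p = q @ r" for q r using that by blast
   have in_ij': "D.awlast u (take n p) : {i, j}" for n using in_ij[of "take n p" "drop n p"] by simp
   obtain n1 where n1: "n1 <= length q" "D.awlast u (take n1 q) ~= i" using qt(2) by (auto simp: leaves_iff)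
   obtain n2 where n2: "n2 <= length r" "D.awlast (D.awlast u q) (take n2 r) ~= j"
    using rs(2) by (auto simp: leaves_iff)
   obtain n3 where n3: "n3 <= length s" "D.awlast (D.awlast (D.awlast u q) r) (take n3 s) ~= i"
    using rs(3) by (auto simp: leaves_iff)
   have 1: "D.awlast u (take n1 p) = j" using n1 in_ij'[of n1] qt(1) by auto
   have 2: "D.awlast u (take (length q + n2) p) = i"
    using n2 in_ij'[of "length q + n2"] qt(1) rs(1) by (auto simp: D.awlast_append)
   have 3: "D.awlast u (take (length q + (length r + n3)) p) = j"
    using n3 in_ij'[of "length q + (length r + n3)"] qt(1) rs(1) by (auto simp: D.awlast_append)
   \<comment> \<open>The three visits happen at weakly increasing positions; consecutive ones are at
     different vertices, hence at different positions.\<close>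
   have "n1 ~= length q + n2" "n2 ~= length r + n3" using 1 2 3 ij(3) by metis+
   then have "length p \<ge> 2" using n1(1) n2(1) n3(1) qt(1) rs(1) by auto
   then obtain a a' p' where p: "p = a # a' # p'" by (metis One_nat_def Suc_1 Suc_le_length_iff)
   then have a: "a : arcs D" "tail D a = u" and a': "a' : arcs D" "tail D a' = head D a"
    and p': "(head D a', p') : quiver_paths D" using path(1) by (auto simp: D.quiver_paths_Cons)
   have v: "u : {i, j}" "head D a : {i, j}" "head D a' : {i, j}"
    using in_ij[of "[]" p] in_ij[of "[a]" "a' # p'"] in_ij[of "[a, a']" p'] p by (simp_all add: D.awlast_eq)
   have ends: "{tail D a, head D a} = {i, j}" "{tail D a', head D a'} = {i, j}"
    unfolding a(2) a'(2) using v double_no_loops[OF a(1)] double_no_loops[OF a'(1)] a(2) a'(2)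
    by (auto intro!: doubleton_eqI)
   have "a' = opposite a" using a a' ends by (intro arc_unique[OF ij(4) _ _ a'(1) ends(2)]) (auto simp: insert_commute)
   then have "pe (u, p) = mul (pe (tail D a, [a, opposite a])) (pe (head D a', p'))"
    using p a by (simp add: D.path_elem_mult_path_elem D.awlast_eq)
   moreover have car: "pe (tail D a, [a, opposite a]) : carrier PP" "pe (head D a', p') : carrier PP"
    using double_path[OF a(1)] p' by (auto intro: path_elem_carrier)
   ultimately have "cls (pe (u, p)) = cls (pe (tail D a, [a, opposite a])) \<otimes>\<^bsub>Pi\<^esub> cls (pe (head D a', p'))"
    by (simp only: cls_mult)
   then show ?thesis using double_arrow_in_KI[OF ij(3,4) a(1) ends(1)] cls_in[OF car(2)]
     ideal.I_r_closed[OF ideal_KI] by (simp only:)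
  qed
 qed
 finally show "ideal_prod Pi (VI i) (ideal_prod Pi (VI j) (VI i)) \<subseteq> KI i j" .
qed

abbreviation vprod :: "'v => ('v, 'a, 'k) pfun set set => ('v, 'a, 'k) pfun set set" where
 "vprod i A \<equiv> ideal_prod Pi (VI i) A"

lemma vprod_ideal: "i : verts Q ==> ideal A Pi ==> ideal (vprod i A) Pi" by (intro Pi.ideal_prod_is_ideal ideal_VI)

lemma vprod_idem:
 assumes "i : verts Q" "ideal A Pi"
 shows "vprod i (vprod i A) = vprod i A"
 using Pi.ideal_prod_assoc[OF ideal_VI[OF assms(1)] ideal_VI[OF assms(1)] assms(2)] VI_idem[OF assms(1)] by simp

lemma vprod_commute:
 assumes i: "i : verts Q" and j: "j : verts Q" and A: "ideal A Pi" and n: "num_arrows Q i j = 0"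
 shows "vprod i (vprod j A) = vprod j (vprod i A)"
proof (cases "i = j")
 case False
 have n': "num_arrows Q j i = 0" using n by (simp add: num_arrows_def insert_commute)
 have "vprod i (vprod j A) = ideal_prod Pi (ideal_prod Pi (VI i) (VI j)) A"
  using i j A by (simp add: Pi.ideal_prod_assoc ideal_VI)
 also have "\<dots> = ideal_prod Pi (ideal_prod Pi (VI j) (VI i)) A"
  using VI_commute_aux[OF i j False n] VI_commute_aux[OF j i _ n'] False KI_commute[of i j] by simp
 also have "\<dots> = vprod j (vprod i A)" using i j A by (simp add: Pi.ideal_prod_assoc ideal_VI)
 finally show ?thesis .
qed simp

lemma vprod_braid:
 assumes i: "i : verts Q" and j: "j : verts Q" and A: "ideal A Pi" and n: "num_arrows Q i j = 1"
 shows "vprod i (vprod j (vprod i A)) = vprod j (vprod i (vprod j A))"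
proof (cases "i = j")
 case False
 have n': "num_arrows Q j i = 1" using n by (simp add: num_arrows_def insert_commute)
 have "vprod i (vprod j (vprod i A)) = ideal_prod Pi (ideal_prod Pi (VI i) (ideal_prod Pi (VI j) (VI i))) A"
  using i j A by (simp add: Pi.ideal_prod_assoc ideal_VI Pi.ideal_prod_is_ideal)
 also have "\<dots> = ideal_prod Pi (ideal_prod Pi (VI j) (ideal_prod Pi (VI i) (VI j))) A"
  using VI_braid_aux[OF i j False n] VI_braid_aux[OF j i _ n'] False KI_commute[of i j] by simp
 also have "\<dots> = vprod j (vprod i (vprod j A))"
  using i j A by (simp add: Pi.ideal_prod_assoc ideal_VI Pi.ideal_prod_is_ideal)
 finally show ?thesis .
qed simp

lemma foldr_vprod_subset:
 assumes "set js <= verts Q" "A \<subseteq> L Z"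
 shows "foldr vprod js A \<subseteq> L (foldr (%i. cat (leaves i)) js Z)" using assms(1)
proof (induction js)
 case Nil
 then show ?case using assms(2) by simp
next
 case (Cons j js)
 then show ?case unfolding foldr.simps o_apply by (intro ideal_prod_L VI_subset_L) auto
qed

text \<open>A trivial factor in \<open>leaves j\<close> starts at a vertex other than j. So if the
  starting vertex occurs in js, some factor is nontrivial and adds an arrow.\<close>

lemma length_foldr_cat:
 "(u, p) : foldr (%i. cat (leaves i)) js {x. n <= length (snd x)} ==>
  n <= length p & (u : set js --> Suc n <= length p)"
proof (induction js arbitrary: u p)
 case (Cons j js)
 then obtain q r where qr: "p = q @ r" "(u, q) : leaves j"
   "(D.awlast u q, r) : foldr (%i. cat (leaves i)) js {x. n <= length (snd x)}"
  unfolding foldr.simps o_apply cat_def by blast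
 show ?case
 proof (cases "q = []")
  case True
  then have "u ~= j" using qr(2) by (simp add: leaves_iff D.awlast_eq)
  then show ?thesis using Cons.IH[OF qr(3)] qr(1) True by (simp add: D.awlast_eq)
 next
  case False
  then have "1 <= length q" by (simp add: Suc_le_eq)
  then show ?thesis using Cons.IH[OF qr(3)] qr(1) by simp
 qed
qed simp

text \<open>Graded Nakayama: an ideal absorbed by all vertex ideals lies in every power of the arrow ideal.\<close>

lemma vprod_fixed_zero:
 assumes W: "ideal W Pi" and fixed: "!!i. i : verts Q ==> vprod i W = W"
 shows "W = {\<zero>\<^bsub>Pi\<^esub>}"
proof -
 interpret W: ideal W Pi by (rule W)
 obtain js where js: "set js = verts Q" using finite_list[OF finite_verts] by blast
 have "foldr vprod js' W = W" if "set js' <= verts Q" for js' using that by (induction js') (auto simp: fixed)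
 then have eq: "foldr vprod js W = W" using js by blast
 have "W \<subseteq> M n" for n
 proof (induction n)
  case 0
  have "M 0 = carrier Pi" by (simp add: M_def high_0 cls_carrier)
  then show ?case using W.a_subset by simp
 next
  case (Suc n)
  have "W \<subseteq> L (foldr (%i. cat (leaves i)) js {x. n <= length (snd x)})"
   using foldr_vprod_subset[of js W "{x. n <= length (snd x)}"] js Suc eq by (simp add: M_eq_L)
  also have "\<dots> \<subseteq> M (Suc n)"
  proof (rule L_subset_ideal[OF ideal_M], clarify)
   fix u p assume x: "(u, p) : quiver_paths D"
    "(u, p) : foldr (%i. cat (leaves i)) js {x. n <= length (snd x)}"
   have "u : set js" using D.quiver_paths_start[OF x(1)] js by simp
   then show "cls (pe (u, p)) : M (Suc n)" using length_foldr_cat[OF x(2)] x(1) by (intro M_I path_elem_high) auto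
  qed
  finally show ?case .
 qed
 moreover have "x = \<zero>\<^bsub>Pi\<^esub>" if x: "x : W" "!!n. x : M n" for x
 proof -
  obtain f where f: "f : carrier PP" "x = cls f" using x(1) W.Icarr cls_carrier by blast
  \<comment> \<open>Take n beyond all lengths occurring in a representative f. If the class also has
    a representative of length at least n, homogeneity makes f itself a relation.\<close>
  have "finite ((%y. length (snd y)) ` {y. f y ~= 0})" using P_finite[OF f(1)] by simp
  then obtain n where n: "ALL m:(%y. length (snd y)) ` {y. f y ~= 0}. m < n" using finite_nat_set_iff_bounded by blast
  have fn: "below n f = f" using n by (auto simp: fun_eq_iff below_apply)
  obtain g where g: "g : high n" "g : carrier PP" "x = cls g" using x(2)[of n] by (rule M_E)
  have "f - g : RR" using f g cls_eq_iff by blast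
  then have "below n (f - g) : RR" by (rule below_R)
  moreover have "below n (f - g) = f" using fn g(1) by (simp add: below_diff high_def)
  ultimately show ?thesis using f cls_eq_zero_iff by simp
 qed
 ultimately show ?thesis using W.zero_closed by blast
qed

text \<open>Every arrow lies in every vertex ideal, because without loops one of its ends differs
  from i. So the first arrows can be distributed over the factors.\<close>

lemma long_path_in_foldr:
 assumes "set js <= verts Q" "(u, p) : quiver_paths D" "length js <= length p"
 shows "cls (pe (u, p)) : foldr vprod js (carrier Pi)" using assms
proof (induction js arbitrary: u p)
 case Nil
 then show ?case by (simp add: cls_in path_elem_carrier)
next
 case (Cons i js)
 then obtain a q where p: "p = a # q" by (cases p) auto
 then have a: "a : arcs D" "tail D a = u" "(head D a, q) : quiver_paths D" "(u, [a]) : quiver_paths D"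
  using Cons.prems(2) D.quiver_paths_start[of "head D a" q] by (auto simp: D.quiver_paths_Cons)
 have i: "i : verts Q" using Cons.prems by simp
 have "cls (pe (u, [a])) : VI i"
 proof (cases "u = i")
  case False
  then show ?thesis
   using path_in_ideal[OF ideal_VI[OF i], of u "[]" "[a]"] a vertex_in_VI[OF i] D.quiver_paths_start[OF a(4)]
   by (simp add: D.awlast_eq)
 next
  case True
  then have "head D a ~= i" using double_no_loops[OF a(1)] a(2) by simp
  then show ?thesis
   using path_in_ideal[OF ideal_VI[OF i], of u "[a]" "[]"] a vertex_in_VI[OF i] D.head_in_verts[OF a(1)]
   by (simp add: D.awlast_eq)
 qed
 moreover have "cls (pe (head D a, q)) : foldr vprod js (carrier Pi)" using Cons.IH[OF _ a(3)] Cons.prems p by simp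
 moreover have "cls (pe (u, p)) = cls (pe (u, [a])) \<otimes>\<^bsub>Pi\<^esub> cls (pe (head D a, q))"
 proof -
  have "pe (u, p) = mul (pe (u, [a])) (pe (head D a, q))"
   using p a by (simp add: D.path_elem_mult_path_elem D.awlast_eq)
  moreover have "pe (u, [a]) : carrier PP" "pe (head D a, q) : carrier PP" using a by (auto intro: path_elem_carrier)
  ultimately show ?thesis by (simp only: cls_mult)
 qed
 ultimately show ?case by (simp add: ideal_prod.prod)
qed

end

subsection \<open>Preprojective algebras of full subquivers\<close>

lemma (in ring) minus_eq_zero_iff:
 assumes "x : carrier R" "y : carrier R"
 shows "x \<ominus> y = \<zero> \<longleftrightarrow> x = y"
proof
 assume "x \<ominus> y = \<zero>"
 moreover have "x = x \<ominus> y \<oplus> y" using assms by (simp add: minus_eq a_assoc l_neg)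
 ultimately show "x = y" using assms by simp
qed (use assms in \<open>simp add: minus_eq r_neg\<close>)

lemma ring_hom_genideal_subset:
 assumes "ring A" "ring B" "h : ring_hom A B" "ideal J B" "S <= carrier A" "h ` S \<subseteq> J"
 shows "h ` (Idl\<^bsub>A\<^esub> S) \<subseteq> J"
proof -
 interpret A: ring A by (rule assms(1))
 interpret B: ring B by (rule assms(2))
 interpret h: ring_hom_ring A B h by (rule ring_hom_ringI2[OF assms(1-3)])
 have "Idl\<^bsub>A\<^esub> S <= {r : carrier A. h r : J}"
  using assms(5,6) by (intro A.genideal_minimal h.ideal_vimage assms(4)) auto
 then show ?thesis by blast
qed

lemma ring_hom_ideal_prod:
 assumes "ring A" "h : ring_hom A B" "ideal I A" "ideal J A" "h ` I \<subseteq> I'" "h ` J \<subseteq> J'"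
 shows "h ` ideal_prod A I J \<subseteq> ideal_prod B I' J'"
proof -
 interpret A: ring A by (rule assms(1))
 interpret I: ideal I A by (rule assms(3))
 interpret J: ideal J A by (rule assms(4))
 have "x : carrier A & h x : ideal_prod B I' J'" if "x : ideal_prod A I J" for x using that
 proof induction
  case (prod i j)
  have c: "i : carrier A" "j : carrier A" using prod I.Icarr J.Icarr by blast+
  have "h i \<otimes>\<^bsub>B\<^esub> h j : ideal_prod B I' J'" using prod assms(5,6) by (intro ideal_prod.prod) blast+
  then show ?case using c by (simp add: ring_hom_mult[OF assms(2)])
 next
  case (sum s t)
  then show ?case using ideal_prod.sum[of "h s" B I' J' "h t"] by (simp add: ring_hom_add[OF assms(2)])
 qed
 then show ?thesis by blast
qed

lemma algebra_iso_factor: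
 assumes "algebra_ideal A I"
  and surj: "h ` carrier A = carrier B"
  and hom: "h : ring_hom A B"
  and scale: "!!c x. x : carrier A ==> h (c \<odot>\<^bsub>A\<^esub> x) = c \<odot>\<^bsub>B\<^esub> h x"
  and ker: "!!x y. x : carrier A ==> y : carrier A ==> h x = h y \<longleftrightarrow> x \<ominus>\<^bsub>A\<^esub> y : I"
 shows "\<exists>\<phi>. \<phi> : algebra_iso B (factor A I)"
proof -
 interpret I: algebra_ideal A I by (rule assms(1))
 define g where "g = inv_into (carrier A) h"
 define \<phi> where "\<phi> y = I +>\<^bsub>A\<^esub> g y" for y
 have g: "g y : carrier A" "h (g y) = y" if "y : carrier B" for y
  using that surj unfolding g_def by (metis inv_into_into, metis f_inv_into_f)
 have \<phi>h: "\<phi> (h x) = I +>\<^bsub>A\<^esub> x" if "x : carrier A" for x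
 proof -
  have "h x : carrier B" using that surj by blast
  then show ?thesis unfolding \<phi>_def using I.coset_eq_iff[OF g(1) that] ker[OF g(1) that] g(2) by blast
 qed
 have B: "EX x:carrier A. y = h x" if "y : carrier B" for y using that surj by blast
 have "bij_betw \<phi> (carrier B) (carrier (factor A I))"
 proof (rule bij_betw_imageI)
  show "inj_on \<phi> (carrier B)"
  proof (rule inj_onI)
   fix y z assume y: "y : carrier B" and z: "z : carrier B" and eq: "\<phi> y = \<phi> z"
   have "h (g y) = h (g z)"
    using eq unfolding \<phi>_def ker[OF g(1)[OF y] g(1)[OF z]] I.coset_eq_iff[OF g(1)[OF y] g(1)[OF z]] .
   then show "y = z" using g(2) y z by simp
  qed
  have "\<phi> ` carrier B = (%x. \<phi> (h x)) ` carrier A" unfolding surj[symmetric] image_image ..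
  also have "\<dots> = (%x. I +>\<^bsub>A\<^esub> x) ` carrier A" by (rule image_cong[OF HOL.refl \<phi>h])
  finally show "\<phi> ` carrier B = carrier (factor A I)" unfolding I.coset_carrier .
 qed
 moreover have "\<phi> : ring_hom B (factor A I)"
 proof (rule ring_hom_memI)
  fix y z assume y: "y : carrier B" and z: "z : carrier B"
  obtain a where a: "a : carrier A" "y = h a" using B[OF y] by blast
  obtain b where b: "b : carrier A" "z = h b" using B[OF z] by blast
  show "\<phi> y : carrier (factor A I)" using a \<phi>h I.coset_carrier by blast
  show "\<phi> (y \<otimes>\<^bsub>B\<^esub> z) = \<phi> y \<otimes>\<^bsub>factor A I\<^esub> \<phi> z"
   unfolding a(2) b(2) ring_hom_mult[OF hom a(1) b(1), symmetric] using a b by (simp add: \<phi>h I.coset_mult)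
  show "\<phi> (y \<oplus>\<^bsub>B\<^esub> z) = \<phi> y \<oplus>\<^bsub>factor A I\<^esub> \<phi> z"
   unfolding a(2) b(2) ring_hom_add[OF hom a(1) b(1), symmetric] using a b by (simp add: \<phi>h I.coset_add)
 next
  show "\<phi> \<one>\<^bsub>B\<^esub> = \<one>\<^bsub>factor A I\<^esub>"
   unfolding ring_hom_one[OF hom, symmetric] by (simp add: \<phi>h I.coset_one)
 qed
 moreover have "\<phi> (c \<odot>\<^bsub>B\<^esub> y) = c \<odot>\<^bsub>factor A I\<^esub> \<phi> y" if y: "y : carrier B" for c y
 proof -
  obtain a where a: "a : carrier A" "y = h a" using B[OF y] by blast
  show ?thesis unfolding a(2) scale[OF a(1), symmetric] using a by (simp add: \<phi>h I.coset_scale)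
 qed
 ultimately show ?thesis unfolding algebra_iso_def ring_iso_def by blast
qed

locale nilpotent_preprojective = preprojective Q field
 for Q :: "('v, 'a) pre_digraph" and field :: "'k::field itself" +
 fixes N :: nat
 assumes long_path_R: "x : quiver_paths D ==> N <= length (snd x) ==> pe x : RR"
begin

lemma high_subset_R: "f : high N ==> f : RR"
 by (induction rule: high_induct) (simp_all only: R_0 R_add R_scale long_path_R)

lemma cls_below: "f : carrier PP ==> cls (below N f) = cls f"
proof -
 assume f: "f : carrier PP"
 have b: "below N f : carrier PP" by (rule below_PP[OF path_algebra_functions[OF f]])
 have "f - below N f : high N" using P_diff[OF f b] by (simp add: high_def) (simp only: below_diff below_below diff_self)
 then have "cls f = cls (below N f)" using cls_eq_iff[OF f b] high_subset_R by blast
 then show ?thesis by (rule HOL.sym)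
qed

end

text \<open>Records what remains of w_0 in the comparison of the two algebras: a word in the
  vertices of Q' along which the product of the vertex ideals of the small algebra is zero.\<close>

locale full_subquiver = B: loopfree_preprojective Q field + S: loopfree_preprojective Q' field
 for Q Q' :: "('v, 'a) pre_digraph" and field :: "'k::field itself" +
 assumes compatible: "tail Q' = tail Q" "head Q' = head Q"
  and verts_subset: "verts Q' <= verts Q"
  and full: "arcs Q' = {a : arcs Q. tail Q a : verts Q' & head Q a : verts Q'}"
 fixes js :: "'v list"
 assumes js: "set js <= verts Q'"
  and js_zero: "foldr S.vprod js (carrier S.Pi) = {\<zero>\<^bsub>S.Pi\<^esub>}"
begin

lemma double_compatible: "tail S.D = tail B.D" "head S.D = head B.D" by (simp_all add: double_quiver_def compatible)

lemma double_arcs: "a : arcs S.D \<longleftrightarrow> a : arcs B.D & tail B.D a : verts Q' & head B.D a : verts Q'"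
 by (cases a) (auto simp: full)

lemma awlast_eq_awlast: "pre_digraph.awlast S.D u p = pre_digraph.awlast B.D u p"
 by (simp add: pre_digraph.awlast_eq double_compatible)

lemma mult_eq_mult: "S.mul = B.mul" unfolding path_mult_def awlast_eq_awlast ..

lemma sub_path: "(u, p) : quiver_paths S.D ==> (u, p) : quiver_paths B.D"
proof (induction p arbitrary: u)
 case (Cons a p)
 then show ?case using double_arcs by (simp add: S.D.quiver_paths_Cons B.D.quiver_paths_Cons double_compatible)
qed (use verts_subset in auto)

lemma path_outside:
 "(u, p) : quiver_paths B.D ==> (u, p) ~: quiver_paths S.D ==>
  EX q r. p = q @ r & B.D.awlast u q ~: verts Q'"
proof (induction p arbitrary: u)
 case Nil
 then show ?case by (auto simp: B.D.awlast_eq)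
next
 case (Cons a p)
 show ?case
 proof (cases "u : verts Q' & head B.D a : verts Q'")
  case True
  then have "(head B.D a, p) ~: quiver_paths S.D" "(head B.D a, p) : quiver_paths B.D" using Cons.prems double_arcs
   by (auto simp: S.D.quiver_paths_Cons B.D.quiver_paths_Cons double_compatible)
  then obtain q r where "p = q @ r" "B.D.awlast (head B.D a) q ~: verts Q'" using Cons.IH by blast
  then have "a # p = (a # q) @ r & B.D.awlast u (a # q) ~: verts Q'"
   using B.D.awlast_append[of u "[a]" q] by (simp add: B.D.awlast_eq)
  then show ?thesis by blast
 next
  case False
  then have "a # p = [] @ (a # p) & B.D.awlast u [] ~: verts Q' \<or>
    a # p = [a] @ p & B.D.awlast u [a] ~: verts Q'"
   using Cons.prems(1) by (auto simp: B.D.awlast_eq B.D.quiver_paths_Cons)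
  then show ?thesis by blast
 qed
qed

definition res :: "('v, 'a, 'k) pfun => ('v, 'a, 'k) pfun" where
 "res f = (%x. if x : quiver_paths S.D then f x else 0)"

lemma fun_linear_res: "fun_linear res" by (rule fun_linearI; rule ext) (simp_all add: res_def)

lemmas res_add = fun_linear_add[OF fun_linear_res]
 and res_scale = fun_linear_scale[OF fun_linear_res]
 and res_diff = fun_linear_diff[OF fun_linear_res]
 and res_0 = fun_linear_0[OF fun_linear_res]

lemma res_PP: "f : carrier B.PP ==> res f : carrier S.PP"
proof -
 assume f: "f : carrier B.PP"
 have "finite {x. res f x ~= 0}" by (rule finite_subset[OF _ B.P_finite[OF f]]) (auto simp: res_def)
 moreover have "res f : S.PF" by (rule pfunctionsI) (simp add: res_def split: if_splits)
 ultimately show ?thesis by (simp add: path_algebra_simps)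
qed

lemma PP_subset: "f : carrier S.PP ==> f : carrier B.PP"
proof -
 assume f: "f : carrier S.PP"
 have "f : B.PF" using pfunctionsD[OF path_algebra_functions[OF f]] sub_path by (intro pfunctionsI) blast
 then show ?thesis using S.P_finite[OF f] by (simp add: path_algebra_simps)
qed

lemma res_sub: "f : carrier S.PP ==> res f = f"
 using pfunctionsD[OF path_algebra_functions[of f]] by (fastforce simp: res_def)

text \<open>A path lies in Q' exactly if both pieces of any of its splittings do, so discarding the
  paths that leave Q' respects the convolution.\<close>

lemma res_mult: "res (B.mul f g) = B.mul (res f) (res g)"
proof (rule ext, clarify)
 fix u p
 have split: "(u, p) : quiver_paths S.D \<longleftrightarrow>
   (u, take n p) : quiver_paths S.D & (B.D.awlast u (take n p), drop n p) : quiver_paths S.D" for n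
  using S.D.quiver_paths_append[of u "take n p" "drop n p"] unfolding awlast_eq_awlast append_take_drop_id .
 show "res (B.mul f g) (u, p) = B.mul (res f) (res g) (u, p)"
 proof (cases "(u, p) : quiver_paths S.D")
  case True
  have "B.mul (res f) (res g) (u, p) = B.mul f g (u, p)" unfolding path_mult_def prod.case
   by (rule sum.cong[OF HOL.refl]) (use split True in \<open>simp add: res_def\<close>)
  then show ?thesis using True by (simp add: res_def)
 next
  case False
  have "B.mul (res f) (res g) (u, p) = 0" unfolding path_mult_def prod.case
   by (rule sum.neutral) (use split False in \<open>auto simp: res_def\<close>)
  then show ?thesis using False by (simp add: res_def)
 qed
qed

lemma res_one: "res \<one>\<^bsub>B.PP\<^esub> = \<one>\<^bsub>S.PP\<^esub>"
proof (rule ext, clarify)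
 show "res \<one>\<^bsub>B.PP\<^esub> (u, p) = \<one>\<^bsub>S.PP\<^esub> (u, p)" for u p
  using verts_subset by (cases p) (auto simp: res_def B.one_apply S.one_apply)
qed

lemma res_path_elem: "x : quiver_paths S.D ==> res (B.pe x) = S.pe x"
  "x ~: quiver_paths S.D ==> res (B.pe x) = 0" by (rule ext; simp add: res_def path_elem_apply)+

lemma res_total: "res B.total = S.total"
proof -
 have "res B.total = (SUM c:arcs B.D. res (fscale (arrow_sign c) (B.pe (tail B.D c, [c, opposite c]))))"
  unfolding B.total_relation_def by (rule fun_linear_sum[OF fun_linear_res])
 also have "\<dots> = (SUM c:arcs S.D. res (fscale (arrow_sign c) (B.pe (tail B.D c, [c, opposite c]))))"
 proof (rule sum.mono_neutral_right[OF B.D.finite_arcs])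
  show "ALL c:arcs B.D - arcs S.D. res (fscale (arrow_sign c) (B.pe (tail B.D c, [c, opposite c]))) = 0"
  proof
   fix c assume "c : arcs B.D - arcs S.D"
   then have "(tail B.D c, [c, opposite c]) ~: quiver_paths S.D" by (simp add: S.D.quiver_paths_Cons)
   from res_path_elem(2)[OF this] show "res (fscale (arrow_sign c) (B.pe (tail B.D c, [c, opposite c]))) = 0"
    unfolding res_scale by (simp only:) (rule ext, simp)
  qed
 qed (use double_arcs in blast)
 also have "\<dots> = S.total" unfolding S.total_relation_def
 proof (rule sum.cong[OF HOL.refl])
  fix c assume "c : arcs S.D"
  then have "(tail B.D c, [c, opposite c]) : quiver_paths S.D" using S.double_path by (simp add: double_compatible)
  then show "res (fscale (arrow_sign c) (B.pe (tail B.D c, [c, opposite c]))) =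
    fscale (arrow_sign c) (S.pe (tail S.D c, [c, opposite c]))"
   unfolding res_scale double_compatible by (simp only: res_path_elem)
 qed
 finally show ?thesis .
qed

lemma ring_PP: "ring B.PP" "ring S.PP" using B.algebra_over_P S.algebra_over_P by (auto simp: algebra_over_def)

lemma res_hom: "res : ring_hom B.PP S.PP" by (rule ring_hom_memI)
  (simp_all only: path_algebra_simps(1,2) res_PP res_mult res_add res_one mult_eq_mult)

lemma ideal_RR: "ideal S.RR S.PP" using S.algebra_ideal_R by (auto simp: algebra_ideal_def)

lemma res_R: "f : B.RR ==> res f : S.RR"
proof -
 have "res ` (Idl\<^bsub>B.PP\<^esub> {B.total}) \<subseteq> S.RR"
  using B.total_relation_carrier S.total_relation_in_R res_total
  by (intro ring_hom_genideal_subset[OF ring_PP res_hom ideal_RR]) simp_all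
 then show "f : B.RR ==> res f : S.RR" unfolding B.preproj_ideal_eq by blast
qed

abbreviation N :: nat where "N \<equiv> length js"

text \<open>The nilpotency bound: a path with at least as many arrows as js has letters lies in the
  product along js, which is zero.\<close>

lemma long_path_R: "x : quiver_paths S.D ==> N <= length (snd x) ==> S.pe x : S.RR"
proof -
 assume x: "x : quiver_paths S.D" "N <= length (snd x)"
 have car: "S.pe x : carrier S.PP" by (rule path_elem_carrier[OF x(1)])
 have "S.cls (S.pe (fst x, snd x)) : foldr S.vprod js (carrier S.Pi)" using x by (intro S.long_path_in_foldr js) simp_all
 then have "S.cls (S.pe x) = \<zero>\<^bsub>S.Pi\<^esub>" unfolding js_zero by simp
 then show ?thesis using S.cls_eq_zero_iff[OF car] by (rule iffD1[rotated])
qed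

sublocale S: nilpotent_preprojective Q' field N by unfold_locales (rule long_path_R)

text \<open>The truncation at N makes the series finite. Paths in Q' with at least N arrows are
  relations, so this does not affect the result.\<close>

definition to_sub :: "('v, 'a, 'k) pfun => ('v, 'a, 'k) pfun set" where
 "to_sub f = S.cls (res (below N f))"

lemma res_below_PP: "f : B.PF ==> res (below N f) : carrier S.PP" by (rule res_PP[OF B.below_PP])

lemma to_sub_in: "f : B.PF ==> to_sub f : carrier S.Pi" unfolding to_sub_def by (rule S.cls_in[OF res_below_PP])

lemma below_res: "below n (res f) = res (below n f)" by (rule ext) (simp add: res_def below_apply)

lemma to_sub_mult: "f : B.PF ==> g : B.PF ==> to_sub (B.mul f g) = to_sub f \<otimes>\<^bsub>S.Pi\<^esub> to_sub g"
proof -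
 assume f: "f : B.PF" and g: "g : B.PF"
 note c = res_below_PP[OF f] res_below_PP[OF g]
 have "to_sub (B.mul f g) = S.cls (below N (res (B.mul (below N f) (below N g))))"
  unfolding to_sub_def below_path_mult[of N _ f g] below_res ..
 also have "\<dots> = S.cls (below N (S.mul (res (below N f)) (res (below N g))))" unfolding res_mult mult_eq_mult ..
 also have "\<dots> = S.cls (S.mul (res (below N f)) (res (below N g)))" by (rule S.cls_below[OF S.P_mult_closed[OF c]])
 also have "\<dots> = to_sub f \<otimes>\<^bsub>S.Pi\<^esub> to_sub g" unfolding to_sub_def by (rule S.cls_mult[OF c])
 finally show ?thesis .
qed

lemma to_sub_add: "f : B.PF ==> g : B.PF ==> to_sub (f + g) = to_sub f \<oplus>\<^bsub>S.Pi\<^esub> to_sub g"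
 unfolding to_sub_def fun_linear_add[OF fun_linear_below] res_add by (rule S.cls_add[OF res_below_PP res_below_PP])

lemma to_sub_scale: "f : B.PF ==> to_sub (fscale c f) = c \<odot>\<^bsub>S.Pi\<^esub> to_sub f"
 unfolding to_sub_def fun_linear_scale[OF fun_linear_below] res_scale by (rule S.cls_scale[OF res_below_PP])

lemma to_sub_finite: "f : carrier B.PP ==> to_sub f = S.cls (res f)"
 unfolding to_sub_def below_res[symmetric] by (rule S.cls_below[OF res_PP])

lemma to_sub_cong:
 assumes f: "f : B.PF" and g: "g : B.PF" and eq: "B.Theta f = B.Theta g"
 shows "to_sub f = to_sub g"
proof -
 have "below N (f - g) : B.RR" using eq B.Theta_eq_iff[OF f g] by blast
 then have "res (below N f - below N g) : S.RR" unfolding below_diff by (rule res_R)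
 then have "res (below N f) - res (below N g) : S.RR" unfolding res_diff .
 then show ?thesis unfolding to_sub_def using S.cls_eq_iff[OF res_below_PP[OF f] res_below_PP[OF g]] by blast
qed

definition proj :: "(nat => ('v, 'a, 'k) pfun set set) => ('v, 'a, 'k) pfun set" where
 "proj x = to_sub (SOME f. f : B.PF & B.Theta f = x)"

lemma proj_Theta: "f : B.PF ==> proj (B.Theta f) = to_sub f"
proof -
 assume f: "f : B.PF"
 then have "EX g. g : B.PF & B.Theta g = B.Theta f" by blast
 from someI_ex[OF this] show ?thesis unfolding proj_def using to_sub_cong[OF _ f] by blast
qed

lemma Lam_cases:
 assumes "x : carrier B.Lam"
 obtains f where "f : B.PF" "x = B.Theta f" using assms unfolding B.Theta_carrier by blast

lemma PF_PP: "f : carrier B.PP ==> f : B.PF" by (rule path_algebra_functions)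

lemma PF_mult: "f : B.PF ==> g : B.PF ==> B.mul f g : B.PF" by (rule B.D.path_mult_closed)

lemma PF_add: "f : B.PF ==> g : B.PF ==> f + g : B.PF" by (rule fun_subspace_add[OF fun_subspace_pfunctions])

lemma PF_scale: "f : B.PF ==> fscale c f : B.PF" by (rule fun_subspace_scale[OF fun_subspace_pfunctions])

lemma PF_diff: "f : B.PF ==> g : B.PF ==> f - g : B.PF" by (rule fun_subspace_diff[OF fun_subspace_pfunctions])

lemma proj_hom: "proj : ring_hom B.Lam S.Pi"
proof (rule ring_hom_memI)
 fix x y assume "x : carrier B.Lam" "y : carrier B.Lam"
 then obtain f g where f: "f : B.PF" "x = B.Theta f" and g: "g : B.PF" "y = B.Theta g" by (meson Lam_cases)
 show "proj x : carrier S.Pi" unfolding f(2) proj_Theta[OF f(1)] by (rule to_sub_in[OF f(1)])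
 show "proj (x \<otimes>\<^bsub>B.Lam\<^esub> y) = proj x \<otimes>\<^bsub>S.Pi\<^esub> proj y"
  unfolding f(2) g(2) B.Theta_mult[OF f(1) g(1), symmetric] proj_Theta[OF f(1)] proj_Theta[OF g(1)]
   proj_Theta[OF PF_mult[OF f(1) g(1)]] by (rule to_sub_mult[OF f(1) g(1)])
 show "proj (x \<oplus>\<^bsub>B.Lam\<^esub> y) = proj x \<oplus>\<^bsub>S.Pi\<^esub> proj y"
  unfolding f(2) g(2) B.Theta_add[OF f(1) g(1), symmetric] proj_Theta[OF f(1)] proj_Theta[OF g(1)]
   proj_Theta[OF PF_add[OF f(1) g(1)]] by (rule to_sub_add[OF f(1) g(1)])
next
 have one: "\<one>\<^bsub>B.PP\<^esub> : carrier B.PP" using ring_PP(1) by (rule ring.ring_simprules(6))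
 show "proj \<one>\<^bsub>B.Lam\<^esub> = \<one>\<^bsub>S.Pi\<^esub>"
  unfolding B.Theta_one[symmetric] proj_Theta[OF PF_PP[OF one]] to_sub_finite[OF one] res_one by (rule S.cls_one)
qed

lemma proj_scale: "x : carrier B.Lam ==> proj (c \<odot>\<^bsub>B.Lam\<^esub> x) = c \<odot>\<^bsub>S.Pi\<^esub> proj x"
proof -
 assume "x : carrier B.Lam"
 then obtain f where f: "f : B.PF" "x = B.Theta f" by (rule Lam_cases)
 show ?thesis unfolding f(2) B.Theta_scale[OF f(1), symmetric] proj_Theta[OF f(1)] proj_Theta[OF PF_scale[OF f(1)]]
  by (rule to_sub_scale[OF f(1)])
qed

lemma proj_surj: "proj ` carrier B.Lam = carrier S.Pi"
proof
 show "proj ` carrier B.Lam <= carrier S.Pi" using ring_hom_closed[OF proj_hom] by blast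
 show "carrier S.Pi \<subseteq> proj ` carrier B.Lam"
 proof
  fix y assume "y : carrier S.Pi"
  then obtain f where f: "f : carrier S.PP" "y = S.cls f" unfolding S.cls_carrier by blast
  have c: "f : carrier B.PP" by (rule PP_subset[OF f(1)])
  have "proj (B.Theta f) = y" unfolding proj_Theta[OF PF_PP[OF c]] to_sub_finite[OF c] res_sub[OF f(1)] f(2) ..
  then show "y : proj ` carrier B.Lam" using B.Theta_in[OF PF_PP[OF c]] by blast
 qed
qed

text \<open>Three inclusions close a circle: this ideal lies in the word ideal, the word ideal in
  the kernel of \<open>proj\<close>, and that kernel in this ideal.\<close>

definition kernel_ideal :: "(nat => ('v, 'a, 'k) pfun set set) set" where
 "kernel_ideal = Idl\<^bsub>B.Lam\<^esub> {B.Theta (B.pe (v, [])) | v. v : verts Q - verts Q'}"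

lemma vertex_path: "v : verts Q ==> B.pe (v, []) : B.PF" by (rule path_elem_functions) simp

lemma kernel_generators: "{B.Theta (B.pe (v, [])) | v. v : verts Q - verts Q'} <= carrier B.Lam"
 using B.Theta_in vertex_path by blast

lemma ring_Lam: "ring B.Lam" "ring S.Pi" using B.algebra_over_Lam S.algebra_over_Pi by (auto simp: algebra_over_def)

lemma ideal_kernel: "ideal kernel_ideal B.Lam"
 unfolding kernel_ideal_def by (rule ring.genideal_ideal[OF ring_Lam(1) kernel_generators])

sublocale K: algebra_ideal B.Lam kernel_ideal using B.algebra_over_Lam ideal_kernel by (simp add: algebra_ideal_def)

lemma path_outside_kernel:
 assumes x: "x : quiver_paths B.D" "x ~: quiver_paths S.D"
 shows "B.Theta (B.pe x) : kernel_ideal"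
proof -
 obtain u p where up: "x = (u, p)" by (cases x)
 obtain q r where qr: "p = q @ r" "B.D.awlast u q ~: verts Q'" using path_outside x unfolding up by blast
 let ?v = "B.D.awlast u q"
 have paths: "(u, q) : quiver_paths B.D" "(?v, r) : quiver_paths B.D"
  using x(1) unfolding up qr(1) B.D.quiver_paths_append by blast+
 have v: "?v : verts Q" using B.D.quiver_paths_end[OF paths(1)] by simp
 note PFs = path_elem_functions[OF paths(1), where 'c = 'k] path_elem_functions[OF paths(2), where 'c = 'k] vertex_path[OF v]
 have eq: "B.pe x = B.mul (B.mul (B.pe (u, q)) (B.pe (?v, []))) (B.pe (?v, r))"
  unfolding up qr(1) by (simp add: B.D.path_elem_mult_path_elem)
 have gen: "B.Theta (B.pe (?v, [])) : kernel_ideal" unfolding kernel_ideal_def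
  using ring.genideal_self[OF ring_Lam(1) kernel_generators] v qr(2) by blast
 have "B.Theta (B.pe x) = B.Theta (B.pe (u, q)) \<otimes>\<^bsub>B.Lam\<^esub> B.Theta (B.pe (?v, [])) \<otimes>\<^bsub>B.Lam\<^esub> B.Theta (B.pe (?v, r))"
  unfolding eq B.Theta_mult[OF PF_mult[OF PFs(1,3)] PFs(2)] B.Theta_mult[OF PFs(1,3)] ..
 then show ?thesis using K.I.I_r_closed[OF K.I.I_l_closed[OF gen B.Theta_in[OF PFs(1)]] B.Theta_in[OF PFs(2)]]
  by (simp only:)
qed

lemma Theta_kernel_add:
 "f : B.PF ==> g : B.PF ==> B.Theta f : kernel_ideal ==> B.Theta g : kernel_ideal ==>
  B.Theta (f + g) : kernel_ideal" by (simp only: B.Theta_add K.I.a_closed)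

lemma Theta_kernel_scale: "f : B.PF ==> B.Theta f : kernel_ideal ==> B.Theta (fscale c f) : kernel_ideal"
 by (simp only: B.Theta_scale K.ideal_scale[OF ideal_kernel])

lemma Theta_kernel_zero: "B.Theta 0 : kernel_ideal" unfolding B.Theta_zero by (rule K.I.zero_closed)

lemma PF_0: "0 : B.PF" by (rule fun_subspace_0[OF fun_subspace_pfunctions])

lemma res_PF: "f : carrier B.PP ==> res f : B.PF" by (rule PF_PP[OF PP_subset[OF res_PP]])

lemma complement_kernel:
 assumes "f : carrier B.PP"
 shows "B.Theta (f - res f) : kernel_ideal" using assms
proof (induction rule: path_algebra_induct)
 case zero
 show ?case unfolding res_0 diff_zero by (rule Theta_kernel_zero)
next
 case (step c x f)
 have px: "B.pe x : carrier B.PP" by (rule path_elem_carrier[OF step.hyps(1)])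
 have car: "B.pe x - res (B.pe x) : B.PF" "f - res f : B.PF" by (rule PF_diff[OF PF_PP res_PF], rule px, rule px)
   (rule PF_diff[OF PF_PP res_PF], rule step.hyps(2), rule step.hyps(2))
 have eq: "fscale c (B.pe x) + f - res (fscale c (B.pe x) + f) =
   fscale c (B.pe x - res (B.pe x)) + (f - res f)" unfolding res_add res_scale by (rule ext) (simp add: algebra_simps)
 have "B.Theta (B.pe x - res (B.pe x)) : kernel_ideal"
 proof (cases "x : quiver_paths S.D")
  case True
  show ?thesis unfolding res_path_elem(1)[OF True] diff_self by (rule Theta_kernel_zero)
 next
  case False
  show ?thesis unfolding res_path_elem(2)[OF False] diff_zero by (rule path_outside_kernel[OF step.hyps(1) False])
 qed
 then show ?case unfolding eq using car step.IH by (intro Theta_kernel_add Theta_kernel_scale PF_scale)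
qed

lemma Theta_res_kernel:
 assumes f: "f : carrier B.PP"
 shows "B.Theta (res f) : kernel_ideal \<longleftrightarrow> B.Theta f : kernel_ideal"
proof -
 have r: "res f : B.PF" "f - res f : B.PF" "f : B.PF" using res_PF[OF f] PF_PP[OF f] by (auto intro: PF_diff)
 have eq: "f = res f + (f - res f)" "res f = f + fscale (-1) (f - res f)" by (rule ext, simp)+
 show ?thesis using Theta_kernel_add[OF r(1,2) _ complement_kernel[OF f]]
   Theta_kernel_add[OF r(3) PF_scale[OF r(2)] _ Theta_kernel_scale[OF r(2) complement_kernel[OF f]], of "-1"]
  unfolding eq[symmetric] by blast
qed

lemma R_kernel: "f : B.RR ==> B.Theta f : kernel_ideal"
proof -
 assume f: "f : B.RR"
 have "ALL n. below n (f - 0) : B.RR" unfolding diff_zero using B.below_R[OF f] by blast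
 then have "B.Theta f = B.Theta 0" using B.Theta_eq_iff[OF PF_PP[OF B.R_carrier[OF f]] PF_0] by blast
 then show ?thesis using Theta_kernel_zero by (simp only:)
qed

text \<open>A relation of Q' need not be a relation of Q, but the total relations differ only by
  paths through outside vertices. Modulo \<open>kernel_ideal\<close> the inclusion of paths is a
  ring homomorphism that kills the total relation of Q', hence the ideal generated by it.\<close>

lemma sub_R_kernel:
 assumes "f : S.RR"
 shows "B.Theta f : kernel_ideal"
proof -
 let ?h = "%f. K.coset (B.Theta f)"
 have PFS: "f : B.PF" if "f : carrier S.PP" for f by (rule PF_PP[OF PP_subset[OF that]])
 note in_Lam = B.Theta_in[OF PFS]
 have one: "\<one>\<^bsub>B.PP\<^esub> : carrier B.PP" using ring_PP(1) by (rule ring.ring_simprules(6))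
 have one': "\<one>\<^bsub>S.PP\<^esub> : carrier S.PP" using ring_PP(2) by (rule ring.ring_simprules(6))
 have hom: "?h : ring_hom S.PP (factor B.Lam kernel_ideal)"
 proof (rule ring_hom_memI)
  fix f g assume f: "f : carrier S.PP" and g: "g : carrier S.PP"
  show "?h f : carrier (factor B.Lam kernel_ideal)" unfolding K.coset_carrier using in_Lam[OF f] by blast
  show "?h (f \<otimes>\<^bsub>S.PP\<^esub> g) = ?h f \<otimes>\<^bsub>factor B.Lam kernel_ideal\<^esub> ?h g"
   unfolding path_algebra_simps(1) mult_eq_mult B.Theta_mult[OF PFS[OF f] PFS[OF g]]
   by (rule K.coset_mult[OF in_Lam[OF f] in_Lam[OF g]])
  show "?h (f \<oplus>\<^bsub>S.PP\<^esub> g) = ?h f \<oplus>\<^bsub>factor B.Lam kernel_ideal\<^esub> ?h g"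
   unfolding path_algebra_simps(2) B.Theta_add[OF PFS[OF f] PFS[OF g]]
   by (rule K.coset_add[OF in_Lam[OF f] in_Lam[OF g]])
 next
  \<comment> \<open>The two units differ by the idempotents of the outside vertices, so the
    inclusion becomes unital only modulo \<open>kernel_ideal\<close>.\<close>
  have eq: "\<one>\<^bsub>B.PP\<^esub> = (\<one>\<^bsub>B.PP\<^esub> - res \<one>\<^bsub>B.PP\<^esub>) + \<one>\<^bsub>S.PP\<^esub>"
   unfolding res_one by (rule ext) simp
  have "B.Theta \<one>\<^bsub>B.PP\<^esub> = B.Theta (\<one>\<^bsub>B.PP\<^esub> - res \<one>\<^bsub>B.PP\<^esub>) \<oplus>\<^bsub>B.Lam\<^esub> B.Theta \<one>\<^bsub>S.PP\<^esub>"
   using B.Theta_add[OF PF_diff[OF PF_PP[OF one] res_PF[OF one]] PFS[OF one']] eq by metis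
  then have "B.Theta \<one>\<^bsub>B.PP\<^esub> \<ominus>\<^bsub>B.Lam\<^esub> B.Theta \<one>\<^bsub>S.PP\<^esub> : kernel_ideal"
   using K.minus_unique[OF B.Theta_in[OF PF_PP[OF one]] in_Lam[OF one']
     B.Theta_in[OF PF_diff[OF PF_PP[OF one] res_PF[OF one]]]] complement_kernel[OF one] by metis
  then have "K.coset (B.Theta \<one>\<^bsub>B.PP\<^esub>) = ?h \<one>\<^bsub>S.PP\<^esub>"
   using K.coset_eq_iff[OF B.Theta_in[OF PF_PP[OF one]] in_Lam[OF one']] by blast
  then show "?h \<one>\<^bsub>S.PP\<^esub> = \<one>\<^bsub>factor B.Lam kernel_ideal\<^esub>"
   unfolding B.Theta_one K.coset_one by (rule HOL.sym)
 qed
 have zero_iff: "?h f = \<zero>\<^bsub>factor B.Lam kernel_ideal\<^esub> \<longleftrightarrow> B.Theta f : kernel_ideal" if f: "f : carrier S.PP" for f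
 proof -
  have "B.Theta f \<ominus>\<^bsub>B.Lam\<^esub> \<zero>\<^bsub>B.Lam\<^esub> = B.Theta f"
   by (rule K.minus_unique[OF in_Lam[OF f] K.zero_closed in_Lam[OF f] K.r_zero[OF in_Lam[OF f]]])
  then show ?thesis unfolding K.coset_zero[symmetric] K.coset_eq_iff[OF in_Lam[OF f] K.zero_closed] by (simp only:)
 qed
 have "?h S.total = \<zero>\<^bsub>factor B.Lam kernel_ideal\<^esub>" unfolding zero_iff[OF S.total_relation_carrier]
  unfolding res_total[symmetric] Theta_res_kernel[OF B.total_relation_carrier]
  by (rule R_kernel[OF B.total_relation_in_R])
 then have "?h ` (Idl\<^bsub>S.PP\<^esub> {S.total}) <= {\<zero>\<^bsub>factor B.Lam kernel_ideal\<^esub>}"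
  using S.total_relation_carrier
  by (intro ring_hom_genideal_subset[OF ring_PP(2) K.ring_factor hom ring.zeroideal[OF K.ring_factor]]) auto
 then show ?thesis using assms zero_iff[OF S.R_carrier[OF assms]] unfolding S.preproj_ideal_eq by blast
qed

lemma long_path_kernel:
 assumes x: "x : quiver_paths B.D" "N <= length (snd x)"
 shows "B.Theta (B.pe x) : kernel_ideal"
proof (cases "x : quiver_paths S.D")
 case True
 then show ?thesis using sub_R_kernel long_path_R x(2) by blast
next
 case False
 then show ?thesis using path_outside_kernel x(1) by blast
qed

text \<open>An infinite series need not lie in an ideal just because its terms do. Grouping the
  paths by their first N arrows gives finitely many summands, each a path in the ideal times a
  series.\<close>

lemma tail_kernel:
 assumes f: "f : B.PF" and long: "!!u p. f (u, p) ~= 0 ==> N <= length p"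
 shows "B.Theta f : kernel_ideal"
proof -
 define part where "part Y = (%(u, p). if (u, take N p) : Y then f (u, p) else 0)" for Y
 define X where "X = {x : quiver_paths B.D. length (snd x) = N}"
 have part_PF: "part Y : B.PF" for Y
  using pfunctionsD[OF f] by (intro pfunctionsI) (auto simp: part_def split: if_splits)
 have finX: "finite X" unfolding X_def by (rule finite_subset[OF _ B.D.finite_quiver_paths[of "Suc N"]]) auto
 have one: "B.Theta (part {x}) : kernel_ideal" if x: "x : X" for x
 proof -
  obtain w q where wq: "x = (w, q)" by (cases x)
  have q: "(w, q) : quiver_paths B.D" "length q = N" using x by (simp_all add: X_def wq)
  define g where "g = (%(v, r). if v = B.D.awlast w q then f (w, q @ r) else 0)"
  have g: "g : B.PF"
  proof (rule pfunctionsI)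
   fix v r assume "g (v, r) ~= 0"
   then have "v = B.D.awlast w q" "(w, q @ r) : quiver_paths B.D"
    using pfunctionsD[OF f, of "(w, q @ r)"] by (auto simp: g_def split: if_splits)
   then show "(v, r) : quiver_paths B.D" by (simp add: B.D.quiver_paths_append)
  qed
  have px: "B.pe (w, q) : B.PF" by (rule path_elem_functions[OF q(1)])
  have "part {x} = B.mul (B.pe (w, q)) g"
  proof (rule ext, clarify)
   fix u p
   have "(EX r. p = q @ r) \<longleftrightarrow> take N p = q"
    using q(2) by (metis append_eq_conv_conj append_take_drop_id)
   then show "part {x} (u, p) = B.mul (B.pe (w, q)) g (u, p)"
    unfolding B.D.path_elem_mult part_def g_def wq prod.case using q(2) by (auto simp: append_eq_conv_conj[symmetric])
  qed
  moreover have "B.Theta (B.mul (B.pe (w, q)) g) : kernel_ideal" unfolding B.Theta_mult[OF px g] using q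
   by (intro K.I.I_r_closed long_path_kernel B.Theta_in g) simp_all
  ultimately show ?thesis by (simp only:)
 qed
 have "B.Theta (part Y) : kernel_ideal" if "finite Y" "Y \<subseteq> X" for Y using that
 proof (induction Y rule: finite_induct)
  case empty
  have "part {} = 0" by (rule ext) (simp add: part_def split: prod.splits)
  then show ?case using Theta_kernel_zero by (simp only:)
 next
  case (insert x Y)
  have "part (insert x Y) = part {x} + part Y"
  proof (rule ext, clarify)
   show "part (insert x Y) (u, p) = (part {x} + part Y) (u, p)" for u p using insert.hyps(2) by (auto simp: part_def)
  qed
  then show ?case using Theta_kernel_add[OF part_PF part_PF one insert.IH] insert.prems by (simp only: insert_subset)
 qed
 moreover have "part X = f"
 proof (rule ext, clarify)
  fix u p
  show "part X (u, p) = f (u, p)"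
  proof (cases "f (u, p) = 0")
   case False
   then have "(u, take N p @ drop N p) : quiver_paths B.D" "N <= length p" using pfunctionsD[OF f] long by auto
   then have "(u, take N p) : X" unfolding B.D.quiver_paths_append by (simp add: X_def)
   then show ?thesis by (simp add: part_def)
  qed (simp add: part_def)
 qed
 ultimately show ?thesis using finX by (metis order_refl)
qed

lemma to_sub_zero_kernel:
 assumes f: "f : B.PF" and zero: "to_sub f = \<zero>\<^bsub>S.Pi\<^esub>"
 shows "B.Theta f : kernel_ideal"
proof -
 have b: "below N f : carrier B.PP" by (rule B.below_PP[OF f])
 have "res (below N f) : S.RR" using zero S.cls_eq_zero_iff[OF res_below_PP[OF f]] unfolding to_sub_def by blast
 then have 1: "B.Theta (below N f) : kernel_ideal" using sub_R_kernel Theta_res_kernel[OF b] by blast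
 have c: "f - below N f : B.PF" by (rule PF_diff[OF f PF_PP[OF b]])
 have 2: "B.Theta (f - below N f) : kernel_ideal" by (rule tail_kernel[OF c]) (simp add: below_apply split: if_splits)
 have "f = below N f + (f - below N f)" by (rule ext) simp
 then show ?thesis using Theta_kernel_add[OF PF_PP[OF b] c 1 2] by (simp only:)
qed

lemma word_ideal_eq: "word_ideal Q is = foldr (%i. ideal_prod B.Lam (vertex_ideal Q i)) is (carrier B.Lam)"
 unfolding word_ideal_def Let_def ideals_set_def by simp

lemma vertex_ideal_eq:
 "i : verts Q ==> vertex_ideal Q i = Idl\<^bsub>B.Lam\<^esub> {\<one>\<^bsub>B.Lam\<^esub> \<ominus>\<^bsub>B.Lam\<^esub> B.Theta (B.pe (i, []))}"
 unfolding vertex_ideal_def Let_def by (simp only: B.vertex_idempotent_eq)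

lemma vertex_generator: "i : verts Q ==> {\<one>\<^bsub>B.Lam\<^esub> \<ominus>\<^bsub>B.Lam\<^esub> B.Theta (B.pe (i, []))} <= carrier B.Lam"
 using B.Theta_in[OF vertex_path] K.minus_closed K.one_closed by blast

lemma ideal_vertex: "i : verts Q ==> ideal (vertex_ideal Q i :: (nat => ('v, 'a, 'k) pfun set set) set) B.Lam"
 unfolding vertex_ideal_eq by (rule K.genideal_ideal[OF vertex_generator])

lemma ideal_word_aux:
 "set is <= verts Q ==> ideal (foldr (%i. ideal_prod B.Lam (vertex_ideal Q i)) is (carrier B.Lam)) B.Lam"
 by (induction "is") (simp_all add: K.oneideal K.ideal_prod_is_ideal ideal_vertex)

lemma ideal_word: "ideal (word_ideal Q js :: (nat => ('v, 'a, 'k) pfun set set) set) B.Lam"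
 unfolding word_ideal_eq using js verts_subset by (intro ideal_word_aux) blast

lemma vertex_in_vertex_ideal:
 assumes "i : verts Q" "v : verts Q" "i ~= v"
 shows "B.Theta (B.pe (v, [])) : vertex_ideal Q i"
proof -
 interpret V: ideal "vertex_ideal Q i :: (nat => ('v, 'a, 'k) pfun set set) set" B.Lam
  by (rule ideal_vertex[OF assms(1)])
 note vi = vertex_path[OF assms(2)] vertex_path[OF assms(1)]
 note ci = B.Theta_in[OF vi(1)] B.Theta_in[OF vi(2)]
 have "B.mul (B.pe (v, [])) (B.pe (i, [])) = 0" using assms(3) by (simp add: B.D.path_elem_mult_path_elem B.D.awlast_eq)
 then have "B.Theta (B.pe (v, [])) \<otimes>\<^bsub>B.Lam\<^esub> B.Theta (B.pe (i, [])) = \<zero>\<^bsub>B.Lam\<^esub>"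
  using B.Theta_mult[OF vi] B.Theta_zero by metis
 then have "B.Theta (B.pe (v, [])) \<otimes>\<^bsub>B.Lam\<^esub> (\<one>\<^bsub>B.Lam\<^esub> \<ominus>\<^bsub>B.Lam\<^esub> B.Theta (B.pe (i, []))) = B.Theta (B.pe (v, []))"
  using ci by (simp only: K.minus_eq K.r_distr K.r_minus K.one_closed K.a_inv_closed K.r_one
    K.minus_zero K.r_zero)
 moreover have "\<one>\<^bsub>B.Lam\<^esub> \<ominus>\<^bsub>B.Lam\<^esub> B.Theta (B.pe (i, [])) : vertex_ideal Q i"
  unfolding vertex_ideal_eq[OF assms(1)] using K.genideal_self[OF vertex_generator[OF assms(1)]] by blast
 ultimately show ?thesis using V.I_l_closed ci(1) by metis
qed

text \<open>The idempotent of an outside vertex lies in the vertex ideal of each vertex of Q'; being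
  its own square, it lies in every product of them.\<close>

lemma kernel_subset_word: "kernel_ideal \<subseteq> word_ideal Q js"
proof -
 have "B.Theta (B.pe (v, [])) : foldr (%i. ideal_prod B.Lam (vertex_ideal Q i)) ks (carrier B.Lam)"
  if "set ks <= verts Q'" and v: "v : verts Q - verts Q'" for v ks using that(1)
 proof (induction ks)
  case Nil
  show ?case using B.Theta_in[OF vertex_path] v by simp
 next
  case (Cons i ks)
  have vi: "B.pe (v, []) : B.PF" using v by (intro vertex_path) blast
  have "B.mul (B.pe (v, [])) (B.pe (v, [])) = B.pe (v, [])" by (simp add: B.D.path_elem_mult_path_elem B.D.awlast_eq)
  then have idem: "B.Theta (B.pe (v, [])) \<otimes>\<^bsub>B.Lam\<^esub> B.Theta (B.pe (v, [])) = B.Theta (B.pe (v, []))"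
   using B.Theta_mult[OF vi vi] by metis
  have "B.Theta (B.pe (v, [])) : vertex_ideal Q i"
   using Cons.prems v verts_subset by (intro vertex_in_vertex_ideal) auto
  then have "B.Theta (B.pe (v, [])) \<otimes>\<^bsub>B.Lam\<^esub> B.Theta (B.pe (v, []))
    : ideal_prod B.Lam (vertex_ideal Q i) (foldr (%i. ideal_prod B.Lam (vertex_ideal Q i)) ks (carrier B.Lam))"
   using Cons by (intro ideal_prod.prod) simp_all
  then show ?case unfolding idem by simp
 qed
 then show ?thesis unfolding kernel_ideal_def word_ideal_eq
  using js by (intro K.genideal_minimal ideal_word[unfolded word_ideal_eq]) blast+
qed

lemma proj_vertex: "i : verts Q' ==> proj (B.Theta (B.pe (i, []))) = S.cls (S.pe (i, []))"
proof -
 assume i: "i : verts Q'"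
 have "B.pe (i, []) : carrier B.PP" using i verts_subset by (intro path_elem_carrier) auto
 then have "proj (B.Theta (B.pe (i, []))) = S.cls (res (B.pe (i, [])))" using proj_Theta[OF PF_PP] to_sub_finite by metis
 also have "res (B.pe (i, [])) = S.pe (i, [])" using i by (intro res_path_elem) simp
 finally show ?thesis .
qed

lemma proj_vertex_ideal:
 assumes i: "i : verts Q'"
 shows "proj ` vertex_ideal Q i \<subseteq> S.VI i"
proof -
 have iQ: "i : verts Q" using i verts_subset by blast
 interpret P: ring_hom_ring B.Lam S.Pi proj by (rule ring_hom_ringI2[OF ring_Lam proj_hom])
 have "proj (\<one>\<^bsub>B.Lam\<^esub> \<ominus>\<^bsub>B.Lam\<^esub> B.Theta (B.pe (i, []))) = \<one>\<^bsub>S.Pi\<^esub> \<ominus>\<^bsub>S.Pi\<^esub> S.cls (S.pe (i, []))"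
  using B.Theta_in[OF vertex_path[OF iQ]] proj_vertex[OF i]
  by (simp only: K.minus_eq S.Pi.minus_eq P.hom_add P.hom_a_inv P.hom_one K.one_closed K.a_inv_closed)
 then show ?thesis unfolding vertex_ideal_eq[OF iQ] S.VI_def using S.Pi.genideal_self[OF S.VI_carrier[OF i]]
  by (intro ring_hom_genideal_subset[OF ring_Lam proj_hom S.ideal_VI[OF i, unfolded S.VI_def] vertex_generator[OF iQ]])
   auto
qed

text \<open>The projection carries each vertex ideal into the vertex ideal of the small algebra,
  hence the word ideal into the product that vanishes by \<open>js_zero\<close>.\<close>

lemma proj_word_ideal:
 assumes "x : word_ideal Q js"
 shows "proj x = \<zero>\<^bsub>S.Pi\<^esub>"
proof -
 have "proj ` foldr (%i. ideal_prod B.Lam (vertex_ideal Q i)) ks (carrier B.Lam) \<subseteq> foldr S.vprod ks (carrier S.Pi)"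
  if "set ks <= verts Q'" for ks using that
 proof (induction ks)
  case Nil
  show ?case using proj_surj by simp
 next
  case (Cons i ks)
  then have "set ks <= verts Q" "i : verts Q" using verts_subset by auto
  then show ?case unfolding foldr.simps o_apply using Cons
   by (intro ring_hom_ideal_prod[OF ring_Lam(1) proj_hom ideal_vertex ideal_word_aux] proj_vertex_ideal) auto
 qed
 from this[OF js] show ?thesis using assms unfolding word_ideal_eq js_zero by blast
qed

lemma exists_algebra_iso:
 "\<exists>\<phi>. \<phi> : algebra_iso S.Pi (factor B.Lam (word_ideal Q js))"
proof (rule algebra_iso_factor)
 show "algebra_ideal B.Lam (word_ideal Q js :: (nat => ('v, 'a, 'k) pfun set set) set)"
  using B.algebra_over_Lam ideal_word by (simp add: algebra_ideal_def)
 show "proj ` carrier B.Lam = carrier S.Pi" by (rule proj_surj)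
 show "proj : ring_hom B.Lam S.Pi" by (rule proj_hom)
 show "proj (c \<odot>\<^bsub>B.Lam\<^esub> x) = c \<odot>\<^bsub>S.Pi\<^esub> proj x" if "x : carrier B.Lam" for c x
  by (rule proj_scale[OF that])
 fix x y assume x: "x : carrier B.Lam" and y: "y : carrier B.Lam"
 interpret P: ring_hom_ring B.Lam S.Pi proj by (rule ring_hom_ringI2[OF ring_Lam proj_hom])
 have diff: "proj (x \<ominus>\<^bsub>B.Lam\<^esub> y) = proj x \<ominus>\<^bsub>S.Pi\<^esub> proj y"
  using x y by (simp only: K.minus_eq S.Pi.minus_eq P.hom_add P.hom_a_inv K.a_inv_closed)
 have c: "x \<ominus>\<^bsub>B.Lam\<^esub> y : carrier B.Lam" by (rule K.minus_closed[OF x y])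
 have "x \<ominus>\<^bsub>B.Lam\<^esub> y : word_ideal Q js" if "proj (x \<ominus>\<^bsub>B.Lam\<^esub> y) = \<zero>\<^bsub>S.Pi\<^esub>"
 proof -
  obtain f where f: "f : B.PF" "x \<ominus>\<^bsub>B.Lam\<^esub> y = B.Theta f" using c by (rule Lam_cases)
  have "to_sub f = \<zero>\<^bsub>S.Pi\<^esub>" using that unfolding f(2) proj_Theta[OF f(1)] .
  then show ?thesis unfolding f(2) using to_sub_zero_kernel[OF f(1)] kernel_subset_word by blast
 qed
 moreover have "proj x = proj y \<longleftrightarrow> proj (x \<ominus>\<^bsub>B.Lam\<^esub> y) = \<zero>\<^bsub>S.Pi\<^esub>"
  unfolding diff using x y by (simp add: S.Pi.minus_eq_zero_iff)
 ultimately show "proj x = proj y \<longleftrightarrow> x \<ominus>\<^bsub>B.Lam\<^esub> y : word_ideal Q js"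
  using proj_word_ideal by blast
qed

end

subsection \<open>Self-injectivity\<close>

lemma fun_linear_fscale: "fun_linear (fscale c)" by (rule fun_linearI; rule ext) (simp_all add: algebra_simps)

lemma ex_projection:
 fixes U :: "('x => 'k::field) set"
 assumes "fun_subspace U"
 shows "EX g. fun_linear g & (ALL f. g f : U) & (ALL f. f : U --> g f = f)" using exists_projection[OF assms] by metis

context nilpotent_preprojective
begin

abbreviation X :: "('v, 'a, 'k) pfun set" where "X \<equiv> dual_module Q"

sublocale nil: nilpotent_double_digraph Q N "X"
proof unfold_locales
 fix xi :: "('v, 'a) dpath => 'k" and p :: "('a + 'a) list" and u :: 'v
 assume xi: "xi : X" and p: "N <= length p"
 show "xi (u, p) = 0"
 proof (cases "(u, p) : quiver_paths D")
  case True
  then have "pairing xi (pe (u, p)) = 0" using p by (intro pairing_R[OF xi] long_path_R) simp_all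
  then show ?thesis by (simp only: pairing_path_elem)
 qed (rule dual_module_path[OF xi])
qed simp

text \<open>Turns an arbitrary function into an element of the path algebra by keeping the finitely
  many short paths. On the path algebra this does not change the class, by
  \<open>cls_restr\<close>.\<close>

definition restr :: "('v, 'a, 'k) pfun => ('v, 'a, 'k) pfun" where
 "restr f = (%x. if x : nil.B then f x else 0)"

lemma restr_PP: "restr f : carrier PP"
proof -
 have "finite {x. restr f x ~= 0}" by (rule finite_subset[OF _ nil.finite_B]) (auto simp: restr_def)
 moreover have "restr f : PF" by (rule pfunctionsI) (auto simp: restr_def nil.B_def split: if_splits)
 ultimately show ?thesis by (simp add: path_algebra_simps)
qed

lemma fun_linear_restr: "fun_linear restr" by (rule fun_linearI; rule ext) (simp_all add: restr_def)

lemmas restr_add = fun_linear_add[OF fun_linear_restr]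
 and restr_scale = fun_linear_scale[OF fun_linear_restr]
 and restr_diff = fun_linear_diff[OF fun_linear_restr]
 and restr_0 = fun_linear_0[OF fun_linear_restr]

lemma cls_restr: "f : carrier PP ==> cls (restr f) = cls f"
proof -
 assume f: "f : carrier PP"
 have "restr f = below N f" using pfunctionsD[OF path_algebra_functions[OF f]]
  by (intro ext) (auto simp: restr_def below_apply nil.B_def)
 then show ?thesis using cls_below[OF f] by (simp only:)
qed

lemma kernel_subspace: "fun_subspace {f. restr f : RR}"
 by (rule fun_subspaceI) (simp_all only: mem_Collect_eq restr_add restr_scale restr_0 R_0 R_add R_scale)

definition is_kernel_proj :: "(('v, 'a, 'k) pfun => ('v, 'a) dpath => 'k) => bool" where
 "is_kernel_proj g \<longleftrightarrow> fun_linear g & (ALL f. restr (g f) : RR) & (ALL f. restr f : RR --> g f = f)"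

definition kernel_proj :: "('v, 'a, 'k) pfun => ('v, 'a, 'k) pfun" where
 "kernel_proj = (SOME g. is_kernel_proj g)"

lemma kernel_proj: "fun_linear kernel_proj" "restr (kernel_proj f) : RR"
  "restr f : RR ==> kernel_proj f = f"
proof -
 have "EX g. is_kernel_proj g"
  unfolding is_kernel_proj_def using ex_projection[OF kernel_subspace] unfolding mem_Collect_eq .
 then have "is_kernel_proj kernel_proj" unfolding kernel_proj_def by (rule someI_ex)
 then have 1: "fun_linear kernel_proj & (ALL f. restr (kernel_proj f) : RR) & (ALL f. restr f : RR --> kernel_proj f = f)"
  unfolding is_kernel_proj_def .
 then show "fun_linear kernel_proj" by (rule conjunct1)
 show "restr (kernel_proj f) : RR" using 1 by blast
 show "restr f : RR ==> kernel_proj f = f" using 1 by blast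
qed

text \<open>A normal form of the elements of the algebra, obtained from a linear complement of the ideal.\<close>

definition nf :: "('v, 'a, 'k) pfun => ('v, 'a, 'k) pfun" where
 "nf f = f - kernel_proj f"

lemma fun_linear_nf: "fun_linear nf"
proof (rule fun_linearI)
 show "nf (u + v) = nf u + nf v" for u v unfolding nf_def fun_linear_add[OF kernel_proj(1)] by (rule ext) simp
 show "nf (fscale c u) = fscale c (nf u)" for c u
  unfolding nf_def fun_linear_scale[OF kernel_proj(1)] by (rule ext) (simp add: algebra_simps)
qed

lemma nf_R: "f : carrier PP ==> f : RR ==> nf f = 0"
proof -
 assume f: "f : carrier PP" "f : RR"
 then have "cls (restr f) = \<zero>\<^bsub>Pi\<^esub>" using cls_restr[OF f(1)] cls_eq_zero_iff[OF f(1)] by metis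
 then have R: "restr f : RR" using cls_eq_zero_iff[OF restr_PP] by blast
 show ?thesis unfolding nf_def kernel_proj(3)[OF R] by (rule diff_self)
qed

lemma nf_cong: "f : carrier PP ==> g : carrier PP ==> cls f = cls g ==> nf f = nf g"
proof -
 assume f: "f : carrier PP" and g: "g : carrier PP" and eq: "cls f = cls g"
 have "nf (f - g) = 0" using cls_eq_iff[OF f g] eq by (intro nf_R P_diff[OF f g]) blast
 then show ?thesis unfolding fun_linear_diff[OF fun_linear_nf] by (metis eq_iff_diff_eq_0)
qed

lemma cls_restr_nf: "f : carrier PP ==> cls (restr (nf f)) = cls f"
proof -
 assume f: "f : carrier PP"
 have "restr f - restr (nf f) = restr (kernel_proj f)" unfolding nf_def restr_diff by (rule ext) simp
 then have "restr f - restr (nf f) : RR" using kernel_proj(2) by simp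
 then have "cls (restr f) = cls (restr (nf f))" using cls_eq_iff[OF restr_PP restr_PP] by blast
 then show ?thesis using cls_restr[OF f] by simp
qed

text \<open>The homomorphism from the regular module to the dual module that takes \<open>1\<close> to \<open>xi\<close>.\<close>

definition act :: "('v, 'a, 'k) pfun => ('v, 'a, 'k) pfun => ('v, 'a, 'k) pfun" where
 "act xi f = (%x. if x : quiver_paths D then pairing xi (mul (pe x) f) else 0)"

lemma mul_pe_PP: "x : quiver_paths D ==> f : carrier PP ==> mul (pe x) f : carrier PP"
 by (rule P_mult_closed[OF path_elem_carrier])

lemma act_add: "f : carrier PP ==> g : carrier PP ==> act xi (f + g) = act xi f + act xi g"
proof
 fix x assume f: "f : carrier PP" and g: "g : carrier PP"
 show "act xi (f + g) x = (act xi f + act xi g) x"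
 proof (cases "x : quiver_paths D")
  case True
  then show ?thesis using pairing_add[OF P_finite[OF mul_pe_PP[OF True f]] P_finite[OF mul_pe_PP[OF True g]], of xi]
   by (simp add: act_def path_mult_add_right)
 qed (simp add: act_def)
qed

lemma act_scale: "f : carrier PP ==> act xi (fscale c f) = fscale c (act xi f)"
proof
 fix x assume f: "f : carrier PP"
 show "act xi (fscale c f) x = fscale c (act xi f) x"
 proof (cases "x : quiver_paths D")
  case True
  then show ?thesis using pairing_scale[OF P_finite[OF mul_pe_PP[OF True f]], of xi]
   by (simp add: act_def path_mult_scale_right)
 qed (simp add: act_def)
qed

lemma act_R: "xi : X ==> f : RR ==> act xi f = 0"
proof
 fix x assume xi: "xi : X" and f: "f : RR"
 show "act xi f x = 0 x" using pairing_R[OF xi R_mult_left[OF f path_elem_carrier]] by (simp add: act_def)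
qed

lemma act_cong: "xi : X ==> f : carrier PP ==> g : carrier PP ==> cls f = cls g ==> act xi f = act xi g"
proof -
 assume xi: "xi : X" and f: "f : carrier PP" and g: "g : carrier PP" and eq: "cls f = cls g"
 have fg: "f - g : RR" using cls_eq_iff[OF f g] eq by blast
 have "act xi (g + (f - g)) = act xi g" unfolding act_add[OF g P_diff[OF f g]] act_R[OF xi fg] by (rule add_0_right)
 then show ?thesis by simp
qed

text \<open>Converse to \<open>pairing_R\<close>: the values on paths of a functional that kills the
  relations form an element of the dual module.\<close>

lemma functional_in_dual:
 assumes add: "!!f g. f : carrier PP ==> g : carrier PP ==> F (f + g) = F f + F g"
  and scale: "!!c f. f : carrier PP ==> F (fscale c f) = c * F f"
  and R: "!!f. f : RR ==> F f = 0"
 shows "(%x. if x : quiver_paths D then F (pe x) else 0) : X" (is "?xi : X")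
proof (rule dual_moduleI)
 have sum: "(SUM c:A. fscale (s c) (g c)) : carrier PP & F (SUM c:A. fscale (s c) (g c)) = (SUM c:A. s c * F (g c))"
  if "finite A" "!!c. c : A ==> g c : carrier PP" for A s and g :: "'a + 'a => ('v, 'a, 'k) pfun" using that
 proof (induction A rule: finite_induct)
  case empty
  show ?case unfolding sum.empty using R_carrier[OF R_0] R[OF R_0] by (rule conjI)
 next
  case (insert c A)
  have prem: "!!c. c : A ==> g c : carrier PP" using insert.prems by blast
  have "(SUM c:A. fscale (s c) (g c)) : carrier PP \<and>
    F (SUM c:A. fscale (s c) (g c)) = (SUM c:A. s c * F (g c))" by (rule insert.IH) (rule prem)
  note IH = conjunct1[OF this] conjunct2[OF this]
  have c: "g c : carrier PP" using insert.prems by simp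
  show ?case unfolding sum.insert[OF insert.hyps] add[OF P_scale[OF c] IH(1)] scale[OF c] IH(2)
   by (rule conjI[OF P_add[OF P_scale[OF c] IH(1)]]) (simp only: sum.insert[OF insert.hyps])
 qed
 fix u :: 'v and p q :: "('a + 'a) list"
 let ?P = "%c. (u, p @ [c, opposite c] @ q)"
 have path: "?P c : quiver_paths D \<longleftrightarrow>
   c : arcs D & tail D c = D.awlast u p & (u, p) : quiver_paths D & (D.awlast u p, q) : quiver_paths D" for c
  by (auto simp: D.quiver_paths_append D.quiver_paths_Cons D.awlast_append D.awlast_eq)
 note path' = path[unfolded append_Cons append_Nil]
 show "(SUM c:arcs D. arrow_sign c * ?xi (?P c)) = 0"
 proof (cases "(u, p) : quiver_paths D & (D.awlast u p, q) : quiver_paths D")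
  case True
  let ?C = "{c : arcs D. tail D c = D.awlast u p}"
  have "(SUM c:arcs D. arrow_sign c * ?xi (?P c)) = (SUM c:?C. arrow_sign c * ?xi (?P c))"
   by (rule sum.mono_neutral_right) (auto simp: path')
  also have "\<dots> = (SUM c:?C. arrow_sign c * F (pe (?P c)))"
   using True by (intro sum.cong[OF HOL.refl]) (simp add: path')
  also have "\<dots> = F (rel u p q)" unfolding relation_elem_def
   using True by (intro sum[THEN conjunct2, symmetric] path_elem_carrier) (auto simp: path')
  also have "\<dots> = 0" using True by (intro R relation_elem_in_R) auto
  finally show ?thesis .
 next
  case False
  then show ?thesis by (intro sum.neutral) (auto simp: path')
 qed
qed (simp split: if_splits)

lemma act_closed:
 assumes xi: "xi : X" and f: "f : carrier PP"
 shows "act xi f : X" unfolding act_def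
proof (rule functional_in_dual)
 show "pairing xi (mul (g + h) f) = pairing xi (mul g f) + pairing xi (mul h f)"
  if "g : carrier PP" "h : carrier PP" for g h
  unfolding path_mult_add_left using that f by (intro pairing_add P_finite P_mult_closed)
 show "pairing xi (mul (fscale c g) f) = c * pairing xi (mul g f)" if "g : carrier PP" for c g
  unfolding path_mult_scale_left using that f by (intro pairing_scale P_finite P_mult_closed)
 show "pairing xi (mul g f) = 0" if "g : RR" for g by (rule pairing_R[OF xi R_mult_right[OF that f]])
qed

lemma arrow_path: "a : arcs D ==> (tail D a, [a]) : quiver_paths D"
 using D.head_in_verts[of a] by (simp add: D.quiver_paths_Cons)

lemma act_arrow:
 assumes a: "a : arcs D"
 shows "act xi (mul (pe (tail D a, [a])) f) = dual_arrow a (act xi f)"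
proof (rule ext, clarify)
 fix u p
 have eq: "mul (pe (u, p)) (mul (pe (tail D a, [a])) f) = mul (if tail D a = D.awlast u p then pe (u, p @ [a]) else 0) f"
  unfolding D.path_mult_assoc[symmetric] by (simp add: D.path_elem_mult_path_elem)
 have snoc: "(u, p @ [a]) : quiver_paths D \<longleftrightarrow> (u, p) : quiver_paths D & tail D a = D.awlast u p"
  using a by (auto simp: D.quiver_paths_snoc)
 have "mul 0 f = 0" by (rule fun_linear_0[OF fun_linear_path_mult_left])
 then show "act xi (mul (pe (tail D a, [a])) f) (u, p) = dual_arrow a (act xi f) (u, p)"
  unfolding act_def dual_arrow_def prod.case eq snoc by (simp add: pairing_0)
qed

lemma act_vertex: "act xi (mul (pe (i, [])) f) = dual_vertex D i (act xi f)"
proof (rule ext, clarify)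
 fix u p
 have "mul (pe (u, p)) (mul (pe (i, [])) f) = mul (if i = D.awlast u p then pe (u, p) else 0) f"
  unfolding D.path_mult_assoc[symmetric] by (simp add: D.path_elem_mult_path_elem)
 moreover have "mul 0 f = 0" by (rule fun_linear_0[OF fun_linear_path_mult_left])
 ultimately show "act xi (mul (pe (i, [])) f) (u, p) = dual_vertex D i (act xi f) (u, p)"
  by (auto simp: act_def dual_vertex_def pairing_0)
qed

lemma act_one:
 assumes xi: "xi : X"
 shows "act xi \<one>\<^bsub>PP\<^esub> = xi"
proof
 fix x show "act xi \<one>\<^bsub>PP\<^esub> x = xi x"
 proof (cases "x : quiver_paths D")
  case True
  then show ?thesis
   unfolding act_def D.path_mult_one[OF path_elem_functions[OF True]] by (simp only: pairing_path_elem if_True)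
 next
  case False
  then show ?thesis using dual_module_path[OF xi] by (simp add: act_def)
 qed
qed

text \<open>Coordinates on the free module with basis \<open>nil.B\<close>; every operation depends only on the
 represented element of the free module.\<close>

definition comp :: "((('v, 'a) dpath) \<times> ('v, 'a) dpath => 'k) => ('v, 'a) dpath => ('v, 'a, 'k) pfun" where
 "comp y b = restr (%x. y (b, x))"

text \<open>Left multiplication by f in every coordinate. The cover is a space of functions, where
  equations must hold literally; normal forms achieve this. The unit then acts as the projection to
  normal forms and not as the identity.\<close>

definition lift :: "('v, 'a, 'k) pfun => ((('v, 'a) dpath) \<times> ('v, 'a) dpath => 'k) => ((('v, 'a) dpath) \<times> ('v, 'a) dpath => 'k)" where
 "lift f y = (%(b, x). nf (mul f (comp y b)) x)"

text \<open>The b-th basis vector of the free module goes to \<chi> b; the map is onto because the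
  \<chi> b span X.\<close>

definition to_dual :: "((('v, 'a) dpath) \<times> ('v, 'a) dpath => 'k) => ('v, 'a, 'k) pfun" where
 "to_dual y = (SUM b:nil.B. act (nil.\<chi> b) (comp y b))"

lemma comp_PP: "comp y b : carrier PP" unfolding comp_def by (rule restr_PP)

lemma comp_add: "comp (y + z) b = comp y b + comp z b" unfolding comp_def by (rule ext) (simp add: restr_def)

lemma comp_scale: "comp (fscale c y) b = fscale c (comp y b)" unfolding comp_def by (rule ext) (simp add: restr_def)

lemma cls_comp_lift: "f : carrier PP ==> cls (comp (lift f y) b) = cls (mul f (comp y b))"
proof -
 assume f: "f : carrier PP"
 have "comp (lift f y) b = restr (nf (mul f (comp y b)))" unfolding comp_def[of "lift f y"] by (simp add: lift_def)
 then show ?thesis using cls_restr_nf[OF P_mult_closed[OF f comp_PP]] by (simp only:)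
qed

lemma lift_eqI:
 assumes "f : carrier PP" "g : carrier PP" "!!b. cls (mul f (comp y b)) = cls (mul g (comp z b))"
 shows "lift f y = lift g z"
 unfolding lift_def using nf_cong[OF P_mult_closed[OF assms(1) comp_PP] P_mult_closed[OF assms(2) comp_PP] assms(3)]
 by (simp only:)

lemma lift_lift: "f : carrier PP ==> g : carrier PP ==> lift f (lift g y) = lift (mul f g) y"
proof (rule lift_eqI)
 fix b assume f: "f : carrier PP" and g: "g : carrier PP"
 have "cls (mul f (comp (lift g y) b)) = cls f \<otimes>\<^bsub>Pi\<^esub> cls (mul g (comp y b))"
  unfolding cls_mult[OF f comp_PP] cls_comp_lift[OF g] ..
 also have "\<dots> = cls (mul (mul f g) (comp y b))"
  unfolding D.path_mult_assoc by (rule cls_mult[OF f P_mult_closed[OF g comp_PP], symmetric])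
 finally show "cls (mul f (comp (lift g y) b)) = cls (mul (mul f g) (comp y b))" .
qed (auto intro: P_mult_closed)

lemma fun_linear_lift: "fun_linear (lift f)" by (rule fun_linearI; rule ext)
  (auto simp: lift_def comp_add comp_scale path_mult_add_right path_mult_scale_right
   fun_linear_add[OF fun_linear_nf] fun_linear_scale[OF fun_linear_nf])

lemma lift_add_left: "lift (f + g) y = lift f y + lift g y"
 by (rule ext) (auto simp: lift_def path_mult_add_left fun_linear_add[OF fun_linear_nf])

lemma lift_scale_left: "lift (fscale c f) y = fscale c (lift f y)"
 by (rule ext) (auto simp: lift_def path_mult_scale_left fun_linear_scale[OF fun_linear_nf])

lemma lift_R: "f : RR ==> lift f y = 0"
proof (rule ext, clarify)
 fix b x assume f: "f : RR"
 show "lift f y (b, x) = 0 (b, x)" unfolding lift_def prod.case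
  using nf_R[OF P_mult_closed[OF R_carrier[OF f] comp_PP] R_mult_right[OF f comp_PP]] by simp
qed

lemma lift_sum_left: "finite C ==> lift (SUM c:C. f c) y = (SUM c:C. lift (f c) y)"
 by (induction C rule: finite_induct) (simp_all only: sum.empty lift_R[OF R_0] sum.insert lift_add_left not_False_eq_True)

lemma fun_linear_to_dual: "fun_linear to_dual" by (rule fun_linearI)
  (simp_all only: to_dual_def comp_add comp_scale act_add[OF comp_PP comp_PP] act_scale[OF comp_PP]
   sum.distrib fun_linear_sum[OF fun_linear_fscale])

lemma to_dual_lift: "f : carrier PP ==> to_dual (lift f y) = (SUM b:nil.B. act (nil.\<chi> b) (mul f (comp y b)))"
 unfolding to_dual_def by (intro sum.cong[OF HOL.refl] act_cong nil.\<chi>_closed comp_PP cls_comp_lift P_mult_closed)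

lemma to_dual_closed: "to_dual y : X" unfolding to_dual_def
 by (intro fun_subspace_sum[OF fun_subspace_dual_module] act_closed nil.\<chi>_closed comp_PP)

definition arrow_op :: "'a + 'a => ((('v, 'a) dpath) \<times> ('v, 'a) dpath => 'k) => ((('v, 'a) dpath) \<times> ('v, 'a) dpath => 'k)" where
 "arrow_op a = lift (if a : arcs D then pe (tail D a, [a]) else 0)"

lemma arrow_op_eq: "a : arcs D ==> arrow_op a = lift (pe (tail D a, [a]))" by (simp add: arrow_op_def)

lemma arrow_PP: "a : arcs D ==> pe (tail D a, [a]) : carrier PP" by (rule path_elem_carrier[OF arrow_path])

lemma vertex_PP: "i : verts Q ==> pe (i, []) : carrier PP" by (rule path_elem_carrier) simp

lemma to_dual_surj:
 assumes "xi : X"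
 shows "EX y. to_dual y = xi"
proof
 have one: "\<one>\<^bsub>PP\<^esub> : carrier PP"
  using algebra_over_P unfolding algebra_over_def by (intro ring.ring_simprules(6)) blast
 let ?y = "%(b, x). xi b * \<one>\<^bsub>PP\<^esub> x"
 have comp: "comp ?y b = fscale (xi b) (restr \<one>\<^bsub>PP\<^esub>)" for b
  unfolding comp_def by (rule ext) (simp add: restr_def)
 have "act (nil.\<chi> b) (restr \<one>\<^bsub>PP\<^esub>) = nil.\<chi> b" for b
  using act_cong[OF nil.\<chi>_closed restr_PP one cls_restr[OF one]] act_one[OF nil.\<chi>_closed] by simp
 then have "to_dual ?y = (SUM b:nil.B. fscale (xi b) (nil.\<chi> b))"
  unfolding to_dual_def comp act_scale[OF restr_PP] by simp
 also have "\<dots> = xi" by (rule nil.\<chi>_expansion[OF assms, symmetric])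
 finally show "to_dual ?y = xi" .
qed

sublocale cover: dual_module_cover Q N X arrow_op "%i. lift (pe (i, []))" to_dual
proof unfold_locales
 show "fun_linear (arrow_op a)" for a unfolding arrow_op_def by (rule fun_linear_lift)
 show "fun_linear (lift (pe (i, [])))" for i by (rule fun_linear_lift)
 show "fun_linear to_dual" by (rule fun_linear_to_dual)
 show "arrow_op a y = 0" if "a ~: arcs D" for a y using that lift_R[OF R_0] by (simp only: arrow_op_def if_False)
 show "arrow_op a (lift (pe (head D a, [])) y) = arrow_op a y" if a: "a : arcs D" for a y
  unfolding arrow_op_eq[OF a] lift_lift[OF arrow_PP[OF a] vertex_PP[OF D.head_in_verts[OF a, simplified]]]
  by (simp add: D.path_elem_mult_path_elem D.awlast_eq)
 show "lift (pe (tail D a, [])) (arrow_op a y) = arrow_op a y" if a: "a : arcs D" for a y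
  unfolding arrow_op_eq[OF a] lift_lift[OF vertex_PP[OF D.tail_in_verts[OF a, simplified]] arrow_PP[OF a]]
  by (simp add: D.path_elem_mult_path_elem D.awlast_eq)
 show "lift (pe (i, [])) (lift (pe (j, [])) y) = (if i = j then lift (pe (i, [])) y else 0)"
  if i: "i : verts Q" and j: "j : verts Q" for i j y unfolding lift_lift[OF vertex_PP[OF i] vertex_PP[OF j]]
  using lift_R[OF R_0] by (simp add: D.path_elem_mult_path_elem D.awlast_eq)
 show "(SUM c:arcs D. fscale (arrow_sign c) (arrow_op c (arrow_op (opposite c) y))) = 0" for y
 proof -
  have "arrow_op c (arrow_op (opposite c) y) = lift (pe (tail D c, [c, opposite c])) y" if c: "c : arcs D" for c
  proof -
   have c': "opposite c : arcs D" using c by simp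
   show ?thesis unfolding arrow_op_eq[OF c] arrow_op_eq[OF c'] lift_lift[OF arrow_PP[OF c] arrow_PP[OF c']]
    by (simp add: D.path_elem_mult_path_elem D.awlast_eq)
  qed
  then have "(SUM c:arcs D. fscale (arrow_sign c) (arrow_op c (arrow_op (opposite c) y))) =
    (SUM c:arcs D. lift (fscale (arrow_sign c) (pe (tail D c, [c, opposite c]))) y)"
   by (intro sum.cong[OF HOL.refl]) (simp only: lift_scale_left)
  also have "\<dots> = lift total y" unfolding total_relation_def by (rule lift_sum_left[OF D.finite_arcs, symmetric])
  also have "\<dots> = 0" by (rule lift_R[OF total_relation_in_R])
  finally show ?thesis .
 qed
 show "to_dual y : X" for y by (rule to_dual_closed)
 show "EX y. to_dual y = xi" if "xi : X" for xi by (rule to_dual_surj[OF that])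
 show "to_dual (arrow_op a y) = dual_arrow a (to_dual y)" if a: "a : arcs D" for a y
  unfolding arrow_op_eq[OF a] to_dual_lift[OF arrow_PP[OF a]] act_arrow[OF a] unfolding to_dual_def
  by (rule fun_linear_sum[OF fun_linear_dual_arrow, symmetric])
 show "to_dual (lift (pe (i, [])) y) = dual_vertex D i (to_dual y)" if i: "i : verts Q" for i y
  unfolding to_dual_lift[OF vertex_PP[OF i]] act_vertex unfolding to_dual_def
  by (rule fun_linear_sum[OF fun_linear_dual_vertex, symmetric])
qed

text \<open>The coordinates of an equivariant section of the free cover are homomorphisms into the
  regular module. They are jointly injective because \<open>to_dual\<close> recovers xi from
  them.\<close>

theorem dual_module_embeds:
 obtains th :: "('v, 'a) dpath => ('v, 'a, 'k) pfun => ('v, 'a, 'k) pfun set"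
 where "!!b xi. th b xi : carrier Pi" "!!b xi \<eta>. th b (xi + \<eta>) = th b xi \<oplus>\<^bsub>Pi\<^esub> th b \<eta>"
  "!!b c xi. th b (fscale c xi) = c \<odot>\<^bsub>Pi\<^esub> th b xi"
  "!!b a xi. a : arcs D ==> xi : X ==> th b (dual_arrow a xi) = cls (pe (tail D a, [a])) \<otimes>\<^bsub>Pi\<^esub> th b xi"
  "!!b i xi. i : verts Q ==> xi : X ==> th b (dual_vertex D i xi) = cls (pe (i, [])) \<otimes>\<^bsub>Pi\<^esub> th b xi"
  "!!xi. xi : X ==> (!!b. b : nil.B ==> th b xi = \<zero>\<^bsub>Pi\<^esub>) ==> xi = 0"
proof (rule cover.exists_equivariant_section)
 fix v assume v: "fun_linear v" "!!xi. xi : X ==> to_dual (v xi) = xi"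
   "!!i xi. i : verts Q ==> xi : X ==> v (dual_vertex D i xi) = lift (pe (i, [])) (v xi)"
   "!!a xi. a : arcs D ==> xi : X ==> v (dual_arrow a xi) = arrow_op a (v xi)"
 let ?th = "%b xi. cls (comp (v xi) b)"
 show ?thesis
 proof (rule that[of ?th])
  show "?th b xi : carrier Pi" for b xi by (rule cls_in[OF comp_PP])
  show "?th b (xi + \<eta>) = ?th b xi \<oplus>\<^bsub>Pi\<^esub> ?th b \<eta>" for b xi \<eta>
   unfolding fun_linear_add[OF v(1)] comp_add by (rule cls_add[OF comp_PP comp_PP])
  show "?th b (fscale c xi) = c \<odot>\<^bsub>Pi\<^esub> ?th b xi" for b c xi
   unfolding fun_linear_scale[OF v(1)] comp_scale by (rule cls_scale[OF comp_PP])
  show "?th b (dual_arrow a xi) = cls (pe (tail D a, [a])) \<otimes>\<^bsub>Pi\<^esub> ?th b xi" if a: "a : arcs D" and xi: "xi : X" for b a xi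
   unfolding v(4)[OF a xi] arrow_op_eq[OF a] cls_comp_lift[OF arrow_PP[OF a]]
   by (rule cls_mult[OF arrow_PP[OF a] comp_PP])
  show "?th b (dual_vertex D i xi) = cls (pe (i, [])) \<otimes>\<^bsub>Pi\<^esub> ?th b xi" if i: "i : verts Q" and xi: "xi : X" for b i xi
   unfolding v(3)[OF i xi] cls_comp_lift[OF vertex_PP[OF i]] by (rule cls_mult[OF vertex_PP[OF i] comp_PP])
  show "xi = 0" if xi: "xi : X" and zero: "!!b. b : nil.B ==> ?th b xi = \<zero>\<^bsub>Pi\<^esub>" for xi
  proof -
   have "act (nil.\<chi> b) (comp (v xi) b) = 0" if "b : nil.B" for b
    using zero[OF that] cls_eq_zero_iff[OF comp_PP] by (intro act_R nil.\<chi>_closed) blast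
   then have "to_dual (v xi) = 0" unfolding to_dual_def by (rule sum.neutral[rule_format])
   then show ?thesis using v(2)[OF xi] by simp
  qed
 qed
qed

end

subsection \<open>Modules\<close>

context lmodule
begin

lemma smult_zero: "a : carrier R ==> a \<odot>\<^bsub>M\<^esub> \<zero>\<^bsub>M\<^esub> = \<zero>\<^bsub>M\<^esub>"
proof -
 assume a: "a : carrier R"
 have "a \<odot>\<^bsub>M\<^esub> \<zero>\<^bsub>M\<^esub> \<oplus>\<^bsub>M\<^esub> a \<odot>\<^bsub>M\<^esub> \<zero>\<^bsub>M\<^esub> = a \<odot>\<^bsub>M\<^esub> \<zero>\<^bsub>M\<^esub>"
  using smult_r_distr[OF a M.zero_closed M.zero_closed] by simp
 then show ?thesis using M.add.l_cancel_one smult_closed[OF a M.zero_closed] by simp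
qed

lemma zero_smult: "x : carrier M ==> \<zero>\<^bsub>R\<^esub> \<odot>\<^bsub>M\<^esub> x = \<zero>\<^bsub>M\<^esub>"
proof -
 assume x: "x : carrier M"
 have "\<zero>\<^bsub>R\<^esub> \<odot>\<^bsub>M\<^esub> x \<oplus>\<^bsub>M\<^esub> \<zero>\<^bsub>R\<^esub> \<odot>\<^bsub>M\<^esub> x = \<zero>\<^bsub>R\<^esub> \<odot>\<^bsub>M\<^esub> x"
  using smult_l_distr[OF R.zero_closed R.zero_closed x] by simp
 then show ?thesis using M.add.l_cancel_one smult_closed[OF R.zero_closed x] by simp
qed

lemma minus_one_smult: "x : carrier M ==> (\<ominus>\<^bsub>R\<^esub> \<one>\<^bsub>R\<^esub>) \<odot>\<^bsub>M\<^esub> x = \<ominus>\<^bsub>M\<^esub> x"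
proof -
 assume x: "x : carrier M"
 have m: "\<ominus>\<^bsub>R\<^esub> \<one>\<^bsub>R\<^esub> : carrier R" by simp
 have "(\<ominus>\<^bsub>R\<^esub> \<one>\<^bsub>R\<^esub>) \<odot>\<^bsub>M\<^esub> x \<oplus>\<^bsub>M\<^esub> x = \<zero>\<^bsub>M\<^esub>"
  using smult_l_distr[OF m R.one_closed x] smult_one[OF x] zero_smult[OF x] R.l_neg[OF R.one_closed] by simp
 then show ?thesis using M.minus_equality[OF _ x smult_closed[OF m x]] by simp
qed

lemma submoduleI:
 assumes "N <= carrier M" "\<zero>\<^bsub>M\<^esub> : N"
  and "!!x y. x : N ==> y : N ==> x \<oplus>\<^bsub>M\<^esub> y : N"
  and smult: "!!a x. a : carrier R ==> x : N ==> a \<odot>\<^bsub>M\<^esub> x : N"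
 shows "submodule N R M"
proof (intro submodule.intro submodule_axioms.intro smult)
 have "\<ominus>\<^bsub>M\<^esub> x : N" if "x : N" for x
  using smult[of "\<ominus>\<^bsub>R\<^esub> \<one>\<^bsub>R\<^esub>" x] minus_one_smult[of x] that assms(1) by auto
 then show "subgroup N (add_monoid M)" using assms by (intro M.add.subgroupI) (auto simp: a_inv_def)
qed

lemma submoduleD:
 assumes "submodule N R M"
 shows "N <= carrier M" "\<zero>\<^bsub>M\<^esub> : N" "!!x y. x : N ==> y : N ==> x \<oplus>\<^bsub>M\<^esub> y : N"
  "!!a x. a : carrier R ==> x : N ==> a \<odot>\<^bsub>M\<^esub> x : N" "!!x. x : N ==> \<ominus>\<^bsub>M\<^esub> x : N"
proof -
 interpret submodule N R M by (rule assms)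
 show "N <= carrier M" "\<zero>\<^bsub>M\<^esub> : N" "!!x y. x : N ==> y : N ==> x \<oplus>\<^bsub>M\<^esub> y : N"
  "!!a x. a : carrier R ==> x : N ==> a \<odot>\<^bsub>M\<^esub> x : N" "!!x. x : N ==> \<ominus>\<^bsub>M\<^esub> x : N"
  using subset one_closed m_closed smult_closed m_inv_closed by (auto simp: a_inv_def)
qed

lemma smult_finsum:
 assumes "finite A" "a : carrier R" "f : A \<rightarrow> carrier M"
 shows "a \<odot>\<^bsub>M\<^esub> (\<Oplus>\<^bsub>M\<^esub>i\<in>A. f i) = (\<Oplus>\<^bsub>M\<^esub>i\<in>A. a \<odot>\<^bsub>M\<^esub> f i)"
 using assms(1,3)
proof (induction A rule: finite_induct)
 case empty
 then show ?case by (simp add: smult_zero assms(2))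
next
 case (insert i A)
 then have "f i : carrier M" "f : A \<rightarrow> carrier M" by auto
 moreover have "a \<odot>\<^bsub>M\<^esub> f i : carrier M" "(%i. a \<odot>\<^bsub>M\<^esub> f i) : A \<rightarrow> carrier M"
  using calculation smult_closed[OF assms(2)] by auto
 ultimately show ?case using insert by (simp add: M.finsum_insert smult_r_distr assms(2))
qed

end

lemma lmodule_homI:
 assumes "!!x. x : carrier M ==> f x : carrier N" "f : extensional (carrier M)"
  and "!!x y. x : carrier M ==> y : carrier M ==> f (x \<oplus>\<^bsub>M\<^esub> y) = f x \<oplus>\<^bsub>N\<^esub> f y"
  and "!!r x. r : carrier R ==> x : carrier M ==> f (r \<odot>\<^bsub>M\<^esub> x) = r \<odot>\<^bsub>N\<^esub> f x"
 shows "f : lmodule_hom R M N" using assms by (auto simp: lmodule_hom_def PiE_def)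

lemma lmodule_homD:
 assumes "f : lmodule_hom R M N"
 shows "x : carrier M ==> f x : carrier N"
  "x : carrier M ==> y : carrier M ==> f (x \<oplus>\<^bsub>M\<^esub> y) = f x \<oplus>\<^bsub>N\<^esub> f y"
  "r : carrier R ==> x : carrier M ==> f (r \<odot>\<^bsub>M\<^esub> x) = r \<odot>\<^bsub>N\<^esub> f x"
  "f : extensional (carrier M)" using assms by (auto simp: lmodule_hom_def PiE_def)

lemma lmodule_hom_zero:
 assumes "lmodule R M" "lmodule R N" "f : lmodule_hom R M N"
 shows "f \<zero>\<^bsub>M\<^esub> = \<zero>\<^bsub>N\<^esub>"
proof -
 interpret M: lmodule R M by (rule assms(1))
 interpret N: lmodule R N by (rule assms(2))
 have "f \<zero>\<^bsub>M\<^esub> \<oplus>\<^bsub>N\<^esub> f \<zero>\<^bsub>M\<^esub> = f \<zero>\<^bsub>M\<^esub>"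
  using lmodule_homD(2)[OF assms(3) M.M.zero_closed M.M.zero_closed] by simp
 then show ?thesis using N.M.add.l_cancel_one lmodule_homD(1)[OF assms(3) M.M.zero_closed] by simp
qed

lemma lmodule_hom_inj:
 assumes "lmodule R M" "lmodule R N" "f : lmodule_hom R M N"
  and "!!x. x : carrier M ==> f x = \<zero>\<^bsub>N\<^esub> ==> x = \<zero>\<^bsub>M\<^esub>"
 shows "inj_on f (carrier M)"
proof (rule inj_onI)
 interpret M: lmodule R M by (rule assms(1))
 interpret N: lmodule R N by (rule assms(2))
 fix x y assume x: "x : carrier M" and y: "y : carrier M" and eq: "f x = f y"
 have d: "x \<oplus>\<^bsub>M\<^esub> \<ominus>\<^bsub>M\<^esub> y : carrier M" using x y by simp
 have "x = x \<oplus>\<^bsub>M\<^esub> \<ominus>\<^bsub>M\<^esub> y \<oplus>\<^bsub>M\<^esub> y"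
  using x y by (simp add: M.M.a_assoc M.M.l_neg)
 then have "f y = f (x \<oplus>\<^bsub>M\<^esub> \<ominus>\<^bsub>M\<^esub> y) \<oplus>\<^bsub>N\<^esub> f y"
  using lmodule_homD(2)[OF assms(3) d y] eq by simp
 then have "f (x \<oplus>\<^bsub>M\<^esub> \<ominus>\<^bsub>M\<^esub> y) = \<zero>\<^bsub>N\<^esub>"
  using N.M.add.r_cancel_one lmodule_homD(1)[OF assms(3)] d y by metis
 then have "x \<oplus>\<^bsub>M\<^esub> \<ominus>\<^bsub>M\<^esub> y = \<zero>\<^bsub>M\<^esub>" using assms(4)[OF d] by simp
 then show "x = y"
  using \<open>x = x \<oplus>\<^bsub>M\<^esub> \<ominus>\<^bsub>M\<^esub> y \<oplus>\<^bsub>M\<^esub> y\<close> y by simp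
qed

lemma regular_module_simps [simp]:
 "carrier (regular_module R) = carrier R" "\<zero>\<^bsub>regular_module R\<^esub> = \<zero>\<^bsub>R\<^esub>"
 "x \<oplus>\<^bsub>regular_module R\<^esub> y = x \<oplus>\<^bsub>R\<^esub> y" "x \<odot>\<^bsub>regular_module R\<^esub> y = x \<otimes>\<^bsub>R\<^esub> y"
 by (simp_all add: regular_module_def ring.defs module.defs)

lemma power_module_simps:
 "carrier (power_module n X) = {..<n} \<rightarrow>\<^sub>E carrier X" "\<zero>\<^bsub>power_module n X\<^esub> = (\<lambda>i\<in>{..<n}. \<zero>\<^bsub>X\<^esub>)"
 "x \<oplus>\<^bsub>power_module n X\<^esub> y = (\<lambda>i\<in>{..<n}. x i \<oplus>\<^bsub>X\<^esub> y i)" "r \<odot>\<^bsub>power_module n X\<^esub> x = (\<lambda>i\<in>{..<n}. r \<odot>\<^bsub>X\<^esub> x i)"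
 by (simp_all add: power_module_def)

lemma lmodule_regular:
 fixes R :: "('r, 'z) ring_scheme"
 assumes "ring R"
 shows "lmodule R (regular_module R)"
proof -
 interpret ring R by (rule assms)
 have "abelian_group (regular_module R)"
 proof (rule abelian_groupI)
  show "EX y:carrier (regular_module R). y \<oplus>\<^bsub>regular_module R\<^esub> x = \<zero>\<^bsub>regular_module R\<^esub>"
   if "x : carrier (regular_module R)" for x
   using that by (intro bexI[of _ "\<ominus>\<^bsub>R\<^esub> x"]) (simp_all add: l_neg)
 qed (simp_all add: a_ac)
 then show ?thesis by (intro lmodule.intro lmodule_axioms.intro assms) (simp_all add: l_distr r_distr m_assoc)
qed

lemma lmodule_power:
 assumes "lmodule R X"
 shows "lmodule R (power_module n X)"
proof -
 interpret X: lmodule R X by (rule assms)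
 let ?P = "power_module n X"
 have mem: "x i : carrier X" if "x : carrier ?P" "i : {..<n}" for x i using that by (auto simp: power_module_simps)
 have eqI: "x = (\<lambda>i\<in>{..<n}. y i)" if "x : carrier ?P" "!!i. i : {..<n} ==> x i = y i" for x y
  using that by (intro ext) (auto simp: power_module_simps PiE_def extensional_def)
 have closed: "(\<lambda>i\<in>{..<n}. y i) : carrier ?P" if "!!i. i : {..<n} ==> y i : carrier X" for y
  using that by (auto simp: power_module_simps)
 have "abelian_group ?P"
 proof (rule abelian_groupI)
  fix x y z assume x: "x : carrier ?P"
  show "EX y:carrier ?P. y \<oplus>\<^bsub>?P\<^esub> x = \<zero>\<^bsub>?P\<^esub>"
  proof
   show "(\<lambda>i\<in>{..<n}. \<ominus>\<^bsub>X\<^esub> x i) \<oplus>\<^bsub>?P\<^esub> x = \<zero>\<^bsub>?P\<^esub>"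
    unfolding power_module_simps by (rule restrict_ext) (simp add: X.M.l_neg mem[OF x])
  qed (rule closed, simp add: mem[OF x])
  show "\<zero>\<^bsub>?P\<^esub> \<oplus>\<^bsub>?P\<^esub> x = x" unfolding power_module_simps
   by (rule eqI[OF x, symmetric]) (simp add: mem[OF x])
  assume y: "y : carrier ?P"
  show "x \<oplus>\<^bsub>?P\<^esub> y : carrier ?P"
   unfolding power_module_simps(3) by (rule closed) (simp add: mem[OF x] mem[OF y])
  show "x \<oplus>\<^bsub>?P\<^esub> y = y \<oplus>\<^bsub>?P\<^esub> x"
   unfolding power_module_simps by (rule restrict_ext) (simp add: mem[OF x] mem[OF y] X.M.a_comm)
  assume z: "z : carrier ?P"
  show "x \<oplus>\<^bsub>?P\<^esub> y \<oplus>\<^bsub>?P\<^esub> z = x \<oplus>\<^bsub>?P\<^esub> (y \<oplus>\<^bsub>?P\<^esub> z)"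
   unfolding power_module_simps by (rule restrict_ext) (simp add: mem[OF x] mem[OF y] mem[OF z] X.M.a_assoc)
 next
  show "\<zero>\<^bsub>?P\<^esub> : carrier ?P" unfolding power_module_simps(2) by (rule closed) simp
 qed
 moreover have "lmodule_axioms R ?P"
 proof (rule lmodule_axioms.intro)
  fix a b x y assume x: "x : carrier ?P"
  show "\<one>\<^bsub>R\<^esub> \<odot>\<^bsub>?P\<^esub> x = x" unfolding power_module_simps
   by (rule eqI[OF x, symmetric]) (simp add: mem[OF x] X.smult_one)
  assume a: "a : carrier R"
  show "a \<odot>\<^bsub>?P\<^esub> x : carrier ?P"
   unfolding power_module_simps(4) by (rule closed) (simp add: mem[OF x] X.smult_closed[OF a])
  show "(a \<otimes>\<^bsub>R\<^esub> b) \<odot>\<^bsub>?P\<^esub> x = a \<odot>\<^bsub>?P\<^esub> (b \<odot>\<^bsub>?P\<^esub> x)"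
    "(a \<oplus>\<^bsub>R\<^esub> b) \<odot>\<^bsub>?P\<^esub> x = a \<odot>\<^bsub>?P\<^esub> x \<oplus>\<^bsub>?P\<^esub> b \<odot>\<^bsub>?P\<^esub> x" if b: "b : carrier R"
   unfolding power_module_simps
   by (rule restrict_ext, simp add: mem[OF x] X.smult_assoc[OF a b] X.smult_l_distr[OF a b])+
  show "a \<odot>\<^bsub>?P\<^esub> (x \<oplus>\<^bsub>?P\<^esub> y) = a \<odot>\<^bsub>?P\<^esub> x \<oplus>\<^bsub>?P\<^esub> a \<odot>\<^bsub>?P\<^esub> y" if y: "y : carrier ?P"
   unfolding power_module_simps by (rule restrict_ext) (simp add: mem[OF x] mem[OF y] X.smult_r_distr[OF a])
 qed
 ultimately show ?thesis by (intro lmodule.intro X.R.ring_axioms)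
qed

lemma hom_to_power:
 assumes "!!i. i < n ==> h i : lmodule_hom R M X" "lmodule R M"
 shows "(\<lambda>m\<in>carrier M. \<lambda>i\<in>{..<n}. h i m) : lmodule_hom R M (power_module n X)"
proof -
 interpret M: lmodule R M by (rule assms(2))
 show ?thesis using lmodule_homD(1-3)[OF assms(1)]
  by (intro lmodule_homI) (auto simp: power_module_simps M.smult_closed intro!: restrict_ext)
qed

lemma jointly_injective_embedding:
 assumes M: "lmodule R M" and X: "lmodule R X" and fin: "finite I"
  and h: "!!i. i : I ==> h i : lmodule_hom R M X"
  and joint: "!!m. m : carrier M ==> (!!i. i : I ==> h i m = \<zero>\<^bsub>X\<^esub>) ==> m = \<zero>\<^bsub>M\<^esub>"
 shows "EX n. EX f:lmodule_hom R M (power_module n X). inj_on f (carrier M)"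
proof -
 obtain e where e: "bij_betw e {..<card I} I" using ex_bij_betw_nat_finite[OF fin] by (auto simp: atLeast0LessThan)
 let ?f = "\<lambda>m\<in>carrier M. \<lambda>i\<in>{..<card I}. h (e i) m"
 have hom: "?f : lmodule_hom R M (power_module (card I) X)" using e by (intro hom_to_power M h) (auto simp: bij_betw_def)
 have "inj_on ?f (carrier M)"
 proof (rule lmodule_hom_inj[OF M lmodule_power[OF X] hom])
  fix m assume m: "m : carrier M" "?f m = \<zero>\<^bsub>power_module (card I) X\<^esub>"
  have "h i m = \<zero>\<^bsub>X\<^esub>" if i: "i : I" for i
  proof -
   have "i : e ` {..<card I}" using e i by (simp add: bij_betw_def)
   then obtain k where k: "k < card I" "e k = i" by auto
   have "?f m k = \<zero>\<^bsub>X\<^esub>" unfolding m(2) using k by (simp add: power_module_simps)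
   then show ?thesis using k m(1) by simp
  qed
  then show "m = \<zero>\<^bsub>M\<^esub>" by (rule joint[OF m(1)])
 qed
 with hom show ?thesis by blast
qed

section \<open>Finitely generated modules embed into free modules\<close>

locale fg_preprojective_module = nilpotent_preprojective Q field N +
  V: lmodule "preprojective_algebra Q :: ('k, ('v, 'a, 'k) pfun set) module" V
 for Q :: "('v, 'a) pre_digraph" and field :: "'k::field itself" and N :: nat
  and V :: "(('v, 'a, 'k) pfun set, 'm) module" +
 fixes S :: "'m set"
 assumes finite_S: "finite S" and S_carrier: "S <= carrier V"
  and S_generates: "!!U. submodule U (preprojective_algebra Q) V ==> S \<subseteq> U ==> U = carrier V"
begin

abbreviation sc :: "'k => 'm => 'm" where
 "sc c m \<equiv> (c \<odot>\<^bsub>Pi\<^esub> \<one>\<^bsub>Pi\<^esub>) \<odot>\<^bsub>V\<^esub> m"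

abbreviation slice :: "('v \<times> ('a + 'a) list \<times> 'm => 'k) => 'm => ('v, 'a, 'k) pfun" where
 "slice y m \<equiv> restr (%(u, p). y (u, p, m))"

text \<open>A linear surjection from a space of functions onto V, so that questions about subspaces
  of V and functionals on V become questions about functions.\<close>

definition combo :: "('v \<times> ('a + 'a) list \<times> 'm => 'k) => 'm" where
 "combo y = (\<Oplus>\<^bsub>V\<^esub>m\<in>S. cls (slice y m) \<odot>\<^bsub>V\<^esub> m)"

lemma scalar_closed: "c \<odot>\<^bsub>Pi\<^esub> \<one>\<^bsub>Pi\<^esub> : carrier Pi"
 by (rule Pi.scale_closed[OF Pi.one_closed])

lemma scalar_mult: "x : carrier Pi ==> (c \<odot>\<^bsub>Pi\<^esub> \<one>\<^bsub>Pi\<^esub>) \<otimes>\<^bsub>Pi\<^esub> x = c \<odot>\<^bsub>Pi\<^esub> x"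
  "x : carrier Pi ==> x \<otimes>\<^bsub>Pi\<^esub> (c \<odot>\<^bsub>Pi\<^esub> \<one>\<^bsub>Pi\<^esub>) = c \<odot>\<^bsub>Pi\<^esub> x"
 by (simp_all only: Pi.scale_mult_left Pi.scale_mult_right Pi.one_closed Pi.l_one Pi.r_one)

lemma S_in: "m : S ==> m : carrier V" using S_carrier by blast

lemma term_closed: "m : S ==> cls (restr f) \<odot>\<^bsub>V\<^esub> m : carrier V"
 by (rule V.smult_closed[OF cls_in[OF restr_PP] S_in])

lemma combo_closed: "combo y : carrier V" unfolding combo_def by (rule V.M.finsum_closed) (simp add: term_closed)

lemma combo_add: "combo (y + z) = combo y \<oplus>\<^bsub>V\<^esub> combo z"
proof -
 have "slice (y + z) m = slice y m + slice z m" for m by (rule ext) (simp add: restr_def split: prod.splits)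
 then have "combo (y + z) = (\<Oplus>\<^bsub>V\<^esub>m\<in>S. cls (slice y m) \<odot>\<^bsub>V\<^esub> m \<oplus>\<^bsub>V\<^esub> cls (slice z m) \<odot>\<^bsub>V\<^esub> m)"
  unfolding combo_def by (intro V.M.finsum_cong' HOL.refl)
   (simp_all add: cls_add[OF restr_PP restr_PP] V.smult_l_distr cls_in[OF restr_PP] S_in term_closed)
 then show ?thesis unfolding combo_def by (simp add: V.M.finsum_addf term_closed)
qed

lemma combo_act:
 assumes g: "g : carrier PP"
 shows "cls g \<odot>\<^bsub>V\<^esub> combo y = combo (%(u, p, m). mul g (slice y m) (u, p))"
proof -
 have slice: "cls (slice (%(u, p, m). mul g (slice y m) (u, p)) m) = cls g \<otimes>\<^bsub>Pi\<^esub> cls (slice y m)" for m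
  using cls_restr[OF P_mult_closed[OF g restr_PP]] cls_mult[OF g restr_PP] by (simp add: case_prod_eta)
 have "cls g \<odot>\<^bsub>V\<^esub> combo y = (\<Oplus>\<^bsub>V\<^esub>m\<in>S. cls g \<odot>\<^bsub>V\<^esub> (cls (slice y m) \<odot>\<^bsub>V\<^esub> m))"
  unfolding combo_def using finite_S cls_in[OF g] by (intro V.smult_finsum) (simp_all add: term_closed)
 also have "\<dots> = combo (%(u, p, m). mul g (slice y m) (u, p))" unfolding combo_def slice
  by (intro V.M.finsum_cong' HOL.refl)
   (simp_all add: V.smult_assoc V.smult_closed Pi.m_closed cls_in[OF g] cls_in[OF restr_PP] S_in)
 finally show ?thesis .
qed

lemma combo_scale: "combo (fscale c y) = sc c (combo y)"
proof -
 have slice: "slice (fscale c y) m = fscale c (slice y m)" for m by (rule ext) (simp add: restr_def split: prod.splits)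
 have "sc c (combo y) = (\<Oplus>\<^bsub>V\<^esub>m\<in>S. sc c (cls (slice y m) \<odot>\<^bsub>V\<^esub> m))"
  unfolding combo_def using finite_S scalar_closed by (intro V.smult_finsum) (simp_all add: term_closed)
 also have "\<dots> = combo (fscale c y)" unfolding combo_def slice cls_scale[OF restr_PP]
  by (intro V.M.finsum_cong' HOL.refl)
   (simp_all add: V.smult_assoc[symmetric] scalar_mult scalar_closed V.smult_closed cls_in[OF restr_PP] S_in)
 finally show ?thesis by (rule HOL.sym)
qed

lemma combo_0: "combo 0 = \<zero>\<^bsub>V\<^esub>"
proof -
 have "combo 0 \<oplus>\<^bsub>V\<^esub> combo 0 = combo 0" using combo_add[of 0 0] by simp
 then show ?thesis using V.M.add.l_cancel_one combo_closed by simp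
qed

lemma range_combo: "range combo = carrier V"
proof (rule S_generates)
 show "submodule (range combo) Pi V"
 proof (rule V.submoduleI)
  show "\<zero>\<^bsub>V\<^esub> : range combo" unfolding combo_0[symmetric] by (rule rangeI)
  show "a \<odot>\<^bsub>V\<^esub> x : range combo" if "a : carrier Pi" "x : range combo" for a x
  proof -
   obtain g where g: "g : carrier PP" "a = cls g" using \<open>a : carrier Pi\<close> unfolding cls_carrier by blast
   obtain y where "x = combo y" using \<open>x : range combo\<close> by blast
   then show ?thesis using combo_act[OF g(1)] g(2) by simp
  qed
  show "x \<oplus>\<^bsub>V\<^esub> y : range combo" if "x : range combo" "y : range combo" for x y
   using that combo_add by (metis (no_types, lifting) rangeE rangeI)
 qed (use combo_closed in blast)
 show "S \<subseteq> range combo"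
 proof
  fix m assume m: "m : S"
  define y where "y = (%(u, p, n). if n = m then \<one>\<^bsub>PP\<^esub> (u, p) else (0::'k))"
  have one: "\<one>\<^bsub>PP\<^esub> : carrier PP"
   using algebra_over_P unfolding algebra_over_def by (intro ring.ring_simprules(6)) blast
  have "(%(u, p). y (u, p, n)) = (if n = m then \<one>\<^bsub>PP\<^esub> else 0)" for n
   by (rule ext) (simp add: y_def split: prod.splits)
  then have "cls (slice y n) = (if n = m then \<one>\<^bsub>Pi\<^esub> else \<zero>\<^bsub>Pi\<^esub>)" for n
   using cls_restr[OF one] cls_one restr_0 cls_zero by (simp split: if_splits)
  then have "combo y = (\<Oplus>\<^bsub>V\<^esub>n\<in>S. if m = n then n else \<zero>\<^bsub>V\<^esub>)"
   unfolding combo_def by (intro V.M.finsum_cong' HOL.refl) (auto simp: S_in V.smult_one V.zero_smult)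
  also have "\<dots> = m" using m finite_S S_in by (intro V.M.finsum_singleton) auto
  finally show "m : range combo" by (metis rangeI)
 qed
qed

definition Fin :: "('v \<times> ('a + 'a) list \<times> 'm) set" where
 "Fin = (%((u, p), m). (u, p, m)) ` (nil.B \<times> S)"

lemma finite_Fin: "finite Fin" unfolding Fin_def using nil.finite_B finite_S by simp

lemma Fin_I: "(u, p) : nil.B ==> m : S ==> (u, p, m) : Fin" unfolding Fin_def by force

lemma combo_cong:
 assumes "!!b. b : Fin ==> y b = z b"
 shows "combo y = combo z"
proof -
 have "slice y m = slice z m" if "m : S" for m
  using assms Fin_I that by (intro ext) (auto simp: restr_def split: prod.splits)
 then show ?thesis unfolding combo_def by (intro V.M.finsum_cong' HOL.refl) (simp_all add: term_closed)
qed

text \<open>V is finite-dimensional: the coordinates in \<open>Fin\<close> of a normal form modulo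
  the kernel of \<open>combo\<close> are linear functionals that separate points.\<close>

lemma fg_functionals:
 obtains z :: "'v \<times> ('a + 'a) list \<times> 'm => 'm => 'k"
 where "!!b x y. x : carrier V ==> y : carrier V ==> z b (x \<oplus>\<^bsub>V\<^esub> y) = z b x + z b y"
  "!!b c x. x : carrier V ==> z b (sc c x) = c * z b x"
  "!!x. x : carrier V ==> (!!b. b : Fin ==> z b x = 0) ==> x = \<zero>\<^bsub>V\<^esub>"
proof -
 let ?W = "{y. combo y = \<zero>\<^bsub>V\<^esub>}"
 have "fun_subspace ?W" using V.smult_zero[OF scalar_closed]
  by (intro fun_subspaceI) (simp_all only: mem_Collect_eq combo_0 combo_add combo_scale V.M.l_zero V.M.zero_closed)
 from ex_projection[OF this] obtain g
  where g: "fun_linear g" "!!f. g f : ?W" "!!f. f : ?W ==> g f = f" by blast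
 define nf where "nf y = y - g y" for y
 have nf: "fun_linear nf"
 proof (rule fun_linearI)
  show "nf (u + v) = nf u + nf v" for u v unfolding nf_def fun_linear_add[OF g(1)] by (rule ext) simp
  show "nf (fscale c u) = fscale c (nf u)" for c u
   unfolding nf_def fun_linear_scale[OF g(1)] by (rule ext) (simp add: algebra_simps)
 qed
 have combo_nf: "combo (nf y) = combo y" for y
 proof -
  have "y = nf y + g y" unfolding nf_def by (rule ext) simp
  then have "combo y = combo (nf y) \<oplus>\<^bsub>V\<^esub> combo (g y)" using combo_add by metis
  then show ?thesis using g(2)[of y] combo_closed by simp
 qed
 have nf_cong: "nf y = nf y'" if eq: "combo y = combo y'" for y y'
 proof -
  have "y = y' + (y - y')" by (rule ext) simp
  then have "combo y = combo y' \<oplus>\<^bsub>V\<^esub> combo (y - y')" using combo_add by metis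
  then have "combo (y - y') = \<zero>\<^bsub>V\<^esub>"
   using eq V.M.add.l_cancel_one[OF combo_closed[of y'] combo_closed[of "y - y'"]] by simp
  then have "nf (y - y') = 0" unfolding nf_def using g(3) by simp
  then show ?thesis unfolding fun_linear_diff[OF nf] by (rule iffD2[OF eq_iff_diff_eq_0])
 qed
 define rep where "rep x = (SOME y. combo y = x)" for x
 have rep: "combo (rep x) = x" if "x : carrier V" for x
 proof -
  have "EX y. combo y = x" using that range_combo by (metis imageE)
  then show ?thesis unfolding rep_def by (rule someI_ex)
 qed
 show ?thesis
 proof (rule that[of "%b x. nf (rep x) b"])
  show "nf (rep (x \<oplus>\<^bsub>V\<^esub> y)) b = nf (rep x) b + nf (rep y) b" if x: "x : carrier V" and y: "y : carrier V" for b x y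
  proof -
   have "nf (rep (x \<oplus>\<^bsub>V\<^esub> y)) = nf (rep x + rep y)"
    using x y by (intro nf_cong) (simp add: rep combo_add)
   then show ?thesis by (simp add: fun_linear_add[OF nf])
  qed
  show "nf (rep (sc c x)) b = c * nf (rep x) b" if x: "x : carrier V" for b c x
  proof -
   have "nf (rep (sc c x)) = nf (fscale c (rep x))"
    using x V.smult_closed[OF scalar_closed x] by (intro nf_cong) (simp add: rep combo_scale)
   then show ?thesis by (simp add: fun_linear_scale[OF nf])
  qed
  show "x = \<zero>\<^bsub>V\<^esub>" if x: "x : carrier V" and zero: "!!b. b : Fin ==> nf (rep x) b = 0" for x
  proof -
   have "combo (nf (rep x)) = combo 0" using zero by (intro combo_cong) simp
   then show ?thesis unfolding combo_nf rep[OF x] combo_0 .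
  qed
 qed
qed

text \<open>The preimage of the submodule under \<open>combo\<close> is a subspace. Projecting the
  finitely many unit functions of \<open>Fin\<close> onto it gives elements that span the submodule
  linearly, hence generate it.\<close>

lemma fg_submodule:
 assumes K: "lmodule Pi K" and h: "h : lmodule_hom Pi K V" and inj: "inj_on h (carrier K)"
 shows "finitely_generated Pi K"
proof -
 interpret K: lmodule Pi K by (rule K)
 let ?U = "{y. combo y : h ` carrier K}"
 have sub: "fun_subspace ?U"
 proof (rule fun_subspaceI)
  show "0 : ?U"
   using lmodule_hom_zero[OF K V.lmodule_axioms h] combo_0 K.M.zero_closed by (metis (mono_tags, lifting) imageI mem_Collect_eq)
  show "f + g : ?U" if fg: "f : ?U" "g : ?U" for f g
  proof -
   obtain x where x: "x : carrier K" "combo f = h x" using fg(1) by blast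
   obtain y where y: "y : carrier K" "combo g = h y" using fg(2) by blast
   have "combo (f + g) = h (x \<oplus>\<^bsub>K\<^esub> y)"
    unfolding combo_add x(2) y(2) by (rule lmodule_homD(2)[OF h x(1) y(1), symmetric])
   then show ?thesis using K.M.add.m_closed[OF x(1) y(1)] by blast
  qed
  show "fscale c f : ?U" if f: "f : ?U" for c f
  proof -
   obtain x where x: "x : carrier K" "combo f = h x" using f by blast
   have "combo (fscale c f) = h ((c \<odot>\<^bsub>Pi\<^esub> \<one>\<^bsub>Pi\<^esub>) \<odot>\<^bsub>K\<^esub> x)"
    unfolding combo_scale x(2) by (rule lmodule_homD(3)[OF h scalar_closed x(1), symmetric])
   then show ?thesis using K.smult_closed[OF scalar_closed x(1)] by blast
  qed
 qed
 from ex_projection[OF this] obtain g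
  where g: "fun_linear g" "!!f. g f : ?U" "!!f. f : ?U ==> g f = f" by blast
 define gen where "gen b = inv_into (carrier K) h (combo (g (%x. if x = b then 1 else 0)))" for b
 have gen: "gen b : carrier K" "h (gen b) = combo (g (%x. if x = b then 1 else 0))" for b
 proof -
  have "combo (g (%x. if x = b then 1 else 0)) : h ` carrier K" using g(2) by blast
  then show "gen b : carrier K" "h (gen b) = combo (g (%x. if x = b then 1 else 0))"
   unfolding gen_def by (rule inv_into_into, rule f_inv_into_f)
 qed
 have "U' = carrier K" if U': "submodule U' Pi K" and genU: "gen ` Fin \<subseteq> U'" for U'
 proof
  note UD = K.submoduleD[OF U']
  show "U' <= carrier K" by (rule UD(1))
  show "carrier K \<subseteq> U'"
  proof
   fix x assume x: "x : carrier K"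
   obtain y0 where y0: "combo y0 = h x" using range_combo lmodule_homD(1)[OF h x] by (metis imageE)
   \<comment> \<open>Cutting the preimage down to \<open>Fin\<close> does not change its value under
     \<open>combo\<close> and makes it a finite combination of unit functions.\<close>
   define y where "y b = (if b : Fin then y0 b else 0)" for b
   have y: "combo y = h x" unfolding y0[symmetric] by (rule combo_cong) (simp add: y_def)
   have expand: "y = (SUM b:Fin. fscale (y b) (%x. if x = b then 1 else 0))"
    by (rule sum_delta_expansion[OF finite_Fin]) (simp add: y_def)
   have "g y = y" using y x by (intro g(3)) blast
   moreover have "g y = (SUM b:Fin. fscale (y b) (g (%x. if x = b then 1 else 0)))"
    by (subst expand) (simp only: fun_linear_sum[OF g(1)] fun_linear_scale[OF g(1)])
   ultimately have "h x = combo (SUM b:Fin. fscale (y b) (g (%x. if x = b then 1 else 0)))" using y by simp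
   moreover have "combo (SUM b:A. fscale (y b) (g (%x. if x = b then 1 else 0))) : h ` U'"
    if "finite A" "A \<subseteq> Fin" for A using that
   proof (induction A rule: finite_induct)
    case empty
    show ?case unfolding sum.empty combo_0 lmodule_hom_zero[OF K V.lmodule_axioms h, symmetric]
     by (rule imageI[OF UD(2)])
   next
    case (insert b A)
    then obtain w where w: "w : U'" "combo (SUM b:A. fscale (y b) (g (%x. if x = b then 1 else 0))) = h w" by blast
    let ?b = "(y b \<odot>\<^bsub>Pi\<^esub> \<one>\<^bsub>Pi\<^esub>) \<odot>\<^bsub>K\<^esub> gen b"
    have b: "?b : U'" using insert.prems genU by (intro UD(4) scalar_closed) blast
    have "combo (SUM b:insert b A. fscale (y b) (g (%x. if x = b then 1 else 0))) = h (?b \<oplus>\<^bsub>K\<^esub> w)"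
     unfolding sum.insert[OF insert.hyps] combo_add combo_scale w(2) gen(2)[symmetric]
      lmodule_homD(3)[OF h scalar_closed gen(1), symmetric]
     using UD(1) b w(1) by (intro lmodule_homD(2)[OF h, symmetric]) blast+
    then show ?case using UD(3)[OF b w(1)] by blast
   qed
   ultimately have "h x : h ` U'" using finite_Fin by simp
   then obtain x' where x': "h x = h x'" "x' : U'" by (rule imageE)
   have "x = x'" using inj_onD[OF inj x'(1) x] UD(1) x'(2) by blast
   then show "x : U'" using x'(2) by simp
  qed
 qed
 then show ?thesis unfolding finitely_generated_def using finite_Fin gen(1)
  by (intro exI[of _ "gen ` Fin"] conjI allI impI finite_imageI image_subsetI) blast+
qed

text \<open>A functional z on V sends m to the function that maps a path x to z(x m), an element of
  the dual module; this is compatible with arrows and vertices. Composing with the embedding of the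
  dual gives homomorphisms to the regular module. If all of them kill m, then every path kills m,
  and so does the unit.\<close>

lemma embeds:
 "EX n. EX f:lmodule_hom Pi V (power_module n (regular_module Pi)). inj_on f (carrier V)"
proof (rule fg_functionals, rule dual_module_embeds)
 fix z :: "'v \<times> ('a + 'a) list \<times> 'm => 'm => 'k"
  and th :: "('v, 'a) dpath => ('v, 'a, 'k) pfun => ('v, 'a, 'k) pfun set"
 assume z_add: "!!b x y. x : carrier V ==> y : carrier V ==> z b (x \<oplus>\<^bsub>V\<^esub> y) = z b x + z b y"
  and z_scale: "!!b c x. x : carrier V ==> z b (sc c x) = c * z b x"
  and z_inj: "!!x. x : carrier V ==> (!!b. b : Fin ==> z b x = 0) ==> x = \<zero>\<^bsub>V\<^esub>"
 assume th: "!!b xi. th b xi : carrier Pi"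
  and th_add: "!!b xi \<eta>. th b (xi + \<eta>) = th b xi \<oplus>\<^bsub>Pi\<^esub> th b \<eta>"
  and th_scale: "!!b c xi. th b (fscale c xi) = c \<odot>\<^bsub>Pi\<^esub> th b xi"
  and th_arrow: "!!b a xi. a : arcs D ==> xi : X ==> th b (dual_arrow a xi) = cls (pe (tail D a, [a])) \<otimes>\<^bsub>Pi\<^esub> th b xi"
  and th_vertex: "!!b i xi. i : verts Q ==> xi : X ==> th b (dual_vertex D i xi) = cls (pe (i, [])) \<otimes>\<^bsub>Pi\<^esub> th b xi"
  and th_inj: "!!xi. xi : X ==> (!!b. b : nil.B ==> th b xi = \<zero>\<^bsub>Pi\<^esub>) ==> xi = 0"
 define dual where "dual j m = (%x. if x : quiver_paths D then z j (cls (pe x) \<odot>\<^bsub>V\<^esub> m) else 0)" for j m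
 have sm: "cls f \<odot>\<^bsub>V\<^esub> m : carrier V" if "f : carrier PP" "m : carrier V" for f m
  by (rule V.smult_closed[OF cls_in[OF that(1)] that(2)])
 have z_zero: "z j \<zero>\<^bsub>V\<^esub> = 0" for j
 proof -
  have "z j \<zero>\<^bsub>V\<^esub> = z j \<zero>\<^bsub>V\<^esub> + z j \<zero>\<^bsub>V\<^esub>"
   using z_add[OF V.M.zero_closed V.M.zero_closed, of j] by (simp only: V.M.l_zero[OF V.M.zero_closed])
  then show ?thesis by (rule add_cancel_right_right[THEN iffD1])
 qed
 have act_add: "cls (f + g) \<odot>\<^bsub>V\<^esub> m = cls f \<odot>\<^bsub>V\<^esub> m \<oplus>\<^bsub>V\<^esub> cls g \<odot>\<^bsub>V\<^esub> m"
  if "f : carrier PP" "g : carrier PP" "m : carrier V" for f g m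
  using that by (simp only: cls_add V.smult_l_distr cls_in)
 have act_scale: "cls (fscale c f) \<odot>\<^bsub>V\<^esub> m = sc c (cls f \<odot>\<^bsub>V\<^esub> m)" "cls (fscale c f) \<odot>\<^bsub>V\<^esub> m = cls f \<odot>\<^bsub>V\<^esub> sc c m"
  if "f : carrier PP" "m : carrier V" for c f m using that cls_in[OF that(1)]
  by (simp_all only: cls_scale V.smult_assoc[symmetric] scalar_closed scalar_mult)
 have act_mult: "cls (mul f g) \<odot>\<^bsub>V\<^esub> m = cls f \<odot>\<^bsub>V\<^esub> (cls g \<odot>\<^bsub>V\<^esub> m)"
  if "f : carrier PP" "g : carrier PP" "m : carrier V" for f g m
  using that by (simp only: cls_mult V.smult_assoc cls_in)
 have act_0: "cls 0 \<odot>\<^bsub>V\<^esub> m = \<zero>\<^bsub>V\<^esub>" if "m : carrier V" for m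
  unfolding cls_zero by (rule V.zero_smult[OF that])
 have pePP: "pe x : carrier PP" if "x : quiver_paths D" for x by (rule path_elem_carrier[OF that])
 have dual: "dual j m : X" if m: "m : carrier V" for j m unfolding dual_def
 proof (rule functional_in_dual)
  show "z j (cls (f + g) \<odot>\<^bsub>V\<^esub> m) = z j (cls f \<odot>\<^bsub>V\<^esub> m) + z j (cls g \<odot>\<^bsub>V\<^esub> m)"
   if "f : carrier PP" "g : carrier PP" for f g
   unfolding act_add[OF that m] by (rule z_add[OF sm[OF that(1) m] sm[OF that(2) m]])
  show "z j (cls (fscale c f) \<odot>\<^bsub>V\<^esub> m) = c * z j (cls f \<odot>\<^bsub>V\<^esub> m)" if "f : carrier PP" for c f
   unfolding act_scale(1)[OF that m] by (rule z_scale[OF sm[OF that m]])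
  show "z j (cls f \<odot>\<^bsub>V\<^esub> m) = 0" if "f : RR" for f
  proof -
   have "cls f = \<zero>\<^bsub>Pi\<^esub>" using cls_eq_zero_iff[OF R_carrier[OF that]] that by blast
   then show ?thesis using V.zero_smult[OF m] z_zero by simp
  qed
 qed
 have dual_add: "dual j (m \<oplus>\<^bsub>V\<^esub> n) = dual j m + dual j n" if m: "m : carrier V" and n: "n : carrier V" for j m n
 proof
  fix x show "dual j (m \<oplus>\<^bsub>V\<^esub> n) x = (dual j m + dual j n) x"
  proof (cases "x : quiver_paths D")
   case True
   have p: "pe x : carrier PP" by (rule pePP[OF True])
   show ?thesis using True z_add[OF sm[OF p m] sm[OF p n]] by (simp add: dual_def V.smult_r_distr[OF cls_in[OF p] m n])
  qed (simp add: dual_def)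
 qed
 have dual_scale: "dual j (sc c m) = fscale c (dual j m)" if m: "m : carrier V" for j c m
 proof
  fix x show "dual j (sc c m) x = fscale c (dual j m) x"
  proof (cases "x : quiver_paths D")
   case True
   have p: "pe x : carrier PP" by (rule pePP[OF True])
   have "cls (pe x) \<odot>\<^bsub>V\<^esub> sc c m = sc c (cls (pe x) \<odot>\<^bsub>V\<^esub> m)"
    using act_scale[OF p m, of c] by simp
   then show ?thesis using True z_scale[OF sm[OF p m]] by (simp add: dual_def)
  qed (simp add: dual_def)
 qed
 have dual_arrow: "dual j (cls (pe (tail D a, [a])) \<odot>\<^bsub>V\<^esub> m) = dual_arrow a (dual j m)"
  if a: "a : arcs D" and m: "m : carrier V" for j a m
 proof (rule ext, clarify)
  fix u p
  have snoc: "(u, p @ [a]) : quiver_paths D \<longleftrightarrow> (u, p) : quiver_paths D & tail D a = D.awlast u p"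
   using a by (auto simp: D.quiver_paths_snoc)
  show "dual j (cls (pe (tail D a, [a])) \<odot>\<^bsub>V\<^esub> m) (u, p) = dual_arrow a (dual j m) (u, p)"
  proof (cases "(u, p) : quiver_paths D")
   case True
   have "mul (pe (u, p)) (pe (tail D a, [a])) = (if tail D a = D.awlast u p then pe (u, p @ [a]) else 0)"
    by (simp add: D.path_elem_mult_path_elem)
   then have "cls (pe (u, p)) \<odot>\<^bsub>V\<^esub> (cls (pe (tail D a, [a])) \<odot>\<^bsub>V\<^esub> m) =
     (if tail D a = D.awlast u p then cls (pe (u, p @ [a])) \<odot>\<^bsub>V\<^esub> m else \<zero>\<^bsub>V\<^esub>)"
    using act_mult[OF pePP[OF True] arrow_PP[OF a] m] act_0[OF m] by (simp split: if_splits)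
   then show ?thesis using True snoc z_zero by (simp add: dual_def dual_arrow_def)
  qed (use snoc in \<open>simp add: dual_def dual_arrow_def\<close>)
 qed
 have dual_vertex: "dual j (cls (pe (i, [])) \<odot>\<^bsub>V\<^esub> m) = dual_vertex D i (dual j m)"
  if i: "i : verts Q" and m: "m : carrier V" for j i m
 proof (rule ext, clarify)
  fix u p
  show "dual j (cls (pe (i, [])) \<odot>\<^bsub>V\<^esub> m) (u, p) = dual_vertex D i (dual j m) (u, p)"
  proof (cases "(u, p) : quiver_paths D")
   case True
   have "mul (pe (u, p)) (pe (i, [])) = (if i = D.awlast u p then pe (u, p) else 0)"
    by (simp add: D.path_elem_mult_path_elem)
   then have "cls (pe (u, p)) \<odot>\<^bsub>V\<^esub> (cls (pe (i, [])) \<odot>\<^bsub>V\<^esub> m) =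
     (if i = D.awlast u p then cls (pe (u, p)) \<odot>\<^bsub>V\<^esub> m else \<zero>\<^bsub>V\<^esub>)"
    using act_mult[OF pePP[OF True] vertex_PP[OF i] m] act_0[OF m] by (simp split: if_splits)
   then show ?thesis using True z_zero by (auto simp: dual_def dual_vertex_def)
  qed (simp add: dual_def dual_vertex_def)
 qed
 define h where "h = (%(b, j). \<lambda>m\<in>carrier V. th b (dual j m))"
 have hom: "h (b, j) : lmodule_hom Pi V (regular_module Pi)" for b j
 proof -
  let ?f = "%m. th b (dual j m)"
  have path: "?f (cls (pe (u, p)) \<odot>\<^bsub>V\<^esub> m) = cls (pe (u, p)) \<otimes>\<^bsub>Pi\<^esub> ?f m"
   if "(u, p) : quiver_paths D" "m : carrier V" for u p m using that
  proof (induction p arbitrary: u)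
   case Nil
   then have u: "u : verts Q" by simp
   show ?case unfolding dual_vertex[OF u Nil(2)] by (rule th_vertex[OF u dual[OF Nil(2)]])
  next
   case (Cons a p)
   then have a: "a : arcs D" "tail D a = u" and p: "(head D a, p) : quiver_paths D"
    by (simp_all add: D.quiver_paths_Cons)
   have split: "pe (u, a # p) = mul (pe (tail D a, [a])) (pe (head D a, p))"
    by (simp add: D.path_elem_mult_path_elem D.awlast_eq a(2))
   have pm: "cls (pe (head D a, p)) \<odot>\<^bsub>V\<^esub> m : carrier V" by (rule sm[OF pePP[OF p] Cons.prems(2)])
   show ?case unfolding split act_mult[OF arrow_PP[OF a(1)] pePP[OF p] Cons.prems(2)] dual_arrow[OF a(1) pm]
     th_arrow[OF a(1) dual[OF pm]] Cons.IH[OF p Cons.prems(2)] unfolding cls_mult[OF arrow_PP[OF a(1)] pePP[OF p]]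
    by (rule Pi.m_assoc[symmetric]) (intro cls_in arrow_PP a pePP p th)+
  qed
  have lin: "?f (cls f \<odot>\<^bsub>V\<^esub> m) = cls f \<otimes>\<^bsub>Pi\<^esub> ?f m" if "f : carrier PP" "m : carrier V" for f m
   using that(1)
  proof (induction rule: path_algebra_induct)
   case zero
   have "?f \<zero>\<^bsub>V\<^esub> \<oplus>\<^bsub>Pi\<^esub> ?f \<zero>\<^bsub>V\<^esub> = ?f \<zero>\<^bsub>V\<^esub>"
    using dual_add[OF V.M.zero_closed V.M.zero_closed] th_add by (metis V.M.l_zero V.M.zero_closed)
   then have "?f \<zero>\<^bsub>V\<^esub> = \<zero>\<^bsub>Pi\<^esub>" using Pi.add.l_cancel_one th by simp
   then show ?case unfolding act_0[OF that(2)] unfolding cls_zero using th by simp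
  next
   case (step c x f)
   have x: "pe x : carrier PP" by (rule pePP[OF step.hyps(1)])
   have px: "?f (cls (pe x) \<odot>\<^bsub>V\<^esub> m) = cls (pe x) \<otimes>\<^bsub>Pi\<^esub> ?f m"
    using path[of "fst x" "snd x" m] step.hyps(1) that(2) by simp
   have "?f (cls (fscale c (pe x) + f) \<odot>\<^bsub>V\<^esub> m) = c \<odot>\<^bsub>Pi\<^esub> ?f (cls (pe x) \<odot>\<^bsub>V\<^esub> m) \<oplus>\<^bsub>Pi\<^esub> ?f (cls f \<odot>\<^bsub>V\<^esub> m)"
    unfolding act_add[OF P_scale[OF x] step.hyps(2) that(2)] act_scale(1)[OF x that(2)]
     dual_add[OF V.smult_closed[OF scalar_closed sm[OF x that(2)]] sm[OF step.hyps(2) that(2)]]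
     dual_scale[OF sm[OF x that(2)]] th_add th_scale ..
   also have "\<dots> = c \<odot>\<^bsub>Pi\<^esub> (cls (pe x) \<otimes>\<^bsub>Pi\<^esub> ?f m) \<oplus>\<^bsub>Pi\<^esub> cls f \<otimes>\<^bsub>Pi\<^esub> ?f m"
    unfolding px step.IH ..
   also have "\<dots> = cls (fscale c (pe x) + f) \<otimes>\<^bsub>Pi\<^esub> ?f m"
    unfolding cls_add[OF P_scale[OF x] step.hyps(2)] cls_scale[OF x] using th cls_in[OF x] cls_in[OF step.hyps(2)]
    by (simp only: Pi.l_distr Pi.scale_closed Pi.scale_mult_left)
   finally show ?case .
  qed
  show ?thesis
  proof (rule lmodule_homI)
   show "h (b, j) (r \<odot>\<^bsub>V\<^esub> m) = r \<odot>\<^bsub>regular_module Pi\<^esub> h (b, j) m" if r: "r : carrier Pi" and m: "m : carrier V" for r m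
   proof -
    obtain f where f: "f : carrier PP" "r = cls f" using r unfolding cls_carrier by blast
    show ?thesis using lin[OF f(1) m] m sm[OF f(1) m] unfolding f(2) by (simp add: h_def)
   qed
  qed (simp_all add: h_def th th_add dual_add)
 qed
 show ?thesis
 proof (rule jointly_injective_embedding[OF V.lmodule_axioms lmodule_regular[OF Pi.ring_axioms]])
  show "finite (nil.B \<times> Fin)" using nil.finite_B finite_Fin by simp
  show "h i : lmodule_hom Pi V (regular_module Pi)" for i using hom by (cases i) simp
  fix m assume m: "m : carrier V" and zero: "!!i. i : nil.B \<times> Fin ==> h i m = \<zero>\<^bsub>regular_module Pi\<^esub>"
  have dual0: "dual j m = 0" if "j : Fin" for j
  proof (rule th_inj[OF dual[OF m]])
   show "th b (dual j m) = \<zero>\<^bsub>Pi\<^esub>" if "b : nil.B" for b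
    using zero[of "(b, j)"] that \<open>j : Fin\<close> m by (simp add: h_def)
  qed
  have z0: "z j (cls (pe x) \<odot>\<^bsub>V\<^esub> m) = 0" if "j : Fin" "x : quiver_paths D" for j x
  proof -
   have "dual j m x = 0" unfolding dual0[OF that(1)] by (rule zero_fun_apply)
   then show ?thesis unfolding dual_def if_P[OF that(2)] .
  qed
  have path0: "cls (pe x) \<odot>\<^bsub>V\<^esub> m = \<zero>\<^bsub>V\<^esub>" if "x : quiver_paths D" for x
   by (rule z_inj[OF sm[OF pePP[OF that] m] z0[OF _ that]])
  have "cls f \<odot>\<^bsub>V\<^esub> m = \<zero>\<^bsub>V\<^esub>" if "f : carrier PP" for f using that
  proof (induction rule: path_algebra_induct)
   case zero
   show ?case by (rule act_0[OF m])
  next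
   case (step c x f)
   have x: "pe x : carrier PP" by (rule pePP[OF step.hyps(1)])
   show ?case unfolding act_add[OF P_scale[OF x] step.hyps(2) m] act_scale(1)[OF x m] path0[OF step.hyps(1)] step.IH
    by (simp add: V.smult_zero scalar_closed)
  qed
  moreover have "\<one>\<^bsub>PP\<^esub> : carrier PP"
   using algebra_over_P unfolding algebra_over_def by (intro ring.ring_simprules(6)) blast
  ultimately have "\<one>\<^bsub>Pi\<^esub> \<odot>\<^bsub>V\<^esub> m = \<zero>\<^bsub>V\<^esub>" unfolding cls_one[symmetric] by blast
  then show "m = \<zero>\<^bsub>V\<^esub>" unfolding V.smult_one[OF m] .
 qed
qed

end

section \<open>Homomorphisms, submodules and direct summands\<close>

lemma lmodule_hom_compose:
 assumes "f : lmodule_hom R M N" "g : lmodule_hom R N P"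
  and "lmodule R M"
 shows "compose (carrier M) g f : lmodule_hom R M P"
proof -
 interpret M: lmodule R M by (rule assms(3))
 show ?thesis by (rule lmodule_homI)
   (simp_all add: compose_def lmodule_homD(1-3)[OF assms(1)] lmodule_homD(1-3)[OF assms(2)] M.smult_closed)
qed

lemma lmodule_hom_id:
 assumes "lmodule R M"
 shows "(\<lambda>x\<in>carrier M. x) : lmodule_hom R M M"
proof -
 interpret M: lmodule R M by (rule assms)
 show ?thesis by (rule lmodule_homI) (simp_all add: M.smult_closed)
qed

lemma lmodule_hom_inverse:
 assumes M: "lmodule R M" and h: "h : lmodule_hom R M N" and bij: "bij_betw h (carrier M) (carrier N)"
 shows "(\<lambda>y\<in>carrier N. inv_into (carrier M) h y) : lmodule_hom R N M"
proof -
 interpret M: lmodule R M by (rule M)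
 let ?g = "inv_into (carrier M) h"
 have g: "?g y : carrier M" "h (?g y) = y" if "y : carrier N" for y
  using that bij by (auto simp: bij_betw_def inv_into_into f_inv_into_f)
 have gh: "?g (h x) = x" if "x : carrier M" for x using that bij by (simp add: bij_betw_def)
 have add: "y \<oplus>\<^bsub>N\<^esub> z = h (?g y \<oplus>\<^bsub>M\<^esub> ?g z)" if "y : carrier N" "z : carrier N" for y z
  using lmodule_homD(2)[OF h g(1)[OF that(1)] g(1)[OF that(2)]] g(2) that by simp
 have smult: "r \<odot>\<^bsub>N\<^esub> y = h (r \<odot>\<^bsub>M\<^esub> ?g y)" if "r : carrier R" "y : carrier N" for r y
  using lmodule_homD(3)[OF h that(1) g(1)[OF that(2)]] g(2) that by simp
 show ?thesis by (rule lmodule_homI)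
   (simp_all add: g add smult gh M.smult_closed lmodule_homD(1)[OF h])
qed

lemma submodule_image:
 assumes "lmodule R M" "lmodule R N" "f : lmodule_hom R M N"
 shows "submodule (f ` carrier M) R N"
proof -
 interpret M: lmodule R M by (rule assms(1))
 interpret N: lmodule R N by (rule assms(2))
 note f = lmodule_homD(1-3)[OF assms(3)]
 show ?thesis
 proof (rule N.submoduleI)
  show "\<zero>\<^bsub>N\<^esub> : f ` carrier M" using lmodule_hom_zero[OF assms] M.M.zero_closed by (metis imageI)
  show "x \<oplus>\<^bsub>N\<^esub> y : f ` carrier M" if xy: "x : f ` carrier M" "y : f ` carrier M" for x y
  proof -
   obtain a where a: "a : carrier M" "x = f a" using xy(1) by blast
   obtain b where b: "b : carrier M" "y = f b" using xy(2) by blast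
   show ?thesis unfolding a(2) b(2) f(2)[OF a(1) b(1), symmetric] using a(1) b(1) by simp
  qed
  show "r \<odot>\<^bsub>N\<^esub> x : f ` carrier M" if r: "r : carrier R" and x: "x : f ` carrier M" for r x
  proof -
   obtain a where a: "a : carrier M" "x = f a" using x by blast
   show ?thesis unfolding a(2) f(3)[OF r a(1), symmetric] using M.smult_closed[OF r a(1)] by (rule imageI)
  qed
 qed (use f(1) in blast)
qed

lemma submodule_equalizer:
 assumes "lmodule R M" "lmodule R N" "f : lmodule_hom R M N" "g : lmodule_hom R M N"
 shows "submodule {x : carrier M. f x = g x} R M"
proof -
 interpret M: lmodule R M by (rule assms(1))
 note f = lmodule_homD(1-3)[OF assms(3)] and g = lmodule_homD(1-3)[OF assms(4)]
 show ?thesis using lmodule_hom_zero[OF assms(1,2,3)] lmodule_hom_zero[OF assms(1,2,4)]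
  by (intro M.submoduleI) (auto simp: f g M.smult_closed)
qed

lemma submodule_preimage:
 assumes "lmodule R M" "lmodule R N" "f : lmodule_hom R M N" "submodule U R N"
 shows "submodule {x : carrier M. f x : U} R M"
proof -
 interpret M: lmodule R M by (rule assms(1))
 interpret N: lmodule R N by (rule assms(2))
 note f = lmodule_homD(1-3)[OF assms(3)] and U = N.submoduleD[OF assms(4)]
 show ?thesis using lmodule_hom_zero[OF assms(1,2,3)] U(2-4) by (intro M.submoduleI) (auto simp: f M.smult_closed)
qed

lemma finitely_generated_image:
 assumes "lmodule R M" "lmodule R N" "f : lmodule_hom R M N" "f ` carrier M = carrier N"
  and "finitely_generated R M"
 shows "finitely_generated R N"
proof -
 interpret N: lmodule R N by (rule assms(2))
 obtain S where S: "finite S" "S <= carrier M"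
   "!!U. submodule U R M ==> S \<subseteq> U ==> U = carrier M"
  using assms(5) unfolding finitely_generated_def by blast
 have "U = carrier N" if U: "submodule U R N" "f ` S \<subseteq> U" for U
 proof -
  have "{x : carrier M. f x : U} = carrier M" using U S(2) by (intro S(3) submodule_preimage[OF assms(1-3)]) auto
  then have "carrier N \<subseteq> U" unfolding assms(4)[symmetric] by blast
  then show ?thesis using N.submoduleD(1)[OF U(1)] by blast
 qed
 moreover have "f ` S <= carrier N" using S(2) lmodule_homD(1)[OF assms(3)] by blast
 ultimately show ?thesis unfolding finitely_generated_def using S(1) by blast
qed

lemma Sub_modules_iff:
 fixes M :: "('r, 'm) module"
 assumes X: "lmodule R X" and M: "M : modules R"
 shows "M : Sub_modules R X \<longleftrightarrow> (EX n. EX f:lmodule_hom R M (power_module n X). inj_on f (carrier M))"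
proof
 assume "M : Sub_modules R X"
 then obtain n N f where N: "submodule N R (power_module n X)"
   and f: "f : lmodule_hom R M ((power_module n X)\<lparr>carrier := N\<rparr>)"
   and bij: "bij_betw f (carrier M) (carrier ((power_module n X)\<lparr>carrier := N\<rparr>))"
  unfolding Sub_modules_def lmodule_isomorphic_def by blast
 have "N <= carrier (power_module n X)" by (rule lmodule.submoduleD(1)[OF lmodule_power[OF X] N])
 then have "f : lmodule_hom R M (power_module n X)" using lmodule_homD[OF f] by (intro lmodule_homI) auto
 then show "EX n. EX f:lmodule_hom R M (power_module n X). inj_on f (carrier M)" using bij by (auto simp: bij_betw_def)
next
 assume "EX n. EX f:lmodule_hom R M (power_module n X). inj_on f (carrier M)"
 then obtain n f where f: "f : lmodule_hom R M (power_module n X)" "inj_on f (carrier M)" by blast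
 have lM: "lmodule R M" using M by (simp add: modules_def)
 let ?N = "f ` carrier M"
 have "submodule ?N R (power_module n X)" by (rule submodule_image[OF lM lmodule_power[OF X] f(1)])
 moreover have "f : lmodule_hom R M ((power_module n X)\<lparr>carrier := ?N\<rparr>)"
  using lmodule_homD[OF f(1)] by (intro lmodule_homI) auto
 moreover have "bij_betw f (carrier M) (carrier ((power_module n X)\<lparr>carrier := ?N\<rparr>))"
  using f(2) by (simp add: bij_betw_def)
 ultimately show "M : Sub_modules R X" unfolding Sub_modules_def lmodule_isomorphic_def using M by blast
qed

text \<open>The retract form of the complements used in \<open>add_modules\<close>. It mentions
  homomorphisms only, so it transfers directly along restriction of scalars.\<close>

definition direct_summand :: "('r, 'z) ring_scheme => ('r, 'm) module => ('r, 'n) module => bool" where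
 "direct_summand R M P \<longleftrightarrow>
   (EX a:lmodule_hom R M P. EX b:lmodule_hom R P M. ALL x:carrier M. b (a x) = x)"

lemma direct_summandD:
 assumes "lmodule R M" "lmodule R P" "a : lmodule_hom R M P" "b : lmodule_hom R P M" "ALL x:carrier M. b (a x) = x"
 shows "EX N N'. submodule N R P & submodule N' R P & N \<inter> N' = {\<zero>\<^bsub>P\<^esub>} & N <+>\<^bsub>P\<^esub> N' = carrier P \<and>
  lmodule_isomorphic R M (P\<lparr>carrier := N\<rparr>)"
proof -
 interpret M: lmodule R M by (rule assms(1))
 interpret P: lmodule R P by (rule assms(2))
 note a = lmodule_homD(1-3)[OF assms(3)] and b = lmodule_homD(1-3)[OF assms(4)]
 note zero = lmodule_hom_zero[OF assms(1-3)] lmodule_hom_zero[OF assms(2,1,4)]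
 have ba: "b (a x) = x" if "x : carrier M" for x using that assms(5) by blast
 let ?N = "a ` carrier M" and ?N' = "{y : carrier P. b y = \<zero>\<^bsub>M\<^esub>}"
 have N: "submodule ?N R P" by (rule submodule_image[OF assms(1-3)])
 have N': "submodule ?N' R P" by (intro P.submoduleI) (auto simp: b zero P.smult_closed M.smult_zero)
 have "?N \<inter> ?N' <= {\<zero>\<^bsub>P\<^esub>}" using ba zero by auto
 moreover have "\<zero>\<^bsub>P\<^esub> : ?N \<inter> ?N'" using P.submoduleD(2)[OF N] P.submoduleD(2)[OF N'] by blast
 ultimately have int: "?N \<inter> ?N' = {\<zero>\<^bsub>P\<^esub>}" by blast
 have sum: "?N <+>\<^bsub>P\<^esub> ?N' = carrier P"
 proof
  show "?N <+>\<^bsub>P\<^esub> ?N' <= carrier P" using a(1) by (auto simp: set_add_def')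
  show "carrier P \<subseteq> ?N <+>\<^bsub>P\<^esub> ?N'"
  proof
   fix y assume y: "y : carrier P"
   have ab: "a (b y) : carrier P" "a (b y) : ?N" using y a(1) b(1) by blast+
   let ?z = "\<ominus>\<^bsub>P\<^esub> a (b y) \<oplus>\<^bsub>P\<^esub> y"
   have z: "?z : carrier P" using ab y by simp
   have eq: "y = a (b y) \<oplus>\<^bsub>P\<^esub> ?z" using ab(1) y by (simp add: P.M.a_assoc[symmetric] P.M.r_neg)
   have "b y = b y \<oplus>\<^bsub>M\<^esub> b ?z" using b(2)[OF ab(1) z] eq ba[OF b(1)[OF y]] by simp
   then have "b ?z = \<zero>\<^bsub>M\<^esub>" using M.M.add.l_cancel_one'[OF b(1)[OF y] b(1)[OF z]] by simp
   then have "?z : ?N'" using z by simp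
   then show "y : ?N <+>\<^bsub>P\<^esub> ?N'" unfolding set_add_def' using eq ab(2) by blast
  qed
 qed
 have "a : lmodule_hom R M (P\<lparr>carrier := ?N\<rparr>)" using lmodule_homD[OF assms(3)] by (intro lmodule_homI) auto
 moreover have "bij_betw a (carrier M) (carrier (P\<lparr>carrier := ?N\<rparr>))"
  using ba by (auto simp: bij_betw_def intro!: inj_on_inverseI[of _ b])
 ultimately have "lmodule_isomorphic R M (P\<lparr>carrier := ?N\<rparr>)" unfolding lmodule_isomorphic_def by blast
 then show ?thesis using N N' int sum by blast
qed

lemma direct_summandI:
 assumes "lmodule R M" "lmodule R P" "submodule N R P" "submodule N' R P" "N \<inter> N' = {\<zero>\<^bsub>P\<^esub>}"
  "N <+>\<^bsub>P\<^esub> N' = carrier P" "lmodule_isomorphic R M (P\<lparr>carrier := N\<rparr>)"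
 shows "direct_summand R M P"
proof -
 interpret M: lmodule R M by (rule assms(1))
 interpret P: lmodule R P by (rule assms(2))
 note N = P.submoduleD[OF assms(3)] and N' = P.submoduleD[OF assms(4)]
 obtain f where f0: "f : lmodule_hom R M (P\<lparr>carrier := N\<rparr>)" and bij: "bij_betw f (carrier M) N"
  using assms(7) unfolding lmodule_isomorphic_def by auto
 have fN: "f x : N" if "x : carrier M" for x using lmodule_homD(1)[OF f0 that] by simp
 have f: "f : lmodule_hom R M P" using lmodule_homD[OF f0] N(1) by (intro lmodule_homI) auto
 note fD = lmodule_homD(1-3)[OF f]
 \<comment> \<open>x is the preimage under f of the N-component of y. Existence and uniqueness of
   the decomposition make this the graph of the retraction.\<close>
 let ?Q = "%y x. x : carrier M & (EX z:N'. y = f x \<oplus>\<^bsub>P\<^esub> z)"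
 have ex: "EX x. ?Q y x" if y: "y : carrier P" for y
 proof -
  obtain u z where u: "u : N" "z : N'" "y = u \<oplus>\<^bsub>P\<^esub> z"
   using y unfolding assms(6)[symmetric] set_add_def' by blast
  obtain x where "x : carrier M" "u = f x" using u(1) bij by (auto simp: bij_betw_def)
  then show ?thesis using u by blast
 qed
 have uniq: "x = x'" if Q: "?Q y x" "?Q y x'" for y x x'
 proof -
  obtain z where z: "z : N'" "y = f x \<oplus>\<^bsub>P\<^esub> z" using Q(1) by blast
  obtain z' where z': "z' : N'" "y = f x' \<oplus>\<^bsub>P\<^esub> z'" using Q(2) by blast
  have c: "f x : carrier P" "f x' : carrier P" "z : carrier P" "z' : carrier P" using Q fD(1) z(1) z'(1) N'(1) by blast+
  have "\<ominus>\<^bsub>P\<^esub> f x' \<oplus>\<^bsub>P\<^esub> f x = \<ominus>\<^bsub>P\<^esub> f x' \<oplus>\<^bsub>P\<^esub> (f x \<oplus>\<^bsub>P\<^esub> z) \<oplus>\<^bsub>P\<^esub> \<ominus>\<^bsub>P\<^esub> z"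
   using c by (simp add: P.M.a_assoc P.M.r_neg)
  also have "f x \<oplus>\<^bsub>P\<^esub> z = f x' \<oplus>\<^bsub>P\<^esub> z'" using z(2) z'(2) by simp
  also have "\<ominus>\<^bsub>P\<^esub> f x' \<oplus>\<^bsub>P\<^esub> (f x' \<oplus>\<^bsub>P\<^esub> z') \<oplus>\<^bsub>P\<^esub> \<ominus>\<^bsub>P\<^esub> z = z' \<oplus>\<^bsub>P\<^esub> \<ominus>\<^bsub>P\<^esub> z"
   using c by (simp add: P.M.a_assoc[symmetric] P.M.l_neg)
  finally have eq: "\<ominus>\<^bsub>P\<^esub> f x' \<oplus>\<^bsub>P\<^esub> f x = z' \<oplus>\<^bsub>P\<^esub> \<ominus>\<^bsub>P\<^esub> z" .
  have "\<ominus>\<^bsub>P\<^esub> f x' \<oplus>\<^bsub>P\<^esub> f x : N" using Q by (intro N(3,5) fN) auto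
  moreover have "z' \<oplus>\<^bsub>P\<^esub> \<ominus>\<^bsub>P\<^esub> z : N'" using z(1) z'(1) by (intro N'(3,5))
  ultimately have "\<ominus>\<^bsub>P\<^esub> f x' \<oplus>\<^bsub>P\<^esub> f x = \<zero>\<^bsub>P\<^esub>" using assms(5) eq by auto
  moreover have "f x = f x' \<oplus>\<^bsub>P\<^esub> (\<ominus>\<^bsub>P\<^esub> f x' \<oplus>\<^bsub>P\<^esub> f x)"
   using c by (simp add: P.M.a_assoc[symmetric] P.M.r_neg)
  ultimately have "f x = f x'" using c by simp
  then show ?thesis using bij Q by (auto simp: bij_betw_def dest: inj_onD)
 qed
 define b where "b = (\<lambda>y\<in>carrier P. SOME x. ?Q y x)"
 have bQ: "?Q y (b y)" if y: "y : carrier P" for y using someI_ex[OF ex[OF y]] y by (simp add: b_def)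
 have b_eq: "b y = x" if "y : carrier P" "?Q y x" for y x using uniq[OF bQ[OF that(1)] that(2)] .
 have b: "b : lmodule_hom R P M"
 proof (rule lmodule_homI)
  show "b y : carrier M" if "y : carrier P" for y using bQ[OF that] by blast
  show "b : extensional (carrier P)" by (simp add: b_def)
  show "b (y \<oplus>\<^bsub>P\<^esub> y') = b y \<oplus>\<^bsub>M\<^esub> b y'" if y: "y : carrier P" and y': "y' : carrier P" for y y'
  proof (rule b_eq)
   obtain z where z: "z : N'" "y = f (b y) \<oplus>\<^bsub>P\<^esub> z" using bQ[OF y] by blast
   obtain z' where z': "z' : N'" "y' = f (b y') \<oplus>\<^bsub>P\<^esub> z'" using bQ[OF y'] by blast
   have m: "b y : carrier M" "b y' : carrier M" using bQ y y' by blast+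
   have c: "f (b y) : carrier P" "f (b y') : carrier P" "z : carrier P" "z' : carrier P"
    using m fD(1) z(1) z'(1) N'(1) by blast+
   have "y \<oplus>\<^bsub>P\<^esub> y' = (f (b y) \<oplus>\<^bsub>P\<^esub> z) \<oplus>\<^bsub>P\<^esub> (f (b y') \<oplus>\<^bsub>P\<^esub> z')"
    using z(2) z'(2) by simp
   also have "\<dots> = f (b y \<oplus>\<^bsub>M\<^esub> b y') \<oplus>\<^bsub>P\<^esub> (z \<oplus>\<^bsub>P\<^esub> z')"
    using c by (simp add: fD(2)[OF m] P.M.a_ac)
   finally show "?Q (y \<oplus>\<^bsub>P\<^esub> y') (b y \<oplus>\<^bsub>M\<^esub> b y')"
    using m N'(3)[OF z(1) z'(1)] M.M.add.m_closed by blast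
  qed (use y y' in simp)
  show "b (r \<odot>\<^bsub>P\<^esub> y) = r \<odot>\<^bsub>M\<^esub> b y" if r: "r : carrier R" and y: "y : carrier P" for r y
  proof (rule b_eq)
   obtain z where z: "z : N'" "y = f (b y) \<oplus>\<^bsub>P\<^esub> z" using bQ[OF y] by blast
   have m: "b y : carrier M" using bQ y by blast
   have c: "f (b y) : carrier P" "z : carrier P" using m fD(1) z(1) N'(1) by blast+
   have "r \<odot>\<^bsub>P\<^esub> y = r \<odot>\<^bsub>P\<^esub> (f (b y) \<oplus>\<^bsub>P\<^esub> z)" using z(2) by simp
   also have "\<dots> = f (r \<odot>\<^bsub>M\<^esub> b y) \<oplus>\<^bsub>P\<^esub> r \<odot>\<^bsub>P\<^esub> z"
    by (simp add: fD(3)[OF r m] P.smult_r_distr[OF r c])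
   finally show "?Q (r \<odot>\<^bsub>P\<^esub> y) (r \<odot>\<^bsub>M\<^esub> b y)"
    using M.smult_closed[OF r m] N'(4)[OF r z(1)] by blast
  qed (rule P.smult_closed[OF r y])
 qed
 have "b (f x) = x" if x: "x : carrier M" for x
 proof (rule b_eq)
  have "f x = f x \<oplus>\<^bsub>P\<^esub> \<zero>\<^bsub>P\<^esub>" using fD(1)[OF x] by simp
  then show "?Q (f x) x" using x N'(2) by blast
 qed (rule fD(1)[OF x])
 then show ?thesis unfolding direct_summand_def using f b by blast
qed

lemma add_modules_iff:
 fixes M :: "('r, 'm) module"
 assumes X: "lmodule R X" and M: "M : modules R"
 shows "M : add_modules R X \<longleftrightarrow> (EX n. direct_summand R M (power_module n X))"
proof -
 have lM: "lmodule R M" using M by (simp add: modules_def)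
 show ?thesis
 proof
  assume "M : add_modules R X"
  then obtain n N N' where "submodule N R (power_module n X)" "submodule N' R (power_module n X)"
    "N \<inter> N' = {\<zero>\<^bsub>power_module n X\<^esub>}" "N <+>\<^bsub>power_module n X\<^esub> N' = carrier (power_module n X)"
    "lmodule_isomorphic R M ((power_module n X)\<lparr>carrier := N\<rparr>)" unfolding add_modules_def by blast
  then have "direct_summand R M (power_module n X)" by (rule direct_summandI[OF lM lmodule_power[OF X]])
  then show "EX n. direct_summand R M (power_module n X)" ..
 next
  assume "EX n. direct_summand R M (power_module n X)"
  then obtain n a b where ab: "a : lmodule_hom R M (power_module n X)"
    "b : lmodule_hom R (power_module n X) M" "ALL x:carrier M. b (a x) = x" unfolding direct_summand_def by blast
  show "M : add_modules R X"
   unfolding add_modules_def using direct_summandD[where a = a and b = b, OF lM lmodule_power[OF X] ab] M by blast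
 qed
qed

subsection \<open>Free modules\<close>

abbreviation free_module :: "('r, 'z) ring_scheme => nat => ('r, nat => 'r) module" where
 "free_module R n \<equiv> power_module n (regular_module R)"

definition unit_vector :: "('r, 'z) ring_scheme => nat => nat => nat => 'r" where
 "unit_vector R n i = (\<lambda>j\<in>{..<n}. if j = i then \<one>\<^bsub>R\<^esub> else \<zero>\<^bsub>R\<^esub>)"

context ring
begin

lemma lmodule_free: "lmodule R (free_module R n)" by (rule lmodule_power[OF lmodule_regular[OF ring_axioms]])

lemma unit_vector_carrier: "unit_vector R n i : carrier (free_module R n)"
 by (auto simp: unit_vector_def power_module_simps)

lemma unit_vectors_generate:
 assumes U: "submodule U R (free_module R n)" and unit: "!!i. i < n ==> unit_vector R n i : U"
 shows "U = carrier (free_module R n)"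
proof
 note UD = lmodule.submoduleD[OF lmodule_free U]
 show "U <= carrier (free_module R n)" by (rule UD(1))
 \<comment> \<open>A vector is built up one coordinate at a time from multiples of unit
   vectors.\<close>
 have part: "(\<lambda>i\<in>{..<n}. if i < k then y i else \<zero>) : U" if y: "y : carrier (free_module R n)" and k: "k <= n" for y k
  using k
 proof (induction k)
  case 0
  show ?case using UD(2) by (simp only: power_module_simps not_less_zero if_False regular_module_simps)
 next
  case (Suc k)
  have yi: "y i : carrier R" if "i < n" for i using y that by (auto simp: power_module_simps)
  have "(\<lambda>i\<in>{..<n}. if i < Suc k then y i else \<zero>) =
    (\<lambda>i\<in>{..<n}. if i < k then y i else \<zero>) \<oplus>\<^bsub>free_module R n\<^esub> y k \<odot>\<^bsub>free_module R n\<^esub> unit_vector R n k"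
   unfolding power_module_simps using Suc.prems by (intro restrict_ext) (auto simp: unit_vector_def yi less_Suc_eq)
  also have "\<dots> : U" using Suc.prems unit yi by (intro UD(3,4) Suc.IH) simp_all
  finally show ?case .
 qed
 show "carrier (free_module R n) \<subseteq> U"
 proof
  fix y assume y: "y : carrier (free_module R n)"
  have "(\<lambda>i\<in>{..<n}. if i < n then y i else \<zero>) = y"
   using y by (intro ext) (auto simp: power_module_simps PiE_def extensional_def)
  then show "y : U" using part[OF y order_refl] by (simp only:)
 qed
qed

lemma finitely_generated_free: "finitely_generated R (free_module R n)" unfolding finitely_generated_def
proof (intro exI conjI allI impI)
 show "finite (unit_vector R n ` {..<n})" by simp
 show "unit_vector R n ` {..<n} <= carrier (free_module R n)" using unit_vector_carrier by blast
 fix U assume U: "submodule U R (free_module R n) & unit_vector R n ` {..<n} \<subseteq> U"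
 show "U = carrier (free_module R n)" by (rule unit_vectors_generate) (use U in auto)
qed

lemma hom_from_free:
 assumes M: "lmodule R M" and x: "!!i. i < n ==> x i : carrier M"
 shows "EX u:lmodule_hom R (free_module R n) M. \<forall>i<n. u (unit_vector R n i) = x i"
proof -
 interpret M: lmodule R M by (rule M)
 let ?u = "\<lambda>y\<in>carrier (free_module R n). \<Oplus>\<^bsub>M\<^esub>i\<in>{..<n}. y i \<odot>\<^bsub>M\<^esub> x i"
 interpret Fr: lmodule R "free_module R n" by (rule lmodule_free)
 have yi: "y i : carrier R" if "y : carrier (free_module R n)" "i < n" for y i
  using that by (auto simp: power_module_simps)
 have "?u : lmodule_hom R (free_module R n) M"
 proof (rule lmodule_homI)
  fix y assume y: "y : carrier (free_module R n)"
  show "?u y : carrier M" using y by (simp add: M.M.finsum_closed M.smult_closed yi x)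
  show "?u (y \<oplus>\<^bsub>free_module R n\<^esub> z) = ?u y \<oplus>\<^bsub>M\<^esub> ?u z" if z: "z : carrier (free_module R n)" for z
  proof -
   have "?u (y \<oplus>\<^bsub>free_module R n\<^esub> z) = (\<Oplus>\<^bsub>M\<^esub>i\<in>{..<n}. (y \<oplus>\<^bsub>free_module R n\<^esub> z) i \<odot>\<^bsub>M\<^esub> x i)"
    using Fr.M.add.m_closed[OF y z] by simp
   also have "\<dots> = (\<Oplus>\<^bsub>M\<^esub>i\<in>{..<n}. y i \<odot>\<^bsub>M\<^esub> x i \<oplus>\<^bsub>M\<^esub> z i \<odot>\<^bsub>M\<^esub> x i)"
    by (intro M.M.finsum_cong' HOL.refl)
     (simp_all add: power_module_simps M.smult_l_distr M.smult_closed yi[OF y] yi[OF z] x)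
   also have "\<dots> = ?u y \<oplus>\<^bsub>M\<^esub> ?u z"
    using y z by (simp add: M.M.finsum_addf M.smult_closed yi x)
   finally show ?thesis .
  qed
  show "?u (r \<odot>\<^bsub>free_module R n\<^esub> y) = r \<odot>\<^bsub>M\<^esub> ?u y" if r: "r : carrier R" for r
  proof -
   have "?u (r \<odot>\<^bsub>free_module R n\<^esub> y) = (\<Oplus>\<^bsub>M\<^esub>i\<in>{..<n}. (r \<odot>\<^bsub>free_module R n\<^esub> y) i \<odot>\<^bsub>M\<^esub> x i)"
    using Fr.smult_closed[OF r y] by simp
   also have "\<dots> = (\<Oplus>\<^bsub>M\<^esub>i\<in>{..<n}. r \<odot>\<^bsub>M\<^esub> (y i \<odot>\<^bsub>M\<^esub> x i))"
    by (intro M.M.finsum_cong' HOL.refl)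
     (simp_all add: power_module_simps M.smult_assoc M.smult_closed r yi[OF y] x)
   also have "\<dots> = r \<odot>\<^bsub>M\<^esub> ?u y" using y r by (simp add: M.smult_finsum M.smult_closed yi x)
   finally show ?thesis .
  qed
 qed simp
 moreover have "?u (unit_vector R n i) = x i" if i: "i < n" for i
 proof -
  have "?u (unit_vector R n i) = (\<Oplus>\<^bsub>M\<^esub>j\<in>{..<n}. if i = j then x j else \<zero>\<^bsub>M\<^esub>)"
   using unit_vector_carrier
   by (simp, intro M.M.finsum_cong' HOL.refl) (auto simp: unit_vector_def x M.smult_one M.zero_smult)
  also have "\<dots> = x i" using i x by (intro M.M.finsum_singleton) auto
  finally show ?thesis .
 qed
 ultimately show ?thesis by blast
qed

end

text \<open>Copies a module into another carrier type along an injection, normalising the values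
  outside the carrier, so that it becomes an object of \<open>modules\<close> over that
  type.\<close>

lemma lmodule_transport:
 fixes M :: "('r, 'n) module" and e :: "'n => 'm"
 assumes M: "lmodule R M" and inj: "inj_on e (carrier M)"
 shows "\<exists>Z\<in>modules R. EX h:lmodule_hom R M Z. bij_betw h (carrier M) (carrier (Z :: ('r, 'm) module))"
proof -
 interpret M: lmodule R M by (rule M)
 let ?C = "e ` carrier M" and ?d = "inv_into (carrier M) e"
 have d: "?d z : carrier M" "e (?d z) = z" if "z : ?C" for z using that by (auto simp: inv_into_into f_inv_into_f)
 have de: "?d (e x) = x" if "x : carrier M" for x using that inj by simp
 have e: "e x : ?C" if "x : carrier M" for x using that by blast
 define Z :: "('r, 'm) module" where
  "Z = \<lparr>carrier = ?C, mult = undefined, one = undefined, zero = e \<zero>\<^bsub>M\<^esub>,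
   add = (\<lambda>x\<in>?C. \<lambda>y\<in>?C. e (?d x \<oplus>\<^bsub>M\<^esub> ?d y)),
   smult = (\<lambda>r\<in>carrier R. \<lambda>x\<in>?C. e (r \<odot>\<^bsub>M\<^esub> ?d x))\<rparr>"
 have Z: "carrier Z = ?C" "\<zero>\<^bsub>Z\<^esub> = e \<zero>\<^bsub>M\<^esub>"
   "!!x y. x : ?C ==> y : ?C ==> x \<oplus>\<^bsub>Z\<^esub> y = e (?d x \<oplus>\<^bsub>M\<^esub> ?d y)"
   "!!r x. r : carrier R ==> x : ?C ==> r \<odot>\<^bsub>Z\<^esub> x = e (r \<odot>\<^bsub>M\<^esub> ?d x)"
  by (simp_all add: Z_def)
 have "abelian_group Z"
 proof (rule abelian_groupI)
  fix x y z assume x: "x : carrier Z"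
  note x' = x[unfolded Z(1)] d[OF x[unfolded Z(1)]]
  show "\<zero>\<^bsub>Z\<^esub> \<oplus>\<^bsub>Z\<^esub> x = x" using x' e by (simp add: Z de)
  show "EX y:carrier Z. y \<oplus>\<^bsub>Z\<^esub> x = \<zero>\<^bsub>Z\<^esub>"
   using x' e by (intro bexI[of _ "e (\<ominus>\<^bsub>M\<^esub> ?d x)"]) (simp_all add: Z de M.M.l_neg)
  assume y: "y : carrier Z"
  note y' = y[unfolded Z(1)] d[OF y[unfolded Z(1)]]
  show "x \<oplus>\<^bsub>Z\<^esub> y : carrier Z" using x' y' by (simp add: Z)
  show "x \<oplus>\<^bsub>Z\<^esub> y = y \<oplus>\<^bsub>Z\<^esub> x" using x' y' by (simp add: Z M.M.a_comm)
  assume z: "z : carrier Z"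
  note z' = z[unfolded Z(1)] d[OF z[unfolded Z(1)]]
  show "x \<oplus>\<^bsub>Z\<^esub> y \<oplus>\<^bsub>Z\<^esub> z = x \<oplus>\<^bsub>Z\<^esub> (y \<oplus>\<^bsub>Z\<^esub> z)"
   using x' y' z' e by (simp add: Z de M.M.a_assoc)
 qed (simp add: Z)
 moreover have "lmodule_axioms R Z"
 proof (rule lmodule_axioms.intro)
  fix a b x y assume x: "x : carrier Z"
  note x' = x[unfolded Z(1)] d[OF x[unfolded Z(1)]]
  show "\<one>\<^bsub>R\<^esub> \<odot>\<^bsub>Z\<^esub> x = x" using x' by (simp add: Z M.smult_one)
  assume a: "a : carrier R"
  show "a \<odot>\<^bsub>Z\<^esub> x : carrier Z" using x' a by (simp add: Z M.smult_closed)
  show "(a \<otimes>\<^bsub>R\<^esub> b) \<odot>\<^bsub>Z\<^esub> x = a \<odot>\<^bsub>Z\<^esub> (b \<odot>\<^bsub>Z\<^esub> x)"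
    "(a \<oplus>\<^bsub>R\<^esub> b) \<odot>\<^bsub>Z\<^esub> x = a \<odot>\<^bsub>Z\<^esub> x \<oplus>\<^bsub>Z\<^esub> b \<odot>\<^bsub>Z\<^esub> x" if "b : carrier R"
   using x' a e that by (simp_all add: Z de M.smult_closed M.smult_assoc M.smult_l_distr)
  show "a \<odot>\<^bsub>Z\<^esub> (x \<oplus>\<^bsub>Z\<^esub> y) = a \<odot>\<^bsub>Z\<^esub> x \<oplus>\<^bsub>Z\<^esub> a \<odot>\<^bsub>Z\<^esub> y" if y: "y : carrier Z"
   using x' a e d[OF y[unfolded Z(1)]] y[unfolded Z(1)] by (simp add: Z de M.smult_closed M.smult_r_distr)
 qed
 ultimately have "lmodule R Z" by (intro lmodule.intro M.R.ring_axioms)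
 moreover have "add Z : carrier Z \<rightarrow>\<^sub>E carrier Z \<rightarrow>\<^sub>E carrier Z"
   "smult Z : carrier R \<rightarrow>\<^sub>E carrier Z \<rightarrow>\<^sub>E carrier Z"
  using d(1) M.smult_closed by (auto simp: Z_def)
 ultimately have "Z : modules R" by (simp add: modules_def) (simp add: Z_def)
 moreover have "restrict e (carrier M) : lmodule_hom R M Z" by (rule lmodule_homI) (simp_all add: Z e de M.smult_closed)
 moreover have "bij_betw (restrict e (carrier M)) (carrier M) (carrier Z)"
  using inj by (simp add: bij_betw_def Z(1) inj_on_restrict_eq)
 ultimately show ?thesis by blast
qed

context ring
begin

lemma projective_if_summand:
 assumes P: "P : fg_modules R" and sum: "direct_summand R P (free_module R n)"
 shows "P : fg_projective_modules R" unfolding fg_projective_modules_def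
proof (intro CollectI conjI P ballI impI)
 fix X Y :: "('a, 'c) module" and g f
 assume XY: "X : fg_modules R" "Y : fg_modules R" and g: "g : lmodule_hom R X Y"
  and f: "f : lmodule_hom R P Y" and surj: "g ` carrier X = carrier Y"
 obtain a b where a: "a : lmodule_hom R P (free_module R n)" and b: "b : lmodule_hom R (free_module R n) P"
   and ba: "ALL x:carrier P. b (a x) = x" using sum unfolding direct_summand_def by blast
 have lm: "lmodule R P" "lmodule R X" "lmodule R Y" using P XY by (simp_all add: fg_modules_def modules_def)
 have "EX x. x : carrier X & g x = f (b (unit_vector R n i))" for i
 proof -
  have "f (b (unit_vector R n i)) : g ` carrier X"
   unfolding surj by (intro lmodule_homD(1)[OF f] lmodule_homD(1)[OF b] unit_vector_carrier)
  then show ?thesis by auto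
 qed
 then obtain x where x: "!!i. x i : carrier X" "!!i. g (x i) = f (b (unit_vector R n i))" by metis
 obtain u where u: "u : lmodule_hom R (free_module R n) X" "!!i. i < n ==> u (unit_vector R n i) = x i"
  using hom_from_free[OF lm(2), of n x] x(1) by blast
 let ?F = "carrier (free_module R n)"
 have c: "compose ?F g u : lmodule_hom R (free_module R n) Y" "compose ?F f b : lmodule_hom R (free_module R n) Y"
  by (rule lmodule_hom_compose[OF u(1) g lmodule_free], rule lmodule_hom_compose[OF b f lmodule_free])
 have all: "{y : ?F. compose ?F g u y = compose ?F f b y} = ?F"
  by (rule unit_vectors_generate[OF submodule_equalizer[OF lmodule_free lm(3) c]])
   (simp add: unit_vector_carrier compose_eq u(2) x(2))
 have eq: "g (u y) = f (b y)" if y: "y : ?F" for y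
 proof -
  have "y : {y : ?F. compose ?F g u y = compose ?F f b y}" unfolding all by (rule y)
  then show ?thesis using y by (simp add: compose_eq)
 qed
 show "EX h:lmodule_hom R P X. compose (carrier P) g h = f"
 proof (rule bexI[of _ "compose (carrier P) u a"])
  show "compose (carrier P) u a : lmodule_hom R P X" by (rule lmodule_hom_compose[OF a u(1) lm(1)])
  show "compose (carrier P) g (compose (carrier P) u a) = f"
  proof
   fix y show "compose (carrier P) g (compose (carrier P) u a) y = f y"
    using eq[OF lmodule_homD(1)[OF a]] ba lmodule_homD(4)[OF f]
    by (cases "y : carrier P") (simp_all add: compose_def extensional_def)
  qed
 qed
qed

text \<open>The clause on the zero module matters later: a type carrying a zero module may be too
  small to hold a copy of a free module of positive rank.\<close>

lemma free_cover:
 assumes M: "lmodule R M" and fg: "finitely_generated R M"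
 shows "EX n. EX u:lmodule_hom R (free_module R n) M. u ` carrier (free_module R n) = carrier M \<and>
  (carrier M = {\<zero>\<^bsub>M\<^esub>} --> n = 0)"
proof (cases "carrier M = {\<zero>\<^bsub>M\<^esub>}")
 case True
 interpret M: lmodule R M by (rule M)
 obtain u where u: "u : lmodule_hom R (free_module R 0) M" using hom_from_free[OF M, of 0] by blast
 have "u ` carrier (free_module R 0) = carrier M" using lmodule_homD(1)[OF u] True by (auto simp: power_module_simps)
 then show ?thesis using u by blast
next
 case False
 obtain S where S: "finite S" "S <= carrier M"
   "!!U. submodule U R M ==> S \<subseteq> U ==> U = carrier M" using fg unfolding finitely_generated_def by blast
 obtain s where s: "bij_betw s {..<card S} S" using ex_bij_betw_nat_finite[OF S(1)] by (auto simp: atLeast0LessThan)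
 have sS: "s i : S" if "i < card S" for i using s that by (auto simp: bij_betw_def)
 obtain u where u: "u : lmodule_hom R (free_module R (card S)) M"
   "!!i. i < card S ==> u (unit_vector R (card S) i) = s i" using hom_from_free[OF M, of "card S" s] sS S(2) by blast
 have "S \<subseteq> u ` carrier (free_module R (card S))"
 proof
  fix x assume "x : S"
  then have "x : s ` {..<card S}" using s by (simp add: bij_betw_def)
  then obtain i where "i < card S" "x = s i" by auto
  then show "x : u ` carrier (free_module R (card S))" using u(2) unit_vector_carrier by (metis imageI)
 qed
 then have "u ` carrier (free_module R (card S)) = carrier M" by (rule S(3)[OF submodule_image[OF lmodule_free M u(1)]])
 then show ?thesis using u(1) False by blast
qed

text \<open>Projectivity of P speaks only about modules on the type of P. So the free cover is first
  copied into that type along e, split there, and the splitting is carried back.\<close>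

lemma summand_if_projective:
 fixes P :: "('a, 'm) module" and e :: "(nat => 'a) => 'm"
 assumes P: "P : fg_projective_modules R"
  and u: "u : lmodule_hom R (free_module R n) P" "u ` carrier (free_module R n) = carrier P"
  and e: "inj_on e (carrier (free_module R n))"
 shows "direct_summand R P (free_module R n)"
proof -
 have lP: "lmodule R P" using P by (simp add: fg_projective_modules_def fg_modules_def modules_def)
 let ?F = "free_module R n"
 obtain Z :: "('a, 'm) module" and h where Z: "Z : modules R" and h: "h : lmodule_hom R ?F Z" "bij_betw h (carrier ?F) (carrier Z)"
  using lmodule_transport[OF lmodule_free e] by blast
 have lZ: "lmodule R Z" using Z by (simp add: modules_def)
 have fgZ: "Z : fg_modules R" using finitely_generated_image[OF lmodule_free lZ h(1) _ finitely_generated_free] h(2) Z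
  by (simp add: fg_modules_def bij_betw_def)
 let ?d = "\<lambda>y\<in>carrier Z. inv_into (carrier ?F) h y"
 have d: "?d : lmodule_hom R Z ?F" by (rule lmodule_hom_inverse[OF lmodule_free h])
 have dh: "?d (h x) = x" if "x : carrier ?F" for x using that h lmodule_homD(1)[OF h(1) that] by (simp add: bij_betw_def)
 let ?g = "compose (carrier Z) u ?d"
 have g: "?g : lmodule_hom R Z P" by (rule lmodule_hom_compose[OF d u(1) lZ])
 have "?g ` carrier Z = carrier P"
 proof
  show "?g ` carrier Z <= carrier P" using lmodule_homD(1)[OF g] by blast
  show "carrier P \<subseteq> ?g ` carrier Z"
  proof
   fix y assume "y : carrier P"
   then obtain x where x: "x : carrier ?F" "y = u x" using u(2) by blast
   have "?g (h x) = y" using x dh[OF x(1)] lmodule_homD(1)[OF h(1) x(1)] by (simp add: compose_def)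
   then show "y : ?g ` carrier Z" using lmodule_homD(1)[OF h(1) x(1)] by blast
  qed
 qed
 moreover have "P : fg_modules R" using P by (simp add: fg_projective_modules_def)
 ultimately obtain s where s: "s : lmodule_hom R P Z" "compose (carrier P) ?g s = (\<lambda>x\<in>carrier P. x)"
  using P fgZ g lmodule_hom_id[OF lP] unfolding fg_projective_modules_def by blast
 have "u (compose (carrier P) ?d s x) = x" if x: "x : carrier P" for x
  using fun_cong[OF s(2), of x] x lmodule_homD(1)[OF s(1) x] by (simp add: compose_def)
 then show ?thesis unfolding direct_summand_def using lmodule_hom_compose[OF s(1) d lP] u(1) by blast
qed

end

subsection \<open>Restriction of scalars along a quotient map\<close>

lemma embedding_compose:
 assumes "lmodule R M" "f : lmodule_hom R M P" "inj_on f (carrier M)"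
  and h: "h : lmodule_hom R P P'" "inj_on h (carrier P)"
 shows "EX f:lmodule_hom R M P'. inj_on f (carrier M)"
proof (rule bexI[of _ "compose (carrier M) h f"])
 show "compose (carrier M) h f : lmodule_hom R M P'" by (rule lmodule_hom_compose[OF assms(2) h(1) assms(1)])
 show "inj_on (compose (carrier M) h f) (carrier M)"
 proof (rule inj_onI)
  fix x y assume x: "x : carrier M" and y: "y : carrier M"
   and eq: "compose (carrier M) h f x = compose (carrier M) h f y"
  have "h (f x) = h (f y)" using eq x y by (simp add: compose_eq)
  then have "f x = f y" by (rule inj_onD[OF h(2)]) (rule lmodule_homD(1)[OF assms(2)], fact)+
  then show "x = y" by (rule inj_onD[OF assms(3) _ x y])
 qed
qed

lemma direct_summand_compose:
 assumes M: "lmodule R M" and P: "lmodule R P'" and sum: "direct_summand R M P"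
  and h: "h : lmodule_hom R P P'" "h' : lmodule_hom R P' P" "!!x. x : carrier P ==> h' (h x) = x"
 shows "direct_summand R M P'"
proof -
 obtain a b where a: "a : lmodule_hom R M P" and b: "b : lmodule_hom R P M"
   and ba: "ALL x:carrier M. b (a x) = x" using sum unfolding direct_summand_def by blast
 have "compose (carrier P') b h' (compose (carrier M) h a x) = x" if x: "x : carrier M" for x
  using ba x h(3)[OF lmodule_homD(1)[OF a x]] lmodule_homD(1)[OF h(1) lmodule_homD(1)[OF a x]]
  by (simp add: compose_def)
 then show ?thesis unfolding direct_summand_def
  using lmodule_hom_compose[OF a h(1) M] lmodule_hom_compose[OF h(2) b P] by blast
qed

locale algebra_quotient = algebra_ideal A I + A': algebra_over A'
 for A :: "('k::field, 'r) module" (structure) and I and A' :: "('k, 's) module" +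
 fixes \<phi> :: "'s => 'r set"
 assumes \<phi>: "\<phi> : algebra_iso A' (factor A I)"
begin

abbreviation Q where "Q \<equiv> factor A I"

sublocale Q: ring Q by (rule ring_factor)

text \<open>The quotient map from A to A/I followed by the inverse of \<phi>. The functor of the
  theorem restricts scalars along it.\<close>

definition psi :: "'r => 's" where
 "psi = (%r. inv_into (carrier A') \<phi> (I +>\<^bsub>A\<^esub> r))"

lemma \<phi>_bij: "bij_betw \<phi> (carrier A') (carrier Q)"
 and \<phi>_hom: "\<phi> : ring_hom A' Q"
 and \<phi>_scale: "x : carrier A' ==> \<phi> (c \<odot>\<^bsub>A'\<^esub> x) = c \<odot>\<^bsub>Q\<^esub> \<phi> x"
 using \<phi> by (auto simp: algebra_iso_def ring_iso_def)

lemma coset_in: "r : carrier A ==> coset r : carrier Q" unfolding coset_carrier by (rule imageI)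

lemma psi_in: "r : carrier A ==> psi r : carrier A'" and \<phi>_psi: "r : carrier A ==> \<phi> (psi r) = coset r"
proof -
 assume "r : carrier A"
 then have c: "coset r : \<phi> ` carrier A'" using coset_in \<phi>_bij by (simp add: bij_betw_def)
 show "psi r : carrier A'" unfolding psi_def by (rule inv_into_into[OF c])
 show "\<phi> (psi r) = coset r" unfolding psi_def by (rule f_inv_into_f[OF c])
qed

lemma psi_eqI: "r : carrier A ==> s : carrier A' ==> \<phi> s = coset r ==> psi r = s"
 using \<phi>_bij \<phi>_psi psi_in by (metis bij_betw_def inj_onD)

lemma psi_add: "r : carrier A ==> r' : carrier A ==> psi (r \<oplus> r') = psi r \<oplus>\<^bsub>A'\<^esub> psi r'"
 by (rule psi_eqI) (simp_all add: psi_in \<phi>_psi coset_add ring_hom_add[OF \<phi>_hom])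

lemma psi_mult: "r : carrier A ==> r' : carrier A ==> psi (r \<otimes> r') = psi r \<otimes>\<^bsub>A'\<^esub> psi r'"
 by (rule psi_eqI) (simp_all add: psi_in \<phi>_psi coset_mult ring_hom_mult[OF \<phi>_hom])

lemma psi_one: "psi \<one> = \<one>\<^bsub>A'\<^esub>"
 by (rule psi_eqI) (simp_all add: coset_one ring_hom_one[OF \<phi>_hom])

lemma psi_scalar: "psi (c \<odot>\<^bsub>A\<^esub> \<one>) = c \<odot>\<^bsub>A'\<^esub> \<one>\<^bsub>A'\<^esub>"
 by (rule psi_eqI) (simp_all add: \<phi>_scale coset_scale ring_hom_one[OF \<phi>_hom] coset_one)

lemma psi_surj:
 assumes "s : carrier A'"
 obtains r where "r : carrier A" "psi r = s"
proof -
 have "\<phi> s : carrier Q" by (rule ring_hom_closed[OF \<phi>_hom assms])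
 then obtain r where "r : carrier A" "\<phi> s = coset r" unfolding coset_carrier by blast
 then show thesis using psi_eqI assms that by blast
qed

abbreviation F :: "('s, 'm) module => ('r, 'm) module" where "F \<equiv> restrict_scalars A psi"

lemma F_simps [simp]:
 "carrier (F M) = carrier M" "zero (F M) = zero M" "add (F M) = add M" "mult (F M) = mult M" "one (F M) = one M"
 by (simp_all add: restrict_scalars_def)

lemma F_smult: "r : carrier A ==> x : carrier M ==> r \<odot>\<^bsub>F M\<^esub> x = psi r \<odot>\<^bsub>M\<^esub> x"
 by (simp add: restrict_scalars_def)

lemma lmodule_F:
 assumes "lmodule A' M"
 shows "lmodule A (F M)"
proof -
 interpret M: lmodule A' M by (rule assms)
 have "abelian_group (F M)"
 proof (rule abelian_groupI)
  show "EX y:carrier (F M). y \<oplus>\<^bsub>F M\<^esub> x = \<zero>\<^bsub>F M\<^esub>" if "x : carrier (F M)" for x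
   using that by (intro bexI[of _ "\<ominus>\<^bsub>M\<^esub> x"]) (simp_all add: M.M.l_neg)
 qed (simp_all add: M.M.a_ac)
 then show ?thesis by (intro lmodule.intro lmodule_axioms.intro ring_axioms)
   (simp_all add: F_smult psi_in M.smult_closed psi_add psi_mult psi_one M.smult_l_distr M.smult_r_distr
    M.smult_assoc M.smult_one)
qed

lemma F_modules:
 assumes "M : modules A'"
 shows "F M : modules A"
proof -
 have M: "lmodule A' M" "add M : carrier M \<rightarrow>\<^sub>E carrier M \<rightarrow>\<^sub>E carrier M" "mult M = undefined" "one M = undefined"
  using assms by (simp_all add: modules_def)
 have "smult (F M) : carrier A \<rightarrow>\<^sub>E carrier (F M) \<rightarrow>\<^sub>E carrier (F M)"
  using lmodule.smult_closed[OF M(1) psi_in] by (auto simp: restrict_scalars_def)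
 then show ?thesis unfolding modules_def using lmodule_F[OF M(1)] M(2-4) by simp
qed

text \<open>\<open>psi\<close> is surjective, so linearity over A and over A' are the same condition
  on the same functions.\<close>

lemma F_hom: "lmodule_hom A (F M) (F N) = lmodule_hom A' M N"
proof (intro equalityI subsetI)
 fix f assume f: "f : lmodule_hom A (F M) (F N)"
 note fD = lmodule_homD[OF f]
 show "f : lmodule_hom A' M N"
 proof (rule lmodule_homI)
  fix s x assume s: "s : carrier A'" and x: "x : carrier M"
  obtain r where r: "r : carrier A" "psi r = s" using s by (rule psi_surj)
  show "f (s \<odot>\<^bsub>M\<^esub> x) = s \<odot>\<^bsub>N\<^esub> f x"
   using fD(3)[OF r(1), of x] fD(1)[of x] x r by (simp add: F_smult)
 qed (use fD(1,2,4) in simp_all)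
next
 fix f assume f: "f : lmodule_hom A' M N"
 note fD = lmodule_homD[OF f]
 show "f : lmodule_hom A (F M) (F N)" by (rule lmodule_homI) (simp_all add: fD F_smult psi_in)
qed

abbreviation X :: "('r, 'r set) module" where "X \<equiv> factor (regular_module A) I"

lemma coset_regular: "I +>\<^bsub>regular_module A\<^esub> x = I +> x" by (simp add: a_r_coset_def')

lemma X_simps: "carrier X = carrier Q" "\<zero>\<^bsub>X\<^esub> = \<zero>\<^bsub>Q\<^esub>" "x \<oplus>\<^bsub>X\<^esub> y = x \<oplus>\<^bsub>Q\<^esub> y"
 by (simp_all add: factor_simps A_RCOSETS_def' coset_regular set_add_def')

lemma X_smult: "r : carrier A ==> q : carrier Q ==> r \<odot>\<^bsub>X\<^esub> q = coset r \<otimes>\<^bsub>Q\<^esub> q"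
proof -
 assume r: "r : carrier A" and "q : carrier Q"
 then obtain a where a: "a : carrier A" "q = coset a" unfolding coset_carrier by blast
 have "(\<Union>x\<in>coset a. coset (r \<otimes> x)) = coset (r \<otimes> a)"
 proof -
  have "coset (r \<otimes> x) = coset (r \<otimes> a)" if "x : coset a" for x
   using coset_mem[OF that a(1)] coset_mult[OF r] a(1) by simp
  moreover have "a : coset a" by (rule coset_self[OF a(1)])
  ultimately show ?thesis by blast
 qed
 then show ?thesis unfolding a(2) by (simp add: factor_simps(6) coset_regular coset_mult[OF r a(1), symmetric])
qed

lemma lmodule_X: "lmodule A X"
proof -
 have "abelian_group X"
 proof (rule abelian_groupI)
  show "EX y:carrier X. y \<oplus>\<^bsub>X\<^esub> x = \<zero>\<^bsub>X\<^esub>" if "x : carrier X" for x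
   using that by (intro bexI[of _ "\<ominus>\<^bsub>Q\<^esub> x"]) (simp_all add: X_simps Q.l_neg)
 qed (simp_all add: X_simps Q.a_ac)
 then show ?thesis by (intro lmodule.intro lmodule_axioms.intro ring_axioms)
   (simp_all add: X_simps X_smult coset_in coset_add coset_mult coset_one Q.l_distr Q.r_distr Q.m_assoc)
qed

lemma lmodule_free': "lmodule A' (free_module A' n)" by (rule A'.lmodule_free)

text \<open>Applying \<phi> in each coordinate identifies the restricted free module with the power
  of A/I. Submodules and summands of the two can then be exchanged.\<close>

lemma free_iso:
 obtains h h' where "h : lmodule_hom A (F (free_module A' n)) (power_module n X)"
  "h' : lmodule_hom A (power_module n X) (F (free_module A' n))"
  "!!x. x : carrier (free_module A' n) ==> h' (h x) = x" "!!y. y : carrier (power_module n X) ==> h (h' y) = y"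
proof -
 let ?P = "free_module A' n"
 let ?h = "\<lambda>y\<in>carrier ?P. \<lambda>i\<in>{..<n}. \<phi> (y i)"
 have yi: "y i : carrier A'" if "y : carrier ?P" "i < n" for y i using that by (auto simp: power_module_simps)
 have P: "lmodule A (F ?P)" by (rule lmodule_F[OF lmodule_free'])
 have hom: "?h : lmodule_hom A (F ?P) (power_module n X)"
 proof (rule lmodule_homI)
  fix y assume "y : carrier (F ?P)"
  then have y: "y : carrier ?P" by simp
  show "?h y : carrier (power_module n X)"
   using y yi ring_hom_closed[OF \<phi>_hom] by (auto simp: power_module_simps X_simps)
  show "?h (y \<oplus>\<^bsub>F ?P\<^esub> z) = ?h y \<oplus>\<^bsub>power_module n X\<^esub> ?h z" if "z : carrier (F ?P)" for z
  proof -
   have z: "z : carrier ?P" using that by simp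
   have "?h (y \<oplus>\<^bsub>?P\<^esub> z) = (\<lambda>i\<in>{..<n}. \<phi> ((y \<oplus>\<^bsub>?P\<^esub> z) i))"
    using lmodule.axioms(2)[OF lmodule_free', THEN abelian_group.axioms(1), THEN abelian_monoid.a_closed, OF y z]
    by simp
   also have "\<dots> = ?h y \<oplus>\<^bsub>power_module n X\<^esub> ?h z" unfolding power_module_simps(3)
    by (rule restrict_ext) (simp add: y z X_simps ring_hom_add[OF \<phi>_hom] yi)
   finally show ?thesis by simp
  qed
  show "?h (r \<odot>\<^bsub>F ?P\<^esub> y) = r \<odot>\<^bsub>power_module n X\<^esub> ?h y" if r: "r : carrier A" for r
  proof -
   have "?h (psi r \<odot>\<^bsub>?P\<^esub> y) = (\<lambda>i\<in>{..<n}. \<phi> ((psi r \<odot>\<^bsub>?P\<^esub> y) i))"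
    using lmodule.smult_closed[OF lmodule_free' psi_in[OF r] y] by simp
   also have "\<dots> = r \<odot>\<^bsub>power_module n X\<^esub> ?h y" unfolding power_module_simps(4)
    by (rule restrict_ext)
     (simp add: y X_smult[OF r] ring_hom_mult[OF \<phi>_hom] yi psi_in[OF r] \<phi>_psi[OF r] ring_hom_closed[OF \<phi>_hom])
   finally show ?thesis using y r by (simp add: F_smult)
  qed
 qed simp
 have bij: "bij_betw ?h (carrier (F ?P)) (carrier (power_module n X))"
 proof (rule bij_betw_imageI)
  show "inj_on ?h (carrier (F ?P))"
  proof (rule inj_onI)
   fix y z assume yz: "y : carrier (F ?P)" "z : carrier (F ?P)" and eq: "?h y = ?h z"
   have y: "y : carrier ?P" and z: "z : carrier ?P" using yz by simp_all
   have "y i = z i" if i: "i < n" for i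
   proof -
    have "\<phi> (y i) = \<phi> (z i)" using fun_cong[OF eq, of i] y z i by simp
    then show ?thesis using \<phi>_bij yi[OF y i] yi[OF z i] by (auto simp: bij_betw_def dest: inj_onD)
   qed
   then show "y = z" using y z by (intro PiE_ext[of y "{..<n}" "%_. carrier A'" z]) (simp_all add: power_module_simps)
  qed
  show "?h ` carrier (F ?P) = carrier (power_module n X)"
  proof
   show "?h ` carrier (F ?P) <= carrier (power_module n X)" using lmodule_homD(1)[OF hom] by blast
   show "carrier (power_module n X) \<subseteq> ?h ` carrier (F ?P)"
   proof
    fix q assume q: "q : carrier (power_module n X)"
    let ?y = "\<lambda>i\<in>{..<n}. inv_into (carrier A') \<phi> (q i)"
    have qi: "q i : \<phi> ` carrier A'" if "i < n" for i
     using q that \<phi>_bij by (auto simp: power_module_simps X_simps bij_betw_def)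
    have y: "?y : carrier ?P" using inv_into_into[OF qi] by (auto simp: power_module_simps)
    have "?h ?y = q"
    proof
     fix i show "?h ?y i = q i" using y q f_inv_into_f[OF qi, of i]
      by (cases "i < n") (auto simp: power_module_simps PiE_def extensional_def)
    qed
    then show "q : ?h ` carrier (F ?P)" using y by (metis F_simps(1) imageI)
   qed
  qed
 qed
 let ?h' = "\<lambda>y\<in>carrier (power_module n X). inv_into (carrier (F ?P)) ?h y"
 show thesis
 proof (rule that[of ?h ?h'])
  show "?h : lmodule_hom A (F ?P) (power_module n X)" by (rule hom)
  show "?h' : lmodule_hom A (power_module n X) (F ?P)" by (rule lmodule_hom_inverse[OF P hom bij])
  show "?h' (?h x) = x" if x: "x : carrier ?P" for x
  proof -
   have x': "x : carrier (F ?P)" using x by simp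
   have "?h x : carrier (power_module n X)" by (rule lmodule_homD(1)[OF hom x'])
   then have "?h' (?h x) = inv_into (carrier (F ?P)) ?h (?h x)" by (rule restrict_apply')
   also have "\<dots> = x" by (rule bij_betw_inv_into_left[OF bij x'])
   finally show ?thesis .
  qed
  show "?h (?h' y) = y" if y: "y : carrier (power_module n X)" for y
   unfolding restrict_apply'[OF y, of "inv_into (carrier (F ?P)) ?h"] by (rule bij_betw_inv_into_right[OF bij y])
 qed
qed

lemma embeds_iff:
 assumes M: "lmodule A' M"
 shows "(EX f:lmodule_hom A' M (free_module A' n). inj_on f (carrier M)) \<longleftrightarrow>
  (EX f:lmodule_hom A (F M) (power_module n X). inj_on f (carrier M))"
proof (rule free_iso[of n])
 fix h h' assume h: "h : lmodule_hom A (F (free_module A' n)) (power_module n X)"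
  "h' : lmodule_hom A (power_module n X) (F (free_module A' n))"
  "!!x. x : carrier (free_module A' n) ==> h' (h x) = x" "!!y. y : carrier (power_module n X) ==> h (h' y) = y"
 have inj: "inj_on h (carrier (F (free_module A' n)))" "inj_on h' (carrier (power_module n X))"
  using h(3,4) by (auto intro: inj_on_inverseI)
 note M' = lmodule_F[OF M]
 show ?thesis unfolding F_hom[symmetric]
  using embedding_compose[OF M' _ _ h(1) inj(1)] embedding_compose[OF M' _ _ h(2) inj(2)] unfolding F_simps by blast
qed

lemma direct_summand_iff:
 assumes M: "lmodule A' M"
 shows "direct_summand A' M (free_module A' n) \<longleftrightarrow> direct_summand A (F M) (power_module n X)"
proof (rule free_iso[of n])
 fix h h' assume h: "h : lmodule_hom A (F (free_module A' n)) (power_module n X)"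
  "h' : lmodule_hom A (power_module n X) (F (free_module A' n))"
  "!!x. x : carrier (free_module A' n) ==> h' (h x) = x" "!!y. y : carrier (power_module n X) ==> h (h' y) = y"
 note M' = lmodule_F[OF M]
 have "direct_summand A' M (free_module A' n) \<longleftrightarrow> direct_summand A (F M) (F (free_module A' n))"
  by (simp add: direct_summand_def F_hom)
 also have "\<dots> \<longleftrightarrow> direct_summand A (F M) (power_module n X)"
  using direct_summand_compose[OF M' lmodule_power[OF lmodule_X] _ h(1,2)]
   direct_summand_compose[OF M' lmodule_F[OF lmodule_free'] _ h(2,1)] h(3,4) unfolding F_simps by blast
 finally show ?thesis .
qed

text \<open>Since I kills M, the action of r depends only on \<open>psi r\<close>. The result is an
  equality of records: objects of \<open>modules\<close> have prescribed values outside their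
  carriers.\<close>

lemma F_lift:
 assumes M: "M : modules A" and killed: "!!r x. r : I ==> x : carrier M ==> r \<odot>\<^bsub>M\<^esub> x = \<zero>\<^bsub>M\<^esub>"
 shows "\<exists>M'\<in>modules A'. F M' = M"
proof -
 have lM: "lmodule A M" using M by (simp add: modules_def)
 interpret M: lmodule A M by (rule lM)
 define rep where "rep s = (SOME r. r : carrier A & psi r = s)" for s
 have rep: "rep s : carrier A" "psi (rep s) = s" if s: "s : carrier A'" for s
 proof -
  obtain r where "r : carrier A & psi r = s" using psi_surj[OF s] by blast
  from someI[of "%r. r : carrier A & psi r = s", OF this]
  show "rep s : carrier A" "psi (rep s) = s" unfolding rep_def by blast+
 qed
 define M' where "M' = \<lparr>carrier = carrier M, mult = mult M, one = one M, zero = zero M, add = add M,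
  smult = \<lambda>s\<in>carrier A'. \<lambda>x\<in>carrier M. rep s \<odot>\<^bsub>M\<^esub> x\<rparr>"
 have M'_simps: "carrier M' = carrier M" "zero M' = zero M" "add M' = add M" "mult M' = mult M" "one M' = one M"
  by (simp_all add: M'_def)
 have sm: "psi r \<odot>\<^bsub>M'\<^esub> x = r \<odot>\<^bsub>M\<^esub> x" if r: "r : carrier A" and x: "x : carrier M" for r x
 proof -
  let ?r = "rep (psi r)"
  have r': "?r : carrier A" "psi ?r = psi r" using rep[OF psi_in[OF r]] by blast+
  have "coset ?r = coset r" using \<phi>_psi[OF r'(1)] \<phi>_psi[OF r] r'(2) by simp
  then have d: "?r \<ominus> r : I" using coset_eq_iff[OF r'(1) r] by simp
  have dc: "?r \<ominus> r : carrier A" using r r'(1) by simp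
  have "?r = (?r \<ominus> r) \<oplus> r" using r r'(1) by (simp add: minus_eq a_assoc l_neg)
  then have "?r \<odot>\<^bsub>M\<^esub> x = (?r \<ominus> r) \<odot>\<^bsub>M\<^esub> x \<oplus>\<^bsub>M\<^esub> r \<odot>\<^bsub>M\<^esub> x"
   using M.smult_l_distr[OF dc r x] by simp
  also have "\<dots> = r \<odot>\<^bsub>M\<^esub> x" using killed[OF d x] M.smult_closed[OF r x] by simp
  finally show ?thesis using psi_in[OF r] x by (simp add: M'_def)
 qed
 have "abelian_group M'"
 proof (rule abelian_groupI)
  show "EX y:carrier M'. y \<oplus>\<^bsub>M'\<^esub> x = \<zero>\<^bsub>M'\<^esub>" if "x : carrier M'" for x
   using that by (intro bexI[of _ "\<ominus>\<^bsub>M\<^esub> x"]) (simp_all add: M'_simps M.M.l_neg)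
 qed (simp_all add: M'_simps M.M.a_ac)
 moreover have "lmodule_axioms A' M'"
 proof (rule lmodule_axioms.intro)
  fix s t x y assume x: "x : carrier M'"
  then have x': "x : carrier M" by (simp add: M'_simps)
  show "\<one>\<^bsub>A'\<^esub> \<odot>\<^bsub>M'\<^esub> x = x"
   using sm[OF one_closed x'] psi_one M.smult_one[OF x'] by simp
  assume "s : carrier A'"
  then obtain r where r: "r : carrier A" "psi r = s" by (rule psi_surj)
  show "s \<odot>\<^bsub>M'\<^esub> x : carrier M'"
   using sm[OF r(1) x'] r(2) M.smult_closed[OF r(1) x'] by (simp add: M'_simps)
  show "s \<odot>\<^bsub>M'\<^esub> (x \<oplus>\<^bsub>M'\<^esub> y) = s \<odot>\<^bsub>M'\<^esub> x \<oplus>\<^bsub>M'\<^esub> s \<odot>\<^bsub>M'\<^esub> y" if "y : carrier M'"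
  proof -
   have y': "y : carrier M" using that by (simp add: M'_simps)
   show ?thesis
    using M.smult_r_distr[OF r(1) x' y'] sm[OF r(1) x'] sm[OF r(1) y'] sm[OF r(1) M.M.add.m_closed[OF x' y']]
    unfolding r(2) by (simp add: M'_simps)
  qed
  assume "t : carrier A'"
  then obtain q where q: "q : carrier A" "psi q = t" by (rule psi_surj)
  show "(s \<otimes>\<^bsub>A'\<^esub> t) \<odot>\<^bsub>M'\<^esub> x = s \<odot>\<^bsub>M'\<^esub> (t \<odot>\<^bsub>M'\<^esub> x)"
   using sm[OF m_closed[OF r(1) q(1)] x'] sm[OF q(1) x'] sm[OF r(1) M.smult_closed[OF q(1) x']]
    M.smult_assoc[OF r(1) q(1) x'] psi_mult[OF r(1) q(1)] r(2) q(2) by simp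
  show "(s \<oplus>\<^bsub>A'\<^esub> t) \<odot>\<^bsub>M'\<^esub> x = s \<odot>\<^bsub>M'\<^esub> x \<oplus>\<^bsub>M'\<^esub> t \<odot>\<^bsub>M'\<^esub> x"
   using sm[OF a_closed[OF r(1) q(1)] x'] sm[OF q(1) x'] sm[OF r(1) x']
    M.smult_l_distr[OF r(1) q(1) x'] psi_add[OF r(1) q(1)] r(2) q(2) by (simp add: M'_simps)
 qed
 ultimately have "lmodule A' M'" by (intro lmodule.intro A'.ring_axioms)
 moreover have "smult M' : carrier A' \<rightarrow>\<^sub>E carrier M' \<rightarrow>\<^sub>E carrier M'"
  using rep(1) M.smult_closed by (auto simp: M'_def)
 ultimately have M'_mod: "M' : modules A'" using M by (simp add: modules_def M'_simps)
 have ext: "smult M : carrier A \<rightarrow>\<^sub>E carrier M \<rightarrow>\<^sub>E carrier M" using M by (simp add: modules_def)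
 have "smult (F M') = smult M"
 proof (intro HOL.ext)
  fix r x
  show "smult (F M') r x = smult M r x"
  proof (cases "r : carrier A")
   case r: True
   have Mr: "smult M r : carrier M \<rightarrow>\<^sub>E carrier M" using ext r by blast
   show ?thesis
   proof (cases "x : carrier M")
    case True
    then show ?thesis using F_smult[OF r, of x M'] sm[OF r True] by (simp add: M'_simps)
   next
    case False
    then show ?thesis using PiE_arb[OF Mr False] r by (simp add: restrict_scalars_def M'_simps)
   qed
  next
   case False
   then show ?thesis using PiE_arb[OF ext False] by (simp add: restrict_scalars_def)
  qed
 qed
 then have "F M' = M" by (intro module.equality) (simp_all add: M'_simps)
 then show ?thesis using M'_mod by blast
qed

text \<open>By surjectivity of \<open>psi\<close> the restricted action determines the action on the
  carriers; elsewhere both actions take the prescribed values.\<close>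

lemma F_inj: "inj_on F (modules A')"
proof (rule inj_onI)
 fix M N assume M: "M : modules A'" and N: "N : modules A'" and eq: "F M = F N"
 have c: "carrier M = carrier N" "zero M = zero N" "add M = add N" "mult M = mult N" "one M = one N"
  using arg_cong[OF eq, of carrier] arg_cong[OF eq, of zero] arg_cong[OF eq, of add]
   arg_cong[OF eq, of mult] arg_cong[OF eq, of one] by (simp_all only: F_simps)
 have extM: "smult M : carrier A' \<rightarrow>\<^sub>E carrier M \<rightarrow>\<^sub>E carrier M"
  and extN: "smult N : carrier A' \<rightarrow>\<^sub>E carrier N \<rightarrow>\<^sub>E carrier N"
  using M N by (simp_all add: modules_def)
 have "smult M = smult N"
 proof (intro HOL.ext)
  fix s x
  show "smult M s x = smult N s x"
  proof (cases "s : carrier A'")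
   case s: True
   then obtain r where r: "r : carrier A" "psi r = s" by (rule psi_surj)
   have Ms: "smult M s : carrier M \<rightarrow>\<^sub>E carrier M" "smult N s : carrier N \<rightarrow>\<^sub>E carrier N"
    using extM extN s by blast+
   show ?thesis
   proof (cases "x : carrier M")
    case True
    then have "psi r \<odot>\<^bsub>M\<^esub> x = psi r \<odot>\<^bsub>N\<^esub> x"
     using F_smult[OF r(1), of x M] F_smult[OF r(1), of x N] c(1) eq by simp
    then show ?thesis using r(2) by simp
   next
    case False
    then show ?thesis using PiE_arb[OF Ms(1) False] PiE_arb[OF Ms(2)] c(1) by simp
   qed
  next
   case False
   then show ?thesis using PiE_arb[OF extM False] PiE_arb[OF extN False] by simp
  qed
 qed
 then show "M = N" using c by (intro module.equality) simp_all
qed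

text \<open>I kills A/I from the left because it is two-sided, hence kills its powers and everything
  that embeds into them.\<close>

lemma Sub_killed:
 assumes M: "M : Sub_modules A X" and r: "r : I" and x: "x : carrier M"
 shows "r \<odot>\<^bsub>M\<^esub> x = \<zero>\<^bsub>M\<^esub>"
proof -
 have mod: "M : modules A" using M by (simp add: Sub_modules_def)
 then have lM: "lmodule A M" by (simp add: modules_def)
 interpret M: lmodule A M by (rule lM)
 obtain n f where f: "f : lmodule_hom A M (power_module n X)" "inj_on f (carrier M)"
  using M Sub_modules_iff[OF lmodule_X mod] by blast
 have rA: "r : carrier A" by (rule I.Icarr[OF r])
 have "coset r = coset \<zero>" using r unfolding coset_eq_iff[OF rA zero_closed] by (simp add: minus_eq rA)
 then have zero: "r \<odot>\<^bsub>X\<^esub> q = \<zero>\<^bsub>X\<^esub>" if "q : carrier Q" for q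
  using that X_smult[OF rA that] coset_zero by (simp add: X_simps)
 have "f (r \<odot>\<^bsub>M\<^esub> x) = r \<odot>\<^bsub>power_module n X\<^esub> f x" by (rule lmodule_homD(3)[OF f(1) rA x])
 also have "\<dots> = \<zero>\<^bsub>power_module n X\<^esub>" unfolding power_module_simps
 proof (rule restrict_ext)
  fix i assume "i : {..<n}"
  then have "f x i : carrier Q" using lmodule_homD(1)[OF f(1) x] by (auto simp: power_module_simps X_simps)
  then show "r \<odot>\<^bsub>X\<^esub> f x i = \<zero>\<^bsub>X\<^esub>" by (rule zero)
 qed
 also have "\<dots> = f \<zero>\<^bsub>M\<^esub>"
  by (rule lmodule_hom_zero[OF lM lmodule_power[OF lmodule_X] f(1), symmetric])
 finally show ?thesis by (rule inj_onD[OF f(2) _ M.smult_closed[OF rA x] M.M.zero_closed])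
qed

lemma hom_space_F:
 assumes N: "N : modules A'"
 shows "hom_space A (F M) (F N) = hom_space A' M N"
proof -
 have ext: "smult N : carrier A' \<rightarrow>\<^sub>E carrier N \<rightarrow>\<^sub>E carrier N" using N by (simp add: modules_def)
 have sm: "(c \<odot>\<^bsub>A\<^esub> \<one>) \<odot>\<^bsub>F N\<^esub> y = (c \<odot>\<^bsub>A'\<^esub> \<one>\<^bsub>A'\<^esub>) \<odot>\<^bsub>N\<^esub> y" for c y
 proof (cases "y : carrier N")
  case True
  then show ?thesis by (simp add: F_smult psi_scalar)
 next
  case False
  have "smult N (c \<odot>\<^bsub>A'\<^esub> \<one>\<^bsub>A'\<^esub>) : carrier N \<rightarrow>\<^sub>E carrier N"
   using ext A'.scale_closed[OF A'.one_closed] by blast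
  from PiE_arb[OF this False] show ?thesis using False by (simp add: restrict_scalars_def)
 qed
 show ?thesis unfolding hom_space_def F_hom sm F_simps ..
qed

end

section \<open>The isomorphism of stable categories over a self-injective quotient\<close>

locale selfinjective_quotient = algebra_quotient A I A' \<phi>
 for A :: "('k::field, 'r) module" (structure) and I and A' :: "('k, 's) module" and \<phi> +
 fixes elements :: "'m itself"
 assumes embeds_in_free: "!!M :: ('s, 'm) module. lmodule A' M ==> finitely_generated A' M ==>
   EX n. EX f:lmodule_hom A' M (free_module A' n). inj_on f (carrier M)"
  and noetherian: "!!(M :: ('s, 'm) module) n f. lmodule A' M ==> f : lmodule_hom A' M (free_module A' n) ==>
   inj_on f (carrier M) ==> finitely_generated A' M"
  and large: "!!(M :: ('s, 'm) module) n. lmodule A' M ==> carrier M ~= {\<zero>\<^bsub>M\<^esub>} ==>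
   \<exists>e :: (nat => 's) => 'm. inj_on e (carrier (free_module A' n))"
begin

abbreviation fg where "fg \<equiv> (fg_modules A' :: ('s, 'm) module set)"
abbreviation Sub where "Sub \<equiv> (Sub_modules A X :: ('r, 'm) module set)"

lemma fg_modulesD: "M : fg ==> M : modules A'" "M : fg ==> lmodule A' M" "M : fg ==> finitely_generated A' M"
 by (simp_all add: fg_modules_def modules_def)

lemma F_Sub: "M : fg ==> F M : Sub" using embeds_in_free[OF fg_modulesD(2,3)] embeds_iff[OF fg_modulesD(2)]
  Sub_modules_iff[OF lmodule_X F_modules[OF fg_modulesD(1)]] unfolding F_simps by blast

lemma Sub_F:
 assumes Z: "Z : Sub"
 shows "\<exists>M\<in>fg. F M = Z"
proof -
 have mod: "Z : modules A" using Z by (simp add: Sub_modules_def)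
 obtain M where M: "M : modules A'" "F M = Z" using F_lift[OF mod Sub_killed[OF Z]] by blast
 have lM: "lmodule A' M" using M(1) by (simp add: modules_def)
 obtain n f where "f : lmodule_hom A (F M) (power_module n X)" "inj_on f (carrier M)"
  using Z Sub_modules_iff[OF lmodule_X mod] unfolding M(2)[symmetric] F_simps by blast
 then obtain g where "g : lmodule_hom A' M (free_module A' n)" "inj_on g (carrier M)" using embeds_iff[OF lM] by blast
 then have "M : fg" using noetherian[OF lM] M(1) by (simp add: fg_modules_def)
 then show ?thesis using M(2) by blast
qed

lemma F_bij: "bij_betw F fg Sub"
proof (rule bij_betw_imageI)
 show "inj_on F fg" by (rule inj_on_subset[OF F_inj]) (use fg_modulesD(1) in blast)
 show "F ` fg = Sub" using F_Sub Sub_F by blast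
qed

text \<open>Both sides say that M is a summand of a free module. From projectivity this requires
  room for a free cover in the carrier type of M, supplied by \<open>large\<close>.\<close>

lemma F_projective:
 assumes M: "M : fg"
 shows "F M : add_modules A X \<longleftrightarrow> M : fg_projective_modules A'"
proof
 assume "F M : add_modules A X"
 then obtain n where "direct_summand A (F M) (power_module n X)"
  using add_modules_iff[OF lmodule_X F_modules[OF fg_modulesD(1)[OF M]]] by blast
 then have "direct_summand A' M (free_module A' n)" using direct_summand_iff[OF fg_modulesD(2)[OF M]] by blast
 then show "M : fg_projective_modules A'" by (rule A'.projective_if_summand[OF M])
next
 assume P: "M : fg_projective_modules A'"
 obtain n u where u: "u : lmodule_hom A' (free_module A' n) M" "u ` carrier (free_module A' n) = carrier M"
   and n: "carrier M = {\<zero>\<^bsub>M\<^esub>} --> n = 0"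
  using A'.free_cover[OF fg_modulesD(2)[OF M] fg_modulesD(3)[OF M]] by blast
 \<comment> \<open>For the zero module the cover has rank 0 and a single element, so any map is
   injective on it.\<close>
 have "\<exists>e :: (nat => 's) => 'm. inj_on e (carrier (free_module A' n))"
 proof (cases "carrier M = {\<zero>\<^bsub>M\<^esub>}")
  case True
  then show ?thesis using n by (auto simp: power_module_simps)
 next
  case False
  then show ?thesis by (rule large[OF fg_modulesD(2)[OF M]])
 qed
 then obtain e :: "(nat => 's) => 'm" where e: "inj_on e (carrier (free_module A' n))" by blast
 have "direct_summand A' M (free_module A' n)" by (rule A'.summand_if_projective[OF P u e])
 then have "direct_summand A (F M) (power_module n X)" using direct_summand_iff[OF fg_modulesD(2)[OF M]] by blast
 then show "F M : add_modules A X" using add_modules_iff[OF lmodule_X F_modules[OF fg_modulesD(1)[OF M]]] by blast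
qed

lemma add_Sub: "Z : (add_modules A X :: ('r, 'm) module set) ==> Z : Sub"
proof -
 assume Z: "Z : (add_modules A X :: ('r, 'm) module set)"
 then have mod: "Z : modules A" by (simp add: add_modules_def)
 obtain n a b where "a : lmodule_hom A Z (power_module n X)" "ALL x:carrier Z. b (a x) = x"
  using Z unfolding add_modules_iff[OF lmodule_X mod] direct_summand_def by blast
 then show ?thesis unfolding Sub_modules_iff[OF lmodule_X mod] by (metis inj_on_inverseI)
qed

text \<open>\<open>F\<close> matches the projective modules with \<open>add_modules A X\<close> and
  leaves homomorphisms unchanged, so the homomorphisms factoring through the two classes form the
  same set.\<close>

lemma factoring_F:
 "factoring_homs A (add_modules A X) (F M) (F N) =
  factoring_homs A' (fg_projective_modules A' :: ('s, 'm) module set) M N"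
proof
 show "factoring_homs A (add_modules A X) (F M) (F N) \<subseteq> factoring_homs A' (fg_projective_modules A') M N"
 proof
  fix x assume "x : factoring_homs A (add_modules A X) (F M) (F N)"
  then obtain f g and Z :: "('r, 'm) module" where x: "x = compose (carrier M) g f" and Z: "Z : add_modules A X"
    and fg: "f : lmodule_hom A (F M) Z" "g : lmodule_hom A Z (F N)" unfolding factoring_homs_def F_simps by blast
  obtain Z' where Z': "Z' : fg" "F Z' = Z" using Sub_F[OF add_Sub[OF Z]] by blast
  have "Z' : fg_projective_modules A'" using F_projective[OF Z'(1)] Z Z'(2) by simp
  then show "x : factoring_homs A' (fg_projective_modules A') M N"
   unfolding factoring_homs_def using x fg unfolding Z'(2)[symmetric] F_hom by blast
 qed
 show "factoring_homs A' (fg_projective_modules A') M N \<subseteq> factoring_homs A (add_modules A X) (F M) (F N)"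
 proof
  fix x assume "x : factoring_homs A' (fg_projective_modules A') M N"
  then obtain f g and Z :: "('s, 'm) module" where x: "x = compose (carrier M) g f" and Z: "Z : fg_projective_modules A'"
    and fg: "f : lmodule_hom A' M Z" "g : lmodule_hom A' Z N" unfolding factoring_homs_def by blast
  have "Z : fg" using Z by (simp add: fg_projective_modules_def)
  then have "F Z : add_modules A X" using F_projective Z by blast
  then show "x : factoring_homs A (add_modules A X) (F M) (F N)"
   unfolding factoring_homs_def F_simps using x fg unfolding F_hom[symmetric] by blast
 qed
qed

text \<open>The homomorphism spaces and the ideals to be factored out are equal on both sides, so
  the cosets are equal too and the functor is the identity on morphisms.\<close>

theorem stable_isomorphism:
 "lin_cat_isomorphism (stable_mod A' :: (_, ('m => 'm) set, 'k) lin_cat) (stable_Sub A I) F (\<lambda>X Y F. F)"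
proof -
 let ?C = "stable_mod A' :: (_, ('m => 'm) set, 'k) lin_cat"
 let ?D = "stable_Sub A I :: (_, ('m => 'm) set, 'k) lin_cat"
 have obj: "Obj ?C = fg" "Obj ?D = Sub" by (simp_all add: stable_mod_def stable_Sub_def stable_category_def Let_def)
 have hom: "Hom ?D (F M) (F N) = Hom ?C M N" if "N : fg" for M N
  unfolding stable_mod_def stable_Sub_def stable_category_def Let_def lin_cat.simps
   factoring_F hom_space_F[OF fg_modulesD(1)[OF that]] ..
 have ident: "Ident ?D (F M) = Ident ?C M" if "M : fg" for M
  unfolding stable_mod_def stable_Sub_def stable_category_def Let_def lin_cat.simps
   factoring_F hom_space_F[OF fg_modulesD(1)[OF that]] F_simps ..
 have comp: "Comp ?D (F M) (F N) (F P) = Comp ?C M N P" if "P : fg" for M N P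
  unfolding stable_mod_def stable_Sub_def stable_category_def Let_def lin_cat.simps
   factoring_F hom_space_F[OF fg_modulesD(1)[OF that]] F_simps ..
 have "lin_functor ?C ?D F (\<lambda>X Y F. F)" unfolding lin_functor_def obj using F_Sub by (simp add: hom ident comp)
 moreover have "bij_betw (\<lambda>F. F) S S" for S :: "('m => 'm) set set" by (simp add: bij_betw_def inj_on_def)
 ultimately show ?thesis unfolding lin_cat_isomorphism_def obj using F_bij by (simp add: hom)
qed

end

subsection \<open>Cardinalities\<close>

text \<open>Over a finite field, 1 plus the product of all X - a has positive degree but takes the
  value 1 everywhere.\<close>

lemma infinite_alg_closed_field: "infinite (UNIV :: 'k::alg_closed_field set)"
proof
 assume fin: "finite (UNIV :: 'k set)"
 define p where "p = (\<Prod>a\<in>(UNIV :: 'k set). [:- a, 1:])"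
 have "degree p = (SUM a:(UNIV :: 'k set). degree [:- a, 1:])" unfolding p_def by (rule degree_prod_sum_eq) simp
 then have "degree p = card (UNIV :: 'k set)" by simp
 then have deg: "degree p > 0" using fin by (simp add: card_gt_0_iff)
 then have "degree (p + 1) > 0" by (subst degree_add_eq_left) simp_all
 then obtain z where "poly (p + 1) z = 0" using alg_closed_imp_poly_has_root by blast
 moreover have "poly p z = 0" unfolding p_def poly_prod using fin by (intro prod_zero bexI[of _ z]) simp_all
 ultimately show False by simp
qed

text \<open>A bijection between pairs and elements is iterated along the list; fixing the length
  makes the code injective.\<close>

lemma infinite_lists_inject:
 assumes "infinite (UNIV :: 'k set)"
 shows "\<exists>f :: 'k list => 'k. inj_on f {xs. length xs = n}"
proof -
 have "\<exists>p :: 'k \<times> 'k => 'k. bij_betw p (UNIV \<times> UNIV) (UNIV :: 'k set)"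
  unfolding card_of_ordIso by (rule card_of_Times_same_infinite[OF assms])
 then obtain p :: "'k \<times> 'k => 'k" where p: "inj p" by (auto simp: bij_betw_def)
 define f where "f xs = foldr (%x y. p (x, y)) xs undefined" for xs
 have "xs = ys" if "length xs = length ys" "f xs = f ys" for xs ys
  using that by (induction xs ys rule: list_induct2) (auto simp: f_def dest!: injD[OF p])
 then show ?thesis by (intro exI[of _ f] inj_onI) simp
qed

context nilpotent_preprojective
begin

text \<open>Modulo relations an element is determined by the coefficients of a chosen representative
  on the finite set \<open>nil.B\<close>, so n elements are encoded by one list of fixed
  length.\<close>

lemma free_module_coordinates:
 "\<exists>(f :: (nat => ('v, 'a, 'k) pfun set) => 'k list) l.
  inj_on f (carrier (free_module Pi n)) & (ALL y. length (f y) = l)"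
proof -
 define rep where "rep x = (SOME f. f : carrier PP & cls f = x)" for x
 have rep: "rep x : carrier PP" "cls (rep x) = x" if "x : carrier Pi" for x
 proof -
  obtain f where "f : carrier PP & cls f = x" using \<open>x : carrier Pi\<close> unfolding cls_carrier by blast
  from someI[of "%f. f : carrier PP & cls f = x", OF this]
  show "rep x : carrier PP" "cls (rep x) = x" unfolding rep_def by blast+
 qed
 obtain bs where bs: "set bs = nil.B" using finite_list[OF nil.finite_B] by blast
 let ?f = "%y. map (%(i, b). rep (y i) b) (List.product [0..<n] bs)"
 have "inj_on ?f (carrier (free_module Pi n))"
 proof (rule inj_onI)
  fix y z assume y: "y : carrier (free_module Pi n)" and z: "z : carrier (free_module Pi n)" and eq: "?f y = ?f z"
  have c: "rep (y i) b = rep (z i) b" if "i < n" "b : nil.B" for i b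
  proof -
   have mem: "(i, b) : set (List.product [0..<n] bs)" using that bs by simp
   from bspec[OF eq[unfolded map_eq_conv] mem]
   show ?thesis by simp
  qed
  have "y i = z i" if i: "i : {..<n}" for i
  proof -
   have yz: "y i : carrier Pi" "z i : carrier Pi" using y z i by (auto simp: power_module_simps)
   have "restr (rep (y i)) = restr (rep (z i))" unfolding restr_def using c i by (intro ext) simp
   then have "cls (rep (y i)) = cls (rep (z i))"
    using cls_restr[OF rep(1)[OF yz(1)]] cls_restr[OF rep(1)[OF yz(2)]] by metis
   then show ?thesis using rep(2) yz by simp
  qed
  then show "y = z" using y z by (intro PiE_ext[of y "{..<n}" "%_. carrier Pi" z]) (simp_all add: power_module_simps)
 qed
 moreover have "ALL y. length (?f y) = length (List.product [0..<n] bs)" by simp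
 ultimately show ?thesis by blast
qed

lemma scalars_inject:
 fixes M :: "(('v, 'a, 'k) pfun set, 'm) module"
 assumes "lmodule Pi M" and x: "x : carrier M" "x ~= \<zero>\<^bsub>M\<^esub>"
 shows "inj (%c :: 'k. (c \<odot>\<^bsub>Pi\<^esub> \<one>\<^bsub>Pi\<^esub>) \<odot>\<^bsub>M\<^esub> x)"
proof (rule injI, rule ccontr)
 interpret M: lmodule Pi M by (rule assms(1))
 fix c d :: 'k
 let ?s = "%c :: 'k. c \<odot>\<^bsub>Pi\<^esub> \<one>\<^bsub>Pi\<^esub>"
 assume eq: "?s c \<odot>\<^bsub>M\<^esub> x = ?s d \<odot>\<^bsub>M\<^esub> x" and "c ~= d"
 have s: "?s c : carrier Pi" for c by (rule Pi.scale_closed[OF Pi.one_closed])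
 note sx = M.smult_closed[OF s x(1)]
 have "?s c = ?s (c - d) \<oplus>\<^bsub>Pi\<^esub> ?s d" using Pi.add_scale[OF Pi.one_closed, of "c - d" d] by simp
 then have "?s d \<odot>\<^bsub>M\<^esub> x = ?s (c - d) \<odot>\<^bsub>M\<^esub> x \<oplus>\<^bsub>M\<^esub> ?s d \<odot>\<^bsub>M\<^esub> x"
  using M.smult_l_distr[OF s[of "c - d"] s[of d] x(1)] eq by simp
 then have zero: "?s (c - d) \<odot>\<^bsub>M\<^esub> x = \<zero>\<^bsub>M\<^esub>"
  using M.M.add.r_cancel_one'[OF sx sx, of d "c - d"] by simp
 have "?s (inverse (c - d)) \<otimes>\<^bsub>Pi\<^esub> ?s (c - d) = \<one>\<^bsub>Pi\<^esub>"
  using \<open>c ~= d\<close> Pi.scale_scale[OF Pi.one_closed, of "inverse (c - d)" "c - d"]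
  by (simp add: Pi.scale_mult_left s Pi.scale_one)
 then have "x = ?s (inverse (c - d)) \<odot>\<^bsub>M\<^esub> (?s (c - d) \<odot>\<^bsub>M\<^esub> x)"
  using M.smult_assoc[OF s[of "inverse (c - d)"] s[of "c - d"] x(1)] M.smult_one[OF x(1)] by simp
 then show False unfolding zero M.smult_zero[OF s] using x(2) by simp
qed

text \<open>A nonzero vector spans a copy of the infinite field k inside M, and the coefficient
  lists of the free module inject into k. So every type that carries a nonzero module has room for
  all free modules of finite rank.\<close>

lemma free_module_injects:
 fixes M :: "(('v, 'a, 'k) pfun set, 'm) module"
 assumes inf: "infinite (UNIV :: 'k set)" and M: "lmodule Pi M" "carrier M ~= {\<zero>\<^bsub>M\<^esub>}"
 shows "\<exists>e :: (nat => ('v, 'a, 'k) pfun set) => 'm. inj_on e (carrier (free_module Pi n))"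
proof -
 interpret M: lmodule Pi M by (rule M(1))
 obtain x where x: "x : carrier M" "x ~= \<zero>\<^bsub>M\<^esub>" using M(2) M.M.zero_closed by blast
 obtain f :: "(nat => ('v, 'a, 'k) pfun set) => 'k list" and l
  where f: "inj_on f (carrier (free_module Pi n))" "!!y. length (f y) = l" using free_module_coordinates[of n] by blast
 obtain g :: "'k list => 'k" where g: "inj_on g {xs. length xs = l}" using infinite_lists_inject[OF inf] by blast
 note j = scalars_inject[OF M(1) x]
 have "inj_on (%y. (g (f y) \<odot>\<^bsub>Pi\<^esub> \<one>\<^bsub>Pi\<^esub>) \<odot>\<^bsub>M\<^esub> x) (carrier (free_module Pi n))"
 proof (rule inj_onI)
  fix y z assume yz: "y : carrier (free_module Pi n)" "z : carrier (free_module Pi n)"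
   "(g (f y) \<odot>\<^bsub>Pi\<^esub> \<one>\<^bsub>Pi\<^esub>) \<odot>\<^bsub>M\<^esub> x = (g (f z) \<odot>\<^bsub>Pi\<^esub> \<one>\<^bsub>Pi\<^esub>) \<odot>\<^bsub>M\<^esub> x"
  have "g (f y) = g (f z)" by (rule injD[OF j yz(3)])
  then have "f y = f z" by (rule inj_onD[OF g]) (simp_all add: f(2))
  then show "y = z" by (rule inj_onD[OF f(1) _ yz(1,2)])
 qed
 then show ?thesis by blast
qed

lemma embeds_in_free:
 fixes M :: "(('v, 'a, 'k) pfun set, 'm) module"
 assumes "lmodule Pi M" "finitely_generated Pi M"
 shows "EX n. EX f:lmodule_hom Pi M (free_module Pi n). inj_on f (carrier M)"
proof -
 obtain S where S: "finite S" "S <= carrier M" "ALL U. submodule U Pi M & S \<subseteq> U --> U = carrier M"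
  using assms(2) unfolding finitely_generated_def by blast
 interpret fg_preprojective_module Q field N M S
  by (rule fg_preprojective_module.intro[OF nilpotent_preprojective_axioms assms(1)], unfold_locales)
   (use S in blast)+
 show ?thesis by (rule embeds)
qed

lemma submodule_of_free:
 fixes M :: "(('v, 'a, 'k) pfun set, 'm) module"
 assumes "lmodule Pi M" "f : lmodule_hom Pi M (free_module Pi n)" "inj_on f (carrier M)"
 shows "finitely_generated Pi M"
proof -
 obtain S where S: "finite S & S <= carrier (free_module Pi n) \<and>
   (ALL U. submodule U Pi (free_module Pi n) & S \<subseteq> U --> U = carrier (free_module Pi n))"
  using Pi.finitely_generated_free[of n, unfolded finitely_generated_def] by (rule exE)
 interpret fg_preprojective_module Q field N "free_module Pi n" S
 proof (rule fg_preprojective_module.intro[OF nilpotent_preprojective_axioms Pi.lmodule_free], unfold_locales)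
  show "finite S" "S <= carrier (free_module Pi n)" using S by (rule conjunct1, rule conjunct1[OF conjunct2])
  show "U = carrier (free_module Pi n)" if "submodule U Pi (free_module Pi n)" "S \<subseteq> U" for U
   by (rule S[THEN conjunct2, THEN conjunct2, rule_format, OF conjI[OF that]])
 qed
 show ?thesis by (rule fg_submodule[OF assms])
qed

end

section \<open>Application to the longest element\<close>

context coxeter_quiver
begin

text \<open>Because Q' is full, the 0-Hecke relations of its vertex ideals are indexed by the arrow
  counts of Q, as \<open>foldr_longest_absorb\<close> requires. The product along js is then fixed
  by every vertex ideal of the small algebra, hence zero by \<open>vprod_fixed_zero\<close>.\<close>

lemma full_subquiver_longest:
 assumes sub: "subgraph Q' Q" and dynkin: "dynkin_quiver Q'"
  and longest: "longest_element Q (verts Q') w" and red: "reduced_expression Q js w"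
 shows "full_subquiver TYPE('k::field) Q Q' js"
proof -
 have compat: "tail Q' = tail Q" "head Q' = head Q" "verts Q' <= verts Q" "arcs Q' <= arcs Q"
  using sub by (simp_all add: subgraph_def compatible_def)
 have fin: "fin_digraph Q'" using dynkin by (simp add: dynkin_quiver_def)
 have loopfree: "loopfree_digraph Q'"
 proof -
  interpret Q': fin_digraph Q' by (rule fin)
  show ?thesis by unfold_locales (use compat no_loops in auto)
 qed
 note full = dynkin_subgraph_full[OF longest red sub dynkin]
 interpret S: loopfree_preprojective Q' "TYPE('k)" using fin loopfree
  by (simp add: loopfree_preprojective_def preprojective_def double_digraph_def)
 interpret B: loopfree_preprojective Q "TYPE('k)" using fin_digraph_axioms loopfree_digraph_axioms
  by (simp add: loopfree_preprojective_def preprojective_def double_digraph_def)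
 let ?W = "foldr S.vprod js (carrier S.Pi)"
 have set: "set js <= verts Q'" by (rule longest_elementD(2)[OF longest red compat(3)])
 have ideal: "ideal (foldr S.vprod ks (carrier S.Pi)) S.Pi" if "set ks <= verts Q'" for ks
  using that by (induction ks) (simp_all add: S.Pi.oneideal S.vprod_ideal)
 have "S.vprod i ?W = ?W" if "i : verts Q'" for i
 proof (rule foldr_longest_absorb[OF longest red compat(3), where S = "{A. ideal A S.Pi}"])
  fix i j A assume i: "i : verts Q'" and j: "j : verts Q'"
  show "num_arrows Q i j <= 1" by (rule full(3)[OF i j])
  assume "A : {A. ideal A S.Pi}"
  then have A: "ideal A S.Pi" by simp
  show "S.vprod i A : {A. ideal A S.Pi}" using S.vprod_ideal[OF i A] by simp
  show "S.vprod i (S.vprod i A) = S.vprod i A" by (rule S.vprod_idem[OF i A])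
  show "S.vprod i (S.vprod j A) = S.vprod j (S.vprod i A)" if "num_arrows Q i j = 0"
   using that unfolding full(2)[OF i j] by (rule S.vprod_commute[OF i j A])
  show "S.vprod i (S.vprod j (S.vprod i A)) = S.vprod j (S.vprod i (S.vprod j A))" if "num_arrows Q i j = 1"
   using that unfolding full(2)[OF i j] by (rule S.vprod_braid[OF i j A])
 qed (use that S.Pi.oneideal in simp_all)
 then have "?W = {\<zero>\<^bsub>S.Pi\<^esub>}" by (rule S.vprod_fixed_zero[OF ideal[OF set]])
 then show ?thesis using compat set full(1) by unfold_locales (simp_all add: inner_arcs_def)
qed

end

theorem theorem2p3p5:
  fixes Q Q' :: "('v, 'a) pre_digraph"
    and \<Lambda> :: "('k::alg_closed_field, nat \<Rightarrow> ('v \<times> ('a + 'a) list \<Rightarrow> 'k) set set) module"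
    and \<Lambda>' :: "('k, ('v \<times> ('a + 'a) list \<Rightarrow> 'k) set) module"
    and I :: "(nat \<Rightarrow> ('v \<times> ('a + 'a) list \<Rightarrow> 'k) set set) set"
    and w\<^sub>0 :: "'v list set"
    and "is" :: "'v list"
  assumes "fin_digraph Q" and "loopfree_digraph Q" and "Digraph_Component.connected Q"
    and "\<not> dynkin_quiver Q"
    and "subgraph Q' Q" and "dynkin_quiver Q'"
    and "\<Lambda> = completed_preprojective_algebra Q"
    and "\<Lambda>' = preprojective_algebra Q'"
    and "longest_element Q (verts Q') w\<^sub>0"
    and "reduced_expression Q is w\<^sub>0"
    and "I = word_ideal Q is"
  shows "(\<exists>\<phi>. \<phi> \<in> algebra_iso \<Lambda>' (factor \<Lambda> I)) \<and>
    (\<forall>\<phi>\<in>algebra_iso \<Lambda>' (factor \<Lambda> I).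
       lin_cat_isomorphism
         (stable_mod \<Lambda>' :: (_, ('m \<Rightarrow> 'm) set, 'k) lin_cat)
         (stable_Sub \<Lambda> I)
         (restrict_scalars \<Lambda> (\<lambda>r. inv_into (carrier \<Lambda>') \<phi> (I +>\<^bsub>\<Lambda>\<^esub> r)))
         (\<lambda>X Y F. F))"
proof -
 interpret C: coxeter_quiver Q using assms(1,2) by (simp add: coxeter_quiver_def)
 interpret full_subquiver Q Q' "TYPE('k)" "is" by (rule C.full_subquiver_longest[OF assms(5,6,9,10)])
 have iso: "\<exists>\<phi>. \<phi> : algebra_iso \<Lambda>' (factor \<Lambda> I)"
  unfolding assms(7,8,11) by (rule exists_algebra_iso)
 moreover have "lin_cat_isomorphism
   (stable_mod \<Lambda>' :: (_, ('m => 'm) set, 'k) lin_cat)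
   (stable_Sub \<Lambda> I)
   (restrict_scalars \<Lambda> (%r. inv_into (carrier \<Lambda>') \<phi> (I +>\<^bsub>\<Lambda>\<^esub> r)))
   (\<lambda>X Y F. F)" if \<phi>: "\<phi> : algebra_iso \<Lambda>' (factor \<Lambda> I)" for \<phi>
 proof -
  have 1: "algebra_quotient \<Lambda> I \<Lambda>' \<phi>"
   using \<phi> ideal_word B.algebra_over_Lam S.algebra_over_Pi unfolding assms(7,8,11)
   by (simp add: algebra_quotient_def algebra_quotient_axioms_def algebra_ideal_def)
  interpret selfinjective_quotient \<Lambda> I \<Lambda>' \<phi> "TYPE('m)"
  proof (rule selfinjective_quotient.intro[OF 1], unfold assms(8), unfold_locales)
   show "EX n. EX f:lmodule_hom S.Pi M (free_module S.Pi n). inj_on f (carrier M)"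
    if "lmodule S.Pi M" "finitely_generated S.Pi M" for M :: "(('v, 'a, 'k) pfun set, 'm) module"
    using that by (rule S.embeds_in_free)
   show "finitely_generated S.Pi M"
    if "lmodule S.Pi M" "f : lmodule_hom S.Pi M (free_module S.Pi n)" "inj_on f (carrier M)"
    for M :: "(('v, 'a, 'k) pfun set, 'm) module" and n f using that by (rule S.submodule_of_free)
   show "\<exists>e :: (nat => ('v, 'a, 'k) pfun set) => 'm. inj_on e (carrier (free_module S.Pi n))"
    if "lmodule S.Pi M" "carrier M ~= {\<zero>\<^bsub>M\<^esub>}" for M :: "(('v, 'a, 'k) pfun set, 'm) module" and n
    using that by (rule S.free_module_injects[OF infinite_alg_closed_field])
  qed
  show ?thesis using stable_isomorphism unfolding psi_def .
 qed
 ultimately show ?thesis by blast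
qed

end
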